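(* Let $\mathcal{C}$ be a locally presentable category and $\mathcal{B}$ a family of morphisms in $\mathcal{C}$ such that $\mathrm{Cell}(\mathcal{B})\subseteq\mathrm{Mono}$. Consider a tower $(\mathbb{I}\mathrm{nj}(\mathcal I_n))_{n\in\omega^+}$ of $\omega$-injectives over $\mathcal{C}$ such that for each $n<\omega$ each morphism of $\mathcal{I}_{n+1}$ is an $F_n\mathcal{B}$-cellular morphism with finitely presentable domain (in $\mathbb{I}\mathrm{nj}(\mathcal I_n)$). Let $m<n\in\omega^+$. Then: 1. the forgetful functor $V^n_m:\mathbb{I}\mathrm{nj}(\mathcal I_n)\to\mathbb{I}\mathrm{nj}(\mathcal I_m)$ sends $F_n\mathcal{B}$-cellular morphisms to $F_m\mathcal{B}$-cellular morphisms; 2. the unit component $X\to V^n_mF^n_mX$ is $F_m\mathcal{B}$-cellular for each $X\in\mathbb{I}\mathrm{nj}(\mathcal I_m)$; 3. $\mathrm{Cell}(F_n\mathcal{B})\subseteq\mathrm{Mono}$; 4. the left adjoint $F^n_m$ is faithful.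
   Context: **Families and cellularity.** A family $\mathcal{I}=(I,\alpha)$ of morphisms in a category $\mathcal{C}$ is a set $I$ with a function assigning to each $i\in I$ a morphism $\alpha_i:A_i\to B_i$; properties of "morphisms of $\mathcal I$" refer to the $\alpha_i$. A morphism is $\mathcal{I}$-cellular if it is a transfinite composite of pushouts of small coproducts of the maps $\alpha_i$; $\mathrm{Cell}(\mathcal I)$ is the class of these. $\mathrm{Mono}$ is the class of monomorphisms of the category in question. For a functor $F$, $F\mathcal{B}$ is the family obtained by applying $F$ to the morphisms of $\mathcal{B}$. **Algebraic injectives.** An algebraic $\mathcal I$-injective is an object $C$ with, for each $i\in I$ and $f:A_i\to C$, a chosen $c(i,f):B_i\to C$ with $c(i,f)\alpha_i=f$. Morphisms are morphisms of $\mathcal{C}$ commuting with the chosen extensions; this gives $\mathbb{I}\mathrm{nj}(\mathcal I)$ and its forgetful functor to $\mathcal{C}$. **Towers.** Let $\omega^+=\{0<1<\cdots<\omega\}$. A tower of $\omega$-injectives over $\mathcal{C}$ is a cochain $n\mapsto\mathbb{I}\mathrm{nj}(\mathcal I_n)$ ($n\in\omega^+$) of categories with $\mathbb{I}\mathrm{nj}(\mathcal I_0)=\mathcal{C}$, each $V^{n+1}_n:\mathbb{I}\mathrm{nj}(\mathcal I_{n+1})\to\mathbb{I}\mathrm{nj}(\mathcal I_n)$ ($n<\omega$) the forgetful functor from algebraic injectives for a given family $\mathcal I_{n+1}$ of morphisms in $\mathbb{I}\mathrm{nj}(\mathcal I_n)$, and $\mathbb{I}\mathrm{nj}(\mathcal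 I_\omega)=\lim_{n<\omega}\mathbb{I}\mathrm{nj}(\mathcal I_n)$. $V^n_m$ are the connecting functors, $F^n_m\dashv V^n_m$ their left adjoints (which exist), $F_n=F^n_0$ and $F_0=\mathrm{id}$. *)

theory Defs
  imports Main "HOL-Library.Extended_Nat"
begin

unbundle cardinal_syntax

section \<open>Universes\<close>

text \<open>
  HOL has no proper classes, so size is measured against an uncountable inaccessible cardinal
  \<open>U\<close>, playing the role of a Grothendieck universe: a set is small if it has fewer than \<open>U\<close>
  elements. Every small set has a copy inside the type \<open>'u\<close> underlying \<open>U\<close>, so small
  index sets, index categories and ordinals may be taken in \<open>'u\<close>.
\<close>

definition inaccessible :: "'u rel \<Rightarrow> bool" where
  "inaccessible U \<longleftrightarrow> Card_order U \<and> natLeq <o U \<and> regularCard U \<and>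
     (\<forall>A \<subseteq> Field U. |A| <o U \<longrightarrow> |Pow A| <o U)"

definition small :: "'u rel \<Rightarrow> 'a set \<Rightarrow> bool" where
  "small U A \<longleftrightarrow> |A| <o U"


section \<open>Categories and functors\<close>

record ('o, 'm) cat =
  Ob :: "'o set"
  Ar :: "'m set"
  Dom :: "'m \<Rightarrow> 'o"
  Cod :: "'m \<Rightarrow> 'o"
  Idt :: "'o \<Rightarrow> 'm"
  Cmp :: "'m \<Rightarrow> 'm \<Rightarrow> 'm"  (infixl "\<cdot>\<index>" 70)

definition hom :: "('o, 'm) cat \<Rightarrow> 'o \<Rightarrow> 'o \<Rightarrow> 'm set" where
  "hom C X Y = {f \<in> Ar C. Dom C f = X \<and> Cod C f = Y}"

definition category :: "('o, 'm) cat \<Rightarrow> bool" where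
  "category C \<longleftrightarrow>
     (\<forall>f \<in> Ar C. Dom C f \<in> Ob C \<and> Cod C f \<in> Ob C) \<and>
     (\<forall>X \<in> Ob C. Idt C X \<in> hom C X X) \<and>
     (\<forall>f \<in> Ar C. \<forall>g \<in> Ar C. Cod C f = Dom C g \<longrightarrow> g \<cdot>\<^bsub>C\<^esub> f \<in> hom C (Dom C f) (Cod C g)) \<and>
     (\<forall>f \<in> Ar C. f \<cdot>\<^bsub>C\<^esub> Idt C (Dom C f) = f \<and> Idt C (Cod C f) \<cdot>\<^bsub>C\<^esub> f = f) \<and>
     (\<forall>f \<in> Ar C. \<forall>g \<in> Ar C. \<forall>h \<in> Ar C. Cod C f = Dom C g \<longrightarrow> Cod C g = Dom C h \<longrightarrow>
        (h \<cdot>\<^bsub>C\<^esub> g) \<cdot>\<^bsub>C\<^esub> f = h \<cdot>\<^bsub>C\<^esub> (g \<cdot>\<^bsub>C\<^esub> f))"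

definition Mono :: "('o, 'm) cat \<Rightarrow> 'm set" where
  "Mono C = {f \<in> Ar C. \<forall>g \<in> Ar C. \<forall>h \<in> Ar C.
     Dom C g = Dom C h \<and> Cod C g = Dom C f \<and> Cod C h = Dom C f \<and> f \<cdot>\<^bsub>C\<^esub> g = f \<cdot>\<^bsub>C\<^esub> h \<longrightarrow> g = h}"

record ('o, 'm, 'p, 'q) fctr =
  on_ob :: "'o \<Rightarrow> 'p"
  on_ar :: "'m \<Rightarrow> 'q"

definition is_functor :: "('o, 'm) cat \<Rightarrow> ('p, 'q) cat \<Rightarrow> ('o, 'm, 'p, 'q) fctr \<Rightarrow> bool" where
  "is_functor C D F \<longleftrightarrow> category C \<and> category D \<and>
     (\<forall>X \<in> Ob C. on_ob F X \<in> Ob D) \<and>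
     (\<forall>f \<in> Ar C. on_ar F f \<in> hom D (on_ob F (Dom C f)) (on_ob F (Cod C f))) \<and>
     (\<forall>X \<in> Ob C. on_ar F (Idt C X) = Idt D (on_ob F X)) \<and>
     (\<forall>f \<in> Ar C. \<forall>g \<in> Ar C. Cod C f = Dom C g \<longrightarrow>
        on_ar F (g \<cdot>\<^bsub>C\<^esub> f) = on_ar F g \<cdot>\<^bsub>D\<^esub> on_ar F f)"

definition is_isomorphism ::
    "('o, 'm) cat \<Rightarrow> ('p, 'q) cat \<Rightarrow> ('o, 'm, 'p, 'q) fctr \<Rightarrow> bool" where
  "is_isomorphism C D F \<longleftrightarrow> is_functor C D F \<and>
     bij_betw (on_ob F) (Ob C) (Ob D) \<and> bij_betw (on_ar F) (Ar C) (Ar D)"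

definition faithful :: "('o, 'm) cat \<Rightarrow> ('o, 'm, 'p, 'q) fctr \<Rightarrow> bool" where
  "faithful C F \<longleftrightarrow> (\<forall>X \<in> Ob C. \<forall>Y \<in> Ob C. inj_on (on_ar F) (hom C X Y))"

definition id_fctr :: "('o, 'm, 'o, 'm) fctr" where
  "id_fctr = \<lparr>on_ob = id, on_ar = id\<rparr>"

text \<open>\<open>F \<stileturn> V\<close> with unit \<open>\<eta>\<close>, for \<open>V : D \<rightarrow> C\<close>.\<close>

definition left_adjoint :: "('o, 'm) cat \<Rightarrow> ('p, 'q) cat \<Rightarrow> ('p, 'q, 'o, 'm) fctr \<Rightarrow>
    ('o, 'm, 'p, 'q) fctr \<Rightarrow> ('o \<Rightarrow> 'm) \<Rightarrow> bool" where
  "left_adjoint C D V F \<eta> \<longleftrightarrow> is_functor D C V \<and> is_functor C D F \<and>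
     (\<forall>X \<in> Ob C. \<eta> X \<in> hom C X (on_ob V (on_ob F X))) \<and>
     (\<forall>f \<in> Ar C. on_ar V (on_ar F f) \<cdot>\<^bsub>C\<^esub> \<eta> (Dom C f) = \<eta> (Cod C f) \<cdot>\<^bsub>C\<^esub> f) \<and>
     (\<forall>X \<in> Ob C. \<forall>Y \<in> Ob D. \<forall>f \<in> hom C X (on_ob V Y).
        \<exists>!g. g \<in> hom D (on_ob F X) Y \<and> on_ar V g \<cdot>\<^bsub>C\<^esub> \<eta> X = f)"


section \<open>Colimits\<close>

definition is_cocone :: "('j, 'k) cat \<Rightarrow> ('o, 'm) cat \<Rightarrow> ('j, 'k, 'o, 'm) fctr \<Rightarrow>
    'o \<Rightarrow> ('j \<Rightarrow> 'm) \<Rightarrow> bool" where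
  "is_cocone J C D Z c \<longleftrightarrow> Z \<in> Ob C \<and> (\<forall>j \<in> Ob J. c j \<in> hom C (on_ob D j) Z) \<and>
     (\<forall>k \<in> Ar J. c (Cod J k) \<cdot>\<^bsub>C\<^esub> on_ar D k = c (Dom J k))"

definition is_colimit :: "('j, 'k) cat \<Rightarrow> ('o, 'm) cat \<Rightarrow> ('j, 'k, 'o, 'm) fctr \<Rightarrow>
    'o \<Rightarrow> ('j \<Rightarrow> 'm) \<Rightarrow> bool" where
  "is_colimit J C D Z c \<longleftrightarrow> is_functor J C D \<and> is_cocone J C D Z c \<and>
     (\<forall>Y d. is_cocone J C D Y d \<longrightarrow> (\<exists>!u. u \<in> hom C Z Y \<and> (\<forall>j \<in> Ob J. u \<cdot>\<^bsub>C\<^esub> c j = d j)))"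

definition cocomplete :: "'u rel \<Rightarrow> ('o, 'm) cat \<Rightarrow> bool" where
  "cocomplete U C \<longleftrightarrow> (\<forall>(J :: ('u, 'u) cat) D.
     category J \<and> small U (Ob J) \<and> small U (Ar J) \<and> is_functor J C D \<longrightarrow>
     (\<exists>Z c. is_colimit J C D Z c))"

definition poset_cat :: "'j rel \<Rightarrow> ('j, 'j \<times> 'j) cat" where
  "poset_cat r = \<lparr>Ob = Field r, Ar = r, Dom = fst, Cod = snd,
     Idt = (\<lambda>a. (a, a)), Cmp = (\<lambda>q p. (fst p, snd q))\<rparr>"

definition discrete_cat :: "'j set \<Rightarrow> ('j, 'j) cat" where
  "discrete_cat J = \<lparr>Ob = J, Ar = J, Dom = id, Cod = id, Idt = id, Cmp = (\<lambda>q p. p)\<rparr>"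

definition is_coproduct :: "('o, 'm) cat \<Rightarrow> 'j set \<Rightarrow> ('j \<Rightarrow> 'o) \<Rightarrow> 'o \<Rightarrow> ('j \<Rightarrow> 'm) \<Rightarrow> bool" where
  "is_coproduct C J X Z c \<longleftrightarrow>
     is_colimit (discrete_cat J) C \<lparr>on_ob = X, on_ar = (\<lambda>j. Idt C (X j))\<rparr> Z c"

text \<open>\<open>q\<close> is the pushout of \<open>f\<close> along \<open>g\<close>, with the square completed by \<open>p\<close>.\<close>

definition is_pushout :: "('o, 'm) cat \<Rightarrow> 'm \<Rightarrow> 'm \<Rightarrow> 'm \<Rightarrow> 'm \<Rightarrow> bool" where
  "is_pushout C f g p q \<longleftrightarrow> f \<in> Ar C \<and> g \<in> Ar C \<and> p \<in> Ar C \<and> q \<in> Ar C \<and>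
     Dom C f = Dom C g \<and> Dom C p = Cod C f \<and> Dom C q = Cod C g \<and> Cod C p = Cod C q \<and>
     p \<cdot>\<^bsub>C\<^esub> f = q \<cdot>\<^bsub>C\<^esub> g \<and>
     (\<forall>p' \<in> Ar C. \<forall>q' \<in> Ar C. Dom C p' = Cod C f \<and> Dom C q' = Cod C g \<and> Cod C p' = Cod C q' \<and>
        p' \<cdot>\<^bsub>C\<^esub> f = q' \<cdot>\<^bsub>C\<^esub> g \<longrightarrow>
        (\<exists>!u. u \<in> hom C (Cod C p) (Cod C p') \<and> u \<cdot>\<^bsub>C\<^esub> p = p' \<and> u \<cdot>\<^bsub>C\<^esub> q = q'))"


section \<open>Locally presentable categories\<close>

text \<open>For a regular cardinal \<open>l\<close>: small \<open>l\<close>-directed posets. Finite directedness is the case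
  \<open>l = natLeq\<close>.\<close>

definition directed_poset :: "'u rel \<Rightarrow> 'k rel \<Rightarrow> 'u rel \<Rightarrow> bool" where
  "directed_poset U l r \<longleftrightarrow> partial_order_on (Field r) r \<and> small U (Field r) \<and>
     (\<forall>S \<subseteq> Field r. |S| <o l \<longrightarrow> (\<exists>b \<in> Field r. \<forall>a \<in> S. (a, b) \<in> r))"

text \<open>
  The functor \<open>hom(K, -)\<close> preserves \<open>l\<close>-directed colimits: for a colimit \<open>Z\<close> of \<open>D\<close>, the
  canonical map from the directed colimit of the sets \<open>hom(K, D j)\<close> to \<open>hom(K, Z)\<close> is
  surjective and injective. Two elements \<open>g \<in> hom(K, D i)\<close> and \<open>h \<in> hom(K, D j)\<close> are
  identified in the former precisely if they become equal in some \<open>hom(K, D k)\<close>, \<open>k \<ge> i, j\<close>.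
\<close>

definition presentable :: "'u rel \<Rightarrow> 'k rel \<Rightarrow> ('o, 'm) cat \<Rightarrow> 'o \<Rightarrow> bool" where
  "presentable U l C K \<longleftrightarrow> K \<in> Ob C \<and>
     (\<forall>r D Z c. directed_poset U l r \<and> is_colimit (poset_cat r) C D Z c \<longrightarrow>
        (\<forall>f \<in> hom C K Z. \<exists>j \<in> Field r. \<exists>g \<in> hom C K (on_ob D j). c j \<cdot>\<^bsub>C\<^esub> g = f) \<and>
        (\<forall>i \<in> Field r. \<forall>j \<in> Field r. \<forall>g \<in> hom C K (on_ob D i). \<forall>h \<in> hom C K (on_ob D j).
           c i \<cdot>\<^bsub>C\<^esub> g = c j \<cdot>\<^bsub>C\<^esub> h \<longrightarrow>
           (\<exists>k. (i, k) \<in> r \<and> (j, k) \<in> r \<and> on_ar D (i, k) \<cdot>\<^bsub>C\<^esub> g = on_ar D (j, k) \<cdot>\<^bsub>C\<^esub> h)))"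

definition finitely_presentable :: "'u rel \<Rightarrow> ('o, 'm) cat \<Rightarrow> 'o \<Rightarrow> bool" where
  "finitely_presentable U C K \<longleftrightarrow> presentable U natLeq C K"

definition locally_presentable :: "'u rel \<Rightarrow> ('o, 'm) cat \<Rightarrow> bool" where
  "locally_presentable U C \<longleftrightarrow> category C \<and>
     (\<forall>X \<in> Ob C. \<forall>Y \<in> Ob C. small U (hom C X Y)) \<and>
     cocomplete U C \<and>
     (\<exists>(l :: 'u rel) G. Card_order l \<and> natLeq \<le>o l \<and> regularCard l \<and> l <o U \<and>
        small U G \<and> (\<forall>K \<in> G. presentable U l C K) \<and>
        (\<forall>X \<in> Ob C. \<exists>r D c. directed_poset U l r \<and> on_ob D ` Field r \<subseteq> G \<and>
           is_colimit (poset_cat r) C D X c))"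


section \<open>Families of morphisms and cellularity\<close>

record ('i, 'm) family =
  Idx :: "'i set"
  mor :: "'i \<Rightarrow> 'm"

definition is_family :: "'u rel \<Rightarrow> ('o, 'm) cat \<Rightarrow> ('i, 'm) family \<Rightarrow> bool" where
  "is_family U C I \<longleftrightarrow> small U (Idx I) \<and> (\<forall>i \<in> Idx I. mor I i \<in> Ar C)"

definition map_family :: "('o, 'm, 'p, 'q) fctr \<Rightarrow> ('i, 'm) family \<Rightarrow> ('i, 'q) family" where
  "map_family F I = \<lparr>Idx = Idx I, mor = (\<lambda>i. on_ar F (mor I i))\<rparr>"

text \<open>Here \<open>s : J \<rightarrow> I\<close> need not be injective, so that summands may be repeated.\<close>

definition small_coproducts :: "'u rel \<Rightarrow> ('o, 'm) cat \<Rightarrow> ('i, 'm) family \<Rightarrow> 'm set" where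
  "small_coproducts U C I = {q. \<exists>(J :: 'u set) s P a Q b. small U J \<and> s ` J \<subseteq> Idx I \<and>
     is_coproduct C J (\<lambda>j. Dom C (mor I (s j))) P a \<and>
     is_coproduct C J (\<lambda>j. Cod C (mor I (s j))) Q b \<and>
     q \<in> hom C P Q \<and> (\<forall>j \<in> J. q \<cdot>\<^bsub>C\<^esub> a j = b j \<cdot>\<^bsub>C\<^esub> mor I (s j))}"

definition pushouts :: "('o, 'm) cat \<Rightarrow> 'm set \<Rightarrow> 'm set" where
  "pushouts C S = {q. \<exists>f \<in> S. \<exists>g p. is_pushout C f g p q}"

definition covers :: "'j rel \<Rightarrow> 'j \<Rightarrow> 'j \<Rightarrow> bool" where
  "covers r a b \<longleftrightarrow> (a, b) \<in> r \<and> a \<noteq> b \<and> (\<forall>c. (a, c) \<in> r \<and> (c, b) \<in> r \<longrightarrow> c = a \<or> c = b)"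

text \<open>
  Composites of smooth chains of morphisms from \<open>S\<close>, indexed by a nonempty small ordinal, given as
  a well-order \<open>r\<close> with least element \<open>z\<close>: the chain is the colimit of its restriction at
  each limit element \<open>a\<close>, and the composite is the leg at \<open>z\<close> of a colimit cocone.
\<close>

definition transfinite_composites :: "'u rel \<Rightarrow> ('o, 'm) cat \<Rightarrow> 'm set \<Rightarrow> 'm set" where
  "transfinite_composites U C S = {f. \<exists>(r :: 'u rel) D Z c z. Well_order r \<and> small U (Field r) \<and>
     z \<in> Field r \<and> (\<forall>a \<in> Field r. (z, a) \<in> r) \<and>
     is_colimit (poset_cat r) C D Z c \<and> f = c z \<and>
     (\<forall>a b. covers r a b \<longrightarrow> on_ar D (a, b) \<in> S) \<and>
     (\<forall>a \<in> Field r. a \<noteq> z \<and> \<not> (\<exists>b. covers r b a) \<longrightarrow>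
        is_colimit (poset_cat (Restr r (underS r a))) C D (on_ob D a) (\<lambda>b. on_ar D (b, a)))}"

definition Cell :: "'u rel \<Rightarrow> ('o, 'm) cat \<Rightarrow> ('i, 'm) family \<Rightarrow> 'm set" where
  "Cell U C I = transfinite_composites U C (pushouts C (small_coproducts U C I))"


section \<open>Algebraic injectives\<close>

text \<open>The function of chosen extensions is only meaningful on \<open>i \<in> I\<close> and \<open>f : A\<^sub>i \<rightarrow> X\<close>;
  it is \<open>undefined\<close> elsewhere, so that distinct objects have distinct extensions.\<close>

definition ext_structure ::
    "('o, 'm) cat \<Rightarrow> ('i, 'm) family \<Rightarrow> 'o \<Rightarrow> ('i \<Rightarrow> 'm \<Rightarrow> 'm) \<Rightarrow> bool" where
  "ext_structure C I X c \<longleftrightarrow> (\<forall>i f.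
     if i \<in> Idx I \<and> f \<in> hom C (Dom C (mor I i)) X
     then c i f \<in> hom C (Cod C (mor I i)) X \<and> c i f \<cdot>\<^bsub>C\<^esub> mor I i = f
     else c i f = undefined)"

type_synonym ('o, 'm, 'i) alg_ob = "'o \<times> ('i \<Rightarrow> 'm \<Rightarrow> 'm)"
type_synonym ('o, 'm, 'i) alg_ar = "('o, 'm, 'i) alg_ob \<times> 'm \<times> ('o, 'm, 'i) alg_ob"

definition alg_inj ::
    "('o, 'm) cat \<Rightarrow> ('i, 'm) family \<Rightarrow> (('o, 'm, 'i) alg_ob, ('o, 'm, 'i) alg_ar) cat" where
  "alg_inj C I = \<lparr>
     Ob = {(X, c). X \<in> Ob C \<and> ext_structure C I X c},
     Ar = {((X, c), u, (Y, d)) | X c u Y d.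
       X \<in> Ob C \<and> ext_structure C I X c \<and> Y \<in> Ob C \<and> ext_structure C I Y d \<and> u \<in> hom C X Y \<and>
       (\<forall>i \<in> Idx I. \<forall>f \<in> hom C (Dom C (mor I i)) X. u \<cdot>\<^bsub>C\<^esub> c i f = d i (u \<cdot>\<^bsub>C\<^esub> f))},
     Dom = fst,
     Cod = (\<lambda>p. snd (snd p)),
     Idt = (\<lambda>A. (A, Idt C (fst A), A)),
     Cmp = (\<lambda>q p. (fst p, fst (snd q) \<cdot>\<^bsub>C\<^esub> fst (snd p), snd (snd q)))\<rparr>"

definition alg_inj_forget ::
    "(('o, 'm, 'i) alg_ob, ('o, 'm, 'i) alg_ar, 'o, 'm) fctr" where
  "alg_inj_forget = \<lparr>on_ob = fst, on_ar = (\<lambda>p. fst (snd p))\<rparr>"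

text \<open>\<open>V : D \<rightarrow> C\<close> is, up to an isomorphism of categories over \<open>C\<close>, the forgetful functor
  from the category of algebraic injectives.\<close>

definition is_alg_inj_forget ::
    "('o, 'm) cat \<Rightarrow> ('i, 'm) family \<Rightarrow> ('p, 'q) cat \<Rightarrow> ('p, 'q, 'o, 'm) fctr \<Rightarrow> bool" where
  "is_alg_inj_forget C I D V \<longleftrightarrow> (\<exists>\<Phi>. is_isomorphism D (alg_inj C I) \<Phi> \<and>
     (\<forall>X \<in> Ob D. on_ob V X = on_ob alg_inj_forget (on_ob \<Phi> X)) \<and>
     (\<forall>f \<in> Ar D. on_ar V f = on_ar alg_inj_forget (on_ar \<Phi> f)))"


section \<open>Towers\<close>

text \<open>The index set \<open>\<omega>\<^sup>+\<close> is \<open>enat\<close>, with \<open>\<omega> = \<infinity>\<close>.\<close>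

definition is_cochain :: "(enat \<Rightarrow> ('o, 'm) cat) \<Rightarrow>
    (enat \<Rightarrow> enat \<Rightarrow> ('o, 'm, 'o, 'm) fctr) \<Rightarrow> bool" where
  "is_cochain E V \<longleftrightarrow>
     (\<forall>n m. m \<le> n \<longrightarrow> is_functor (E n) (E m) (V n m)) \<and>
     (\<forall>n. (\<forall>X \<in> Ob (E n). on_ob (V n n) X = X) \<and> (\<forall>f \<in> Ar (E n). on_ar (V n n) f = f)) \<and>
     (\<forall>n m k. k \<le> m \<and> m \<le> n \<longrightarrow>
        (\<forall>X \<in> Ob (E n). on_ob (V m k) (on_ob (V n m) X) = on_ob (V n k) X) \<and>
        (\<forall>f \<in> Ar (E n). on_ar (V m k) (on_ar (V n m) f) = on_ar (V n k) f))"

definition seq_limit :: "(enat \<Rightarrow> ('o, 'm) cat) \<Rightarrow> (enat \<Rightarrow> enat \<Rightarrow> ('o, 'm, 'o, 'm) fctr) \<Rightarrow>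
    (nat \<Rightarrow> 'o, nat \<Rightarrow> 'm) cat" where
  "seq_limit E V = \<lparr>
     Ob = {X. \<forall>n. X n \<in> Ob (E (enat n)) \<and> on_ob (V (enat (Suc n)) (enat n)) (X (Suc n)) = X n},
     Ar = {f. \<forall>n. f n \<in> Ar (E (enat n)) \<and> on_ar (V (enat (Suc n)) (enat n)) (f (Suc n)) = f n},
     Dom = (\<lambda>f n. Dom (E (enat n)) (f n)),
     Cod = (\<lambda>f n. Cod (E (enat n)) (f n)),
     Idt = (\<lambda>X n. Idt (E (enat n)) (X n)),
     Cmp = (\<lambda>g f n. g n \<cdot>\<^bsub>E (enat n)\<^esub> f n)\<rparr>"

text \<open>
  A tower \<open>E\<close> of \<open>\<omega>\<close>-injectives over \<open>C\<close> for the families \<open>I (n + 1)\<close> of morphisms in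
  \<open>E n\<close>. Since the categories of a sequence share one type of objects and one of morphisms, each
  \<open>E (n + 1)\<close>, and the limit \<open>E \<infinity>\<close>, is given up to isomorphism over the lower stages.
  The carriers of \<open>C\<close> need not exhaust these types.
\<close>

definition is_tower :: "'u rel \<Rightarrow> ('o, 'm) cat \<Rightarrow> (nat \<Rightarrow> ('i, 'm) family) \<Rightarrow>
    (enat \<Rightarrow> ('o, 'm) cat) \<Rightarrow> (enat \<Rightarrow> enat \<Rightarrow> ('o, 'm, 'o, 'm) fctr) \<Rightarrow> bool" where
  "is_tower U C I E V \<longleftrightarrow> is_cochain E V \<and> E 0 = C \<and>
     (\<forall>n. is_family U (E (enat n)) (I (Suc n)) \<and>
        is_alg_inj_forget (E (enat n)) (I (Suc n)) (E (enat (Suc n))) (V (enat (Suc n)) (enat n))) \<and>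
     is_isomorphism (E \<infinity>) (seq_limit E V)
       \<lparr>on_ob = (\<lambda>X n. on_ob (V \<infinity> (enat n)) X), on_ar = (\<lambda>f n. on_ar (V \<infinity> (enat n)) f)\<rparr>"

text \<open>
  A choice of left adjoint \<open>F\<^sup>n\<^sub>m\<close> of \<open>V\<^sup>n\<^sub>m\<close>, with its unit. Existence is not part of
  the definition of a tower: it is a consequence of local presentability.
\<close>

definition chosen_adjoint :: "(enat \<Rightarrow> ('o, 'm) cat) \<Rightarrow> (enat \<Rightarrow> enat \<Rightarrow> ('o, 'm, 'o, 'm) fctr) \<Rightarrow>
    enat \<Rightarrow> enat \<Rightarrow> ('o, 'm, 'o, 'm) fctr \<times> ('o \<Rightarrow> 'm)" where
  "chosen_adjoint E V n m = (if n = m then (id_fctr, Idt (E n))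
     else (SOME (F, \<eta>). left_adjoint (E m) (E n) (V n m) F \<eta>))"

definition Free :: "(enat \<Rightarrow> ('o, 'm) cat) \<Rightarrow> (enat \<Rightarrow> enat \<Rightarrow> ('o, 'm, 'o, 'm) fctr) \<Rightarrow>
    enat \<Rightarrow> enat \<Rightarrow> ('o, 'm, 'o, 'm) fctr" where
  "Free E V n m = fst (chosen_adjoint E V n m)"

definition free_unit :: "(enat \<Rightarrow> ('o, 'm) cat) \<Rightarrow> (enat \<Rightarrow> enat \<Rightarrow> ('o, 'm, 'o, 'm) fctr) \<Rightarrow>
    enat \<Rightarrow> enat \<Rightarrow> 'o \<Rightarrow> 'm" where
  "free_unit E V n m = snd (chosen_adjoint E V n m)"

text \<open>The family \<open>F\<^sub>n B\<close> of morphisms in \<open>E n\<close>, where \<open>F\<^sub>n = F\<^sup>n\<^sub>0\<close>.\<close>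

definition free_family :: "(enat \<Rightarrow> ('o, 'm) cat) \<Rightarrow> (enat \<Rightarrow> enat \<Rightarrow> ('o, 'm, 'o, 'm) fctr) \<Rightarrow>
    ('b, 'm) family \<Rightarrow> enat \<Rightarrow> ('b, 'm) family" where
  "free_family E V B n = map_family (Free E V n 0) B"

end

theory Submission
  imports Defs "HOL-Library.Countable_Set"
begin

text \<open>Consider one step \<open>V : Inj(I) \<rightarrow> E\<close> of the tower. The free algebraic injective on an object with a
  partially defined extension structure is the colimit of a sequence of pushouts of the morphisms of \<open>I\<close>,
  each stage adding the extensions that are missing. Two facts make this work: the domains are finitely
  presentable, so the sequence stops at \<open>\<omega>\<close>; and the generating cells are monic, so the partial
  structure carried along the sequence stays single-valued and only missing extensions are added. Hence
  the passage from an object of \<open>E\<close> with a single-valued partial structure to the free algebraic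
  injective is cellular. The empty structure gives the units. A pushout of a free cell
  in \<open>Inj(I)\<close> is formed by pushing out in \<open>E\<close> and completing the structure inherited from the
  original object, so \<open>V\<close> preserves these pushouts up to cellular morphisms; since \<open>V\<close> preserves
  directed colimits, it preserves cellularity, and since it is faithful, cellular morphisms upstairs are
  monic. At the limit stage, units and pushouts are colimits of the sequences of their finite-stage
  counterparts, whose connecting morphisms are cellular. A left adjoint with monic units is
  faithful.\<close>

section \<open>Small sets\<close>

text \<open>Three obstacles shape the argument. Cellular morphisms, as defined, are not visibly
  closed under composition or pushout. They are therefore redescribed by chains with a last element
  (\<open>cc\<close>) whose steps attach small families of generators simultaneously
  (\<open>csteps\<close>); a composite of such chains is then a refinement of well-orders by a
  lexicographic sum. Next, general colimits of algebraic injectives are not computed in the base.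
  Presenting colimits by generators and relations (\<open>relcoc\<close>) treats all shapes at once:
  take the colimit in the base and complete it with respect to the structures that the summands
  bring along. Finally, a stage of the tower has no known properties before it is reached: presented
  colimits, local smallness, the adjoint \<open>F_k\<close> and monicity of cells form one joint
  induction hypothesis (\<open>Inv\<close>), because monicity at stage \<open>k\<close> is what
  makes the completions leading to stage \<open>k + 1\<close> cellular. Adjoints are fixed by choice
  only, so stages are compared through universal arrows, which are unique up to isomorphism;
  isomorphisms are cellular.\<close>

locale universe =
  fixes U :: "'u rel"
  assumes inacc: "inaccessible U"
begin

lemma U_card: "Card_order U" and U_unc: "natLeq <o U" and U_reg: "regularCard U"
  using inacc by (auto simp: inaccessible_def)

lemma U_inf: "\<not> finite (Field U)"
  using U_unc U_card by (metis Card_order_iff_ordLeq_card_of Field_card_of Field_natLeq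
      card_of_ordLeq_infinite infinite_UNIV_nat natLeq_Card_order card_of_Field_ordIso
      ordIso_ordLeq_trans ordLess_imp_ordLeq ordLeq_transitive ordIso_symmetric)

lemma U_stable: "stable U"
  using regularCard_stable[OF U_card U_inf U_reg] .

lemma small_subset: "small U A \<Longrightarrow> B \<subseteq> A \<Longrightarrow> small U B"
  unfolding small_def by (meson card_of_mono1 ordLeq_ordLess_trans)

lemma small_image: "small U A \<Longrightarrow> small U (f ` A)"
  unfolding small_def by (meson card_of_image ordLeq_ordLess_trans)

lemma small_Sigma: "small U A \<Longrightarrow> (\<And>a. a \<in> A \<Longrightarrow> small U (F a)) \<Longrightarrow> small U (Sigma A F)"
  unfolding small_def using stable_elim[OF U_stable] by blast

lemma small_Times: "small U A \<Longrightarrow> small U B \<Longrightarrow> small U (A \<times> B)"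
  by (rule small_Sigma)

lemma small_Un: "small U A \<Longrightarrow> small U B \<Longrightarrow> small U (A \<union> B)"
  unfolding small_def using card_of_Un_ordLess_infinite_Field[OF U_inf U_card] by blast

text \<open>\<open>U\<close> is uncountable, so the \<omega>-sequences that build free objects and
  the limit stage count as small diagrams.\<close>

lemma small_countable:
  assumes "countable A" shows "small U A"
proof -
  obtain f :: "_ \<Rightarrow> nat" where "inj_on f A" using assms by (auto simp: countable_def)
  then have "|A| \<le>o |UNIV :: nat set|" by (intro card_of_ordLeq[THEN iffD1]) auto
  also have "|UNIV :: nat set| =o natLeq" by (rule card_of_nat)
  finally show ?thesis unfolding small_def using U_unc by (metis ordLeq_ordLess_trans)
qed

lemma small_finite: "finite A \<Longrightarrow> small U A"
  by (simp add: countable_finite small_countable)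

lemma small_insert: "small U A \<Longrightarrow> small U (insert a A)"
  using small_Un[of "{a}" A] small_finite[of "{a}"] by simp

lemma small_inj_image: "inj_on f A \<Longrightarrow> small U (f ` A) \<Longrightarrow> small U A"
  using small_image[of "f ` A" "inv_into A f"] by simp

text \<open>The definitions allow only index sets in \<open>'u\<close>. Diagrams with any other
  small index set are relabelled along such an injection.\<close>

lemma small_embeds:
  assumes "small U A" shows "\<exists>\<phi> :: 'a \<Rightarrow> 'u. inj_on \<phi> A"
proof -
  have "|A| \<le>o U" using assms small_def ordLess_imp_ordLeq by blast
  also have "U =o |Field U|" using U_card by (metis card_of_Field_ordIso ordIso_symmetric)
  finally have "|A| \<le>o |Field U|" .
  then show ?thesis using card_of_ordLeq[of A "Field U"] by blast
qed

text \<open>A small set in \<open>'u\<close> has fewer elements than \<open>U\<close>, hence misses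
  one. This leaves room to put a new last element on top of a small well-order.\<close>

lemma small_proper:
  assumes "small U (A :: 'u set)" shows "\<exists>x. x \<notin> A"
proof (rule ccontr)
  assume "\<not> ?thesis"
  then have "Field U \<subseteq> A" by auto
  then have "small U (Field U)" using small_subset assms by blast
  then show False unfolding small_def using U_card
    by (metis card_of_Field_ordIso not_ordLess_ordIso)
qed

end


section \<open>Categories and functors\<close>

lemma hom_ArD: "f \<in> hom C X Y \<Longrightarrow> f \<in> Ar C \<and> Dom C f = X \<and> Cod C f = Y"
  by (simp add: hom_def)

lemma hom_self: "f \<in> Ar C \<Longrightarrow> f \<in> hom C (Dom C f) (Cod C f)"
  by (simp add: hom_def)

lemma hom_dom: "category C \<Longrightarrow> f \<in> hom C X Y \<Longrightarrow> X \<in> Ob C"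
  by (auto simp: category_def hom_def)

lemma hom_cod: "category C \<Longrightarrow> f \<in> hom C X Y \<Longrightarrow> Y \<in> Ob C"
  by (auto simp: category_def hom_def)

lemma id_hom: "category C \<Longrightarrow> X \<in> Ob C \<Longrightarrow> Idt C X \<in> hom C X X"
  by (auto simp: category_def)

lemma comp_hom: "category C \<Longrightarrow> f \<in> hom C X Y \<Longrightarrow> g \<in> hom C Y Z \<Longrightarrow> g \<cdot>\<^bsub>C\<^esub> f \<in> hom C X Z"
  by (simp add: category_def hom_def)

lemma comp_assoc: "category C \<Longrightarrow> f \<in> hom C X Y \<Longrightarrow> g \<in> hom C Y Z \<Longrightarrow> h \<in> hom C Z W \<Longrightarrow>
    (h \<cdot>\<^bsub>C\<^esub> g) \<cdot>\<^bsub>C\<^esub> f = h \<cdot>\<^bsub>C\<^esub> (g \<cdot>\<^bsub>C\<^esub> f)"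
  by (simp add: category_def hom_def)

lemma id_left: "category C \<Longrightarrow> f \<in> hom C X Y \<Longrightarrow> Idt C Y \<cdot>\<^bsub>C\<^esub> f = f"
  by (auto simp: category_def hom_def)

lemma id_right: "category C \<Longrightarrow> f \<in> hom C X Y \<Longrightarrow> f \<cdot>\<^bsub>C\<^esub> Idt C X = f"
  by (auto simp: category_def hom_def)

lemma functor_cats: "is_functor C D F \<Longrightarrow> category C" "is_functor C D F \<Longrightarrow> category D"
  by (auto simp: is_functor_def)

lemma functor_ob: "is_functor C D F \<Longrightarrow> X \<in> Ob C \<Longrightarrow> on_ob F X \<in> Ob D"
  by (auto simp: is_functor_def)

lemma functor_hom: "is_functor C D F \<Longrightarrow> f \<in> hom C X Y \<Longrightarrow> on_ar F f \<in> hom D (on_ob F X) (on_ob F Y)"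
  unfolding is_functor_def hom_def by blast

lemma functor_id: "is_functor C D F \<Longrightarrow> X \<in> Ob C \<Longrightarrow> on_ar F (Idt C X) = Idt D (on_ob F X)"
  by (auto simp: is_functor_def)

lemma functor_comp: "is_functor C D F \<Longrightarrow> f \<in> hom C X Y \<Longrightarrow> g \<in> hom C Y Z \<Longrightarrow>
    on_ar F (g \<cdot>\<^bsub>C\<^esub> f) = on_ar F g \<cdot>\<^bsub>D\<^esub> on_ar F f"
  by (simp add: is_functor_def hom_def)

definition iso_ar :: "('o, 'm) cat \<Rightarrow> 'o \<Rightarrow> 'o \<Rightarrow> 'm \<Rightarrow> bool" where
  "iso_ar C X Y f \<longleftrightarrow> f \<in> hom C X Y \<and>
     (\<exists>g \<in> hom C Y X. g \<cdot>\<^bsub>C\<^esub> f = Idt C X \<and> f \<cdot>\<^bsub>C\<^esub> g = Idt C Y)"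

lemma iso_arI: "f \<in> hom C X Y \<Longrightarrow> g \<in> hom C Y X \<Longrightarrow> g \<cdot>\<^bsub>C\<^esub> f = Idt C X \<Longrightarrow> f \<cdot>\<^bsub>C\<^esub> g = Idt C Y \<Longrightarrow>
    iso_ar C X Y f"
  by (auto simp: iso_ar_def)

lemma iso_id: "category C \<Longrightarrow> X \<in> Ob C \<Longrightarrow> iso_ar C X X (Idt C X)"
  by (intro iso_arI[where g = "Idt C X"]) (auto intro: id_hom id_left)

lemma iso_hom: "iso_ar C X Y f \<Longrightarrow> f \<in> hom C X Y"
  by (simp add: iso_ar_def)

lemma functor_iso:
  assumes "is_functor C D F" "iso_ar C X Y f"
  shows "iso_ar D (on_ob F X) (on_ob F Y) (on_ar F f)"
proof -
  obtain g where g: "g \<in> hom C Y X" "g \<cdot>\<^bsub>C\<^esub> f = Idt C X" "f \<cdot>\<^bsub>C\<^esub> g = Idt C Y" and f: "f \<in> hom C X Y"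
    using assms(2) by (auto simp: iso_ar_def)
  have "X \<in> Ob C" by (rule hom_dom[OF functor_cats(1)[OF assms(1)] f])
  moreover have "Y \<in> Ob C" by (rule hom_cod[OF functor_cats(1)[OF assms(1)] f])
  ultimately show ?thesis
    using functor_comp[OF assms(1) f g(1)] functor_comp[OF assms(1) g(1) f] g functor_id[OF assms(1)]
      functor_hom[OF assms(1) f] functor_hom[OF assms(1) g(1)]
    by (intro iso_arI) auto
qed

lemma Mono_cancel:
  assumes "f \<in> Mono C" "f \<in> hom C X Y" "g \<in> hom C W X" "h \<in> hom C W X" "f \<cdot>\<^bsub>C\<^esub> g = f \<cdot>\<^bsub>C\<^esub> h"
  shows "g = h"
  using assms unfolding Mono_def hom_def by auto


section \<open>Colimits given by generators and relations\<close>

text \<open>A relation \<open>(j, a, k, b)\<close> demands \<open>c j \<cdot> a = c k \<cdot> b\<close> of a cocone \<open>c\<close>. All shapes of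
  colimits below are instances.\<close>

definition rel_wf :: "('o, 'm) cat \<Rightarrow> 'j set \<Rightarrow> ('j \<Rightarrow> 'o) \<Rightarrow> ('j \<times> 'm \<times> 'j \<times> 'm) set \<Rightarrow> bool" where
  "rel_wf C J X R \<longleftrightarrow> (\<forall>j \<in> J. X j \<in> Ob C) \<and>
     (\<forall>(j, a, k, b) \<in> R. j \<in> J \<and> k \<in> J \<and> (\<exists>A. a \<in> hom C A (X j) \<and> b \<in> hom C A (X k)))"

definition relcone :: "('o, 'm) cat \<Rightarrow> 'j set \<Rightarrow> ('j \<Rightarrow> 'o) \<Rightarrow> ('j \<times> 'm \<times> 'j \<times> 'm) set \<Rightarrow>
    'o \<Rightarrow> ('j \<Rightarrow> 'm) \<Rightarrow> bool" where
  "relcone C J X R Y d \<longleftrightarrow> Y \<in> Ob C \<and> (\<forall>j \<in> J. d j \<in> hom C (X j) Y) \<and>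
     (\<forall>(j, a, k, b) \<in> R. d j \<cdot>\<^bsub>C\<^esub> a = d k \<cdot>\<^bsub>C\<^esub> b)"

definition relcolim :: "('o, 'm) cat \<Rightarrow> 'j set \<Rightarrow> ('j \<Rightarrow> 'o) \<Rightarrow> ('j \<times> 'm \<times> 'j \<times> 'm) set \<Rightarrow>
    'o \<Rightarrow> ('j \<Rightarrow> 'm) \<Rightarrow> bool" where
  "relcolim C J X R Z c \<longleftrightarrow> relcone C J X R Z c \<and>
     (\<forall>Y d. relcone C J X R Y d \<longrightarrow> (\<exists>!u. u \<in> hom C Z Y \<and> (\<forall>j \<in> J. u \<cdot>\<^bsub>C\<^esub> c j = d j)))"

text \<open>Cocompleteness in the form that is carried up the tower: transferring it to algebraic
  injectives requires moving only a set of objects and a set of equations, not a shape category. The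
  index set lies in \<open>'u\<close>; \<open>relcoc_any\<close> removes this restriction.\<close>

definition relcoc :: "'u rel \<Rightarrow> ('o, 'm) cat \<Rightarrow> bool" where
  "relcoc U C \<longleftrightarrow> (\<forall>(J :: 'u set) X R. small U J \<and> small U R \<and> rel_wf C J X R \<longrightarrow>
     (\<exists>Z c. relcolim C J X R Z c))"

lemma (in universe) relcoc_any:
  fixes J :: "'j set"
  assumes "relcoc U C" "small U J" "small U R" "rel_wf C J X R"
  shows "\<exists>Z c. relcolim C J X R Z c"
proof -
  obtain \<phi> :: "'j \<Rightarrow> 'u" where \<phi>: "inj_on \<phi> J" using small_embeds assms(2) by blast
  define \<psi> where "\<psi> = inv_into J \<phi>"
  have [simp]: "\<And>j. j \<in> J \<Longrightarrow> \<psi> (\<phi> j) = j" by (simp add: \<psi>_def \<phi>)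
  define R' where "R' = (\<lambda>(j, a, k, b). (\<phi> j, a, \<phi> k, b)) ` R"
  have RJ: "(j, a, k, b) \<in> R \<Longrightarrow> j \<in> J \<and> k \<in> J" for j a k b using assms(4) by (auto simp: rel_wf_def)
  have cone: "relcone C (\<phi> ` J) (X \<circ> \<psi>) R' Y d \<longleftrightarrow> relcone C J X R Y (d \<circ> \<phi>)" for Y d
    unfolding relcone_def R'_def by auto
  have cone': "relcone C J X R Y d \<Longrightarrow> relcone C (\<phi> ` J) (X \<circ> \<psi>) R' Y (d \<circ> \<psi>)" for Y d
    unfolding relcone_def R'_def using RJ by fastforce
  have "rel_wf C (\<phi> ` J) (X \<circ> \<psi>) R'" using assms(4) RJ unfolding rel_wf_def R'_def by fastforce
  moreover have "small U (\<phi> ` J)" "small U R'" unfolding R'_def by (intro small_image assms)+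
  ultimately obtain Z c where Z: "relcolim C (\<phi> ` J) (X \<circ> \<psi>) R' Z c"
    using assms(1) unfolding relcoc_def by blast
  have "relcolim C J X R Z (c \<circ> \<phi>)"
    unfolding relcolim_def
  proof (intro conjI allI impI)
    show "relcone C J X R Z (c \<circ> \<phi>)" using Z cone unfolding relcolim_def by blast
    fix Y d assume "relcone C J X R Y d"
    then have "\<exists>!u. u \<in> hom C Z Y \<and> (\<forall>j \<in> \<phi> ` J. u \<cdot>\<^bsub>C\<^esub> c j = (d \<circ> \<psi>) j)"
      using Z cone' unfolding relcolim_def by blast
    then show "\<exists>!u. u \<in> hom C Z Y \<and> (\<forall>j \<in> J. u \<cdot>\<^bsub>C\<^esub> (c \<circ> \<phi>) j = d j)" by simp
  qed
  then show ?thesis by blast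
qed

text \<open>The shape category is copied along injections of its objects and arrows into
  \<open>'u\<close>; cocones correspond under relabelling.\<close>

lemma (in universe) cocomplete_any:
  fixes J :: "('j, 'k) cat"
  assumes "cocomplete U C" "category J" "small U (Ob J)" "small U (Ar J)" "is_functor J C D"
  shows "\<exists>Z c. is_colimit J C D Z c"
proof -
  obtain \<phi> :: "'j \<Rightarrow> 'u" where \<phi>: "inj_on \<phi> (Ob J)" using small_embeds assms(3) by blast
  obtain \<psi> :: "'k \<Rightarrow> 'u" where \<psi>: "inj_on \<psi> (Ar J)" using small_embeds assms(4) by blast
  define \<phi>' where "\<phi>' = inv_into (Ob J) \<phi>"
  define \<psi>' where "\<psi>' = inv_into (Ar J) \<psi>"
  have [simp]: "\<And>j. j \<in> Ob J \<Longrightarrow> \<phi>' (\<phi> j) = j" by (simp add: \<phi>'_def \<phi>)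
  have [simp]: "\<And>j. j \<in> Ar J \<Longrightarrow> \<psi>' (\<psi> j) = j" by (simp add: \<psi>'_def \<psi>)
  define J' where "J' = \<lparr>Ob = \<phi> ` Ob J, Ar = \<psi> ` Ar J, Dom = \<lambda>k. \<phi> (Dom J (\<psi>' k)),
     Cod = \<lambda>k. \<phi> (Cod J (\<psi>' k)), Idt = \<lambda>a. \<psi> (Idt J (\<phi>' a)), Cmp = \<lambda>q p. \<psi> (Cmp J (\<psi>' q) (\<psi>' p))\<rparr>"
  define D' where "D' = \<lparr>on_ob = on_ob D \<circ> \<phi>', on_ar = on_ar D \<circ> \<psi>'\<rparr>"
  have obs: "k \<in> Ar J \<Longrightarrow> Dom J k \<in> Ob J \<and> Cod J k \<in> Ob J" for k
    using assms(2) by (auto simp: category_def)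
  have ids: "j \<in> Ob J \<Longrightarrow> Idt J j \<in> Ar J \<and> Dom J (Idt J j) = j \<and> Cod J (Idt J j) = j" for j
    using assms(2) by (auto simp: category_def hom_def)
  have inj: "j \<in> Ob J \<Longrightarrow> k \<in> Ob J \<Longrightarrow> \<phi> j = \<phi> k \<longleftrightarrow> j = k" for j k
    using \<phi> by (auto simp: inj_on_def)
  have cmp: "f \<in> Ar J \<Longrightarrow> g \<in> Ar J \<Longrightarrow> Cod J f = Dom J g \<Longrightarrow>
      g \<cdot>\<^bsub>J\<^esub> f \<in> Ar J \<and> Dom J (g \<cdot>\<^bsub>J\<^esub> f) = Dom J f \<and> Cod J (g \<cdot>\<^bsub>J\<^esub> f) = Cod J g" for f g
    using assms(2) by (auto simp: category_def hom_def)
  have "category J'"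
    unfolding category_def J'_def hom_def using assms(2)
    by (auto simp: obs ids inj cmp category_def)
  moreover have "is_functor J' C D'"
    using assms(5) \<open>category J'\<close> unfolding is_functor_def
    by (auto simp: J'_def D'_def obs ids inj cmp)
  moreover have "small U (Ob J')" "small U (Ar J')"
    using assms(3,4) small_image by (auto simp: J'_def)
  ultimately obtain Z c where Z: "is_colimit J' C D' Z c"
    using assms(1) unfolding cocomplete_def by blast
  have cone: "is_cocone J' C D' Y d \<longleftrightarrow> is_cocone J C D Y (d \<circ> \<phi>)" for Y d
    unfolding is_cocone_def J'_def D'_def by (auto simp: obs)
  have cone': "is_cocone J C D Y d \<Longrightarrow> is_cocone J' C D' Y (d \<circ> \<phi>')" for Y d
    unfolding is_cocone_def J'_def D'_def by (auto simp: obs)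
  have "is_colimit J C D Z (c \<circ> \<phi>)"
    unfolding is_colimit_def
  proof (intro conjI allI impI assms)
    show "is_cocone J C D Z (c \<circ> \<phi>)" using Z cone unfolding is_colimit_def by blast
    fix Y d assume "is_cocone J C D Y d"
    then have "\<exists>!u. u \<in> hom C Z Y \<and> (\<forall>j \<in> Ob J'. u \<cdot>\<^bsub>C\<^esub> c j = (d \<circ> \<phi>') j)"
      using Z cone' unfolding is_colimit_def by blast
    then show "\<exists>!u. u \<in> hom C Z Y \<and> (\<forall>j \<in> Ob J. u \<cdot>\<^bsub>C\<^esub> (c \<circ> \<phi>) j = d j)" by (simp add: J'_def)
  qed
  then show ?thesis by blast
qed

text \<open>Cells of the shape category of a presentation. \<open>Gen\<close> and \<open>Rel\<close>
  label its objects and, at the same time, their identity arrows; \<open>Lft\<close> and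
  \<open>Rgt\<close> are the two arrows from a relation to the generators that it compares.\<close>

datatype ('j, 'r) presented = Gen 'j | Rel 'r | Lft 'r | Rgt 'r

lemma (in universe) cocomplete_relcoc:
  assumes "cocomplete U C" "category C"
  shows "relcoc U C"
  unfolding relcoc_def
proof (intro allI impI, elim conjE)
  fix J :: "'u set" and X and R :: "('u \<times> 'b \<times> 'u \<times> 'b) set"
  assume J: "small U J" and R: "small U R" and wf: "rel_wf C J X R"
  define s where "s = (\<lambda>\<rho> :: 'u \<times> 'b \<times> 'u \<times> 'b. fst \<rho>)"
  define p where "p = (\<lambda>\<rho> :: 'u \<times> 'b \<times> 'u \<times> 'b. fst (snd \<rho>))"
  define t where "t = (\<lambda>\<rho> :: 'u \<times> 'b \<times> 'u \<times> 'b. fst (snd (snd \<rho>)))"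
  define q where "q = (\<lambda>\<rho> :: 'u \<times> 'b \<times> 'u \<times> 'b. snd (snd (snd \<rho>)))"
  have wfR: "s \<rho> \<in> J \<and> t \<rho> \<in> J \<and> p \<rho> \<in> hom C (Dom C (p \<rho>)) (X (s \<rho>)) \<and>
      q \<rho> \<in> hom C (Dom C (p \<rho>)) (X (t \<rho>))" if "\<rho> \<in> R" for \<rho>
    using wf that unfolding rel_wf_def s_def p_def t_def q_def hom_def by fastforce
  have wfX: "X j \<in> Ob C" if "j \<in> J" for j using wf that by (auto simp: rel_wf_def)
  have relcone_alt: "relcone C J X R Y d \<longleftrightarrow> Y \<in> Ob C \<and> (\<forall>j \<in> J. d j \<in> hom C (X j) Y) \<and>
     (\<forall>\<rho> \<in> R. d (s \<rho>) \<cdot>\<^bsub>C\<^esub> p \<rho> = d (t \<rho>) \<cdot>\<^bsub>C\<^esub> q \<rho>)" for Y d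
    unfolding relcone_def s_def p_def t_def q_def by (auto simp: split_beta)
  define src where "src = (\<lambda>x :: ('u, 'u \<times> 'b \<times> 'u \<times> 'b) presented. case x of Gen j \<Rightarrow> Gen j :: ('u, 'u \<times> 'b \<times> 'u \<times> 'b) presented | Rel \<rho> \<Rightarrow> Rel \<rho> | Lft \<rho> \<Rightarrow> Rel \<rho> | Rgt \<rho> \<Rightarrow> Rel \<rho>)"
  define tgt where "tgt = (\<lambda>x :: ('u, 'u \<times> 'b \<times> 'u \<times> 'b) presented. case x of Gen j \<Rightarrow> Gen j | Rel \<rho> \<Rightarrow> Rel \<rho> | Lft \<rho> \<Rightarrow> Gen (s \<rho>) | Rgt \<rho> \<Rightarrow> Gen (t \<rho>))"
  define obs where "obs = Gen ` J \<union> Rel ` R"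
  define ars where "ars = obs \<union> Lft ` R \<union> Rgt ` R"
  \<comment> \<open>All arrows other than identities go from a relation to a generator, so in a
    composable pair one member is an identity and composition merely selects the other.\<close>
  define K where "K = \<lparr>Ob = obs, Ar = ars, Dom = src, Cod = tgt, Idt = id,
     Cmp = \<lambda>g f. if g \<in> obs then f else g\<rparr>"
  define D where "D = \<lparr>on_ob = (\<lambda>x. case x of Gen j \<Rightarrow> X j | Rel \<rho> \<Rightarrow> Dom C (p \<rho>) | _ \<Rightarrow> undefined),
     on_ar = (\<lambda>x. case x of Gen j \<Rightarrow> Idt C (X j) | Rel \<rho> \<Rightarrow> Idt C (Dom C (p \<rho>)) | Lft \<rho> \<Rightarrow> p \<rho> | Rgt \<rho> \<Rightarrow> q \<rho>)\<rparr>"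
  have K: "category K"
    unfolding category_def K_def hom_def ars_def obs_def src_def tgt_def using wfR by auto
  have pO: "Dom C (p \<rho>) \<in> Ob C" if "\<rho> \<in> R" for \<rho> using wfR[OF that] hom_dom[OF assms(2)] by blast
  note ids = id_hom[OF assms(2)] id_left[OF assms(2)] id_right[OF assms(2)]
  have cmps: "p \<rho> \<cdot>\<^bsub>C\<^esub> Idt C (Dom C (p \<rho>)) = p \<rho>" "q \<rho> \<cdot>\<^bsub>C\<^esub> Idt C (Dom C (p \<rho>)) = q \<rho>"
      "Idt C (X (s \<rho>)) \<cdot>\<^bsub>C\<^esub> p \<rho> = p \<rho>" "Idt C (X (t \<rho>)) \<cdot>\<^bsub>C\<^esub> q \<rho> = q \<rho>" if "\<rho> \<in> R" for \<rho>
    using wfR[OF that] ids by blast+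
  have D: "is_functor K C D"
    unfolding is_functor_def
  proof (intro conjI ballI impI K assms(2))
    show "on_ob D x \<in> Ob C" if "x \<in> Ob K" for x
      using that wfX pO by (auto simp: K_def D_def obs_def)
    show "on_ar D x \<in> hom C (on_ob D (Dom K x)) (on_ob D (Cod K x))" if "x \<in> Ar K" for x
      using that wfX pO wfR by (auto simp: K_def D_def obs_def ars_def src_def tgt_def ids)
    show "on_ar D (Idt K x) = Idt C (on_ob D x)" if "x \<in> Ob K" for x
      using that by (auto simp: K_def D_def obs_def)
    show "on_ar D (g \<cdot>\<^bsub>K\<^esub> f) = on_ar D g \<cdot>\<^bsub>C\<^esub> on_ar D f"
      if "f \<in> Ar K" "g \<in> Ar K" "Cod K f = Dom K g" for f g
      using that wfX pO cmps
      by (auto simp: K_def D_def obs_def ars_def src_def tgt_def id_left[OF assms(2) ids(1)])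
  qed
  have "small U obs" unfolding obs_def by (intro small_Un small_image J R)
  then have "small U (Ob K)" "small U (Ar K)"
    unfolding K_def ars_def by (auto intro!: small_Un small_image R)
  then have "\<exists>Z c. is_colimit K C D Z c" using cocomplete_any[OF assms(1) K _ _ D] by blast
  then obtain Z c where Z: "is_colimit K C D Z c" by blast
  \<comment> \<open>The leg at a relation is forced: it is the common value of the two composites.
    Arrow labels are not objects and receive no leg.\<close>
  define ext where "ext = (\<lambda>d x. case x of Gen j \<Rightarrow> d j | Rel \<rho> \<Rightarrow> d (s \<rho>) \<cdot>\<^bsub>C\<^esub> p \<rho> | _ \<Rightarrow> undefined)"
  have c1: "is_cocone K C D Y (ext d)" if "relcone C J X R Y d" for Y d
  proof -
    have h: "d (s \<rho>) \<cdot>\<^bsub>C\<^esub> p \<rho> \<in> hom C (Dom C (p \<rho>)) Y" if "\<rho> \<in> R" for \<rho>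
      using \<open>relcone C J X R Y d\<close> that wfR[OF that] comp_hom[OF assms(2)] unfolding relcone_alt by blast
    have h': "(d (s \<rho>) \<cdot>\<^bsub>C\<^esub> p \<rho>) \<cdot>\<^bsub>C\<^esub> Idt C (Dom C (p \<rho>)) = d (s \<rho>) \<cdot>\<^bsub>C\<^esub> p \<rho>" if "\<rho> \<in> R" for \<rho>
      using ids(3)[OF h[OF that]] .
    have e: "d (t \<rho>) \<cdot>\<^bsub>C\<^esub> q \<rho> = d (s \<rho>) \<cdot>\<^bsub>C\<^esub> p \<rho>" if "\<rho> \<in> R" for \<rho>
      using \<open>relcone C J X R Y d\<close> that unfolding relcone_alt by simp
    have i: "d j \<cdot>\<^bsub>C\<^esub> Idt C (X j) = d j" if "j \<in> J" for j
      using \<open>relcone C J X R Y d\<close> that ids unfolding relcone_alt by blast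
    show ?thesis
      using that wfR h h' e i unfolding relcone_alt is_cocone_def
      by (simp add: K_def D_def obs_def ars_def src_def tgt_def ext_def ball_Un)
  qed
  have c2: "relcone C J X R Y (d \<circ> Gen)" if "is_cocone K C D Y d" for Y d
    using that unfolding relcone_alt is_cocone_def
    by (simp add: K_def D_def obs_def ars_def src_def tgt_def ball_Un)
  have c3: "d (Rel \<rho>) = d (Gen (s \<rho>)) \<cdot>\<^bsub>C\<^esub> p \<rho>" if "is_cocone K C D Y d" "\<rho> \<in> R" for Y d \<rho>
    using that unfolding is_cocone_def
    by (simp add: K_def D_def obs_def ars_def src_def tgt_def ball_Un)
  have Zc: "is_cocone K C D Z c" using Z by (simp add: is_colimit_def)
  have "relcolim C J X R Z (c \<circ> Gen)"
    unfolding relcolim_def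
  proof (intro conjI allI impI)
    show "relcone C J X R Z (c \<circ> Gen)" by (rule c2[OF Zc])
    fix Y d assume d: "relcone C J X R Y d"
    have "(\<forall>x \<in> Ob K. u \<cdot>\<^bsub>C\<^esub> c x = ext d x) \<longleftrightarrow> (\<forall>j \<in> J. u \<cdot>\<^bsub>C\<^esub> (c \<circ> Gen) j = d j)"
      if u: "u \<in> hom C Z Y" for u
    proof
      assume "\<forall>x \<in> Ob K. u \<cdot>\<^bsub>C\<^esub> c x = ext d x"
      then show "\<forall>j \<in> J. u \<cdot>\<^bsub>C\<^esub> (c \<circ> Gen) j = d j" by (auto simp: K_def obs_def ext_def)
    next
      assume a: "\<forall>j \<in> J. u \<cdot>\<^bsub>C\<^esub> (c \<circ> Gen) j = d j"
      have "u \<cdot>\<^bsub>C\<^esub> c (Rel \<rho>) = d (s \<rho>) \<cdot>\<^bsub>C\<^esub> p \<rho>" if \<rho>: "\<rho> \<in> R" for \<rho>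
      proof -
        have "c (Gen (s \<rho>)) \<in> hom C (X (s \<rho>)) Z"
          using c2[OF Zc] wfR[OF \<rho>] by (auto simp: relcone_def)
        then have "u \<cdot>\<^bsub>C\<^esub> (c (Gen (s \<rho>)) \<cdot>\<^bsub>C\<^esub> p \<rho>) = (u \<cdot>\<^bsub>C\<^esub> c (Gen (s \<rho>))) \<cdot>\<^bsub>C\<^esub> p \<rho>"
          using comp_assoc[OF assms(2)] u wfR[OF \<rho>] by metis
        then show ?thesis using a wfR[OF \<rho>] c3[OF Zc \<rho>] by simp
      qed
      then show "\<forall>x \<in> Ob K. u \<cdot>\<^bsub>C\<^esub> c x = ext d x" using a by (auto simp: K_def obs_def ext_def)
    qed
    moreover have "\<exists>!u. u \<in> hom C Z Y \<and> (\<forall>x \<in> Ob K. u \<cdot>\<^bsub>C\<^esub> c x = ext d x)"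
      using Z c1[OF d] unfolding is_colimit_def by blast
    ultimately show "\<exists>!u. u \<in> hom C Z Y \<and> (\<forall>j \<in> J. u \<cdot>\<^bsub>C\<^esub> (c \<circ> Gen) j = d j)" by metis
  qed
  then show "\<exists>Z c. relcolim C J X R Z c" by blast
qed

section \<open>Uniqueness and transport of presented colimits\<close>

lemma relcone_comp:
  assumes "category C" "rel_wf C J X R" "relcone C J X R Z c" "u \<in> hom C Z Y"
  shows "relcone C J X R Y (\<lambda>j. u \<cdot>\<^bsub>C\<^esub> c j)"
proof -
  have "(u \<cdot>\<^bsub>C\<^esub> c j) \<cdot>\<^bsub>C\<^esub> a = (u \<cdot>\<^bsub>C\<^esub> c k) \<cdot>\<^bsub>C\<^esub> b" if r: "(j, a, k, b) \<in> R" for j a k b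
  proof -
    obtain A where "a \<in> hom C A (X j)" "b \<in> hom C A (X k)" "j \<in> J" "k \<in> J"
      using assms(2) r unfolding rel_wf_def by blast
    moreover have "c j \<in> hom C (X j) Z" "c k \<in> hom C (X k) Z" "c j \<cdot>\<^bsub>C\<^esub> a = c k \<cdot>\<^bsub>C\<^esub> b"
      using assms(3) r calculation unfolding relcone_def by auto
    ultimately show ?thesis using comp_assoc[OF assms(1) _ _ assms(4)] by metis
  qed
  then show ?thesis
    using assms(3,4) comp_hom[OF assms(1)] hom_cod[OF assms(1,4)] unfolding relcone_def by blast
qed

lemma relcolim_cone: "relcolim C J X R Z c \<Longrightarrow> relcone C J X R Z c"
  by (simp add: relcolim_def)

lemma relcolim_eq:
  assumes "category C" "rel_wf C J X R" "relcolim C J X R Z c" "u \<in> hom C Z Y" "v \<in> hom C Z Y"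
    "\<And>j. j \<in> J \<Longrightarrow> u \<cdot>\<^bsub>C\<^esub> c j = v \<cdot>\<^bsub>C\<^esub> c j"
  shows "u = v"
proof -
  have "relcone C J X R Y (\<lambda>j. v \<cdot>\<^bsub>C\<^esub> c j)"
    using relcone_comp[OF assms(1,2) relcolim_cone[OF assms(3)] assms(5)] .
  then have "\<exists>!w. w \<in> hom C Z Y \<and> (\<forall>j \<in> J. w \<cdot>\<^bsub>C\<^esub> c j = v \<cdot>\<^bsub>C\<^esub> c j)"
    using assms(3) unfolding relcolim_def by blast
  then show ?thesis using assms(4-6) by blast
qed

lemma relcolim_iso:
  assumes "category C" "rel_wf C J X R" "relcolim C J X R Z c" "relcolim C J X R Z' c'"
  shows "\<exists>i. iso_ar C Z Z' i \<and> (\<forall>j \<in> J. i \<cdot>\<^bsub>C\<^esub> c j = c' j)"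
proof -
  have c: "relcone C J X R Z c" and c': "relcone C J X R Z' c'"
    using relcolim_cone[OF assms(3)] relcolim_cone[OF assms(4)] by simp_all
  obtain i where i: "i \<in> hom C Z Z'" "\<And>j. j \<in> J \<Longrightarrow> i \<cdot>\<^bsub>C\<^esub> c j = c' j"
    using assms(3) c' unfolding relcolim_def by blast
  obtain k where k: "k \<in> hom C Z' Z" "\<And>j. j \<in> J \<Longrightarrow> k \<cdot>\<^bsub>C\<^esub> c' j = c j"
    using assms(4) c unfolding relcolim_def by blast
  have h: "c j \<in> hom C (X j) Z" "c' j \<in> hom C (X j) Z'" if "j \<in> J" for j
    using c c' that by (auto simp: relcone_def)
  have O: "Z \<in> Ob C" "Z' \<in> Ob C" using c c' by (auto simp: relcone_def)
  have "k \<cdot>\<^bsub>C\<^esub> i = Idt C Z"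
    by (rule relcolim_eq[OF assms(1,2,3) comp_hom[OF assms(1) i(1) k(1)] id_hom[OF assms(1) O(1)]])
      (metis assms(1) comp_assoc h(1) i k id_left)
  moreover have "i \<cdot>\<^bsub>C\<^esub> k = Idt C Z'"
    by (rule relcolim_eq[OF assms(1,2,4) comp_hom[OF assms(1) k(1) i(1)] id_hom[OF assms(1) O(2)]])
      (metis assms(1) comp_assoc h(2) i k id_left)
  ultimately show ?thesis using i(2) iso_arI[OF i(1) k(1)] by blast
qed

lemma relcolim_transport:
  assumes "category C" "rel_wf C J X R" "relcolim C J X R Z c" "iso_ar C Z Z' i"
  shows "relcolim C J X R Z' (\<lambda>j. i \<cdot>\<^bsub>C\<^esub> c j)"
proof -
  obtain k where i: "i \<in> hom C Z Z'" and k: "k \<in> hom C Z' Z" "k \<cdot>\<^bsub>C\<^esub> i = Idt C Z" "i \<cdot>\<^bsub>C\<^esub> k = Idt C Z'"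
    using assms(4) unfolding iso_ar_def by blast
  have c: "relcone C J X R Z c" using assms(3) by (rule relcolim_cone)
  have h: "c j \<in> hom C (X j) Z" if "j \<in> J" for j using c that by (auto simp: relcone_def)
  note cat = assms(1)
  show ?thesis unfolding relcolim_def
  proof (intro conjI allI impI)
    show "relcone C J X R Z' (\<lambda>j. i \<cdot>\<^bsub>C\<^esub> c j)" using relcone_comp[OF cat assms(2) c i] .
    fix Y d assume d: "relcone C J X R Y d"
    obtain u where u: "u \<in> hom C Z Y" "\<And>j. j \<in> J \<Longrightarrow> u \<cdot>\<^bsub>C\<^esub> c j = d j"
      using assms(3) d unfolding relcolim_def by blast
    show "\<exists>!w. w \<in> hom C Z' Y \<and> (\<forall>j \<in> J. w \<cdot>\<^bsub>C\<^esub> (i \<cdot>\<^bsub>C\<^esub> c j) = d j)"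
    proof (rule ex1I[of _ "u \<cdot>\<^bsub>C\<^esub> k"], safe)
      show 1: "u \<cdot>\<^bsub>C\<^esub> k \<in> hom C Z' Y" by (rule comp_hom[OF cat k(1) u(1)])
      fix j assume j: "j \<in> J"
      have "(u \<cdot>\<^bsub>C\<^esub> k) \<cdot>\<^bsub>C\<^esub> (i \<cdot>\<^bsub>C\<^esub> c j) = u \<cdot>\<^bsub>C\<^esub> ((k \<cdot>\<^bsub>C\<^esub> i) \<cdot>\<^bsub>C\<^esub> c j)"
        using comp_assoc[OF cat comp_hom[OF cat h[OF j] i] k(1) u(1)] comp_assoc[OF cat h[OF j] i k(1)] by simp
      then show "(u \<cdot>\<^bsub>C\<^esub> k) \<cdot>\<^bsub>C\<^esub> (i \<cdot>\<^bsub>C\<^esub> c j) = d j" using k u(2)[OF j] id_left[OF cat h[OF j]] by simp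
    next
      fix w assume w: "w \<in> hom C Z' Y" "\<forall>j \<in> J. w \<cdot>\<^bsub>C\<^esub> (i \<cdot>\<^bsub>C\<^esub> c j) = d j"
      have "w \<cdot>\<^bsub>C\<^esub> i = u"
        by (rule relcolim_eq[OF cat assms(2,3) comp_hom[OF cat i w(1)] u(1)])
          (metis comp_assoc[OF cat h i w(1)] w(2) u(2))
      then have "u \<cdot>\<^bsub>C\<^esub> k = w \<cdot>\<^bsub>C\<^esub> (i \<cdot>\<^bsub>C\<^esub> k)" using comp_assoc[OF cat k(1) i w(1)] by simp
      then show "w = u \<cdot>\<^bsub>C\<^esub> k" using k id_right[OF cat w(1)] by simp
    qed
  qed
qed


section \<open>Colimits of poset diagrams\<close>

text \<open>The index set \<open>A\<close> is kept apart from the relation \<open>r\<close>, which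
  may extend beyond it. Restricting a diagram to an initial segment or to a cofinal part then
  changes \<open>A\<close> only.\<close>

definition pdiag :: "('o, 'm) cat \<Rightarrow> 'j set \<Rightarrow> 'j rel \<Rightarrow> ('j \<Rightarrow> 'o) \<Rightarrow> ('j \<Rightarrow> 'j \<Rightarrow> 'm) \<Rightarrow> bool" where
  "pdiag C A r X h \<longleftrightarrow> (\<forall>a \<in> A. X a \<in> Ob C \<and> h a a = Idt C (X a)) \<and>
     (\<forall>a \<in> A. \<forall>b \<in> A. (a, b) \<in> r \<longrightarrow> h a b \<in> hom C (X a) (X b)) \<and>
     (\<forall>a \<in> A. \<forall>b \<in> A. \<forall>c \<in> A. (a, b) \<in> r \<longrightarrow> (b, c) \<in> r \<longrightarrow> h b c \<cdot>\<^bsub>C\<^esub> h a b = h a c)"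

definition pcone :: "('o, 'm) cat \<Rightarrow> 'j set \<Rightarrow> 'j rel \<Rightarrow> ('j \<Rightarrow> 'o) \<Rightarrow> ('j \<Rightarrow> 'j \<Rightarrow> 'm) \<Rightarrow>
    'o \<Rightarrow> ('j \<Rightarrow> 'm) \<Rightarrow> bool" where
  "pcone C A r X h Y d \<longleftrightarrow> Y \<in> Ob C \<and> (\<forall>a \<in> A. d a \<in> hom C (X a) Y) \<and>
     (\<forall>a \<in> A. \<forall>b \<in> A. (a, b) \<in> r \<longrightarrow> d b \<cdot>\<^bsub>C\<^esub> h a b = d a)"

definition pcolim :: "('o, 'm) cat \<Rightarrow> 'j set \<Rightarrow> 'j rel \<Rightarrow> ('j \<Rightarrow> 'o) \<Rightarrow> ('j \<Rightarrow> 'j \<Rightarrow> 'm) \<Rightarrow>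
    'o \<Rightarrow> ('j \<Rightarrow> 'm) \<Rightarrow> bool" where
  "pcolim C A r X h Z c \<longleftrightarrow> pcone C A r X h Z c \<and>
     (\<forall>Y d. pcone C A r X h Y d \<longrightarrow> (\<exists>!u. u \<in> hom C Z Y \<and> (\<forall>a \<in> A. u \<cdot>\<^bsub>C\<^esub> c a = d a)))"

text \<open>The identity on the right-hand side brings the cocone equation for a comparable pair
  into the shape of a relation.\<close>

definition poset_rels :: "('o, 'm) cat \<Rightarrow> 'j set \<Rightarrow> 'j rel \<Rightarrow> ('j \<Rightarrow> 'o) \<Rightarrow> ('j \<Rightarrow> 'j \<Rightarrow> 'm) \<Rightarrow>
    ('j \<times> 'm \<times> 'j \<times> 'm) set" where
  "poset_rels C A r X h = (\<lambda>(a, b). (b, h a b, a, Idt C (X a))) ` {(a, b). a \<in> A \<and> b \<in> A \<and> (a, b) \<in> r}"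

lemma poset_rels_wf: "category C \<Longrightarrow> pdiag C A r X h \<Longrightarrow> rel_wf C A X (poset_rels C A r X h)"
  unfolding rel_wf_def poset_rels_def
proof (intro conjI ballI, simp add: pdiag_def, clarsimp)
  fix a b assume c: "category C" and p: "pdiag C A r X h" and ab: "a \<in> A" "b \<in> A" "(a, b) \<in> r"
  have "h a b \<in> hom C (X a) (X b)" "Idt C (X a) \<in> hom C (X a) (X a)"
    using p ab id_hom[OF c] unfolding pdiag_def by blast+
  then show "\<exists>A. h a b \<in> hom C A (X b) \<and> Idt C (X a) \<in> hom C A (X a)" by blast
qed

lemma pcone_relcone:
  assumes "category C" shows "pcone C A r X h = relcone C A X (poset_rels C A r X h)"
proof (intro ext)
  fix Y d
  have "d a \<cdot>\<^bsub>C\<^esub> Idt C (X a) = d a" if "d a \<in> hom C (X a) Y" for a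
    using id_right[OF assms that] .
  then show "pcone C A r X h Y d = relcone C A X (poset_rels C A r X h) Y d"
    unfolding pcone_def relcone_def poset_rels_def by auto
qed

lemma pcolim_relcolim:
  "category C \<Longrightarrow> pcolim C A r X h = relcolim C A X (poset_rels C A r X h)"
  by (intro ext) (simp add: pcolim_def relcolim_def pcone_relcone)

lemma (in universe) pcolim_exists:
  assumes "relcoc U C" "category C" "small U A" "pdiag C A r X h"
  shows "\<exists>Z c. pcolim C A r X h Z c"
proof -
  have "small U (poset_rels C A r X h)"
    unfolding poset_rels_def
    by (intro small_image small_subset[OF small_Times[OF assms(3,3)]]) auto
  then show ?thesis
    using relcoc_any[OF assms(1,3) _ poset_rels_wf[OF assms(2,4)]] pcolim_relcolim[OF assms(2)] by metis
qed

lemma pcolim_cone: "pcolim C A r X h Z c \<Longrightarrow> pcone C A r X h Z c"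
  by (simp add: pcolim_def)

lemma pcolim_ob: "pcolim C A r X h Z c \<Longrightarrow> Z \<in> Ob C"
  by (simp add: pcolim_def pcone_def)

lemma pcolim_leg: "pcolim C A r X h Z c \<Longrightarrow> a \<in> A \<Longrightarrow> c a \<in> hom C (X a) Z"
  by (simp add: pcolim_def pcone_def)

lemma pcolim_leg_comp: "pcolim C A r X h Z c \<Longrightarrow> a \<in> A \<Longrightarrow> b \<in> A \<Longrightarrow> (a, b) \<in> r \<Longrightarrow> c b \<cdot>\<^bsub>C\<^esub> h a b = c a"
  by (simp add: pcolim_def pcone_def)

lemma pcolim_factor:
  assumes "pcolim C A r X h Z c" "pcone C A r X h Y d"
  obtains u where "u \<in> hom C Z Y" "\<And>a. a \<in> A \<Longrightarrow> u \<cdot>\<^bsub>C\<^esub> c a = d a"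
  using assms unfolding pcolim_def by blast

lemma pcolim_eq:
  assumes "category C" "pdiag C A r X h" "pcolim C A r X h Z c" "u \<in> hom C Z Y" "v \<in> hom C Z Y"
    "\<And>a. a \<in> A \<Longrightarrow> u \<cdot>\<^bsub>C\<^esub> c a = v \<cdot>\<^bsub>C\<^esub> c a"
  shows "u = v"
  using relcolim_eq[OF assms(1) poset_rels_wf[OF assms(1,2)] _ assms(4-6)] assms(3)
  by (simp add: pcolim_relcolim[OF assms(1)])

lemma pcolim_iso:
  assumes "category C" "pdiag C A r X h" "pcolim C A r X h Z c" "pcolim C A r X h Z' c'"
  shows "\<exists>i. iso_ar C Z Z' i \<and> (\<forall>a \<in> A. i \<cdot>\<^bsub>C\<^esub> c a = c' a)"
  using relcolim_iso[OF assms(1) poset_rels_wf[OF assms(1,2)]] assms(3,4)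
  by (simp add: pcolim_relcolim[OF assms(1)])

lemma pcolim_transport:
  assumes "category C" "pdiag C A r X h" "pcolim C A r X h Z c" "iso_ar C Z Z' i"
  shows "pcolim C A r X h Z' (\<lambda>a. i \<cdot>\<^bsub>C\<^esub> c a)"
  using relcolim_transport[OF assms(1) poset_rels_wf[OF assms(1,2)] _ assms(4)] assms(3)
  by (simp add: pcolim_relcolim[OF assms(1)])

lemma pcolim_cong:
  assumes "\<And>a. a \<in> A \<Longrightarrow> X a = X' a" "\<And>a b. a \<in> A \<Longrightarrow> b \<in> A \<Longrightarrow> (a, b) \<in> r \<Longrightarrow> h a b = h' a b"
    "\<And>a. a \<in> A \<Longrightarrow> c a = c' a"
  shows "pcolim C A r X h Z c \<longleftrightarrow> pcolim C A r X' h' Z c'"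
proof -
  have cone: "pcone C A r X h = pcone C A r X' h'"
    unfolding pcone_def using assms(1,2) by (intro ext) auto
  have "pcone C A r X' h' Z c \<longleftrightarrow> pcone C A r X' h' Z c'"
    unfolding pcone_def using assms(3) by auto
  then show ?thesis unfolding pcolim_def cone using assms(3) by auto
qed

text \<open>Every \<open>x\<close> lies below some \<open>\<phi> b\<close>, so the legs of any
  cocone at \<open>x\<close> are recovered from those on the image of \<open>\<phi>\<close>. Since
  \<open>Z\<close> already carries a cocone on all of \<open>A\<close>, this cofinality is enough:
  no cocone has to be extended.\<close>

lemma pcolim_reindex:
  assumes "category C" "pdiag C A r X h" "pcone C A r X h Z c"
    and "pcolim C A' r' (\<lambda>a. X (\<phi> a)) (\<lambda>a b. h (\<phi> a) (\<phi> b)) Z (\<lambda>a. c (\<phi> a))"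
    and "\<And>a. a \<in> A' \<Longrightarrow> \<phi> a \<in> A" "\<And>a b. a \<in> A' \<Longrightarrow> b \<in> A' \<Longrightarrow> (a, b) \<in> r' \<Longrightarrow> (\<phi> a, \<phi> b) \<in> r"
    and cof: "\<And>x. x \<in> A \<Longrightarrow> \<exists>a \<in> A'. (x, \<phi> a) \<in> r"
  shows "pcolim C A r X h Z c"
  unfolding pcolim_def
proof (intro conjI allI impI assms(3))
  fix Y d assume d: "pcone C A r X h Y d"
  then have "pcone C A' r' (\<lambda>a. X (\<phi> a)) (\<lambda>a b. h (\<phi> a) (\<phi> b)) Y (\<lambda>a. d (\<phi> a))"
    using assms(5,6) unfolding pcone_def by auto
  then have ex: "\<exists>!u. u \<in> hom C Z Y \<and> (\<forall>a \<in> A'. u \<cdot>\<^bsub>C\<^esub> c (\<phi> a) = d (\<phi> a))"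
    using assms(4) unfolding pcolim_def by blast
  have "(\<forall>a \<in> A'. u \<cdot>\<^bsub>C\<^esub> c (\<phi> a) = d (\<phi> a)) \<longleftrightarrow> (\<forall>a \<in> A. u \<cdot>\<^bsub>C\<^esub> c a = d a)" if u: "u \<in> hom C Z Y" for u
  proof (intro iffI ballI)
    fix x assume a: "\<forall>a \<in> A'. u \<cdot>\<^bsub>C\<^esub> c (\<phi> a) = d (\<phi> a)" and x: "x \<in> A"
    obtain b where b: "b \<in> A'" "(x, \<phi> b) \<in> r" using cof[OF x] by blast
    then have bA: "\<phi> b \<in> A" using assms(5) by blast
    have h: "h x (\<phi> b) \<in> hom C (X x) (X (\<phi> b))" using assms(2) x bA b unfolding pdiag_def by blast
    have c: "c (\<phi> b) \<in> hom C (X (\<phi> b)) Z" "c (\<phi> b) \<cdot>\<^bsub>C\<^esub> h x (\<phi> b) = c x"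
      using assms(3) bA x b unfolding pcone_def by auto
    have "d (\<phi> b) \<cdot>\<^bsub>C\<^esub> h x (\<phi> b) = d x" using d bA x b unfolding pcone_def by auto
    then show "u \<cdot>\<^bsub>C\<^esub> c x = d x" using comp_assoc[OF assms(1) h c(1) u] c(2) a b by simp
  qed (use assms(5) in blast)
  with ex show "\<exists>!u. u \<in> hom C Z Y \<and> (\<forall>a \<in> A. u \<cdot>\<^bsub>C\<^esub> c a = d a)" by metis
qed

definition dirset :: "'j set \<Rightarrow> 'j rel \<Rightarrow> bool" where
  "dirset A r \<longleftrightarrow> A \<noteq> {} \<and> (\<forall>a \<in> A. (a, a) \<in> r) \<and>
     (\<forall>a \<in> A. \<forall>b \<in> A. (a, b) \<in> r \<longrightarrow> (b, a) \<in> r \<longrightarrow> a = b) \<and>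
     (\<forall>a \<in> A. \<forall>b \<in> A. \<forall>c \<in> A. (a, b) \<in> r \<longrightarrow> (b, c) \<in> r \<longrightarrow> (a, c) \<in> r) \<and>
     (\<forall>a \<in> A. \<forall>b \<in> A. \<exists>c \<in> A. (a, c) \<in> r \<and> (b, c) \<in> r)"

lemma dirset_ne: "dirset A r \<Longrightarrow> A \<noteq> {}"
  by (simp add: dirset_def)

lemma dirset_refl: "dirset A r \<Longrightarrow> a \<in> A \<Longrightarrow> (a, a) \<in> r"
  unfolding dirset_def by blast

lemma dirset_antisym: "dirset A r \<Longrightarrow> a \<in> A \<Longrightarrow> b \<in> A \<Longrightarrow> (a, b) \<in> r \<Longrightarrow> (b, a) \<in> r \<Longrightarrow> a = b"
  unfolding dirset_def by blast

lemma dirset_trans: "dirset A r \<Longrightarrow> (a, b) \<in> r \<Longrightarrow> (b, c) \<in> r \<Longrightarrow> a \<in> A \<Longrightarrow> b \<in> A \<Longrightarrow> c \<in> A \<Longrightarrow> (a, c) \<in> r"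
  unfolding dirset_def by blast

lemma dirset_bound:
  assumes "dirset A r" "a \<in> A" "b \<in> A"
  obtains c where "c \<in> A" "(a, c) \<in> r" "(b, c) \<in> r"
  using assms unfolding dirset_def by meson

text \<open>The passage opposite to \<open>pcolim_reindex\<close>: a cocone known only on the
  cofinal part \<open>A'\<close> must be extended to \<open>A\<close>, by going from
  \<open>x\<close> to some later index in \<open>A'\<close>. Directedness of \<open>A'\<close> makes
  the result independent of that index.\<close>

lemma pcolim_restrict:
  assumes "category C" "pdiag C A r X h" "pcolim C A r X h Z c" "dirset A r" "A' \<subseteq> A" "dirset A' r"
    and cof: "\<And>x. x \<in> A \<Longrightarrow> \<exists>a \<in> A'. (x, a) \<in> r"
  shows "pcolim C A' r X h Z c"
  unfolding pcolim_def
proof (intro conjI allI impI)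
  show "pcone C A' r X h Z c" using pcolim_cone[OF assms(3)] assms(5) unfolding pcone_def by blast
  fix Y d assume d: "pcone C A' r X h Y d"
  have hh: "h a b \<in> hom C (X a) (X b)" if "a \<in> A" "b \<in> A" "(a, b) \<in> r" for a b
    using assms(2) that unfolding pdiag_def by blast
  have hhh: "h b e \<cdot>\<^bsub>C\<^esub> h a b = h a e" if "a \<in> A" "b \<in> A" "e \<in> A" "(a, b) \<in> r" "(b, e) \<in> r" for a b e
    using assms(2) that unfolding pdiag_def by blast
  have dh: "d a \<in> hom C (X a) Y" if "a \<in> A'" for a using d that unfolding pcone_def by blast
  have dd: "d b \<cdot>\<^bsub>C\<^esub> h a b = d a" if "a \<in> A'" "b \<in> A'" "(a, b) \<in> r" for a b
    using d that unfolding pcone_def by blast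
  define p where "p x = (SOME a. a \<in> A' \<and> (x, a) \<in> r)" for x
  have p: "p x \<in> A'" "(x, p x) \<in> r" "p x \<in> A" if "x \<in> A" for x
    using someI_ex[of "\<lambda>a. a \<in> A' \<and> (x, a) \<in> r"] cof[OF that] assms(5) unfolding p_def by blast+
  define d' where "d' x = d (p x) \<cdot>\<^bsub>C\<^esub> h x (p x)" for x
  \<comment> \<open>The chosen index \<open>p x\<close> and the arbitrary \<open>a\<close> are
    compared at a common upper bound in \<open>A'\<close>.\<close>
  have wd: "d' x = d a \<cdot>\<^bsub>C\<^esub> h x a" if x: "x \<in> A" and a: "a \<in> A'" "(x, a) \<in> r" for x a
  proof -
    obtain e where e: "e \<in> A'" "(p x, e) \<in> r" "(a, e) \<in> r"
      using assms(6) p[OF x] a unfolding dirset_def by blast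
    have A: "a \<in> A" "e \<in> A" using a e assms(5) by auto
    have "d a \<cdot>\<^bsub>C\<^esub> h x a = d e \<cdot>\<^bsub>C\<^esub> h x e"
      using comp_assoc[OF assms(1) hh[OF x A(1) a(2)] hh[OF A e(3)] dh[OF e(1)]]
        dd[OF a(1) e(1) e(3)] hhh[OF x A a(2) e(3)] by simp
    moreover have "d' x = d e \<cdot>\<^bsub>C\<^esub> h x e"
      using comp_assoc[OF assms(1) hh[OF x p(3)[OF x] p(2)[OF x]] hh[OF p(3)[OF x] A(2) e(2)] dh[OF e(1)]]
        dd[OF p(1)[OF x] e(1) e(2)] hhh[OF x p(3)[OF x] A(2) p(2)[OF x] e(2)] by (simp add: d'_def)
    ultimately show ?thesis by simp
  qed
  have YO: "Y \<in> Ob C" using d by (simp add: pcone_def)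
  have d'A: "d' a = d a" if "a \<in> A'" for a
  proof -
    have "a \<in> A" "(a, a) \<in> r" using that assms(5,6) unfolding dirset_def by auto
    moreover have "h a a = Idt C (X a)" using assms(2) \<open>a \<in> A\<close> by (auto simp: pdiag_def)
    ultimately show ?thesis using wd[OF _ that] id_right[OF assms(1) dh[OF that]] by simp
  qed
  have "pcone C A r X h Y d'"
    unfolding pcone_def
  proof (intro conjI ballI impI YO)
    fix x assume x: "x \<in> A"
    show "d' x \<in> hom C (X x) Y"
      unfolding d'_def using comp_hom[OF assms(1) hh[OF x p(3)[OF x] p(2)[OF x]] dh[OF p(1)[OF x]]] .
    fix y assume y: "y \<in> A" and xy: "(x, y) \<in> r"
    have xp: "(x, p y) \<in> r" using assms(4) x y p[OF y] xy unfolding dirset_def by blast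
    have "d' y \<cdot>\<^bsub>C\<^esub> h x y = d (p y) \<cdot>\<^bsub>C\<^esub> h x (p y)"
      unfolding d'_def
      using comp_assoc[OF assms(1) hh[OF x y xy] hh[OF y p(3)[OF y] p(2)[OF y]] dh[OF p(1)[OF y]]]
        hhh[OF x y p(3)[OF y] xy p(2)[OF y]] by simp
    then show "d' y \<cdot>\<^bsub>C\<^esub> h x y = d' x" using wd[OF x p(1)[OF y] xp] by simp
  qed
  then obtain u where u: "u \<in> hom C Z Y" "\<And>a. a \<in> A \<Longrightarrow> u \<cdot>\<^bsub>C\<^esub> c a = d' a"
    using pcolim_factor[OF assms(3)] by blast
  show "\<exists>!u. u \<in> hom C Z Y \<and> (\<forall>a \<in> A'. u \<cdot>\<^bsub>C\<^esub> c a = d a)"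
  proof (rule ex1I[of _ u])
    show "u \<in> hom C Z Y \<and> (\<forall>a \<in> A'. u \<cdot>\<^bsub>C\<^esub> c a = d a)" using u d'A assms(5) by auto
    fix v assume v: "v \<in> hom C Z Y \<and> (\<forall>a \<in> A'. v \<cdot>\<^bsub>C\<^esub> c a = d a)"
    show "v = u"
    proof (rule pcolim_eq[OF assms(1-3)])
      fix x assume x: "x \<in> A"
      have cp: "c (p x) \<cdot>\<^bsub>C\<^esub> h x (p x) = c x" using pcolim_leg_comp[OF assms(3) x p(3)[OF x] p(2)[OF x]] .
      have "v \<cdot>\<^bsub>C\<^esub> c x = (v \<cdot>\<^bsub>C\<^esub> c (p x)) \<cdot>\<^bsub>C\<^esub> h x (p x)"
        using comp_assoc[OF assms(1) hh[OF x p(3)[OF x] p(2)[OF x]] pcolim_leg[OF assms(3) p(3)[OF x]]] v cp by metis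
      also have "\<dots> = d' x" using v p(1)[OF x] by (simp add: d'_def)
      finally show "v \<cdot>\<^bsub>C\<^esub> c x = u \<cdot>\<^bsub>C\<^esub> c x" using u(2)[OF x] by simp
    qed (use u v in auto)
  qed
qed

section \<open>Functors on posets and diagrams indexed by subsets\<close>

lemma poset_cat_category:
  assumes "Preorder r" shows "category (poset_cat r)"
proof -
  have t: "(a, b) \<in> r \<Longrightarrow> (b, c) \<in> r \<Longrightarrow> (a, c) \<in> r" for a b c
    using assms by (auto simp: preorder_on_def trans_def)
  have "a \<in> Field r \<Longrightarrow> (a, a) \<in> r" for a using assms by (auto simp: preorder_on_def refl_on_def)
  then show ?thesis
    unfolding category_def poset_cat_def hom_def by (auto simp: FieldI1 FieldI2 intro: t)
qed

lemma poset_cocone: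
  "is_cocone (poset_cat r) C D Y d \<longleftrightarrow> pcone C (Field r) r (on_ob D) (\<lambda>a b. on_ar D (a, b)) Y d"
  unfolding is_cocone_def pcone_def poset_cat_def by (auto simp: FieldI1 FieldI2)

lemma poset_functor_pdiag:
  assumes "is_functor (poset_cat r) C D"
  shows "pdiag C (Field r) r (on_ob D) (\<lambda>a b. on_ar D (a, b))"
proof -
  have "on_ar D (b, c) \<cdot>\<^bsub>C\<^esub> on_ar D (a, b) = on_ar D (a, c)" if "(a, b) \<in> r" "(b, c) \<in> r" for a b c
    using functor_comp[OF assms, of "(a, b)" a b "(b, c)" c] that by (simp add: poset_cat_def hom_def)
  moreover have "on_ar D (a, a) = Idt C (on_ob D a)" if "a \<in> Field r" for a
    using functor_id[OF assms, of a] that by (simp add: poset_cat_def)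
  moreover have "on_ob D a \<in> Ob C" if "a \<in> Field r" for a
    using functor_ob[OF assms, of a] that by (simp add: poset_cat_def)
  moreover have "on_ar D (a, b) \<in> hom C (on_ob D a) (on_ob D b)" if "(a, b) \<in> r" for a b
    using functor_hom[OF assms, of "(a, b)" a b] that by (simp add: poset_cat_def hom_def)
  ultimately show ?thesis unfolding pdiag_def by blast
qed

lemma poset_colimitD:
  assumes "is_colimit (poset_cat r) C D Z c"
  shows "pdiag C (Field r) r (on_ob D) (\<lambda>a b. on_ar D (a, b))"
    "pcolim C (Field r) r (on_ob D) (\<lambda>a b. on_ar D (a, b)) Z c"
proof -
  have F: "Ob (poset_cat r) = Field r" by (simp add: poset_cat_def)
  have "is_functor (poset_cat r) C D" using assms by (simp add: is_colimit_def)
  then show "pdiag C (Field r) r (on_ob D) (\<lambda>a b. on_ar D (a, b))" by (rule poset_functor_pdiag)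
  show "pcolim C (Field r) r (on_ob D) (\<lambda>a b. on_ar D (a, b)) Z c"
    using assms unfolding is_colimit_def poset_cocone pcolim_def F by (elim conjE) (intro conjI)
qed

lemma poset_functorI:
  assumes "category C" "Preorder r" "pdiag C (Field r) r X h"
  shows "is_functor (poset_cat r) C \<lparr>on_ob = X, on_ar = (\<lambda>p. h (fst p) (snd p))\<rparr>"
  using assms(3) poset_cat_category[OF assms(2)] assms(1) unfolding is_functor_def pdiag_def
  by (auto simp: poset_cat_def FieldI1 FieldI2)

lemma poset_colimitI:
  assumes "category C" "Preorder r" "pdiag C (Field r) r X h" "pcolim C (Field r) r X h Z c"
  shows "is_colimit (poset_cat r) C \<lparr>on_ob = X, on_ar = (\<lambda>p. h (fst p) (snd p))\<rparr> Z c"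
proof -
  have "Ob (poset_cat r) = Field r" by (simp add: poset_cat_def)
  then show ?thesis
    using assms(4) poset_functorI[OF assms(1-3)] unfolding is_colimit_def poset_cocone pcolim_def
    by (simp only: fctr.simps fst_conv snd_conv) blast
qed

lemma dirset_finite_bound:
  assumes "dirset A r" "finite S" "S \<subseteq> A"
  shows "\<exists>b \<in> A. \<forall>a \<in> S. (a, b) \<in> r"
  using assms(2,3)
proof (induction S)
  case empty
  then show ?case using dirset_ne[OF assms(1)] by auto
next
  case (insert x S)
  then obtain b where b: "b \<in> A" "\<forall>a \<in> S. (a, b) \<in> r" by auto
  have x: "x \<in> A" "S \<subseteq> A" using insert by auto
  then obtain e where e: "e \<in> A" "(x, e) \<in> r" "(b, e) \<in> r"
    using dirset_bound[OF assms(1) _ b(1)] by metis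
  have "(a, e) \<in> r" if "a \<in> S" for a
    using dirset_trans[OF assms(1), of a b e] b e x that by blast
  then show ?case using e by auto
qed

text \<open>A copy of the diagram indexed in \<open>'u\<close> meets the definition: sets below
  \<open>natLeq\<close> are the finite ones, and these have upper bounds by induction. The
  conclusion is then read back for the original index set, which may have any type.\<close>

lemma (in universe) finitely_presentable_directed:
  fixes A :: "'j set"
  assumes "category C" "finitely_presentable U C K" "small U A" "dirset A r" "pdiag C A r X h"
    "pcolim C A r X h Z c"
  shows "\<forall>f \<in> hom C K Z. \<exists>a \<in> A. \<exists>g \<in> hom C K (X a). c a \<cdot>\<^bsub>C\<^esub> g = f"
    "\<forall>a \<in> A. \<forall>b \<in> A. \<forall>g \<in> hom C K (X a). \<forall>k \<in> hom C K (X b). c a \<cdot>\<^bsub>C\<^esub> g = c b \<cdot>\<^bsub>C\<^esub> k \<longrightarrow>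
       (\<exists>d \<in> A. (a, d) \<in> r \<and> (b, d) \<in> r \<and> h a d \<cdot>\<^bsub>C\<^esub> g = h b d \<cdot>\<^bsub>C\<^esub> k)"
proof -
  obtain \<phi> :: "'j \<Rightarrow> 'u" where \<phi>: "inj_on \<phi> A" using small_embeds assms(3) by blast
  define \<psi> where "\<psi> = inv_into A \<phi>"
  have \<psi>: "\<And>j. j \<in> A \<Longrightarrow> \<psi> (\<phi> j) = j" by (simp add: \<psi>_def \<phi>)
  define r' where "r' = {(\<phi> a, \<phi> b) | a b. a \<in> A \<and> b \<in> A \<and> (a, b) \<in> r}"
  have r': "(x, y) \<in> r' \<longleftrightarrow> x \<in> \<phi> ` A \<and> y \<in> \<phi> ` A \<and> (\<psi> x, \<psi> y) \<in> r" for x y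
    unfolding r'_def using \<psi> by force
  have F: "Field r' = \<phi> ` A"
    using assms(4) unfolding Field_def dirset_def r'_def by blast
  have po: "partial_order_on (Field r') r'"
    unfolding partial_order_on_def preorder_on_def
  proof (intro conjI)
    show "refl_on (Field r') r'" using dirset_refl[OF assms(4)] by (auto simp: refl_on_def F r' \<psi>)
    show "r' \<subseteq> Field r' \<times> Field r'" by (auto simp: Field_def)
    show "trans r'" using dirset_trans[OF assms(4)] by (intro transI) (auto simp: r' \<psi>)
    show "antisym r'" using dirset_antisym[OF assms(4)] by (intro antisymI) (auto simp: r' \<psi>, blast)
  qed
  have dir: "directed_poset U natLeq r'"
    unfolding directed_poset_def
  proof (intro conjI po allI impI)
    show "small U (Field r')" unfolding F by (intro small_image assms)
    fix S assume S: "S \<subseteq> Field r'" "|S| <o natLeq"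
    have "finite S" using S(2) by (simp add: finite_iff_ordLess_natLeq)
    then have "finite (\<psi> ` S)" "\<psi> ` S \<subseteq> A" using S(1) F \<psi> by auto
    then obtain b where b: "b \<in> A" "\<forall>a \<in> \<psi> ` S. (a, b) \<in> r"
      using dirset_finite_bound[OF assms(4)] by blast
    then show "\<exists>b \<in> Field r'. \<forall>a \<in> S. (a, b) \<in> r'"
      using S F \<psi> by (intro bexI[of _ "\<phi> b"]) (auto simp: r')
  qed
  define D where "D = \<lparr>on_ob = X \<circ> \<psi>, on_ar = (\<lambda>p. h (\<psi> (fst p)) (\<psi> (snd p)))\<rparr>"
  have pd: "pdiag C (Field r') r' (X \<circ> \<psi>) (\<lambda>a b. h (\<psi> a) (\<psi> b))"
    using assms(5) unfolding pdiag_def F r' by (auto simp: \<psi>)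
  have pcone_iff: "pcone C (Field r') r' (X \<circ> \<psi>) (\<lambda>a b. h (\<psi> a) (\<psi> b)) Y d \<longleftrightarrow> pcone C A r X h Y (d \<circ> \<phi>)" for Y d
    unfolding pcone_def F r' by (auto simp: \<psi>)
  have "pcolim C (Field r') r' (X \<circ> \<psi>) (\<lambda>a b. h (\<psi> a) (\<psi> b)) Z (c \<circ> \<psi>)"
    unfolding pcolim_def
  proof (intro conjI allI impI)
    show "pcone C (Field r') r' (X \<circ> \<psi>) (\<lambda>a b. h (\<psi> a) (\<psi> b)) Z (c \<circ> \<psi>)"
      unfolding pcone_iff using pcolim_cone[OF assms(6)] by (auto simp: pcone_def \<psi>)
    fix Y d assume "pcone C (Field r') r' (X \<circ> \<psi>) (\<lambda>a b. h (\<psi> a) (\<psi> b)) Y d"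
    then have "pcone C A r X h Y (d \<circ> \<phi>)" by (simp only: pcone_iff)
    then have "\<exists>!u. u \<in> hom C Z Y \<and> (\<forall>a \<in> A. u \<cdot>\<^bsub>C\<^esub> c a = (d \<circ> \<phi>) a)"
      using assms(6) unfolding pcolim_def by blast
    then show "\<exists>!u. u \<in> hom C Z Y \<and> (\<forall>a \<in> Field r'. u \<cdot>\<^bsub>C\<^esub> (c \<circ> \<psi>) a = d a)"
      by (simp add: F \<psi>)
  qed
  then have col: "is_colimit (poset_cat r') C D Z (c \<circ> \<psi>)"
    using poset_colimitI[OF assms(1) _ pd] po unfolding D_def partial_order_on_def by blast
  note P = assms(2)[unfolded finitely_presentable_def presentable_def]
  have P1: "\<forall>f \<in> hom C K Z. \<exists>j \<in> Field r'. \<exists>g \<in> hom C K (on_ob D j). (c \<circ> \<psi>) j \<cdot>\<^bsub>C\<^esub> g = f"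
    and P2: "\<forall>i \<in> Field r'. \<forall>j \<in> Field r'. \<forall>g \<in> hom C K (on_ob D i). \<forall>h \<in> hom C K (on_ob D j).
           (c \<circ> \<psi>) i \<cdot>\<^bsub>C\<^esub> g = (c \<circ> \<psi>) j \<cdot>\<^bsub>C\<^esub> h \<longrightarrow>
           (\<exists>k. (i, k) \<in> r' \<and> (j, k) \<in> r' \<and> on_ar D (i, k) \<cdot>\<^bsub>C\<^esub> g = on_ar D (j, k) \<cdot>\<^bsub>C\<^esub> h)"
    using P dir col by blast+
  show "\<forall>f \<in> hom C K Z. \<exists>a \<in> A. \<exists>g \<in> hom C K (X a). c a \<cdot>\<^bsub>C\<^esub> g = f"
    using P1 unfolding F D_def by (fastforce simp: \<psi>)
  show "\<forall>a \<in> A. \<forall>b \<in> A. \<forall>g \<in> hom C K (X a). \<forall>k \<in> hom C K (X b). c a \<cdot>\<^bsub>C\<^esub> g = c b \<cdot>\<^bsub>C\<^esub> k \<longrightarrow>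
       (\<exists>d \<in> A. (a, d) \<in> r \<and> (b, d) \<in> r \<and> h a d \<cdot>\<^bsub>C\<^esub> g = h b d \<cdot>\<^bsub>C\<^esub> k)"
  proof (intro ballI impI)
    fix a b g k assume ab: "a \<in> A" "b \<in> A" and gk: "g \<in> hom C K (X a)" "k \<in> hom C K (X b)"
      and eq: "c a \<cdot>\<^bsub>C\<^esub> g = c b \<cdot>\<^bsub>C\<^esub> k"
    have "\<phi> a \<in> Field r'" "\<phi> b \<in> Field r'" "g \<in> hom C K (on_ob D (\<phi> a))" "k \<in> hom C K (on_ob D (\<phi> b))"
      "(c \<circ> \<psi>) (\<phi> a) \<cdot>\<^bsub>C\<^esub> g = (c \<circ> \<psi>) (\<phi> b) \<cdot>\<^bsub>C\<^esub> k"
      using ab gk eq by (auto simp: F D_def \<psi>)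
    then obtain d where "(\<phi> a, d) \<in> r'" "(\<phi> b, d) \<in> r'" "on_ar D (\<phi> a, d) \<cdot>\<^bsub>C\<^esub> g = on_ar D (\<phi> b, d) \<cdot>\<^bsub>C\<^esub> k"
      using P2 by blast
    then show "\<exists>d \<in> A. (a, d) \<in> r \<and> (b, d) \<in> r \<and> h a d \<cdot>\<^bsub>C\<^esub> g = h b d \<cdot>\<^bsub>C\<^esub> k"
      using ab by (intro bexI[of _ "\<psi> d"]) (auto simp: r' D_def \<psi>)
  qed
qed


section \<open>Simultaneous pushouts of a family of morphisms\<close>

text \<open>These are the pushouts of coproducts of the morphisms \<open>al j\<close>, described without forming the
  coproducts.\<close>

definition mwf :: "('o, 'm) cat \<Rightarrow> 'o \<Rightarrow> 'j set \<Rightarrow> ('j \<Rightarrow> 'm) \<Rightarrow> ('j \<Rightarrow> 'm) \<Rightarrow> bool" where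
  "mwf C W J al g \<longleftrightarrow> W \<in> Ob C \<and> (\<forall>j \<in> J. al j \<in> Ar C \<and> g j \<in> hom C (Dom C (al j)) W)"

definition mcone :: "('o, 'm) cat \<Rightarrow> 'o \<Rightarrow> 'j set \<Rightarrow> ('j \<Rightarrow> 'm) \<Rightarrow> ('j \<Rightarrow> 'm) \<Rightarrow>
    'o \<Rightarrow> 'm \<Rightarrow> ('j \<Rightarrow> 'm) \<Rightarrow> bool" where
  "mcone C W J al g Y u e \<longleftrightarrow> u \<in> hom C W Y \<and>
     (\<forall>j \<in> J. e j \<in> hom C (Cod C (al j)) Y \<and> e j \<cdot>\<^bsub>C\<^esub> al j = u \<cdot>\<^bsub>C\<^esub> g j)"

definition mpush :: "('o, 'm) cat \<Rightarrow> 'o \<Rightarrow> 'j set \<Rightarrow> ('j \<Rightarrow> 'm) \<Rightarrow> ('j \<Rightarrow> 'm) \<Rightarrow>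
    'o \<Rightarrow> 'm \<Rightarrow> ('j \<Rightarrow> 'm) \<Rightarrow> bool" where
  "mpush C W J al g Z u e \<longleftrightarrow> mcone C W J al g Z u e \<and>
     (\<forall>Y u' e'. mcone C W J al g Y u' e' \<longrightarrow>
        (\<exists>!w. w \<in> hom C Z Y \<and> w \<cdot>\<^bsub>C\<^esub> u = u' \<and> (\<forall>j \<in> J. w \<cdot>\<^bsub>C\<^esub> e j = e' j)))"

text \<open>The generator \<open>None\<close> stands for the base \<open>W\<close> and
  \<open>Some j\<close> for the codomain of \<open>al j\<close>; the relation at \<open>j\<close> is
  the commuting square at \<open>j\<close>.\<close>

definition mpush_rels :: "'j set \<Rightarrow> ('j \<Rightarrow> 'm) \<Rightarrow> ('j \<Rightarrow> 'm) \<Rightarrow>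
    ('j option \<times> 'm \<times> 'j option \<times> 'm) set" where
  "mpush_rels J al g = (\<lambda>j. (Some j, al j, None, g j)) ` J"

definition mpush_obs :: "('o, 'm) cat \<Rightarrow> 'o \<Rightarrow> ('j \<Rightarrow> 'm) \<Rightarrow> 'j option \<Rightarrow> 'o" where
  "mpush_obs C W al = case_option W (\<lambda>j. Cod C (al j))"

lemma mpush_rels_wf:
  "mwf C W J al g \<Longrightarrow> category C \<Longrightarrow> rel_wf C (insert None (Some ` J)) (mpush_obs C W al) (mpush_rels J al g)"
  unfolding mwf_def rel_wf_def mpush_obs_def mpush_rels_def
  by (auto simp: hom_def category_def)

lemma mcone_relcone:
  "category C \<Longrightarrow> mcone C W J al g Z u e \<longleftrightarrow>
     relcone C (insert None (Some ` J)) (mpush_obs C W al) (mpush_rels J al g) Z (case_option u e)"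
  unfolding mcone_def relcone_def mpush_obs_def mpush_rels_def by (auto dest: hom_cod)

lemma mpush_relcolim:
  assumes "category C"
  shows "mpush C W J al g Z u e \<longleftrightarrow>
    relcolim C (insert None (Some ` J)) (mpush_obs C W al) (mpush_rels J al g) Z (case_option u e)"
proof -
  let ?N = "insert None (Some ` J)"
  have iff: "(\<exists>!w. w \<in> hom C Z Y \<and> w \<cdot>\<^bsub>C\<^esub> u = d None \<and> (\<forall>j \<in> J. w \<cdot>\<^bsub>C\<^esub> e j = d (Some j))) \<longleftrightarrow>
      (\<exists>!w. w \<in> hom C Z Y \<and> (\<forall>j \<in> ?N. w \<cdot>\<^bsub>C\<^esub> case_option u e j = d j))" for Y d
    by simp
  have s: "d = case_option (d None) (\<lambda>j. d (Some j))" for d :: "'c option \<Rightarrow> 'b"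
    by (auto split: option.split)
  have "(\<forall>Y u' e'. mcone C W J al g Y u' e' \<longrightarrow>
        (\<exists>!w. w \<in> hom C Z Y \<and> w \<cdot>\<^bsub>C\<^esub> u = u' \<and> (\<forall>j \<in> J. w \<cdot>\<^bsub>C\<^esub> e j = e' j))) \<longleftrightarrow>
    (\<forall>Y d. mcone C W J al g Y (d None) (\<lambda>j. d (Some j)) \<longrightarrow>
        (\<exists>!w. w \<in> hom C Z Y \<and> w \<cdot>\<^bsub>C\<^esub> u = d None \<and> (\<forall>j \<in> J. w \<cdot>\<^bsub>C\<^esub> e j = d (Some j))))"
    (is "?L = ?R")
  proof
    assume ?R
    show ?L
    proof (intro allI impI)
      fix Y u' e' assume "mcone C W J al g Y u' e'"
      then show "\<exists>!w. w \<in> hom C Z Y \<and> w \<cdot>\<^bsub>C\<^esub> u = u' \<and> (\<forall>j \<in> J. w \<cdot>\<^bsub>C\<^esub> e j = e' j)"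
        using \<open>?R\<close>[rule_format, of Y "case_option u' e'"] by simp
    qed
  qed blast
  also have "\<dots> \<longleftrightarrow> (\<forall>Y d. relcone C ?N (mpush_obs C W al) (mpush_rels J al g) Y d \<longrightarrow>
      (\<exists>!w. w \<in> hom C Z Y \<and> (\<forall>j \<in> ?N. w \<cdot>\<^bsub>C\<^esub> case_option u e j = d j)))"
    unfolding mcone_relcone[OF assms] s[symmetric] iff ..
  finally show ?thesis
    unfolding mpush_def relcolim_def by (rule conj_cong[OF mcone_relcone[OF assms]])
qed

lemma mpush_eq:
  assumes "category C" "mwf C W J al g" "mpush C W J al g Z u e" "x \<in> hom C Z Y" "y \<in> hom C Z Y"
    "x \<cdot>\<^bsub>C\<^esub> u = y \<cdot>\<^bsub>C\<^esub> u" "\<And>j. j \<in> J \<Longrightarrow> x \<cdot>\<^bsub>C\<^esub> e j = y \<cdot>\<^bsub>C\<^esub> e j"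
  shows "x = y"
proof (rule relcolim_eq[OF assms(1) mpush_rels_wf[OF assms(2,1)] _ assms(4,5)])
  show "relcolim C (insert None (Some ` J)) (mpush_obs C W al) (mpush_rels J al g) Z (case_option u e)"
    using assms(3) unfolding mpush_relcolim[OF assms(1)] .
qed (use assms(6,7) in auto)

lemma mpush_iso:
  assumes "category C" "mwf C W J al g" "mpush C W J al g Z u e" "mpush C W J al g Z' u' e'"
  obtains i where "iso_ar C Z Z' i" "i \<cdot>\<^bsub>C\<^esub> u = u'" "\<And>j. j \<in> J \<Longrightarrow> i \<cdot>\<^bsub>C\<^esub> e j = e' j"
proof -
  have "\<exists>i. iso_ar C Z Z' i \<and>
     (\<forall>j \<in> insert None (Some ` J). i \<cdot>\<^bsub>C\<^esub> case_option u e j = case_option u' e' j)"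
    using relcolim_iso[OF assms(1) mpush_rels_wf[OF assms(2,1)]] assms(3,4)
    unfolding mpush_relcolim[OF assms(1)] by blast
  then show ?thesis using that by auto
qed

lemma mpush_cone: "mpush C W J al g Z u e \<Longrightarrow> mcone C W J al g Z u e"
  by (simp add: mpush_def)

lemma mpush_factor:
  assumes "mpush C W J al g Z u e" "mcone C W J al g Y u' e'"
  obtains w where "w \<in> hom C Z Y" "w \<cdot>\<^bsub>C\<^esub> u = u'" "\<And>j. j \<in> J \<Longrightarrow> w \<cdot>\<^bsub>C\<^esub> e j = e' j"
  using assms unfolding mpush_def by blast

lemma mpushI:
  assumes "mcone C W J al g Z u e"
    and "\<And>Y u' e'. mcone C W J al g Y u' e' \<Longrightarrow>
        \<exists>w. w \<in> hom C Z Y \<and> w \<cdot>\<^bsub>C\<^esub> u = u' \<and> (\<forall>j \<in> J. w \<cdot>\<^bsub>C\<^esub> e j = e' j)"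
    and "\<And>Y x y. x \<in> hom C Z Y \<Longrightarrow> y \<in> hom C Z Y \<Longrightarrow> x \<cdot>\<^bsub>C\<^esub> u = y \<cdot>\<^bsub>C\<^esub> u \<Longrightarrow>
        (\<And>j. j \<in> J \<Longrightarrow> x \<cdot>\<^bsub>C\<^esub> e j = y \<cdot>\<^bsub>C\<^esub> e j) \<Longrightarrow> x = y"
  shows "mpush C W J al g Z u e"
  unfolding mpush_def
proof (intro conjI allI impI assms(1))
  fix Y u' e' assume "mcone C W J al g Y u' e'"
  from assms(2)[OF this] show "\<exists>!w. w \<in> hom C Z Y \<and> w \<cdot>\<^bsub>C\<^esub> u = u' \<and> (\<forall>j \<in> J. w \<cdot>\<^bsub>C\<^esub> e j = e' j)"
    by (elim exE) (rule ex1I, assumption, metis assms(3))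
qed

lemma (in universe) mpush_exists:
  assumes "relcoc U C" "category C" "small U J" "mwf C W J al g"
  shows "\<exists>Z u e. mpush C W J al g Z u e"
proof -
  have "small U (insert None (Some ` J))" "small U (mpush_rels J al g)"
    unfolding mpush_rels_def by (intro small_insert small_image assms)+
  then obtain Z c where c: "relcolim C (insert None (Some ` J)) (mpush_obs C W al) (mpush_rels J al g) Z c"
    using relcoc_any[OF assms(1) _ _ mpush_rels_wf[OF assms(4,2)]] by blast
  have "case_option (c None) (\<lambda>j. c (Some j)) = c" by (auto split: option.split)
  then have "mpush C W J al g Z (c None) (\<lambda>j. c (Some j))"
    using c mpush_relcolim[OF assms(2)] by metis
  then show ?thesis by blast
qed

section \<open>Well-orders\<close>

lemma Well_order_facts:
  assumes "Well_order r"
  shows "\<And>a. a \<in> Field r \<Longrightarrow> (a, a) \<in> r"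
    "\<And>a b. (a, b) \<in> r \<Longrightarrow> (b, a) \<in> r \<Longrightarrow> a = b"
    "\<And>a b c. (a, b) \<in> r \<Longrightarrow> (b, c) \<in> r \<Longrightarrow> (a, c) \<in> r"
    "\<And>a b. a \<in> Field r \<Longrightarrow> b \<in> Field r \<Longrightarrow> (a, b) \<in> r \<or> (b, a) \<in> r"
    "\<And>B. B \<subseteq> Field r \<Longrightarrow> B \<noteq> {} \<Longrightarrow> \<exists>a \<in> B. \<forall>b \<in> B. (a, b) \<in> r"
proof -
  have lin: "Linear_order r" using assms by (simp add: well_order_on_def)
  show r: "\<And>a. a \<in> Field r \<Longrightarrow> (a, a) \<in> r" using lin by (auto simp: order_on_defs refl_on_def)
  show "\<And>a b. (a, b) \<in> r \<Longrightarrow> (b, a) \<in> r \<Longrightarrow> a = b" using lin by (auto simp: order_on_defs antisym_def)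
  show "\<And>a b c. (a, b) \<in> r \<Longrightarrow> (b, c) \<in> r \<Longrightarrow> (a, c) \<in> r"
    using lin unfolding order_on_defs trans_def by blast
  have "\<And>a b. a \<in> Field r \<Longrightarrow> b \<in> Field r \<Longrightarrow> a \<noteq> b \<Longrightarrow> (a, b) \<in> r \<or> (b, a) \<in> r"
    using lin unfolding order_on_defs total_on_def by blast
  then show "\<And>a b. a \<in> Field r \<Longrightarrow> b \<in> Field r \<Longrightarrow> (a, b) \<in> r \<or> (b, a) \<in> r" using r by metis
  show "\<And>B. B \<subseteq> Field r \<Longrightarrow> B \<noteq> {} \<Longrightarrow> \<exists>a \<in> B. \<forall>b \<in> B. (a, b) \<in> r"
    using assms Linear_order_Well_order_iff[OF lin] by blast
qed

lemma Well_orderI: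
  assumes "r \<subseteq> A \<times> A" "\<And>a. a \<in> A \<Longrightarrow> (a, a) \<in> r"
    "\<And>a b. (a, b) \<in> r \<Longrightarrow> (b, a) \<in> r \<Longrightarrow> a = b"
    "\<And>a b c. (a, b) \<in> r \<Longrightarrow> (b, c) \<in> r \<Longrightarrow> (a, c) \<in> r"
    "\<And>B. B \<subseteq> A \<Longrightarrow> B \<noteq> {} \<Longrightarrow> \<exists>a \<in> B. \<forall>b \<in> B. (a, b) \<in> r"
  shows "Well_order r" "Field r = A"
proof -
  show F: "Field r = A" using assms(1,2) unfolding Field_def by blast
  have tot: "(a, b) \<in> r \<or> (b, a) \<in> r" if "a \<in> A" "b \<in> A" for a b
    using assms(5)[of "{a, b}"] that by auto
  have "Linear_order r"
    unfolding linear_order_on_def partial_order_on_def preorder_on_def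
  proof (intro conjI)
    show "refl_on (Field r) r" using assms(2) by (auto simp: refl_on_def F)
    show "r \<subseteq> Field r \<times> Field r" using assms(1) F by simp
    show "trans r" using assms(4) by (rule transI)
    show "antisym r" using assms(3) by (rule antisymI)
    show "total_on (Field r) r" using tot by (auto simp: total_on_def F)
  qed
  then show "Well_order r" using assms(5) Linear_order_Well_order_iff F by metis
qed

lemma Well_order_dirset:
  assumes "Well_order r" "A \<subseteq> Field r" "A \<noteq> {}"
  shows "dirset A r"
  unfolding dirset_def
proof (intro conjI ballI impI)
  note wo = Well_order_facts[OF assms(1)]
  show "A \<noteq> {}" by fact
  show "(a, a) \<in> r" if "a \<in> A" for a using wo(1) that assms(2) by blast
  show "a = b" if "(a, b) \<in> r" "(b, a) \<in> r" for a b using wo(2) that .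
  show "(a, c) \<in> r" if "(a, b) \<in> r" "(b, c) \<in> r" for a b c using wo(3) that .
  show "\<exists>c \<in> A. (a, c) \<in> r \<and> (b, c) \<in> r" if "a \<in> A" "b \<in> A" for a b
    using wo(1)[of a] wo(1)[of b] wo(4)[of a b] that assms(2) by blast
qed

lemma underS_Field: "underS r a \<subseteq> Field r"
  by (auto simp: underS_def Field_def)

lemma pcolim_cong_rel:
  assumes "\<And>a b. a \<in> A \<Longrightarrow> b \<in> A \<Longrightarrow> (a, b) \<in> r \<longleftrightarrow> (a, b) \<in> r'"
  shows "pcolim C A r X h Z c \<longleftrightarrow> pcolim C A r' X h Z c"
proof -
  have "pcone C A r X h = pcone C A r' X h"
    unfolding pcone_def using assms by (intro ext) auto
  then show ?thesis unfolding pcolim_def by simp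
qed

lemma pdiag_subset: "pdiag C A r X h \<Longrightarrow> B \<subseteq> A \<Longrightarrow> pdiag C B r X h"
  unfolding pdiag_def by blast

lemma pdiag_ob: "pdiag C A r X h \<Longrightarrow> a \<in> A \<Longrightarrow> X a \<in> Ob C"
  by (simp add: pdiag_def)

lemma pdiag_id: "pdiag C A r X h \<Longrightarrow> a \<in> A \<Longrightarrow> h a a = Idt C (X a)"
  by (simp add: pdiag_def)

lemma pdiag_hom: "pdiag C A r X h \<Longrightarrow> (a, b) \<in> r \<Longrightarrow> a \<in> A \<Longrightarrow> b \<in> A \<Longrightarrow> h a b \<in> hom C (X a) (X b)"
  by (simp add: pdiag_def)

lemma pdiag_comp: "pdiag C A r X h \<Longrightarrow> (a, b) \<in> r \<Longrightarrow> (b, c) \<in> r \<Longrightarrow> a \<in> A \<Longrightarrow> b \<in> A \<Longrightarrow> c \<in> A \<Longrightarrow>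
    h b c \<cdot>\<^bsub>C\<^esub> h a b = h a c"
  unfolding pdiag_def by blast


section \<open>Composites of smooth chains with a last object\<close>

text \<open>A transfinite composite is given by a chain together with a separate colimit. Here the
  colimit is made the last object \<open>t\<close>, and the composite is the single morphism
  \<open>h z t\<close>; smoothness at \<open>t\<close> covers the case of limit length. With both
  ends inside the chain, chains can be inserted into one another.\<close>

definition cchain :: "('o, 'm) cat \<Rightarrow> 'm set \<Rightarrow> 'j rel \<Rightarrow> ('j \<Rightarrow> 'o) \<Rightarrow> ('j \<Rightarrow> 'j \<Rightarrow> 'm) \<Rightarrow>
    'j \<Rightarrow> 'j \<Rightarrow> bool" where
  "cchain C S r X h z t \<longleftrightarrow> Well_order r \<and> z \<in> Field r \<and> t \<in> Field r \<and>
     (\<forall>a \<in> Field r. (z, a) \<in> r \<and> (a, t) \<in> r) \<and> pdiag C (Field r) r X h \<and>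
     (\<forall>a b. covers r a b \<longrightarrow> h a b \<in> S) \<and>
     (\<forall>a \<in> Field r. a \<noteq> z \<and> \<not> (\<exists>b. covers r b a) \<longrightarrow>
        pcolim C (underS r a) r X h (X a) (\<lambda>b. h b a))"

definition cc :: "'u rel \<Rightarrow> ('o, 'm) cat \<Rightarrow> 'm set \<Rightarrow> 'm set" where
  "cc U C S = {f. \<exists>(r :: 'u rel) X h z t. small U (Field r) \<and> cchain C S r X h z t \<and> f = h z t}"

lemma cchainD:
  assumes "cchain C S r X h z t"
  shows "Well_order r" "z \<in> Field r" "t \<in> Field r" "\<And>a. a \<in> Field r \<Longrightarrow> (z, a) \<in> r"
    "\<And>a. a \<in> Field r \<Longrightarrow> (a, t) \<in> r" "pdiag C (Field r) r X h"
    "\<And>a b. covers r a b \<Longrightarrow> h a b \<in> S"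
    "\<And>a. a \<in> Field r \<Longrightarrow> a \<noteq> z \<Longrightarrow> \<nexists>b. covers r b a \<Longrightarrow> pcolim C (underS r a) r X h (X a) (\<lambda>b. h b a)"
  using assms unfolding cchain_def by blast+

lemma cc_hom:
  fixes U :: "'u rel"
  assumes "f \<in> cc U C S"
  shows "f \<in> Ar C"
proof -
  obtain r :: "'u rel" and X h z t where r: "cchain C S r X h z t" and f: "f = h z t"
    using assms unfolding cc_def by blast
  note D = cchainD[OF r]
  show ?thesis using pdiag_hom[OF D(6) D(5)[OF D(2)] D(2,3)] f by (simp add: hom_def)
qed

text \<open>Chains may be indexed by any small well-order, for example by extended naturals, by
  pairs or by optional elements; they are copied into \<open>'u\<close>. Covering pairs and limit
  elements are preserved because the copy is order isomorphic.\<close>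

lemma (in universe) cc_intro:
  fixes r :: "'j rel"
  assumes cat: "category C" and "small U (Field r)" and ch: "cchain C S r X h z t"
  shows "h z t \<in> cc U C S"
proof -
  note D = cchainD[OF ch]
  note wo = Well_order_facts[OF D(1)]
  obtain \<phi> :: "'j \<Rightarrow> 'u" where \<phi>: "inj_on \<phi> (Field r)" using small_embeds assms(2) by blast
  define \<psi> where "\<psi> = inv_into (Field r) \<phi>"
  have \<psi>: "\<And>j. j \<in> Field r \<Longrightarrow> \<psi> (\<phi> j) = j" by (simp add: \<psi>_def \<phi>)
  define r' where "r' = {(\<phi> a, \<phi> b) | a b. (a, b) \<in> r}"
  have r': "(x, y) \<in> r' \<longleftrightarrow> x \<in> \<phi> ` Field r \<and> y \<in> \<phi> ` Field r \<and> (\<psi> x, \<psi> y) \<in> r" for x y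
  proof
    assume "(x, y) \<in> r'"
    then obtain a b where "(a, b) \<in> r" "x = \<phi> a" "y = \<phi> b" unfolding r'_def by blast
    then show "x \<in> \<phi> ` Field r \<and> y \<in> \<phi> ` Field r \<and> (\<psi> x, \<psi> y) \<in> r"
      using \<psi> by (simp add: FieldI1 FieldI2)
  next
    assume a: "x \<in> \<phi> ` Field r \<and> y \<in> \<phi> ` Field r \<and> (\<psi> x, \<psi> y) \<in> r"
    then obtain a b where "a \<in> Field r" "b \<in> Field r" "x = \<phi> a" "y = \<phi> b" by blast
    then show "(x, y) \<in> r'" using a \<psi> unfolding r'_def by auto
  qed
  have w1: "r' \<subseteq> \<phi> ` Field r \<times> \<phi> ` Field r" by (auto simp: r')
  have w2: "(x, x) \<in> r'" if "x \<in> \<phi> ` Field r" for x using that by (auto simp: r' \<psi> wo(1))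
  have w3: "a = b" if "(a, b) \<in> r'" "(b, a) \<in> r'" for a b
    using that wo(2)[of "\<psi> a" "\<psi> b"] by (auto simp: r' \<psi>)
  have w4: "(a, c) \<in> r'" if "(a, b) \<in> r'" "(b, c) \<in> r'" for a b c
    using that wo(3)[of "\<psi> a" "\<psi> b" "\<psi> c"] by (auto simp: r')
  have w5: "\<exists>a \<in> B. \<forall>b \<in> B. (a, b) \<in> r'" if B: "B \<subseteq> \<phi> ` Field r" "B \<noteq> {}" for B
  proof -
    have "\<psi> ` B \<subseteq> Field r" "\<psi> ` B \<noteq> {}" using B \<psi> by auto
    then obtain a where a: "a \<in> \<psi> ` B" "\<forall>b \<in> \<psi> ` B. (a, b) \<in> r" using wo(5)[of "\<psi> ` B"] by blast
    then show ?thesis using B by (auto simp: r' subset_iff)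
  qed
  have wo': "Well_order r'" and F: "Field r' = \<phi> ` Field r"
    by (rule Well_orderI[OF w1], erule w2, erule (1) w3, erule (1) w4, erule (1) w5)+
  have cov: "covers r' (\<phi> a) (\<phi> b) \<longleftrightarrow> covers r a b" if "a \<in> Field r" "b \<in> Field r" for a b
  proof -
    have e: "\<phi> x = \<phi> y \<longleftrightarrow> x = y" if "x \<in> Field r" "y \<in> Field r" for x y using \<psi> that by metis
    have "(\<forall>c. (\<phi> a, c) \<in> r' \<and> (c, \<phi> b) \<in> r' \<longrightarrow> c = \<phi> a \<or> c = \<phi> b) \<longleftrightarrow>
      (\<forall>c \<in> Field r. (a, c) \<in> r \<and> (c, b) \<in> r \<longrightarrow> c = a \<or> c = b)"
      using that by (auto simp: r' \<psi> e)
    also have "\<dots> \<longleftrightarrow> (\<forall>c. (a, c) \<in> r \<and> (c, b) \<in> r \<longrightarrow> c = a \<or> c = b)"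
      by (auto intro: FieldI1)
    finally show ?thesis using that unfolding covers_def by (simp add: r' \<psi> e)
  qed
  have pd: "pdiag C (Field r') r' (X \<circ> \<psi>) (\<lambda>a b. h (\<psi> a) (\<psi> b))"
    using D(6) unfolding pdiag_def F by (auto simp: r' \<psi>)
  have "cchain C S r' (X \<circ> \<psi>) (\<lambda>a b. h (\<psi> a) (\<psi> b)) (\<phi> z) (\<phi> t)"
    unfolding cchain_def
  proof (intro conjI wo' pd allI impI ballI)
    show "\<phi> z \<in> Field r'" "\<phi> t \<in> Field r'" using D F by auto
    show "(\<phi> z, a) \<in> r'" "(a, \<phi> t) \<in> r'" if "a \<in> Field r'" for a
      using that D(2-5) unfolding F r' by (auto simp: \<psi>)
    show "h (\<psi> a) (\<psi> b) \<in> S" if c: "covers r' a b" for a b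
    proof -
      obtain x y where "x \<in> Field r" "y \<in> Field r" "a = \<phi> x" "b = \<phi> y"
        using c unfolding covers_def r' by blast
      then show ?thesis using D(7) c cov \<psi> by simp
    qed
    show "pcolim C (underS r' a) r' (X \<circ> \<psi>) (\<lambda>a b. h (\<psi> a) (\<psi> b)) ((X \<circ> \<psi>) a) (\<lambda>b. h (\<psi> b) (\<psi> a))"
      if a': "a \<in> Field r'" and n: "a \<noteq> \<phi> z \<and> (\<nexists>b. covers r' b a)" for a
    proof -
      obtain x where x: "x \<in> Field r" "a = \<phi> x" using a' unfolding F by blast
      have "\<nexists>b. covers r b x" using n x cov unfolding covers_def by (metis FieldI1)
      then have pc: "pcolim C (underS r x) r X h (X x) (\<lambda>b. h b x)" using D(8)[OF x(1)] x n by blast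
      have un: "underS r' a = \<phi> ` underS r x"
      proof (intro set_eqI iffI)
        fix y assume y: "y \<in> underS r' a"
        then have "y \<in> \<phi> ` Field r" "(\<psi> y, x) \<in> r" "y \<noteq> a" using x \<psi> unfolding underS_def r' by auto
        then show "y \<in> \<phi> ` underS r x" using x \<psi> by (auto simp: underS_def)
      next
        fix y assume "y \<in> \<phi> ` underS r x"
        then obtain b where "y = \<phi> b" "(b, x) \<in> r" "b \<noteq> x" "b \<in> Field r"
          by (auto simp: underS_def FieldI1)
        then show "y \<in> underS r' a" using x \<psi> unfolding underS_def r' by (auto dest: inj_onD[OF \<phi>])
      qed
      have pu: "\<psi> (\<phi> b) = b" if "b \<in> underS r x" for b using that \<psi> underS_Field[of r x] by blast
      show ?thesis
      proof (rule pcolim_reindex[OF cat, where A' = "underS r x" and \<phi> = \<phi> and r' = r])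
        show "pdiag C (underS r' a) r' (X \<circ> \<psi>) (\<lambda>a b. h (\<psi> a) (\<psi> b))"
          by (rule pdiag_subset[OF pd underS_Field])
        show "pcone C (underS r' a) r' (X \<circ> \<psi>) (\<lambda>a b. h (\<psi> a) (\<psi> b)) ((X \<circ> \<psi>) a) (\<lambda>b. h (\<psi> b) (\<psi> a))"
          using pcolim_cone[OF pc] x unfolding pcone_def un r' by (auto simp: pu \<psi>)
        have "pcolim C (underS r x) r (\<lambda>a. (X \<circ> \<psi>) (\<phi> a)) (\<lambda>a b. h (\<psi> (\<phi> a)) (\<psi> (\<phi> b))) (X x)
           (\<lambda>b. h (\<psi> (\<phi> b)) x)"
          using pc by (subst pcolim_cong[where X' = X and h' = h and c' = "\<lambda>b. h b x"]) (auto simp: pu)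
        then show "pcolim C (underS r x) r (\<lambda>a. (X \<circ> \<psi>) (\<phi> a)) (\<lambda>a b. h (\<psi> (\<phi> a)) (\<psi> (\<phi> b)))
          ((X \<circ> \<psi>) a) (\<lambda>b. h (\<psi> (\<phi> b)) (\<psi> a))" using x \<psi> by simp
        show "\<And>b. b \<in> underS r x \<Longrightarrow> \<phi> b \<in> underS r' a" using un by blast
        show "\<And>a b. a \<in> underS r x \<Longrightarrow> b \<in> underS r x \<Longrightarrow> (a, b) \<in> r \<Longrightarrow> (\<phi> a, \<phi> b) \<in> r'"
          unfolding r'_def by blast
        show "\<exists>a \<in> underS r x. (y, \<phi> a) \<in> r'" if y: "y \<in> underS r' a" for y
        proof -
          obtain b where b: "y = \<phi> b" "b \<in> underS r x" using y unfolding un by blast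
          then have "(b, b) \<in> r" using wo(1) underS_Field[of r x] by blast
          then have "(y, \<phi> b) \<in> r'" unfolding r'_def b(1) by blast
          then show ?thesis using b(2) by blast
        qed
      qed
    qed
  qed
  moreover have "small U (Field r')" unfolding F by (intro small_image assms)
  moreover have "h z t = h (\<psi> (\<phi> z)) (\<psi> (\<phi> t))" using D \<psi> by simp
  ultimately show ?thesis unfolding cc_def by blast
qed

lemma cchain_composite_hom:
  assumes "cchain C S r X h z t" shows "h z t \<in> hom C (X z) (X t)"
proof -
  note D = cchainD[OF assms]
  show ?thesis by (rule pdiag_hom[OF D(6) D(5)[OF D(2)] D(2,3)])
qed


section \<open>Sequences\<close>

primrec nh0 :: "('o, 'm) cat \<Rightarrow> (nat \<Rightarrow> 'o) \<Rightarrow> (nat \<Rightarrow> 'm) \<Rightarrow> nat \<Rightarrow> nat \<Rightarrow> 'm" where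
  "nh0 C X u m 0 = Idt C (X m)"
| "nh0 C X u m (Suc k) = u (m + k) \<cdot>\<^bsub>C\<^esub> nh0 C X u m k"

text \<open>The connecting morphism of a sequence, recursive in the number of steps. For
  \<open>n < m\<close> truncated subtraction gives the identity of \<open>X m\<close>, a value
  outside the order relation.\<close>

definition nh :: "('o, 'm) cat \<Rightarrow> (nat \<Rightarrow> 'o) \<Rightarrow> (nat \<Rightarrow> 'm) \<Rightarrow> nat \<Rightarrow> nat \<Rightarrow> 'm" where
  "nh C X u m n = nh0 C X u m (n - m)"

abbreviation nle :: "nat rel" where "nle \<equiv> {(m, n). m \<le> n}"

context
  fixes C :: "('o, 'm) cat" and X u
  assumes cat: "category C" and u: "\<And>n. u n \<in> hom C (X n) (X (Suc n))"
begin

lemma nh_self: "nh C X u m m = Idt C (X m)"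
  by (simp add: nh_def)

lemma nh_Suc: "m \<le> n \<Longrightarrow> nh C X u m (Suc n) = u n \<cdot>\<^bsub>C\<^esub> nh C X u m n"
  by (simp add: nh_def Suc_diff_le)

lemma seq_ob: "X n \<in> Ob C"
  using hom_dom[OF cat u] .

lemma nh_hom: "m \<le> n \<Longrightarrow> nh C X u m n \<in> hom C (X m) (X n)"
  by (induction n rule: nat_induct_at_least)
    (auto simp: nh_self nh_Suc intro: id_hom[OF cat seq_ob] comp_hom[OF cat _ u])

lemma nh_step: "nh C X u n (Suc n) = u n"
  using nh_Suc[of n n] nh_self id_right[OF cat u] by simp

lemma nh_comp:
  assumes "k \<le> m" "m \<le> n"
  shows "nh C X u m n \<cdot>\<^bsub>C\<^esub> nh C X u k m = nh C X u k n"
  using assms(2)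
proof (induction n rule: nat_induct_at_least)
  case base
  then show ?case using id_left[OF cat nh_hom[OF assms(1)]] nh_self by simp
next
  case (Suc n)
  have "k \<le> n" using Suc assms(1) by simp
  then show ?case
    using comp_assoc[OF cat nh_hom[OF assms(1)] nh_hom[OF \<open>m \<le> n\<close>] u[of n]] Suc by (simp add: nh_Suc)
qed

lemma seq_pdiag: "pdiag C UNIV nle X (nh C X u)"
  unfolding pdiag_def using seq_ob nh_self nh_hom nh_comp by auto

lemma seq_pcone:
  "pcone C UNIV nle X (nh C X u) Y d \<longleftrightarrow>
     Y \<in> Ob C \<and> (\<forall>n. d n \<in> hom C (X n) Y) \<and> (\<forall>n. d (Suc n) \<cdot>\<^bsub>C\<^esub> u n = d n)"
proof
  assume "pcone C UNIV nle X (nh C X u) Y d"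
  then show "Y \<in> Ob C \<and> (\<forall>n. d n \<in> hom C (X n) Y) \<and> (\<forall>n. d (Suc n) \<cdot>\<^bsub>C\<^esub> u n = d n)"
    unfolding pcone_def using nh_step by (metis (mono_tags, lifting) UNIV_I case_prodI le_SucI le_refl mem_Collect_eq)
next
  assume a: "Y \<in> Ob C \<and> (\<forall>n. d n \<in> hom C (X n) Y) \<and> (\<forall>n. d (Suc n) \<cdot>\<^bsub>C\<^esub> u n = d n)"
  have "d n \<cdot>\<^bsub>C\<^esub> nh C X u m n = d m" if "m \<le> n" for m n
    using that
  proof (induction n rule: nat_induct_at_least)
    case base
    then show ?case using a id_right[OF cat] nh_self by metis
  next
    case (Suc n)
    have "d (Suc n) \<cdot>\<^bsub>C\<^esub> (u n \<cdot>\<^bsub>C\<^esub> nh C X u m n) = (d (Suc n) \<cdot>\<^bsub>C\<^esub> u n) \<cdot>\<^bsub>C\<^esub> nh C X u m n"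
      using comp_assoc[OF cat nh_hom[OF \<open>m \<le> n\<close>] u[of n]] a by metis
    then show ?case using Suc a by (simp add: nh_Suc)
  qed
  then show "pcone C UNIV nle X (nh C X u) Y d" unfolding pcone_def using a by auto
qed

end

lemma nle_dirset: "dirset UNIV nle"
  unfolding dirset_def by (auto intro: nat_le_linear) (meson nat_le_linear order_refl)

lemma enat_Well_order: "Well_order {(a, b :: enat). a \<le> b}" "Field {(a, b :: enat). a \<le> b} = UNIV"
proof -
  have least: "\<exists>a \<in> B. \<forall>b \<in> B. (a, b) \<in> {(a, b :: enat). a \<le> b}" if B: "B \<noteq> {}" for B
  proof -
    obtain x where "x \<in> B" using B by blast
    then have "(LEAST a. a \<in> B) \<in> B" by (rule LeastI)
    moreover have "\<forall>b \<in> B. ((LEAST a. a \<in> B), b) \<in> {(a, b). a \<le> b}" by (simp add: Least_le)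
    ultimately show ?thesis by blast
  qed
  show "Well_order {(a, b :: enat). a \<le> b}" "Field {(a, b :: enat). a \<le> b} = UNIV"
    using least by - (rule Well_orderI[where A = UNIV]; auto)+
qed

text \<open>The sequence and its colimit together form a chain over the extended naturals. The only
  nonzero element without a predecessor is \<open>\<infinity>\<close>, and smoothness there is the
  given colimit property.\<close>

lemma (in universe) cc_seq:
  assumes cat: "category C" and u: "\<And>n. u n \<in> hom C (X n) (X (Suc n))"
    and pc: "pcolim C UNIV nle X (nh C X u) Z c" and S: "\<And>n. u n \<in> S"
  shows "c 0 \<in> cc U C S"
proof -
  let ?r = "{(a, b :: enat). a \<le> b}"
  note nh = nh_self[where X = X and u = u, OF cat u] nh_hom[where X = X and u = u, OF cat u]
    nh_step[where X = X and u = u, OF cat u] nh_comp[where X = X and u = u, OF cat u]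
    seq_ob[where X = X and u = u, OF cat u]
  have c: "Z \<in> Ob C" "\<And>n. c n \<in> hom C (X n) Z" "\<And>m n. m \<le> n \<Longrightarrow> c n \<cdot>\<^bsub>C\<^esub> nh C X u m n = c m"
    using pcolim_cone[OF pc] unfolding pcone_def by auto
  define Y where "Y a = (case a of enat n \<Rightarrow> X n | \<infinity> \<Rightarrow> Z)" for a
  define h where "h a b = (case a of enat m \<Rightarrow> (case b of enat n \<Rightarrow> nh C X u m n | \<infinity> \<Rightarrow> c m) | \<infinity> \<Rightarrow> Idt C Z)" for a b
  have pd: "pdiag C UNIV ?r Y h"
    unfolding pdiag_def
  proof (intro conjI ballI impI)
    fix a b e :: enat
    show "Y a \<in> Ob C" "h a a = Idt C (Y a)"
      by (cases a; simp add: Y_def h_def c nh)+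
    show "h a b \<in> hom C (Y a) (Y b)" if "(a, b) \<in> ?r"
      using that by (cases a; cases b; simp add: Y_def h_def c nh id_hom[OF cat])
    show "h b e \<cdot>\<^bsub>C\<^esub> h a b = h a e" if "(a, b) \<in> ?r" "(b, e) \<in> ?r"
      using that id_left[OF cat c(2)] id_left[OF cat id_hom[OF cat c(1)]]
      by (cases a; cases b; cases e; simp add: Y_def h_def c nh)
  qed
  have "cchain C S ?r Y h 0 \<infinity>"
    unfolding cchain_def enat_Well_order(2)
  proof (intro conjI ballI allI impI pd enat_Well_order(1)[unfolded enat_Well_order(2)])
    fix a b assume "covers ?r a b"
    then have "a < b" "\<And>e. a \<le> e \<Longrightarrow> e \<le> b \<Longrightarrow> e = a \<or> e = b" unfolding covers_def by auto
    then obtain m where m: "a = enat m" "eSuc a \<le> b" by (metis enat.exhaust enat_ord_simps(6) ileI1)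
    then have "b = enat (Suc m)"
      using \<open>\<And>e. a \<le> e \<Longrightarrow> e \<le> b \<Longrightarrow> e = a \<or> e = b\<close>[of "eSuc a"] by (auto simp: eSuc_enat)
    then show "h a b \<in> S" using m S nh by (simp add: h_def)
  next
    fix a :: enat assume a: "a \<noteq> 0 \<and> (\<nexists>b. covers ?r b a)"
    have "a = \<infinity>"
    proof (rule ccontr)
      assume "a \<noteq> \<infinity>"
      then obtain n where "a = enat (Suc n)" using a by (metis enat.exhaust not0_implies_Suc zero_enat_def)
      then have "covers ?r (enat n) a"
        unfolding covers_def
        by (auto simp: ) (metis Suc_ile_eq dual_order.antisym enat_ord_simps(1) enat_ile le_Suc_eq)
      then show False using a by blast
    qed
    have un: "underS ?r \<infinity> = range enat" by (auto simp: underS_def image_iff)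
    have "pcolim C (range enat) ?r Y h Z (\<lambda>b. h b \<infinity>)"
    proof (rule pcolim_reindex[OF cat, where A' = UNIV and r' = nle and \<phi> = enat])
      show "pdiag C (range enat) ?r Y h" using pd by (rule pdiag_subset) simp
      show "pcone C (range enat) ?r Y h Z (\<lambda>b. h b \<infinity>)"
        unfolding pcone_def by (auto simp: c h_def Y_def)
      show "pcolim C UNIV nle (\<lambda>a. Y (enat a)) (\<lambda>a b. h (enat a) (enat b)) Z (\<lambda>a. h (enat a) \<infinity>)"
        using pc by (simp add: Y_def h_def)
    qed auto
    then show "pcolim C (underS ?r a) ?r Y h (Y a) (\<lambda>b. h b a)"
      using \<open>a = \<infinity>\<close> un by (simp add: Y_def)
  qed auto
  then have "h 0 \<infinity> \<in> cc U C S"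
    by (intro cc_intro[OF cat]) (auto intro!: small_countable simp: enat_Well_order)
  then show ?thesis by (simp add: h_def zero_enat_def)
qed

lemma comp_reassoc:
  "category C \<Longrightarrow> g \<cdot>\<^bsub>C\<^esub> f = e \<Longrightarrow> f \<in> hom C Y Z \<Longrightarrow> g \<in> hom C Z W \<Longrightarrow> q \<in> hom C X Y \<Longrightarrow>
    g \<cdot>\<^bsub>C\<^esub> (f \<cdot>\<^bsub>C\<^esub> q) = e \<cdot>\<^bsub>C\<^esub> q"
  using comp_assoc[of C q X Y f Z g W] by simp

text \<open>The pair is prolonged by identities of \<open>W\<close> to an \<omega>-sequence with
  colimit \<open>W\<close>; this is why the identity of \<open>W\<close> has to be an admissible
  step.\<close>

lemma (in universe) cc_two:
  assumes cat: "category C" and f: "f \<in> hom C X Y" and g: "g \<in> hom C Y W"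
    and S: "f \<in> S" "g \<in> S" "Idt C W \<in> S"
  shows "g \<cdot>\<^bsub>C\<^esub> f \<in> cc U C S"
proof -
  define Q where "Q n = (if n = 0 then X else if n = 1 then Y else W)" for n :: nat
  define u where "u n = (if n = 0 then f else if n = 1 then g else Idt C W)" for n :: nat
  define c where "c n = (if n = 0 then g \<cdot>\<^bsub>C\<^esub> f else if n = 1 then g else Idt C W)" for n :: nat
  have W: "W \<in> Ob C" by (rule hom_cod[OF cat g])
  note iW = id_hom[OF cat W]
  have u: "u n \<in> hom C (Q n) (Q (Suc n))" for n
    unfolding u_def Q_def using f g iW by auto
  note sp = seq_pcone[where X = Q and u = u, OF cat u]
  have pc: "pcolim C UNIV nle Q (nh C Q u) W c"
    unfolding pcolim_def
  proof (intro conjI allI impI)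
    show "pcone C UNIV nle Q (nh C Q u) W c"
      unfolding sp unfolding c_def Q_def u_def
      using f g iW W comp_hom[OF cat f g] id_left[OF cat g] id_left[OF cat iW] by auto
    fix Z d assume "pcone C UNIV nle Q (nh C Q u) Z d"
    then have d: "\<And>n. d n \<in> hom C (Q n) Z" "\<And>n. d (Suc n) \<cdot>\<^bsub>C\<^esub> u n = d n" unfolding sp by blast+
    \<comment> \<open>From index 2 on all connecting morphisms are identities, so a cocone is
      constant there and \<open>d 2\<close> is the factorization.\<close>
    have dc: "d (Suc (Suc n)) = d 2" for n
    proof (induction n)
      case (Suc n)
      have "d (Suc (Suc (Suc n))) \<in> hom C W Z" using d(1)[of "Suc (Suc (Suc n))"] by (simp add: Q_def)
      then show ?case using d(2)[of "Suc (Suc n)"] id_right[OF cat] Suc by (simp add: u_def)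
    qed (simp add: numeral_2_eq_2)
    have d2: "d 2 \<in> hom C W Z" using d(1)[of 2] by (simp add: Q_def)
    have d1: "d 2 \<cdot>\<^bsub>C\<^esub> g = d 1" using d(2)[of 1] by (simp add: u_def numeral_2_eq_2)
    have d0: "d 2 \<cdot>\<^bsub>C\<^esub> (g \<cdot>\<^bsub>C\<^esub> f) = d 0"
      using d(2)[of 0] d1 comp_assoc[OF cat f g d2] by (simp add: u_def)
    show "\<exists>!w. w \<in> hom C W Z \<and> (\<forall>a \<in> UNIV. w \<cdot>\<^bsub>C\<^esub> c a = d a)"
    proof (rule ex1I[of _ "d 2"], intro conjI ballI d2)
      fix n :: nat
      show "d 2 \<cdot>\<^bsub>C\<^esub> c n = d n"
      proof (cases "n = 0 \<or> n = 1")
        case True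
        then show ?thesis using d0 d1 by (auto simp: c_def)
      next
        case False
        then obtain m where "n = Suc (Suc m)" by (metis One_nat_def not0_implies_Suc)
        then show ?thesis using dc id_right[OF cat d2] by (simp add: c_def)
      qed
    next
      fix w assume w: "w \<in> hom C W Z \<and> (\<forall>a \<in> UNIV. w \<cdot>\<^bsub>C\<^esub> c a = d a)"
      then have "w \<cdot>\<^bsub>C\<^esub> c 2 = d 2" "w \<in> hom C W Z" by blast+
      then show "w = d 2" using id_right[OF cat, of w W Z] by (simp add: c_def)
    qed
  qed
  have "u n \<in> S" for n using S by (simp add: u_def)
  from cc_seq[OF cat u pc this] show ?thesis by (simp add: c_def)
qed

lemma (in universe) cc_base:
  assumes "category C" "f \<in> S" "f \<in> hom C X Y" "Idt C Y \<in> S"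
  shows "f \<in> cc U C S"
  using cc_two[OF assms(1,3) id_hom[OF assms(1)] assms(2,4,4)] hom_cod[OF assms(1,3)]
    id_left[OF assms(1,3)] by simp


section \<open>Transfinite composites of transfinite composites\<close>

text \<open>Each step \<open>h a (\<sigma> a)\<close> of a chain is itself the composite of a chain \<open>Y a\<close> indexed by
  \<open>R a\<close>; the refinement is indexed by the lexicographic sum of the \<open>R a\<close>. At the last element,
  \<open>\<sigma> t = t\<close> and \<open>Y t\<close> composes to an identity.\<close>

locale lexsum = universe U for U :: "'u rel" +
  fixes C :: "('o, 'm) cat" and S and r :: "'a rel" and X h z t and \<sigma>
    and R :: "'a \<Rightarrow> 'b rel" and Y k y0 y1
  assumes cat: "category C"
    and wo: "Well_order r" and zF: "z \<in> Field r" and tF: "t \<in> Field r"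
    and z: "\<And>a. a \<in> Field r \<Longrightarrow> (z, a) \<in> r" and t: "\<And>a. a \<in> Field r \<Longrightarrow> (a, t) \<in> r"
    and pd: "pdiag C (Field r) r X h"
    and lim: "\<And>a. a \<in> Field r \<Longrightarrow> a \<noteq> z \<Longrightarrow> \<nexists>b. covers r b a \<Longrightarrow> pcolim C (underS r a) r X h (X a) (\<lambda>b. h b a)"
    and \<sigma>F: "\<And>a. a \<in> Field r \<Longrightarrow> \<sigma> a \<in> Field r" and a\<sigma>: "\<And>a. a \<in> Field r \<Longrightarrow> (a, \<sigma> a) \<in> r"
    and \<sigma>t: "\<sigma> t = t" and \<sigma>cov: "\<And>a. a \<in> Field r \<Longrightarrow> a \<noteq> t \<Longrightarrow> covers r a (\<sigma> a)"
    and ch: "\<And>a. a \<in> Field r \<Longrightarrow> cchain C S (R a) (Y a) (k a) (y0 a) (y1 a)"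
    and Y0: "\<And>a. a \<in> Field r \<Longrightarrow> Y a (y0 a) = X a" and Y1: "\<And>a. a \<in> Field r \<Longrightarrow> Y a (y1 a) = X (\<sigma> a)"
    and k01: "\<And>a. a \<in> Field r \<Longrightarrow> k a (y0 a) (y1 a) = h a (\<sigma> a)"
    and ids: "\<And>x. x \<in> Ob C \<Longrightarrow> Idt C x \<in> S"
    and sm: "small U (Field r)" "\<And>a. a \<in> Field r \<Longrightarrow> small U (Field (R a))"
begin

abbreviation "F \<equiv> Field r"

definition "A = Sigma F (\<lambda>a. Field (R a))"

definition "L = {((a, x), (b, y)). (a, x) \<in> A \<and> (b, y) \<in> A \<and> (a \<noteq> b \<and> (a, b) \<in> r \<or> a = b \<and> (x, y) \<in> R a)}"

definition "XX = (\<lambda>(a, x). Y a x)"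

text \<open>Between different blocks: run to the end of \<open>Y a\<close>, cross in the coarse
  chain, enter \<open>Y b\<close> from its start. The crossing begins at \<open>\<sigma> a\<close>,
  not at \<open>a\<close>, because the last object of \<open>Y a\<close> is
  \<open>X (\<sigma> a)\<close>.\<close>

definition "H = (\<lambda>(a, x) (b, y). if a = b then k a x y
   else (k b (y0 b) y \<cdot>\<^bsub>C\<^esub> h (\<sigma> a) b) \<cdot>\<^bsub>C\<^esub> k a x (y1 a))"

lemmas w = Well_order_facts[OF wo]
lemmas ww = Well_order_facts[OF cchainD(1)[OF ch]]

lemma A_iff: "(a, x) \<in> A \<longleftrightarrow> a \<in> F \<and> x \<in> Field (R a)"
  by (auto simp: A_def)

lemma L_iff: "((a, x), (b, y)) \<in> L \<longleftrightarrow> a \<in> F \<and> x \<in> Field (R a) \<and> b \<in> F \<and> y \<in> Field (R b) \<and>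
   (a \<noteq> b \<and> (a, b) \<in> r \<or> a = b \<and> (x, y) \<in> R a)"
  by (auto simp: L_def A_iff)

lemma \<sigma>_le: "(a, b) \<in> r \<Longrightarrow> a \<noteq> b \<Longrightarrow> (\<sigma> a, b) \<in> r"
proof -
  assume ab: "(a, b) \<in> r" "a \<noteq> b"
  have F: "a \<in> F" "b \<in> F" using ab by (auto simp: Field_def)
  have "a \<noteq> t" using ab t[OF F(2)] w(2) by blast
  then have c: "covers r a (\<sigma> a)" using \<sigma>cov F by blast
  have "(\<sigma> a, b) \<in> r \<or> (b, \<sigma> a) \<in> r" using w(4)[OF \<sigma>F[OF F(1)] F(2)] .
  moreover have "b = \<sigma> a" if "(b, \<sigma> a) \<in> r" using c ab that unfolding covers_def by blast
  ultimately show ?thesis using w(1)[OF F(2)] by auto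
qed

lemma \<sigma>_ne: "a \<in> F \<Longrightarrow> a \<noteq> t \<Longrightarrow> \<sigma> a \<noteq> a"
  using \<sigma>cov[of a] by (auto simp: covers_def)

lemma less_ne_t: "(a, b) \<in> r \<Longrightarrow> a \<noteq> b \<Longrightarrow> a \<noteq> t"
  using t[of b] w(2)[of a b] by (auto simp: Field_def)

lemma L_wo: "Well_order L" and L_Field: "Field L = A"
proof -
  have 1: "L \<subseteq> A \<times> A" unfolding L_def by blast
  have 2: "(p, p) \<in> L" if "p \<in> A" for p
    using that ww(1) by (cases p) (simp add: L_iff A_iff)
  have 3: "p = q" if "(p, q) \<in> L" "(q, p) \<in> L" for p q
    using that w(2) ww(2) by (cases p; cases q) (simp add: L_iff, blast)
  have 4: "(p, s) \<in> L" if "(p, q) \<in> L" "(q, s) \<in> L" for p q s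
  proof -
    obtain a x b y c v where e: "p = (a, x)" "q = (b, y)" "s = (c, v)" by (cases p; cases q; cases s)
    show ?thesis
    proof (cases "a = b \<or> b = c")
      case True
      then show ?thesis using that ww(3)[of a x y v] unfolding e L_iff by blast
    next
      case False
      then have "(a, b) \<in> r" "(b, c) \<in> r" using that unfolding e L_iff by blast+
      then have "(a, c) \<in> r" "a \<noteq> c" using w(3) w(2) False by blast+
      then show ?thesis using that unfolding e L_iff by blast
    qed
  qed
  have 5: "\<exists>p \<in> B. \<forall>q \<in> B. (p, q) \<in> L" if B: "B \<subseteq> A" "B \<noteq> {}" for B
  proof -
    have "fst ` B \<subseteq> F" "fst ` B \<noteq> {}" using B by (auto simp: A_def)
    then obtain a where a: "a \<in> fst ` B" "\<forall>b \<in> fst ` B. (a, b) \<in> r" using w(5)[of "fst ` B"] by blast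
    define P where "P = {x. (a, x) \<in> B}"
    have aF: "a \<in> F" and P: "P \<subseteq> Field (R a)" "P \<noteq> {}" using a B by (auto simp: A_def P_def)
    then obtain x where x: "x \<in> P" "\<forall>y \<in> P. (x, y) \<in> R a" using ww(5)[OF aF, of P] by blast
    have "((a, x), q) \<in> L" if q: "q \<in> B" for q
    proof -
      obtain b y where e: "q = (b, y)" by (cases q)
      have m: "b \<in> F" "y \<in> Field (R b)" "x \<in> Field (R a)" using q B x P e by (auto simp: A_def)
      show ?thesis
      proof (cases "a = b")
        case True
        then have "y \<in> P" using q e by (simp add: P_def)
        then show ?thesis using True x m aF unfolding e L_iff by blast
      next
        case False
        have "(a, b) \<in> r" using a q e by force
        then show ?thesis using False m aF unfolding e L_iff by blast
      qed
    qed
    then show ?thesis using x(1) unfolding P_def by blast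
  qed
  show "Well_order L" "Field L = A"
    by (rule Well_orderI[OF 1], erule 2, erule (1) 3, erule (1) 4, erule (1) 5)+
qed

lemma hh: "(a, b) \<in> r \<Longrightarrow> h a b \<in> hom C (X a) (X b)"
  using pdiag_hom[OF pd] by (simp add: FieldI1 FieldI2)

lemma hcomp: "(a, b) \<in> r \<Longrightarrow> (b, c) \<in> r \<Longrightarrow> h b c \<cdot>\<^bsub>C\<^esub> h a b = h a c"
  using pdiag_comp[OF pd] by (simp add: FieldI1 FieldI2)

lemma hid: "a \<in> F \<Longrightarrow> h a a = Idt C (X a)"
  using pdiag_id[OF pd] .

lemma kk: "a \<in> F \<Longrightarrow> (x, y) \<in> R a \<Longrightarrow> k a x y \<in> hom C (Y a x) (Y a y)"
  using pdiag_hom[OF cchainD(6)[OF ch]] by (simp add: FieldI1 FieldI2)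

lemma kcomp: "a \<in> F \<Longrightarrow> (x, y) \<in> R a \<Longrightarrow> (y, v) \<in> R a \<Longrightarrow> k a y v \<cdot>\<^bsub>C\<^esub> k a x y = k a x v"
  using pdiag_comp[OF cchainD(6)[OF ch]] by (simp add: FieldI1 FieldI2)

lemma kid: "a \<in> F \<Longrightarrow> x \<in> Field (R a) \<Longrightarrow> k a x x = Idt C (Y a x)"
  using pdiag_id[OF cchainD(6)[OF ch]] .

lemmas y0F = cchainD(2)[OF ch]
lemmas y1F = cchainD(3)[OF ch]
lemmas y0_le = cchainD(4)[OF ch]
lemmas y1_le = cchainD(5)[OF ch]

lemma Bhom: "b \<in> F \<Longrightarrow> y \<in> Field (R b) \<Longrightarrow> k b (y0 b) y \<in> hom C (X b) (Y b y)"
  using kk[OF _ y0_le] Y0 by simp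

lemma Thom: "a \<in> F \<Longrightarrow> x \<in> Field (R a) \<Longrightarrow> k a x (y1 a) \<in> hom C (Y a x) (X (\<sigma> a))"
  using kk[OF _ y1_le] Y1 by simp

lemma H_eq: "H (a, x) (a, y) = k a x y"
  by (simp add: H_def)

lemma H_ne: "a \<noteq> b \<Longrightarrow> H (a, x) (b, y) = (k b (y0 b) y \<cdot>\<^bsub>C\<^esub> h (\<sigma> a) b) \<cdot>\<^bsub>C\<^esub> k a x (y1 a)"
  by (simp add: H_def)

lemma H_ne': "a \<noteq> b \<Longrightarrow> ((a, x), (b, y)) \<in> L \<Longrightarrow>
   H (a, x) (b, y) = k b (y0 b) y \<cdot>\<^bsub>C\<^esub> (h (\<sigma> a) b \<cdot>\<^bsub>C\<^esub> k a x (y1 a))"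
  using comp_assoc[OF cat Thom hh Bhom, of a x b y] \<sigma>_le[of a b] by (simp add: H_ne L_iff)

lemma H_hom: "((a, x), (b, y)) \<in> L \<Longrightarrow> H (a, x) (b, y) \<in> hom C (Y a x) (Y b y)"
proof (cases "a = b")
  case True
  assume "((a, x), (b, y)) \<in> L"
  then show ?thesis using True kk by (simp add: H_eq L_iff)
next
  case False
  assume l: "((a, x), (b, y)) \<in> L"
  then have "(\<sigma> a, b) \<in> r" using False \<sigma>_le by (simp add: L_iff)
  then show ?thesis using l False comp_hom[OF cat Thom comp_hom[OF cat hh Bhom]] by (simp add: H_ne L_iff)
qed

text \<open>The essential case is that of three different blocks. There the middle block is entered
  up to \<open>y\<close> and left from \<open>y\<close>; the two pieces compose to the whole of
  \<open>Y b\<close>, which is \<open>h b (\<sigma> b)\<close> and merges into the coarse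
  chain.\<close>

lemma H_comp:
  assumes l1: "((a, x), (b, y)) \<in> L" and l2: "((b, y), (c, v)) \<in> L"
  shows "H (b, y) (c, v) \<cdot>\<^bsub>C\<^esub> H (a, x) (b, y) = H (a, x) (c, v)"
proof -
  have m: "a \<in> F" "b \<in> F" "c \<in> F" "x \<in> Field (R a)" "y \<in> Field (R b)" "v \<in> Field (R c)"
    using l1 l2 by (auto simp: L_iff)
  have l3: "((a, x), (c, v)) \<in> L" using Well_order_facts(3)[OF L_wo l1 l2] .
  consider "a = b" "b = c" | "a = b" "b \<noteq> c" | "a \<noteq> b" "b = c" | "a \<noteq> b" "b \<noteq> c" by blast
  then show ?thesis
  proof cases
    case 1
    then show ?thesis using l1 l2 kcomp by (simp add: H_eq L_iff)
  next
    case 2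
    then have le: "(x, y) \<in> R a" "(\<sigma> a, c) \<in> r" "y \<in> Field (R a)" using l1 l2 \<sigma>_le by (simp_all add: L_iff)
    have "((k c (y0 c) v \<cdot>\<^bsub>C\<^esub> h (\<sigma> a) c) \<cdot>\<^bsub>C\<^esub> k a y (y1 a)) \<cdot>\<^bsub>C\<^esub> k a x y =
      (k c (y0 c) v \<cdot>\<^bsub>C\<^esub> h (\<sigma> a) c) \<cdot>\<^bsub>C\<^esub> (k a y (y1 a) \<cdot>\<^bsub>C\<^esub> k a x y)"
      by (rule comp_assoc[OF cat kk[OF m(1) le(1)] Thom[OF m(1) le(3)] comp_hom[OF cat hh[OF le(2)] Bhom[OF m(3,6)]]])
    moreover have "k a y (y1 a) \<cdot>\<^bsub>C\<^esub> k a x y = k a x (y1 a)"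
      using kcomp[OF m(1) le(1) y1_le[OF m(1) le(3)]] .
    ultimately show ?thesis using 2 by (simp add: H_eq H_ne)
  next
    case 3
    then have le: "(y, v) \<in> R b" "(\<sigma> a, b) \<in> r" using l1 l2 \<sigma>_le by (simp_all add: L_iff)
    have T: "h (\<sigma> a) b \<cdot>\<^bsub>C\<^esub> k a x (y1 a) \<in> hom C (Y a x) (X b)"
      by (rule comp_hom[OF cat Thom[OF m(1,4)] hh[OF le(2)]])
    have "k b y v \<cdot>\<^bsub>C\<^esub> (k b (y0 b) y \<cdot>\<^bsub>C\<^esub> (h (\<sigma> a) b \<cdot>\<^bsub>C\<^esub> k a x (y1 a))) =
       k b (y0 b) v \<cdot>\<^bsub>C\<^esub> (h (\<sigma> a) b \<cdot>\<^bsub>C\<^esub> k a x (y1 a))"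
      by (rule comp_reassoc[OF cat kcomp[OF m(2) y0_le[OF m(2,5)] le(1)] Bhom[OF m(2,5)] kk[OF m(2) le(1)] T])
    then show ?thesis using 3 H_ne'[OF 3(1) l1] H_ne'[of a c x v] l3 by (simp add: H_eq)
  next
    case 4
    then have le: "(\<sigma> a, b) \<in> r" "(\<sigma> b, c) \<in> r" "(a, b) \<in> r" "(b, c) \<in> r"
      using l1 l2 \<sigma>_le by (simp_all add: L_iff)
    have ac: "a \<noteq> c" using 4 le w(2) by blast
    have b\<sigma>: "(b, \<sigma> b) \<in> r" using a\<sigma>[OF m(2)] .
    have T: "h (\<sigma> a) b \<cdot>\<^bsub>C\<^esub> k a x (y1 a) \<in> hom C (Y a x) (X b)"
      by (rule comp_hom[OF cat Thom[OF m(1,4)] hh[OF le(1)]])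
    have T': "k a x (y1 a) \<in> hom C (Y a x) (X (\<sigma> a))" by (rule Thom[OF m(1,4)])
    have e0: "k b y (y1 b) \<cdot>\<^bsub>C\<^esub> k b (y0 b) y = h b (\<sigma> b)"
      using kcomp[OF m(2) y0_le[OF m(2,5)] y1_le[OF m(2,5)]] k01[OF m(2)] by simp
    have e1: "k b y (y1 b) \<cdot>\<^bsub>C\<^esub> (k b (y0 b) y \<cdot>\<^bsub>C\<^esub> (h (\<sigma> a) b \<cdot>\<^bsub>C\<^esub> k a x (y1 a))) =
        h b (\<sigma> b) \<cdot>\<^bsub>C\<^esub> (h (\<sigma> a) b \<cdot>\<^bsub>C\<^esub> k a x (y1 a))"
      by (rule comp_reassoc[OF cat e0 Bhom[OF m(2,5)] Thom[OF m(2,5)] T])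
    have e2: "h b (\<sigma> b) \<cdot>\<^bsub>C\<^esub> (h (\<sigma> a) b \<cdot>\<^bsub>C\<^esub> k a x (y1 a)) = h (\<sigma> a) (\<sigma> b) \<cdot>\<^bsub>C\<^esub> k a x (y1 a)"
      by (rule comp_reassoc[OF cat hcomp[OF le(1) b\<sigma>] hh[OF le(1)] hh[OF b\<sigma>] T'])
    have \<sigma>\<sigma>: "(\<sigma> a, \<sigma> b) \<in> r" using w(3)[OF le(1) b\<sigma>] .
    have e3: "h (\<sigma> b) c \<cdot>\<^bsub>C\<^esub> (h (\<sigma> a) (\<sigma> b) \<cdot>\<^bsub>C\<^esub> k a x (y1 a)) = h (\<sigma> a) c \<cdot>\<^bsub>C\<^esub> k a x (y1 a)"
      by (rule comp_reassoc[OF cat hcomp[OF \<sigma>\<sigma> le(2)] hh[OF \<sigma>\<sigma>] hh[OF le(2)] T'])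
    have Hab: "H (a, x) (b, y) \<in> hom C (Y a x) (Y b y)" by (rule H_hom[OF l1])
    have "H (b, y) (c, v) \<cdot>\<^bsub>C\<^esub> H (a, x) (b, y) =
        k c (y0 c) v \<cdot>\<^bsub>C\<^esub> (h (\<sigma> b) c \<cdot>\<^bsub>C\<^esub> (k b y (y1 b) \<cdot>\<^bsub>C\<^esub> H (a, x) (b, y)))"
      using comp_assoc[OF cat Hab comp_hom[OF cat Thom[OF m(2,5)] hh[OF le(2)]] Bhom[OF m(3,6)]]
        comp_assoc[OF cat Hab Thom[OF m(2,5)] hh[OF le(2)]] H_ne'[OF 4(2) l2] by simp
    also have "\<dots> = k c (y0 c) v \<cdot>\<^bsub>C\<^esub> (h (\<sigma> a) c \<cdot>\<^bsub>C\<^esub> k a x (y1 a))"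
      unfolding H_ne'[OF 4(1) l1] e1 e2 e3 ..
    also have "\<dots> = H (a, x) (c, v)" using H_ne'[OF ac l3] by simp
    finally show ?thesis .
  qed
qed

lemma H_pdiag: "pdiag C A L XX H"
  unfolding pdiag_def
proof (intro conjI ballI impI)
  fix p q s assume m: "p \<in> A" "q \<in> A" "s \<in> A"
  obtain a x b y c v where e: "p = (a, x)" "q = (b, y)" "s = (c, v)" by (cases p; cases q; cases s)
  show "XX p \<in> Ob C" using m pdiag_ob[OF cchainD(6)[OF ch]] unfolding e by (simp add: XX_def A_iff)
  show "H p p = Idt C (XX p)" using m kid unfolding e by (simp add: XX_def A_iff H_eq)
  show "H p q \<in> hom C (XX p) (XX q)" if "(p, q) \<in> L" using that H_hom unfolding e by (simp add: XX_def)
  show "H q s \<cdot>\<^bsub>C\<^esub> H p q = H p s" if "(p, q) \<in> L" "(q, s) \<in> L" using that H_comp unfolding e by blast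
qed

lemma k_first: "a \<in> F \<Longrightarrow> k a (y0 a) (y0 a) = Idt C (X a)" "a \<in> F \<Longrightarrow> k a (y1 a) (y1 a) = Idt C (X (\<sigma> a))"
  using kid[OF _ y0F] kid[OF _ y1F] Y0 Y1 by simp_all

lemma H_first:
  assumes "(a, b) \<in> r" shows "H (a, y0 a) (b, y0 b) = h a b"
proof (cases "a = b")
  case True
  then show ?thesis using assms k_first hid by (simp add: H_eq FieldI1)
next
  case False
  have F: "a \<in> F" "b \<in> F" using assms by (auto simp: Field_def)
  have s: "(\<sigma> a, b) \<in> r" using \<sigma>_le[OF assms False] .
  have "H (a, y0 a) (b, y0 b) = h (\<sigma> a) b \<cdot>\<^bsub>C\<^esub> h a (\<sigma> a)"
    using False k_first F id_left[OF cat hh[OF s]] k01 by (simp add: H_ne)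
  then show ?thesis using hcomp[OF a\<sigma>[OF F(1)] s] by simp
qed

text \<open>Apart from covering pairs inside a block there are the seams from the end of block
  \<open>a\<close> to the start of block \<open>\<sigma> a\<close>. Both sides of a seam carry the
  object \<open>X (\<sigma> a)\<close>, and the step is an identity; hence the requirement
  \<open>ids\<close>.\<close>

lemma L_step:
  assumes "covers L p q" shows "H p q \<in> S"
proof -
  obtain a x b y where e: "p = (a, x)" "q = (b, y)" by (cases p; cases q)
  have l: "((a, x), (b, y)) \<in> L" and ne: "(a, x) \<noteq> (b, y)"
    and bt: "\<And>c v. ((a, x), (c, v)) \<in> L \<Longrightarrow> ((c, v), (b, y)) \<in> L \<Longrightarrow> (c, v) = (a, x) \<or> (c, v) = (b, y)"
    using assms unfolding covers_def e by blast+
  have m: "a \<in> F" "b \<in> F" "x \<in> Field (R a)" "y \<in> Field (R b)" using l by (auto simp: L_iff)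
  show ?thesis
  proof (cases "a = b")
    case True
    have "covers (R a) x y"
      unfolding covers_def
    proof (intro conjI allI impI)
      show "(x, y) \<in> R a" "x \<noteq> y" using l ne True by (auto simp: L_iff)
      fix v assume v: "(x, v) \<in> R a \<and> (v, y) \<in> R a"
      then have "v \<in> Field (R a)" by (auto simp: Field_def)
      then have "(a, v) = (a, x) \<or> (a, v) = (b, y)" using bt[of a v] v True m by (simp add: L_iff)
      then show "v = x \<or> v = y" by blast
    qed
    then show ?thesis using cchainD(7)[OF ch[OF m(1)]] True by (simp add: e H_eq)
  next
    case False
    then have ab: "(a, b) \<in> r" using l by (simp add: L_iff)
    have at: "a \<noteq> t" using less_ne_t ab False by blast
    have "(a, y1 a) = (a, x) \<or> (a, y1 a) = (b, y)"
      using bt[of a "y1 a"] m y1F[OF m(1)] y1_le[OF m(1,3)] ab False by (simp add: L_iff)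
    then have x: "x = y1 a" using False by blast
    have \<sigma>: "\<sigma> a \<in> F" "\<sigma> a \<noteq> a" "(\<sigma> a, b) \<in> r" "(a, \<sigma> a) \<in> r"
      using \<sigma>F[OF m(1)] \<sigma>_ne[OF m(1) at] \<sigma>_le[OF ab False] a\<sigma>[OF m(1)] by auto
    have "(\<sigma> a, y0 (\<sigma> a)) = (a, x) \<or> (\<sigma> a, y0 (\<sigma> a)) = (b, y)"
      using bt[of "\<sigma> a" "y0 (\<sigma> a)"] m y0F[OF \<sigma>(1)] y0_le[OF \<sigma>(1)] \<sigma> by (auto simp: L_iff)
    then have y: "b = \<sigma> a" "y = y0 b" using \<sigma> by auto
    have "H p q = Idt C (X b)"
      using False x y k_first m hid id_left[OF cat id_hom[OF cat pdiag_ob[OF pd m(2)]]]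
      by (simp add: e H_ne)
    then show ?thesis using ids[OF pdiag_ob[OF pd m(2)]] by simp
  qed
qed

text \<open>A limit of the lexicographic order is of one of two kinds: a limit inside its block,
  where the earlier part of that block is cofinal, or the start of a block whose index is itself a
  limit of \<open>r\<close>, where the starts of the earlier blocks are cofinal. Smoothness is thus
  inherited from \<open>Y b\<close> or from \<open>X\<close>.\<close>

lemma L_limit:
  assumes p: "p \<in> A" "p \<noteq> (z, y0 z)" and nc: "\<nexists>q. covers L q p"
  shows "pcolim C (underS L p) L XX H (XX p) (\<lambda>q. H q p)"
proof -
  obtain b y where e: "p = (b, y)" by (cases p)
  have m: "b \<in> F" "y \<in> Field (R b)" using p e by (auto simp: A_iff)
  note LW = Well_order_facts[OF L_wo, unfolded L_Field]
  have sub: "underS L p \<subseteq> A" using underS_Field[of L p] L_Field by simp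
  have pdu: "pdiag C (underS L p) L XX H" by (rule pdiag_subset[OF H_pdiag sub])
  have cone: "pcone C (underS L p) L XX H (XX p) (\<lambda>q. H q p)"
    unfolding pcone_def
  proof (intro conjI ballI impI)
    show "XX p \<in> Ob C" by (rule pdiag_ob[OF H_pdiag p(1)])
    fix q assume "q \<in> underS L p"
    then have q: "(q, p) \<in> L" "q \<in> A" using sub by (auto simp: underS_def)
    show "H q p \<in> hom C (XX q) (XX p)" by (rule pdiag_hom[OF H_pdiag q(1) q(2) p(1)])
    fix s assume "s \<in> underS L p" and qs: "(q, s) \<in> L"
    then have s: "(s, p) \<in> L" "s \<in> A" using sub by (auto simp: underS_def)
    show "H s p \<cdot>\<^bsub>C\<^esub> H q s = H q p" by (rule pdiag_comp[OF H_pdiag qs s(1) q(2) s(2) p(1)])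
  qed
  show ?thesis
  proof (cases "y = y0 b")
    case False
    have "\<nexists>x. covers (R b) x y"
    proof
      assume "\<exists>x. covers (R b) x y"
      then obtain x where x: "covers (R b) x y" by blast
      then have xF: "x \<in> Field (R b)" by (auto simp: covers_def Field_def)
      have "covers L (b, x) (b, y)"
        unfolding covers_def
      proof (intro conjI allI impI)
        show "((b, x), (b, y)) \<in> L" "(b, x) \<noteq> (b, y)" using x xF m by (auto simp: covers_def L_iff)
        fix q assume q: "((b, x), q) \<in> L \<and> (q, (b, y)) \<in> L"
        obtain c v where cv: "q = (c, v)" by (cases q)
        have "c = b" using q w(2)[of b c] unfolding cv L_iff by blast
        then have "(x, v) \<in> R b" "(v, y) \<in> R b" using q unfolding cv L_iff by auto
        then show "q = (b, x) \<or> q = (b, y)" using x \<open>c = b\<close> cv unfolding covers_def by blast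
      qed
      then show False using nc e by blast
    qed
    then have pc: "pcolim C (underS (R b) y) (R b) (Y b) (k b) (Y b y) (\<lambda>x. k b x y)"
      by (rule cchainD(8)[OF ch[OF m(1)] m(2) False])
    have inL: "(b, x) \<in> underS L p" if "x \<in> underS (R b) y" for x
      using that m unfolding underS_def e by (auto simp: L_iff Field_def)
    show ?thesis
    proof (rule pcolim_reindex[OF cat pdu cone, where A' = "underS (R b) y" and r' = "R b" and \<phi> = "Pair b"])
      show "pcolim C (underS (R b) y) (R b) (\<lambda>a. XX (b, a)) (\<lambda>a c. H (b, a) (b, c)) (XX p) (\<lambda>a. H (b, a) p)"
        using pc by (simp add: XX_def H_eq e)
      show "(b, a) \<in> underS L p" if "a \<in> underS (R b) y" for a by (rule inL[OF that])
      show "((b, a), (b, c)) \<in> L" if "(a, c) \<in> R b" for a c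
        using that m by (auto simp: L_iff Field_def)
      show "\<exists>a \<in> underS (R b) y. (q, (b, a)) \<in> L" if q: "q \<in> underS L p" for q
      proof -
        obtain c v where cv: "q = (c, v)" by (cases q)
        have l: "((c, v), (b, y)) \<in> L" "(c, v) \<noteq> (b, y)" using q unfolding underS_def cv e by auto
        show ?thesis
        proof (cases "c = b")
          case True
          then have "v \<in> underS (R b) y" using l by (auto simp: underS_def L_iff)
          moreover have "(q, (b, v)) \<in> L" using LW(1) q sub cv True by blast
          ultimately show ?thesis by blast
        next
          case False': False
          have "y0 b \<in> underS (R b) y" using False y0_le[OF m] by (auto simp: underS_def)
          moreover have "(q, (b, y0 b)) \<in> L" using l False' y0F[OF m(1)] unfolding cv by (auto simp: L_iff)
          ultimately show ?thesis by blast
        qed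
      qed
    qed
  next
    case True
    have bz: "b \<noteq> z" using p(2) e True by blast
    have nb: "\<nexists>a. covers r a b"
    proof
      assume "\<exists>a. covers r a b"
      then obtain a where a: "covers r a b" by blast
      then have ab: "(a, b) \<in> r" "a \<noteq> b" "a \<in> F" by (auto simp: covers_def Field_def)
      have "covers L (a, y1 a) (b, y0 b)"
        unfolding covers_def
      proof (intro conjI allI impI)
        show "((a, y1 a), (b, y0 b)) \<in> L" "(a, y1 a) \<noteq> (b, y0 b)"
          using ab m y0F y1F by (auto simp: L_iff)
        fix q assume q: "((a, y1 a), q) \<in> L \<and> (q, (b, y0 b)) \<in> L"
        obtain c v where cv: "q = (c, v)" by (cases q)
        have "(a, c) \<in> r" "(c, b) \<in> r" using q w(1) unfolding cv L_iff by auto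
        then have "c = a \<or> c = b" using a unfolding covers_def by blast
        moreover have "v = y1 a" if "c = a"
          using q that y1_le[OF ab(3), of v] ww(2)[OF ab(3), of v "y1 a"] unfolding cv L_iff by auto
        moreover have "v = y0 b" if "c = b"
          using q that y0_le[OF m(1), of v] ww(2)[OF m(1), of v "y0 b"] unfolding cv L_iff by auto
        ultimately show "q = (a, y1 a) \<or> q = (b, y0 b)" using cv by blast
      qed
      then show False using nc e True by blast
    qed
    have pc: "pcolim C (underS r b) r X h (X b) (\<lambda>a. h a b)" by (rule lim[OF m(1) bz nb])
    have uF: "a \<in> F" "(a, b) \<in> r" "a \<noteq> b" if "a \<in> underS r b" for a
      using that by (auto simp: underS_def Field_def)
    show ?thesis
    proof (rule pcolim_reindex[OF cat pdu cone, where A' = "underS r b" and r' = r and \<phi> = "\<lambda>a. (a, y0 a)"])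
      have "pcolim C (underS r b) r (\<lambda>a. XX (a, y0 a)) (\<lambda>a c. H (a, y0 a) (c, y0 c)) (X b) (\<lambda>a. H (a, y0 a) p)"
        using pc
        by (subst pcolim_cong[where X' = X and h' = h and c' = "\<lambda>a. h a b"])
          (auto simp: XX_def Y0 uF H_first e True)
      then show "pcolim C (underS r b) r (\<lambda>a. XX (a, y0 a)) (\<lambda>a c. H (a, y0 a) (c, y0 c)) (XX p) (\<lambda>a. H (a, y0 a) p)"
        using e True Y0 m by (simp add: XX_def)
      show "(a, y0 a) \<in> underS L p" if "a \<in> underS r b" for a
        using uF[OF that] m y0F by (auto simp: underS_def e L_iff)
      show "((a, y0 a), (c, y0 c)) \<in> L" if "a \<in> underS r b" "c \<in> underS r b" "(a, c) \<in> r" for a c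
        using uF[OF that(1)] uF[OF that(2)] that(3) y0F y0_le by (auto simp: L_iff)
      show "\<exists>a \<in> underS r b. (q, (a, y0 a)) \<in> L" if q: "q \<in> underS L p" for q
      proof -
        obtain c v where cv: "q = (c, v)" by (cases q)
        have l: "((c, v), (b, y)) \<in> L" "(c, v) \<noteq> (b, y)" using q unfolding underS_def cv e by auto
        have "c \<noteq> b"
        proof
          assume cb: "c = b"
          then have "(v, y0 b) \<in> R b" "v \<in> Field (R b)" using l True by (auto simp: L_iff)
          then have "v = y0 b" using ww(2)[OF m(1)] y0_le[OF m(1)] by blast
          then show False using l cb True by blast
        qed
        then have c: "(c, b) \<in> r" "c \<in> F" "v \<in> Field (R c)" using l by (auto simp: L_iff)
        have ct: "c \<noteq> t" using less_ne_t[OF c(1) \<open>c \<noteq> b\<close>] .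
        have s: "(\<sigma> c, b) \<in> r" "\<sigma> c \<in> F" "\<sigma> c \<noteq> c" "(c, \<sigma> c) \<in> r"
          using \<sigma>_le[OF c(1) \<open>c \<noteq> b\<close>] \<sigma>F[OF c(2)] \<sigma>_ne[OF c(2) ct] a\<sigma>[OF c(2)] by auto
        \<comment> \<open>As \<open>b\<close> is a limit, the successor of \<open>c\<close> is still
          below \<open>b\<close>, so the start of the next block bounds all of block
          \<open>c\<close>.\<close>
        have "\<sigma> c \<noteq> b" using nb \<sigma>cov[OF c(2) ct] by auto
        then have "\<sigma> c \<in> underS r b" using s by (auto simp: underS_def)
        moreover have "(q, (\<sigma> c, y0 (\<sigma> c))) \<in> L" using s c y0F[OF s(2)] unfolding cv by (auto simp: L_iff)
        ultimately show ?thesis by blast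
      qed
    qed
  qed
qed

lemma L_chain: "cchain C S L XX H (z, y0 z) (t, y1 t)"
  unfolding cchain_def L_Field
proof (intro conjI ballI allI impI L_wo[unfolded L_Field] H_pdiag)
  show "(z, y0 z) \<in> A" "(t, y1 t) \<in> A" using zF tF y0F y1F by (auto simp: A_iff)
  fix p assume p: "p \<in> A"
  obtain b y where e: "p = (b, y)" by (cases p)
  have m: "b \<in> F" "y \<in> Field (R b)" using p e by (auto simp: A_iff)
  show "((z, y0 z), p) \<in> L" using m z[OF m(1)] y0F[OF zF] y0_le[OF m] zF unfolding e by (auto simp: L_iff)
  show "(p, (t, y1 t)) \<in> L" using m t[OF m(1)] y1F[OF tF] y1_le[OF m] tF unfolding e by (auto simp: L_iff)
qed (use L_step L_limit in blast)+

text \<open>The last block contributes \<open>h t (\<sigma> t)\<close>, which is an identity since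
  \<open>\<sigma> t = t\<close>.\<close>

lemma L_composite: "H (z, y0 z) (t, y1 t) = h z t"
proof (cases "z = t")
  case True
  then show ?thesis using k01[OF tF] \<sigma>t by (simp add: H_eq)
next
  case False
  have zt: "(z, t) \<in> r" using z[OF tF] .
  have s: "(\<sigma> z, t) \<in> r" using \<sigma>_le[OF zt False] .
  have "h t (\<sigma> t) \<cdot>\<^bsub>C\<^esub> h (\<sigma> z) t = h (\<sigma> z) t" using hid[OF tF] \<sigma>t id_left[OF cat hh[OF s]] by simp
  then show ?thesis using False k01[OF tF] k01[OF zF] hcomp[OF a\<sigma>[OF zF] s] by (simp add: H_ne)
qed

lemma composite_in_cc: "h z t \<in> cc U C S"
proof -
  have "small U (Field L)" unfolding L_Field A_def using sm by (intro small_Sigma)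
  from cc_intro[OF cat this L_chain] show ?thesis unfolding L_composite .
qed

end

lemma cchain_trivial:
  assumes "category C" "Q \<in> Ob C"
  shows "cchain C S {(w, w)} (\<lambda>_. Q) (\<lambda>_ _. Idt C Q) w w"
proof -
  have w: "Well_order {(w, w)}" by (rule Well_orderI[of _ "{w}"]) auto
  have F: "Field {(w, w)} = {w}" by auto
  have "\<not> covers {(w, w)} a b" for a b by (auto simp: covers_def)
  then show ?thesis
    using id_hom[OF assms] id_left[OF assms(1) id_hom[OF assms]] assms(2)
    unfolding cchain_def pdiag_def by (auto simp: w[unfolded F])
qed

text \<open>Each step to a successor is refined by a chain that witnesses it; the last element
  receives a one-point chain. The endpoints of a witness match because composition determines domain
  and codomain.\<close>

lemma (in universe) cc_cc:
  assumes cat: "category C" and ids: "\<And>x. x \<in> Ob C \<Longrightarrow> Idt C x \<in> S"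
  shows "cc U C (cc U C S) \<subseteq> cc U C S"
proof
  fix f assume "f \<in> cc U C (cc U C S)"
  then obtain r :: "'u rel" and X h z t where sm: "small U (Field r)"
    and c: "cchain C (cc U C S) r X h z t" and f: "f = h z t" unfolding cc_def[of U C "cc U C S"] by blast
  note D = cchainD[OF c]
  note w = Well_order_facts[OF D(1)]
  define \<sigma> where "\<sigma> a = (if a = t then t else SOME b. covers r a b)" for a
  have cov: "covers r a (\<sigma> a)" if a: "a \<in> Field r" "a \<noteq> t" for a
  proof -
    \<comment> \<open>Successors exist by well-ordering: the set of strictly later elements contains
      the last element \<open>t\<close> and has a minimum.\<close>
    let ?B = "{b \<in> Field r. (a, b) \<in> r \<and> b \<noteq> a}"
    have "t \<in> ?B" using a D by auto
    then obtain b where b: "b \<in> ?B" "\<forall>x \<in> ?B. (b, x) \<in> r" using w(5)[of ?B] by blast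
    have "covers r a b"
      unfolding covers_def
    proof (intro conjI allI impI)
      show "(a, b) \<in> r" "a \<noteq> b" using b by auto
      fix x assume x: "(a, x) \<in> r \<and> (x, b) \<in> r"
      then have "x \<in> Field r" by (auto simp: Field_def)
      then show "x = a \<or> x = b" using b x w(2) by blast
    qed
    then show ?thesis using a unfolding \<sigma>_def by (simp add: someI[of "covers r a"])
  qed
  have \<sigma>: "\<sigma> a \<in> Field r" "(a, \<sigma> a) \<in> r" if a: "a \<in> Field r" for a
    using cov[OF a] w(1)[OF a] a by (cases "a = t"; auto simp: covers_def \<sigma>_def Field_def)+
  have "\<exists>(R :: 'u rel) Y k y0 y1. small U (Field R) \<and> cchain C S R Y k y0 y1 \<and> Y y0 = X a \<and> Y y1 = X (\<sigma> a) \<and>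
      k y0 y1 = h a (\<sigma> a)" if a: "a \<in> Field r" for a
  proof (cases "a = t")
    case True
    have o: "X t \<in> Ob C" by (rule pdiag_ob[OF D(6,3)])
    have "\<sigma> t = t" "h t t = Idt C (X t)" using pdiag_id[OF D(6,3)] by (auto simp: \<sigma>_def)
    moreover have "small U (Field {(undefined :: 'u, undefined :: 'u)})" by (rule small_finite) simp
    ultimately show ?thesis using cchain_trivial[OF cat o, of S "undefined :: 'u"] True
      by (intro exI[of _ "{(undefined, undefined)}"] exI[of _ "\<lambda>_. X t"] exI[of _ "\<lambda>_ _. Idt C (X t)"] exI[of _ undefined]) simp
  next
    case False
    then have "h a (\<sigma> a) \<in> cc U C S" using D(7) cov a by blast
    then obtain R :: "'u rel" and Y k y0 y1 where R: "small U (Field R)" "cchain C S R Y k y0 y1" "h a (\<sigma> a) = k y0 y1"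
      unfolding cc_def by blast
    have "k y0 y1 \<in> hom C (Y y0) (Y y1)" by (rule cchain_composite_hom[OF R(2)])
    moreover have "h a (\<sigma> a) \<in> hom C (X a) (X (\<sigma> a))" by (rule pdiag_hom[OF D(6) \<sigma>(2)[OF a] a \<sigma>(1)[OF a]])
    ultimately have "Y y0 = X a" "Y y1 = X (\<sigma> a)" using R(3) by (auto simp: hom_def)
    then show ?thesis using R by metis
  qed
  then obtain R :: "'u \<Rightarrow> 'u rel" and Y k y0 y1 where
    "\<And>a. a \<in> Field r \<Longrightarrow> small U (Field (R a)) \<and> cchain C S (R a) (Y a) (k a) (y0 a) (y1 a) \<and>
      Y a (y0 a) = X a \<and> Y a (y1 a) = X (\<sigma> a) \<and> k a (y0 a) (y1 a) = h a (\<sigma> a)" by metis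
  then interpret lexsum U C S r X h z t \<sigma> R Y k y0 y1
    by unfold_locales (use cat D \<sigma> cov ids sm in \<open>auto simp: \<sigma>_def\<close>)
  show "f \<in> cc U C S" unfolding f by (rule composite_in_cc)
qed

section \<open>Chains with a last object against transfinite composites\<close>

lemma Well_order_add_top:
  assumes "Well_order r" "m \<notin> Field r"
  defines "r' \<equiv> r \<union> insert m (Field r) \<times> {m}"
  shows "Well_order r'" "Field r' = insert m (Field r)"
proof -
  note w = Well_order_facts[OF assms(1)]
  have nm: "(m, a) \<notin> r" "(a, m) \<notin> r" for a using assms(2) by (auto simp: Field_def)
  have 1: "r' \<subseteq> insert m (Field r) \<times> insert m (Field r)" unfolding r'_def by (auto simp: Field_def)
  have 2: "(a, a) \<in> r'" if "a \<in> insert m (Field r)" for a using that w(1) unfolding r'_def by auto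
  have 3: "a = b" if "(a, b) \<in> r'" "(b, a) \<in> r'" for a b
    using that w(2) nm assms(2) unfolding r'_def by (auto simp: Field_def)
  have 4: "(a, c) \<in> r'" if "(a, b) \<in> r'" "(b, c) \<in> r'" for a b c
    using that w(3)[of a b c] nm unfolding r'_def by (auto simp: Field_def)
  have 5: "\<exists>a \<in> B. \<forall>b \<in> B. (a, b) \<in> r'" if B: "B \<subseteq> insert m (Field r)" "B \<noteq> {}" for B
  proof (cases "B = {m}")
    case True
    then show ?thesis unfolding r'_def by auto
  next
    case False
    then have "B - {m} \<subseteq> Field r" "B - {m} \<noteq> {}" using B by auto
    then obtain a where a: "a \<in> B - {m}" "\<forall>b \<in> B - {m}. (a, b) \<in> r" using w(5)[of "B - {m}"] by blast
    then have "\<forall>b \<in> B. (a, b) \<in> r'" using B unfolding r'_def by auto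
    then show ?thesis using a by blast
  qed
  show "Well_order r'" "Field r' = insert m (Field r)"
    by (rule Well_orderI[OF 1], erule 2, erule (1) 3, erule (1) 4, erule (1) 5)+
qed

text \<open>The colimit object becomes a new last object \<open>m\<close>. Without a previous last
  element, \<open>m\<close> is a limit and smooth by definition. Otherwise the new step is the
  colimit leg at the old last element; this leg is invertible, whence the demand that
  \<open>S\<close> contain isomorphisms.\<close>

lemma (in universe) transfinite_composites_cc:
  assumes cat: "category C" and iso: "\<And>X Y f. iso_ar C X Y f \<Longrightarrow> f \<in> S"
  shows "transfinite_composites U C S \<subseteq> cc U C S"
proof
  fix f assume "f \<in> transfinite_composites U C S"
  then obtain r :: "'u rel" and D Z c z where wo: "Well_order r" and sm: "small U (Field r)" and z: "z \<in> Field r"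
    and zl: "\<And>a. a \<in> Field r \<Longrightarrow> (z, a) \<in> r" and col: "is_colimit (poset_cat r) C D Z c" and f: "f = c z"
    and st: "\<And>a b. covers r a b \<Longrightarrow> on_ar D (a, b) \<in> S"
    and lm: "\<And>a. a \<in> Field r \<Longrightarrow> a \<noteq> z \<Longrightarrow> \<nexists>b. covers r b a \<Longrightarrow>
        is_colimit (poset_cat (Restr r (underS r a))) C D (on_ob D a) (\<lambda>b. on_ar D (b, a))"
    unfolding transfinite_composites_def by blast
  note w = Well_order_facts[OF wo]
  define X where "X = on_ob D"
  define h where "h a b = on_ar D (a, b)" for a b
  have pd: "pdiag C (Field r) r X h" and pc: "pcolim C (Field r) r X h Z c"
    using poset_colimitD[OF col] unfolding X_def h_def by blast+
  have lim: "pcolim C (underS r a) r X h (X a) (\<lambda>b. h b a)"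
    if a: "a \<in> Field r" "a \<noteq> z" "\<nexists>b. covers r b a" for a
  proof -
    have "Field (Restr r (underS r a)) = underS r a"
      using w(1) by (auto simp: Field_def underS_def)
    then have "pcolim C (underS r a) (Restr r (underS r a)) X h (X a) (\<lambda>b. h b a)"
      using poset_colimitD(2)[OF lm[OF a]] unfolding X_def h_def by simp
    then show ?thesis by (subst (asm) pcolim_cong_rel[where r' = r]) auto
  qed
  obtain m where m: "m \<notin> Field r" using small_proper[OF sm] by blast
  define r' where "r' = r \<union> insert m (Field r) \<times> {m}"
  have wo': "Well_order r'" and F': "Field r' = insert m (Field r)"
    using Well_order_add_top[OF wo m] unfolding r'_def by auto
  have nm: "(m, a) \<notin> r" "(a, m) \<notin> r" for a using m by (auto simp: Field_def)
  define X' where "X' a = (if a = m then Z else X a)" for a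
  define h' where "h' a b = (if b = m then if a = m then Idt C Z else c a else h a b)" for a b
  note ch = pcolim_leg[OF pc] and cc = pcolim_leg_comp[OF pc] and ZO = pcolim_ob[OF pc]
  have rF: "(a, b) \<in> r \<Longrightarrow> a \<in> Field r \<and> b \<in> Field r" for a b by (auto simp: Field_def)
  have pd': "pdiag C (insert m (Field r)) r' X' h'"
    unfolding pdiag_def
  proof (intro conjI ballI impI)
    fix a b e assume m: "a \<in> insert m (Field r)" "b \<in> insert m (Field r)" "e \<in> insert m (Field r)"
    show "X' a \<in> Ob C" using m ZO pdiag_ob[OF pd] by (auto simp: X'_def)
    show "h' a a = Idt C (X' a)" using m pdiag_id[OF pd] by (auto simp: X'_def h'_def)
    show "h' a b \<in> hom C (X' a) (X' b)" if "(a, b) \<in> r'"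
      using that m nm pdiag_hom[OF pd] ch id_hom[OF cat ZO] by (auto simp: X'_def h'_def r'_def)
    show "h' b e \<cdot>\<^bsub>C\<^esub> h' a b = h' a e" if "(a, b) \<in> r'" "(b, e) \<in> r'"
      using that m nm pdiag_comp[OF pd, of a b e] cc[of a b] id_left[OF cat ch[of a]] id_left[OF cat id_hom[OF cat ZO]]
      by (auto simp: h'_def r'_def)
  qed
  have "cchain C S r' X' h' z m"
    unfolding cchain_def F'
  proof (intro conjI ballI allI impI pd' wo'[unfolded F'])
    show "z \<in> insert m (Field r)" "m \<in> insert m (Field r)" using z by auto
    show "(z, a) \<in> r'" "(a, m) \<in> r'" if "a \<in> insert m (Field r)" for a
      using that zl z unfolding r'_def by auto
    show "h' a b \<in> S" if co: "covers r' a b" for a b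
    proof (cases "b = m")
      case False
      have "covers r a b" using co False unfolding covers_def r'_def by auto
      moreover have "h' a b = h a b" using False by (simp add: h'_def)
      ultimately show ?thesis using st unfolding h_def by simp
    next
      case True
      have a: "a \<in> Field r" "a \<noteq> m" using co True unfolding covers_def r'_def by (auto dest: rF)
      have mx: "(x, a) \<in> r" if x: "x \<in> Field r" for x
      proof (rule ccontr)
        assume "(x, a) \<notin> r"
        then have "(a, x) \<in> r" "x \<noteq> a" using w(4)[OF a(1) x] w(1) x by auto
        moreover have "(x, m) \<in> r'" "x \<noteq> m" using x m unfolding r'_def by auto
        ultimately show False using co True unfolding covers_def r'_def by blast
      qed
      \<comment> \<open>The element \<open>a\<close> is the last of \<open>r\<close>, so
        \<open>X a\<close> receives a cocone, and the induced morphism from \<open>Z\<close> is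
        inverse to the leg \<open>c a\<close>.\<close>
      have "pcone C (Field r) r X h (X a) (\<lambda>x. h x a)"
        unfolding pcone_def
      proof (intro conjI ballI impI pdiag_ob[OF pd a(1)])
        show "h x a \<in> hom C (X x) (X a)" if "x \<in> Field r" for x by (rule pdiag_hom[OF pd mx[OF that] that a(1)])
        show "h y a \<cdot>\<^bsub>C\<^esub> h x y = h x a" if "x \<in> Field r" "y \<in> Field r" "(x, y) \<in> r" for x y
          by (rule pdiag_comp[OF pd that(3) mx[OF that(2)] that(1,2) a(1)])
      qed
      then obtain k where k: "k \<in> hom C Z (X a)" "\<And>x. x \<in> Field r \<Longrightarrow> k \<cdot>\<^bsub>C\<^esub> c x = h x a"
        using pcolim_factor[OF pc] by blast
      have "c a \<cdot>\<^bsub>C\<^esub> k = Idt C Z"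
      proof (rule pcolim_eq[OF cat pd pc comp_hom[OF cat k(1) ch[OF a(1)]] id_hom[OF cat ZO]])
        fix x assume x: "x \<in> Field r"
        show "(c a \<cdot>\<^bsub>C\<^esub> k) \<cdot>\<^bsub>C\<^esub> c x = Idt C Z \<cdot>\<^bsub>C\<^esub> c x"
          using comp_assoc[OF cat ch[OF x] k(1) ch[OF a(1)]] k(2)[OF x] cc[OF x a(1) mx[OF x]] id_left[OF cat ch[OF x]] by simp
      qed
      then have "iso_ar C (X a) Z (c a)"
        using k(2)[OF a(1)] pdiag_id[OF pd a(1)] by (intro iso_arI[OF ch[OF a(1)] k(1)]) auto
      then show ?thesis using iso True a by (simp add: h'_def)
    qed
    show "pcolim C (underS r' a) r' X' h' (X' a) (\<lambda>b. h' b a)"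
      if "a \<in> insert m (Field r)" and n: "a \<noteq> z \<and> (\<nexists>b. covers r' b a)" for a
    proof (cases "a = m")
      case True
      have "underS r' a = Field r" using True m unfolding underS_def r'_def by (auto dest: rF)
      moreover have "pcolim C (Field r) r' X' h' Z (\<lambda>b. h' b m)"
      proof (subst pcolim_cong_rel[where r' = r])
        show "((a, b) \<in> r') = ((a, b) \<in> r)" if "a \<in> Field r" "b \<in> Field r" for a b
          using that m unfolding r'_def by auto
        show "pcolim C (Field r) r X' h' Z (\<lambda>b. h' b m)"
          using pc by (subst pcolim_cong[where X' = X and h' = h and c' = c]) (use m in \<open>auto simp: X'_def h'_def\<close>)
      qed
      ultimately show ?thesis using True by (simp add: X'_def)
    next
      case False
      then have aF: "a \<in> Field r" using that by auto
      have "\<nexists>b. covers r b a"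
      proof
        assume "\<exists>b. covers r b a"
        then obtain b where b: "covers r b a" by blast
        then have "covers r' b a" using False nm unfolding covers_def r'_def by blast
        then show False using n by blast
      qed
      then have l: "pcolim C (underS r a) r X h (X a) (\<lambda>b. h b a)" using lim[OF aF] n by blast
      have u: "underS r' a = underS r a" using False unfolding underS_def r'_def by auto
      have sub: "b \<in> Field r \<and> b \<noteq> m" if "b \<in> underS r a" for b
        using that m rF unfolding underS_def by blast
      show ?thesis unfolding u
      proof (subst pcolim_cong_rel[where r' = r])
        show "((x, b) \<in> r') = ((x, b) \<in> r)" if "x \<in> underS r a" "b \<in> underS r a" for x b
          using sub[OF that(1)] sub[OF that(2)] unfolding r'_def by auto
        show "pcolim C (underS r a) r X' h' (X' a) (\<lambda>b. h' b a)"
          using l False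
          by (subst pcolim_cong[where X' = X and h' = h and c' = "\<lambda>b. h b a"])
            (auto simp: X'_def h'_def dest: sub)
      qed
    qed
  qed
  moreover have "small U (Field r')" unfolding F' by (rule small_insert[OF sm])
  ultimately have "h' z m \<in> cc U C S" using cc_intro[OF cat, of r' S X' h' z m] by simp
  moreover have "h' z m = f" using z m f by (auto simp: h'_def)
  ultimately show "f \<in> cc U C S" by simp
qed

lemma Well_order_Restr:
  assumes "Well_order r" "A \<subseteq> Field r"
  shows "Field (Restr r A) = A" "Preorder (Restr r A)"
proof -
  note w = Well_order_facts[OF assms(1)]
  have "(a, a) \<in> Restr r A" if "a \<in> A" for a using w(1) assms(2) that by blast
  then show F: "Field (Restr r A) = A" by (auto simp: Field_def)
  show "Preorder (Restr r A)"
    unfolding preorder_on_def F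
  proof (intro conjI)
    show "refl_on A (Restr r A)" using w(1) assms(2) by (auto simp: refl_on_def)
    show "trans (Restr r A)" using w(3) by (intro transI) blast
  qed auto
qed

text \<open>The last element \<open>t\<close> is terminal in the index order, so \<open>X t\<close>
  with the legs \<open>h a t\<close> is a colimit of the whole chain.\<close>

lemma cc_transfinite_composites:
  fixes U :: "'u rel"
  assumes cat: "category C"
  shows "cc U C S \<subseteq> transfinite_composites U C S"
proof
  fix f assume "f \<in> cc U C S"
  then obtain r :: "'u rel" and X h z t where sm: "small U (Field r)"
    and c: "cchain C S r X h z t" and f: "f = h z t" unfolding cc_def by blast
  note D = cchainD[OF c]
  define E where "E = \<lparr>on_ob = X, on_ar = (\<lambda>p. h (fst p) (snd p))\<rparr>"
  have pre: "Preorder r" using D(1) by (auto simp: order_on_defs)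
  have tc: "pcolim C (Field r) r X h (X t) (\<lambda>a. h a t)"
    unfolding pcolim_def
  proof (intro conjI allI impI)
    show "pcone C (Field r) r X h (X t) (\<lambda>a. h a t)"
      unfolding pcone_def
      using pdiag_ob[OF D(6,3)] pdiag_hom[OF D(6) D(5) _ D(3)] pdiag_comp[OF D(6) _ D(5) _ _ D(3)] by blast
    fix Y d assume d: "pcone C (Field r) r X h Y d"
    then have dt: "d t \<in> hom C (X t) Y" "\<And>a. a \<in> Field r \<Longrightarrow> d t \<cdot>\<^bsub>C\<^esub> h a t = d a"
      using D(3,5) unfolding pcone_def by blast+
    show "\<exists>!u. u \<in> hom C (X t) Y \<and> (\<forall>a \<in> Field r. u \<cdot>\<^bsub>C\<^esub> h a t = d a)"
    proof (rule ex1I[of _ "d t"])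
      show "d t \<in> hom C (X t) Y \<and> (\<forall>a \<in> Field r. d t \<cdot>\<^bsub>C\<^esub> h a t = d a)" using dt by blast
      fix u assume u: "u \<in> hom C (X t) Y \<and> (\<forall>a \<in> Field r. u \<cdot>\<^bsub>C\<^esub> h a t = d a)"
      then have "u \<cdot>\<^bsub>C\<^esub> h t t = d t" using D(3) by blast
      then show "u = d t" using pdiag_id[OF D(6,3)] id_right[OF cat, of u "X t" Y] u by simp
    qed
  qed
  have col: "is_colimit (poset_cat r) C E (X t) (\<lambda>a. h a t)"
    unfolding E_def by (rule poset_colimitI[OF cat pre D(6) tc])
  have lim: "is_colimit (poset_cat (Restr r (underS r a))) C E (on_ob E a) (\<lambda>b. on_ar E (b, a))"
    if a: "a \<in> Field r" "a \<noteq> z" "\<nexists>b. covers r b a" for a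
  proof -
    note R = Well_order_Restr[OF D(1) underS_Field[of r a]]
    have pd: "pdiag C (Field (Restr r (underS r a))) (Restr r (underS r a)) X h"
      using pdiag_subset[OF D(6) underS_Field[of r a]] unfolding R(1) pdiag_def by blast
    have "pcolim C (underS r a) (Restr r (underS r a)) X h (X a) (\<lambda>b. h b a)"
      using D(8)[OF a] by (subst pcolim_cong_rel[where r' = r]) auto
    then have "pcolim C (Field (Restr r (underS r a))) (Restr r (underS r a)) X h (X a) (\<lambda>b. h b a)"
      unfolding R(1) .
    from poset_colimitI[OF cat R(2) pd this] show ?thesis unfolding E_def by simp
  qed
  show "f \<in> transfinite_composites U C S"
    unfolding transfinite_composites_def mem_Collect_eq
    by (rule exI[of _ r], rule exI[of _ E], rule exI[of _ "X t"], rule exI[of _ "\<lambda>a. h a t"], rule exI[of _ z])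
      (use D sm col lim f in \<open>auto simp: E_def\<close>)
qed


section \<open>Pushouts of coproducts\<close>

text \<open>One stage of a cell complex. The map \<open>s\<close> may repeat a generator, since the
  same one may be attached in several places, and \<open>J\<close> may be empty. Speaking of the
  attached family avoids choosing coproducts of the domains and codomains.\<close>

definition csteps :: "'u rel \<Rightarrow> ('o, 'm) cat \<Rightarrow> ('i, 'm) family \<Rightarrow> 'm set" where
  "csteps U C I = {u. \<exists>(J :: 'u set) s W g Z e. small U J \<and> s ` J \<subseteq> Idx I \<and>
     mwf C W J (\<lambda>j. mor I (s j)) g \<and> mpush C W J (\<lambda>j. mor I (s j)) g Z u e}"

lemma cstepsI:
  fixes J :: "'u set" and U :: "'u rel"
  assumes "small U J" "s ` J \<subseteq> Idx I" "mwf C W J (\<lambda>j. mor I (s j)) g" "mpush C W J (\<lambda>j. mor I (s j)) g Z u e"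
  shows "u \<in> csteps U C I"
  unfolding csteps_def mem_Collect_eq using assms by (intro exI conjI)

lemma coproduct_relcolim:
  assumes cat: "category C" and X: "\<And>j. j \<in> J \<Longrightarrow> X j \<in> Ob C"
  shows "is_coproduct C J X Z c \<longleftrightarrow> relcolim C J X {} Z c"
proof -
  let ?D = "\<lparr>on_ob = X, on_ar = (\<lambda>j. Idt C (X j))\<rparr>"
  have "category (discrete_cat J)"
    unfolding category_def discrete_cat_def hom_def by auto
  then have F: "is_functor (discrete_cat J) C ?D"
    using cat X id_hom[OF cat X] id_left[OF cat id_hom[OF cat X]]
    unfolding is_functor_def by (auto simp: discrete_cat_def)
  have "d j \<cdot>\<^bsub>C\<^esub> Idt C (X j) = d j" if "d j \<in> hom C (X j) Y" for j d Y
    using id_right[OF cat that] .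
  then have co: "is_cocone (discrete_cat J) C ?D Y d \<longleftrightarrow> relcone C J X {} Y d" for Y d
    unfolding is_cocone_def relcone_def by (auto simp: discrete_cat_def)
  show ?thesis
    unfolding is_coproduct_def is_colimit_def relcolim_def co using F by (simp add: discrete_cat_def)
qed

text \<open>A morphism out of a coproduct is a family of morphisms out of the summands. Applied to
  \<open>Q\<close> it gives the cocones of the family, applied to \<open>P\<close> it reduces
  commutativity of the square to the single squares.\<close>

lemma pushouts_csteps:
  fixes U :: "'u rel"
  assumes cat: "category C" and fam: "is_family U C I"
  shows "pushouts C (small_coproducts U C I) \<subseteq> csteps U C I"
proof
  fix u assume "u \<in> pushouts C (small_coproducts U C I)"
  then obtain f g p where f: "f \<in> small_coproducts U C I" and po: "is_pushout C f g p u"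
    unfolding pushouts_def by blast
  obtain J :: "'u set" and s P a Q b where all: "small U J \<and> s ` J \<subseteq> Idx I \<and>
     is_coproduct C J (\<lambda>j. Dom C (mor I (s j))) P a \<and>
     is_coproduct C J (\<lambda>j. Cod C (mor I (s j))) Q b \<and>
     f \<in> hom C P Q \<and> (\<forall>j \<in> J. f \<cdot>\<^bsub>C\<^esub> a j = b j \<cdot>\<^bsub>C\<^esub> mor I (s j))"
    using f unfolding small_coproducts_def mem_Collect_eq by (elim exE) (rule that)
  then have J: "small U J" "s ` J \<subseteq> Idx I"
    and P: "is_coproduct C J (\<lambda>j. Dom C (mor I (s j))) P a"
    and Q: "is_coproduct C J (\<lambda>j. Cod C (mor I (s j))) Q b"
    and fh: "f \<in> hom C P Q" and fc: "\<And>j. j \<in> J \<Longrightarrow> f \<cdot>\<^bsub>C\<^esub> a j = b j \<cdot>\<^bsub>C\<^esub> mor I (s j)"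
    by auto
  define m where "m j = mor I (s j)" for j
  have mA: "m j \<in> hom C (Dom C (m j)) (Cod C (m j))" if "j \<in> J" for j
    using fam J(2) that unfolding is_family_def m_def hom_def by auto
  have P': "relcolim C J (\<lambda>j. Dom C (m j)) {} P a"
    using P coproduct_relcolim[OF cat, of J "\<lambda>j. Dom C (m j)" P a] hom_dom[OF cat mA] unfolding m_def by simp
  have Q': "relcolim C J (\<lambda>j. Cod C (m j)) {} Q b"
    using Q coproduct_relcolim[OF cat, of J "\<lambda>j. Cod C (m j)" Q b] hom_cod[OF cat mA] unfolding m_def by simp
  have wfP: "rel_wf C J (\<lambda>j. Dom C (m j)) {}" and wfQ: "rel_wf C J (\<lambda>j. Cod C (m j)) {}"
    using hom_dom[OF cat mA] hom_cod[OF cat mA] unfolding rel_wf_def by auto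
  have a: "a j \<in> hom C (Dom C (m j)) P" and b: "b j \<in> hom C (Cod C (m j)) Q" if "j \<in> J" for j
    using relcolim_cone[OF P'] relcolim_cone[OF Q'] that unfolding relcone_def by auto
  define W where "W = Cod C g"
  define Z where "Z = Cod C p"
  have gh: "g \<in> hom C P W" and ph: "p \<in> hom C Q Z" and uh: "u \<in> hom C W Z" and eq: "p \<cdot>\<^bsub>C\<^esub> f = u \<cdot>\<^bsub>C\<^esub> g"
    using po fh unfolding is_pushout_def W_def Z_def hom_def by auto
  have pu: "\<exists>!w. w \<in> hom C Z Y \<and> w \<cdot>\<^bsub>C\<^esub> p = p' \<and> w \<cdot>\<^bsub>C\<^esub> u = q'"
    if "p' \<in> hom C Q Y" "q' \<in> hom C W Y" "p' \<cdot>\<^bsub>C\<^esub> f = q' \<cdot>\<^bsub>C\<^esub> g" for p' q' Y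
  proof -
    have "\<forall>p' \<in> Ar C. \<forall>q' \<in> Ar C. Dom C p' = Cod C f \<and> Dom C q' = Cod C g \<and> Cod C p' = Cod C q' \<and>
        p' \<cdot>\<^bsub>C\<^esub> f = q' \<cdot>\<^bsub>C\<^esub> g \<longrightarrow>
        (\<exists>!w. w \<in> hom C (Cod C p) (Cod C p') \<and> w \<cdot>\<^bsub>C\<^esub> p = p' \<and> w \<cdot>\<^bsub>C\<^esub> u = q')"
      using po unfolding is_pushout_def by (elim conjE)
    moreover have "p' \<in> Ar C" "q' \<in> Ar C" "Dom C p' = Cod C f \<and> Dom C q' = Cod C g \<and> Cod C p' = Cod C q' \<and>
        p' \<cdot>\<^bsub>C\<^esub> f = q' \<cdot>\<^bsub>C\<^esub> g"
      using that(3) hom_ArD[OF fh] hom_ArD[OF that(1)] hom_ArD[OF that(2)] by (simp_all add: W_def)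
    ultimately have "\<exists>!w. w \<in> hom C (Cod C p) (Cod C p') \<and> w \<cdot>\<^bsub>C\<^esub> p = p' \<and> w \<cdot>\<^bsub>C\<^esub> u = q'"
      by blast
    then show ?thesis using hom_ArD[OF that(1)] by (simp add: Z_def)
  qed
  define gg where "gg j = g \<cdot>\<^bsub>C\<^esub> a j" for j
  define e where "e j = p \<cdot>\<^bsub>C\<^esub> b j" for j
  have wf: "mwf C W J m gg"
    unfolding mwf_def gg_def using mA comp_hom[OF cat a gh] hom_cod[OF cat gh] by (auto simp: hom_def)
  have "mpush C W J m gg Z u e"
  proof (rule mpushI)
    have "e j \<cdot>\<^bsub>C\<^esub> m j = u \<cdot>\<^bsub>C\<^esub> gg j" if j: "j \<in> J" for j
    proof -
      have "e j \<cdot>\<^bsub>C\<^esub> m j = p \<cdot>\<^bsub>C\<^esub> (f \<cdot>\<^bsub>C\<^esub> a j)"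
        unfolding e_def using comp_assoc[OF cat mA[OF j] b[OF j] ph] fc[OF j] by (simp add: m_def)
      also have "\<dots> = u \<cdot>\<^bsub>C\<^esub> gg j"
        using comp_assoc[OF cat a[OF j] fh ph] comp_assoc[OF cat a[OF j] gh uh] eq by (simp add: gg_def)
      finally show ?thesis .
    qed
    then show "mcone C W J m gg Z u e"
      unfolding mcone_def using uh comp_hom[OF cat b ph] by (auto simp: e_def)
  next
    fix Y u' e' assume "mcone C W J m gg Y u' e'"
    then have u': "u' \<in> hom C W Y" and e': "\<And>j. j \<in> J \<Longrightarrow> e' j \<in> hom C (Cod C (m j)) Y"
      and ee: "\<And>j. j \<in> J \<Longrightarrow> e' j \<cdot>\<^bsub>C\<^esub> m j = u' \<cdot>\<^bsub>C\<^esub> gg j" unfolding mcone_def by auto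
    have "relcone C J (\<lambda>j. Cod C (m j)) {} Y e'"
      unfolding relcone_def using e' hom_cod[OF cat u'] by auto
    then obtain p' where p': "p' \<in> hom C Q Y" "\<And>j. j \<in> J \<Longrightarrow> p' \<cdot>\<^bsub>C\<^esub> b j = e' j"
      using Q' unfolding relcolim_def by blast
    have "p' \<cdot>\<^bsub>C\<^esub> f = u' \<cdot>\<^bsub>C\<^esub> g"
    proof (rule relcolim_eq[OF cat wfP P' comp_hom[OF cat fh p'(1)] comp_hom[OF cat gh u']])
      fix j assume j: "j \<in> J"
      have "(p' \<cdot>\<^bsub>C\<^esub> f) \<cdot>\<^bsub>C\<^esub> a j = (p' \<cdot>\<^bsub>C\<^esub> b j) \<cdot>\<^bsub>C\<^esub> m j"
        using comp_assoc[OF cat a[OF j] fh p'(1)] comp_assoc[OF cat mA[OF j] b[OF j] p'(1)] fc[OF j] by (simp add: m_def)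
      then show "(p' \<cdot>\<^bsub>C\<^esub> f) \<cdot>\<^bsub>C\<^esub> a j = (u' \<cdot>\<^bsub>C\<^esub> g) \<cdot>\<^bsub>C\<^esub> a j"
        using p'(2)[OF j] ee[OF j] comp_assoc[OF cat a[OF j] gh u'] by (simp add: gg_def)
    qed
    then obtain w where w: "w \<in> hom C Z Y" "w \<cdot>\<^bsub>C\<^esub> p = p'" "w \<cdot>\<^bsub>C\<^esub> u = u'" using pu[OF p'(1) u'] by blast
    then have "w \<cdot>\<^bsub>C\<^esub> e j = e' j" if "j \<in> J" for j
      using comp_assoc[OF cat b[OF that] ph w(1)] p'(2)[OF that] by (simp add: e_def)
    then show "\<exists>w. w \<in> hom C Z Y \<and> w \<cdot>\<^bsub>C\<^esub> u = u' \<and> (\<forall>j \<in> J. w \<cdot>\<^bsub>C\<^esub> e j = e' j)" using w by blast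
  next
    fix Y x y assume x: "x \<in> hom C Z Y" and y: "y \<in> hom C Z Y" and xu: "x \<cdot>\<^bsub>C\<^esub> u = y \<cdot>\<^bsub>C\<^esub> u"
      and xe: "\<And>j. j \<in> J \<Longrightarrow> x \<cdot>\<^bsub>C\<^esub> e j = y \<cdot>\<^bsub>C\<^esub> e j"
    have xp: "x \<cdot>\<^bsub>C\<^esub> p = y \<cdot>\<^bsub>C\<^esub> p"
    proof (rule relcolim_eq[OF cat wfQ Q' comp_hom[OF cat ph x] comp_hom[OF cat ph y]])
      fix j assume j: "j \<in> J"
      show "(x \<cdot>\<^bsub>C\<^esub> p) \<cdot>\<^bsub>C\<^esub> b j = (y \<cdot>\<^bsub>C\<^esub> p) \<cdot>\<^bsub>C\<^esub> b j"
        using comp_assoc[OF cat b[OF j] ph x] comp_assoc[OF cat b[OF j] ph y] xe[OF j] by (simp add: e_def)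
    qed
    have "(y \<cdot>\<^bsub>C\<^esub> p) \<cdot>\<^bsub>C\<^esub> f = (y \<cdot>\<^bsub>C\<^esub> u) \<cdot>\<^bsub>C\<^esub> g"
      using comp_assoc[OF cat fh ph y] comp_assoc[OF cat gh uh y] eq by simp
    from pu[OF comp_hom[OF cat ph y] comp_hom[OF cat uh y] this] show "x = y" using x y xp xu by blast
  qed
  then show "u \<in> csteps U C I" using cstepsI[OF J, of C W gg Z u e] wf unfolding m_def by blast
qed

text \<open>The direction that requires colimits: the coproducts \<open>P\<close> and
  \<open>Q\<close> have to be formed before the simultaneous attachment can be read as one
  pushout.\<close>

lemma (in universe) csteps_pushouts:
  assumes cat: "category C" and fam: "is_family U C I" and rc: "relcoc U C"
  shows "csteps U C I \<subseteq> pushouts C (small_coproducts U C I)"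
proof
  fix u assume "u \<in> csteps U C I"
  then obtain J :: "'u set" and s W gg Z e where "small U J \<and> s ` J \<subseteq> Idx I \<and>
     mwf C W J (\<lambda>j. mor I (s j)) gg \<and> mpush C W J (\<lambda>j. mor I (s j)) gg Z u e"
    unfolding csteps_def mem_Collect_eq by (elim exE) (rule that)
  then have J: "small U J" "s ` J \<subseteq> Idx I"
    and wf: "mwf C W J (\<lambda>j. mor I (s j)) gg" and mp: "mpush C W J (\<lambda>j. mor I (s j)) gg Z u e"
    by auto
  define m where "m j = mor I (s j)" for j
  note wf = wf[folded m_def] and mp = mp[folded m_def]
  have mA: "m j \<in> hom C (Dom C (m j)) (Cod C (m j))" if "j \<in> J" for j
    using fam J(2) that unfolding is_family_def m_def hom_def by auto
  have wfP: "rel_wf C J (\<lambda>j. Dom C (m j)) {}" and wfQ: "rel_wf C J (\<lambda>j. Cod C (m j)) {}"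
    using hom_dom[OF cat mA] hom_cod[OF cat mA] unfolding rel_wf_def by auto
  obtain P a where P': "relcolim C J (\<lambda>j. Dom C (m j)) {} P a" using relcoc_any[OF rc J(1) small_finite[OF finite.emptyI] wfP] by blast
  obtain Q b where Q': "relcolim C J (\<lambda>j. Cod C (m j)) {} Q b" using relcoc_any[OF rc J(1) small_finite[OF finite.emptyI] wfQ] by blast
  have a: "a j \<in> hom C (Dom C (m j)) P" and b: "b j \<in> hom C (Cod C (m j)) Q" if "j \<in> J" for j
    using relcolim_cone[OF P'] relcolim_cone[OF Q'] that unfolding relcone_def by auto
  have g': "gg j \<in> hom C (Dom C (m j)) W" if "j \<in> J" for j using wf that unfolding mwf_def by auto
  have mc: "u \<in> hom C W Z" "\<And>j. j \<in> J \<Longrightarrow> e j \<in> hom C (Cod C (m j)) Z" "\<And>j. j \<in> J \<Longrightarrow> e j \<cdot>\<^bsub>C\<^esub> m j = u \<cdot>\<^bsub>C\<^esub> gg j"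
    using mpush_cone[OF mp] unfolding mcone_def by auto
  have QO: "Q \<in> Ob C" using relcolim_cone[OF Q'] by (simp add: relcone_def)
  have WO: "W \<in> Ob C" using wf by (simp add: mwf_def)
  have "relcone C J (\<lambda>j. Dom C (m j)) {} Q (\<lambda>j. b j \<cdot>\<^bsub>C\<^esub> m j)"
    unfolding relcone_def using QO comp_hom[OF cat mA b] by auto
  then obtain f where f: "f \<in> hom C P Q" "\<And>j. j \<in> J \<Longrightarrow> f \<cdot>\<^bsub>C\<^esub> a j = b j \<cdot>\<^bsub>C\<^esub> m j"
    using P' unfolding relcolim_def by blast
  have "relcone C J (\<lambda>j. Dom C (m j)) {} W gg" unfolding relcone_def using WO g' by auto
  then obtain g where g: "g \<in> hom C P W" "\<And>j. j \<in> J \<Longrightarrow> g \<cdot>\<^bsub>C\<^esub> a j = gg j"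
    using P' unfolding relcolim_def by blast
  have "relcone C J (\<lambda>j. Cod C (m j)) {} Z e"
    unfolding relcone_def using hom_cod[OF cat mc(1)] mc(2) by auto
  then obtain p where p: "p \<in> hom C Q Z" "\<And>j. j \<in> J \<Longrightarrow> p \<cdot>\<^bsub>C\<^esub> b j = e j"
    using Q' unfolding relcolim_def by blast
  \<comment> \<open>Morphisms out of the coproduct \<open>P\<close> agree when they agree on the
    summands, so the large square commutes exactly if each small one does.\<close>
  have key: "(x \<cdot>\<^bsub>C\<^esub> f = y \<cdot>\<^bsub>C\<^esub> g) \<longleftrightarrow> (\<forall>j \<in> J. (x \<cdot>\<^bsub>C\<^esub> b j) \<cdot>\<^bsub>C\<^esub> m j = y \<cdot>\<^bsub>C\<^esub> gg j)"
    if x: "x \<in> hom C Q Y" and y: "y \<in> hom C W Y" for x y Y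
  proof -
    have 1: "(x \<cdot>\<^bsub>C\<^esub> f) \<cdot>\<^bsub>C\<^esub> a j = (x \<cdot>\<^bsub>C\<^esub> b j) \<cdot>\<^bsub>C\<^esub> m j" if j: "j \<in> J" for j
      using comp_assoc[OF cat a[OF j] f(1) x] comp_assoc[OF cat mA[OF j] b[OF j] x] f(2)[OF j] by simp
    have 2: "(y \<cdot>\<^bsub>C\<^esub> g) \<cdot>\<^bsub>C\<^esub> a j = y \<cdot>\<^bsub>C\<^esub> gg j" if j: "j \<in> J" for j
      using comp_assoc[OF cat a[OF j] g(1) y] g(2)[OF j] by simp
    show ?thesis
      using relcolim_eq[OF cat wfP P' comp_hom[OF cat f(1) x] comp_hom[OF cat g(1) y]] 1 2 by metis
  qed
  have "is_pushout C f g p u"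
    unfolding is_pushout_def
  proof (intro conjI ballI impI, goal_cases)
    case (10 p' q')
    define Y where "Y = Cod C p'"
    have p': "p' \<in> hom C Q Y" and q': "q' \<in> hom C W Y" and eq: "p' \<cdot>\<^bsub>C\<^esub> f = q' \<cdot>\<^bsub>C\<^esub> g"
      using 10 f g by (auto simp: hom_def Y_def)
    have "mcone C W J m gg Y q' (\<lambda>j. p' \<cdot>\<^bsub>C\<^esub> b j)"
      unfolding mcone_def using q' comp_hom[OF cat b p'] eq key[OF p' q'] by blast
    then have ex: "\<exists>!w. w \<in> hom C Z Y \<and> w \<cdot>\<^bsub>C\<^esub> u = q' \<and> (\<forall>j \<in> J. w \<cdot>\<^bsub>C\<^esub> e j = p' \<cdot>\<^bsub>C\<^esub> b j)"
      using mp unfolding mpush_def by blast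
    have "(\<forall>j \<in> J. w \<cdot>\<^bsub>C\<^esub> e j = p' \<cdot>\<^bsub>C\<^esub> b j) \<longleftrightarrow> w \<cdot>\<^bsub>C\<^esub> p = p'" if w: "w \<in> hom C Z Y" for w
    proof -
      have "(w \<cdot>\<^bsub>C\<^esub> p) \<cdot>\<^bsub>C\<^esub> b j = w \<cdot>\<^bsub>C\<^esub> e j" if j: "j \<in> J" for j
        using comp_assoc[OF cat b[OF j] p(1) w] p(2)[OF j] by simp
      then show ?thesis using relcolim_eq[OF cat wfQ Q' comp_hom[OF cat p(1) w] p'] by metis
    qed
    then have "\<exists>!w. w \<in> hom C Z Y \<and> w \<cdot>\<^bsub>C\<^esub> p = p' \<and> w \<cdot>\<^bsub>C\<^esub> u = q'" using ex by metis
    moreover have "Cod C p = Z" using p by (simp add: hom_def)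
    ultimately show ?case by (simp add: Y_def)
  next
    case 9
    show ?case using key[OF p(1) mc(1)] p(2) mc(3) by simp
  qed (use f g p mc in \<open>auto simp: hom_def\<close>)
  moreover have "f \<in> small_coproducts U C I"
    unfolding small_coproducts_def mem_Collect_eq
  proof (intro exI conjI)
    show "is_coproduct C J (\<lambda>j. Dom C (mor I (s j))) P a"
      using P' coproduct_relcolim[OF cat, of J "\<lambda>j. Dom C (m j)" P a] hom_dom[OF cat mA] unfolding m_def by simp
    show "is_coproduct C J (\<lambda>j. Cod C (mor I (s j))) Q b"
      using Q' coproduct_relcolim[OF cat, of J "\<lambda>j. Cod C (m j)" Q b] hom_cod[OF cat mA] unfolding m_def by simp
  qed (use J f in \<open>auto simp: m_def\<close>)
  ultimately show "u \<in> pushouts C (small_coproducts U C I)" unfolding pushouts_def by blast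
qed

section \<open>Closure properties of cellular morphisms\<close>

text \<open>A pushout square is the case of a one-element family of \<^const>\<open>mpush\<close>.\<close>

abbreviation po :: "('o, 'm) cat \<Rightarrow> 'm \<Rightarrow> 'm \<Rightarrow> 'o \<Rightarrow> 'o \<Rightarrow> 'm \<Rightarrow> 'm \<Rightarrow> bool" where
  "po C f g W Z q p \<equiv> mpush C W {()} (\<lambda>_. f) (\<lambda>_. g) Z q (\<lambda>_. p)"

lemma mconeI: "u \<in> hom C W Y \<Longrightarrow> (\<And>j. j \<in> J \<Longrightarrow> e j \<in> hom C (Cod C (al j)) Y) \<Longrightarrow>
    (\<And>j. j \<in> J \<Longrightarrow> e j \<cdot>\<^bsub>C\<^esub> al j = u \<cdot>\<^bsub>C\<^esub> g j) \<Longrightarrow> mcone C W J al g Y u e"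
  by (simp add: mcone_def)

lemma mconeD:
  assumes "mcone C W J al g Y u e"
  shows "u \<in> hom C W Y" "\<And>j. j \<in> J \<Longrightarrow> e j \<in> hom C (Cod C (al j)) Y"
    "\<And>j. j \<in> J \<Longrightarrow> e j \<cdot>\<^bsub>C\<^esub> al j = u \<cdot>\<^bsub>C\<^esub> g j"
  using assms by (auto simp: mcone_def)

lemmas mpushD = mconeD[OF mpush_cone]

lemma mwfD:
  assumes "mwf C W J al g"
  shows "W \<in> Ob C" "\<And>j. j \<in> J \<Longrightarrow> al j \<in> hom C (Dom C (al j)) (Cod C (al j))"
    "\<And>j. j \<in> J \<Longrightarrow> g j \<in> hom C (Dom C (al j)) W"
  using assms by (auto simp: mwf_def hom_def)

lemma po_factor:
  assumes "po C f g W Z q p" "q' \<in> hom C W Y" "p' \<in> hom C (Cod C f) Y" "p' \<cdot>\<^bsub>C\<^esub> f = q' \<cdot>\<^bsub>C\<^esub> g"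
  obtains w where "w \<in> hom C Z Y" "w \<cdot>\<^bsub>C\<^esub> q = q'" "w \<cdot>\<^bsub>C\<^esub> p = p'"
proof -
  have "mcone C W {()} (\<lambda>_. f) (\<lambda>_. g) Y q' (\<lambda>_. p')" using assms(2-4) by (simp add: mcone_def)
  then have "\<exists>!w. w \<in> hom C Z Y \<and> w \<cdot>\<^bsub>C\<^esub> q = q' \<and> (\<forall>j \<in> {()}. w \<cdot>\<^bsub>C\<^esub> p = p')"
    using assms(1) unfolding mpush_def by blast
  then show ?thesis using that by auto
qed

lemma mpush_unique:
  assumes "category C" "mwf C W J al g" "mpush C W J al g Z u e" "mcone C W J al g Y u' e'"
  shows "\<exists>!w. w \<in> hom C Z Y \<and> w \<cdot>\<^bsub>C\<^esub> u = u' \<and> (\<forall>j \<in> J. w \<cdot>\<^bsub>C\<^esub> e j = e' j)"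
  using assms unfolding mpush_def by blast

lemma mpush_empty_iso:
  assumes cat: "category C" and i: "iso_ar C W Z u"
  shows "mpush C W {} al g Z u e"
proof (rule mpushI)
  obtain k where u: "u \<in> hom C W Z" and k: "k \<in> hom C Z W" "k \<cdot>\<^bsub>C\<^esub> u = Idt C W" "u \<cdot>\<^bsub>C\<^esub> k = Idt C Z"
    using i unfolding iso_ar_def by blast
  show "mcone C W {} al g Z u e" by (rule mconeI[OF u]) auto
  show "\<exists>w. w \<in> hom C Z Y \<and> w \<cdot>\<^bsub>C\<^esub> u = u' \<and> (\<forall>j \<in> {}. w \<cdot>\<^bsub>C\<^esub> e j = e' j)"
    if m: "mcone C W {} al g Y u' e'" for Y u' e'
    using comp_hom[OF cat k(1) mconeD(1)[OF m]] comp_assoc[OF cat u k(1) mconeD(1)[OF m]] k(2)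
      id_right[OF cat mconeD(1)[OF m]] by (intro exI[of _ "u' \<cdot>\<^bsub>C\<^esub> k"]) simp
  show "x = y" if x: "x \<in> hom C Z Y" and y: "y \<in> hom C Z Y" and e: "x \<cdot>\<^bsub>C\<^esub> u = y \<cdot>\<^bsub>C\<^esub> u" for x y Y
  proof -
    have "v = (v \<cdot>\<^bsub>C\<^esub> u) \<cdot>\<^bsub>C\<^esub> k" if v: "v \<in> hom C Z Y" for v
      unfolding comp_assoc[OF cat k(1) u v] k(3) by (rule id_right[OF cat v, symmetric])
    from this[OF x] this[OF y] e show ?thesis by metis
  qed
qed

lemma mpush_empty_is_iso:
  assumes cat: "category C" and W: "W \<in> Ob C" and mp: "mpush C W {} al g Z u e"
  shows "iso_ar C W Z u"
proof -
  have wf: "mwf C W {} al g" using W by (simp add: mwf_def)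
  have "mpush C W {} al g W (Idt C W) e" by (rule mpush_empty_iso[OF cat iso_id[OF cat W]])
  then obtain i where "iso_ar C W Z i" "i \<cdot>\<^bsub>C\<^esub> Idt C W = u" using mpush_iso[OF cat wf _ mp] by blast
  then show ?thesis using id_right[OF cat iso_hom] by simp
qed

locale cellular_cat = universe U for U :: "'u rel" +
  fixes C :: "('o, 'm) cat" and B :: "('i, 'm) family"
  assumes cat: "category C" and rc: "relcoc U C" and fam: "is_family U C B"
begin

definition "Cel = cc U C (csteps U C B)"

text \<open>An isomorphism attaches the empty family. Cellularity is therefore insensitive to the
  choice of pushouts, colimits and adjoints.\<close>

lemma iso_csteps:
  assumes "iso_ar C X Y f" shows "f \<in> csteps U C B"
proof (rule cstepsI[where J = "{}" and W = X and Z = Y])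
  show "small U {}" by (rule small_finite) simp
  show "mwf C X {} (\<lambda>j. mor B (s j)) g" for s :: "'u \<Rightarrow> 'i" and g
    using hom_dom[OF cat iso_hom[OF assms]] by (simp add: mwf_def)
  show "mpush C X {} (\<lambda>j. mor B (s j)) g Y f e" for s :: "'u \<Rightarrow> 'i" and g e
    by (rule mpush_empty_iso[OF cat assms])
qed simp

lemma id_csteps: "X \<in> Ob C \<Longrightarrow> Idt C X \<in> csteps U C B"
  by (rule iso_csteps[OF iso_id[OF cat]])

lemma cc_Cel: "cc U C Cel \<subseteq> Cel"
  unfolding Cel_def by (rule cc_cc[OF cat id_csteps])

lemma csteps_Cel: "f \<in> csteps U C B \<Longrightarrow> f \<in> Cel"
proof -
  assume f: "f \<in> csteps U C B"
  then obtain J :: "'u set" and s W g Z e where "small U J \<and> s ` J \<subseteq> Idx B \<and>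
     mwf C W J (\<lambda>j. mor B (s j)) g \<and> mpush C W J (\<lambda>j. mor B (s j)) g Z f e"
    unfolding csteps_def mem_Collect_eq by (elim exE) (rule that)
  then have mp: "mpush C W J (\<lambda>j. mor B (s j)) g Z f e" by (elim conjE)
  note fh = mpushD(1)[OF mp]
  show ?thesis unfolding Cel_def by (rule cc_base[OF cat f fh id_csteps[OF hom_cod[OF cat fh]]])
qed

lemma iso_Cel: "iso_ar C X Y f \<Longrightarrow> f \<in> Cel"
  by (rule csteps_Cel[OF iso_csteps])

lemma comp_Cel:
  assumes "f \<in> Cel" "g \<in> Cel" "f \<in> hom C X Y" "g \<in> hom C Y W"
  shows "g \<cdot>\<^bsub>C\<^esub> f \<in> Cel"
  using cc_two[OF cat assms(3,4,1,2)] iso_Cel[OF iso_id[OF cat hom_cod[OF cat assms(4)]]] cc_Cel by blast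

text \<open>Connects the definition with the description by chains; closure properties are proved
  for \<open>Cel\<close> and transferred by this equation.\<close>

lemma Cell_Cel: "Cell U C B = Cel"
proof
  have 1: "pushouts C (small_coproducts U C B) \<subseteq> csteps U C B" by (rule pushouts_csteps[OF cat fam])
  have 2: "csteps U C B \<subseteq> pushouts C (small_coproducts U C B)" by (rule csteps_pushouts[OF cat fam rc])
  have eq: "pushouts C (small_coproducts U C B) = csteps U C B" using 1 2 by (rule equalityI)
  show "Cell U C B \<subseteq> Cel" unfolding Cell_def eq Cel_def
    by (rule transfinite_composites_cc[OF cat iso_csteps])
  show "Cel \<subseteq> Cell U C B" unfolding Cell_def eq Cel_def by (rule cc_transfinite_composites[OF cat])
qed

lemma transfinite_Cel: "transfinite_composites U C Cel \<subseteq> Cel"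
  by (rule subset_trans[OF transfinite_composites_cc[OF cat iso_Cel] cc_Cel])

lemma po_exists:
  assumes "f \<in> hom C A A'" "g \<in> hom C A W"
  obtains Z q p where "po C f g W Z q p"
proof -
  have "mwf C W {()} (\<lambda>_. f) (\<lambda>_. g)" using assms hom_cod[OF cat assms(2)] by (auto simp: mwf_def hom_def)
  then obtain Z u e where m: "mpush C W {()} (\<lambda>_. f) (\<lambda>_. g) Z u e"
    using mpush_exists[OF rc cat small_finite] by blast
  have "e = (\<lambda>_. e ())" by (rule ext) simp
  then show ?thesis using m that by metis
qed

text \<open>Pasting of pushouts: generators attached to \<open>A\<close> by \<open>g0\<close> are
  attached to \<open>W\<close> by the composites of \<open>g0\<close> with \<open>g\<close>.\<close>

lemma po_pushout_csteps:
  assumes f: "f \<in> csteps U C B" and fh: "f \<in> hom C A A'" and g: "g \<in> hom C A W" and p: "po C f g W Z q p"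
  shows "q \<in> csteps U C B"
proof -
  obtain J :: "'u set" and s W0 g0 Z0 e0 where "small U J \<and> s ` J \<subseteq> Idx B \<and>
     mwf C W0 J (\<lambda>j. mor B (s j)) g0 \<and> mpush C W0 J (\<lambda>j. mor B (s j)) g0 Z0 f e0"
    using f unfolding csteps_def mem_Collect_eq by (elim exE) (rule that)
  then have J: "small U J" "s ` J \<subseteq> Idx B" and wf0: "mwf C W0 J (\<lambda>j. mor B (s j)) g0"
    and mp0: "mpush C W0 J (\<lambda>j. mor B (s j)) g0 Z0 f e0" by auto
  define m where "m j = mor B (s j)" for j
  note wf0 = wf0[folded m_def] and mp0 = mp0[folded m_def]
  have WZ: "W0 = A" "Z0 = A'" using mpushD(1)[OF mp0] fh by (auto simp: hom_def)
  note wf = wf0[unfolded WZ] and mp = mp0[unfolded WZ]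
  note wfD = mwfD[OF wf] and mpD = mpushD[OF mp]
  have wfp: "mwf C W {()} (\<lambda>_. f) (\<lambda>_. g)" using fh g hom_cod[OF cat g] by (auto simp: mwf_def hom_def)
  have pD: "q \<in> hom C W Z" "p \<in> hom C A' Z" "p \<cdot>\<^bsub>C\<^esub> f = q \<cdot>\<^bsub>C\<^esub> g"
    using mpushD[OF p] fh by (auto simp: hom_def)
  have wfW: "mwf C W J m (\<lambda>j. g \<cdot>\<^bsub>C\<^esub> g0 j)"
    using wfD comp_hom[OF cat wfD(3) g] hom_cod[OF cat g] by (auto simp: mwf_def hom_def)
  have "mpush C W J m (\<lambda>j. g \<cdot>\<^bsub>C\<^esub> g0 j) Z q (\<lambda>j. p \<cdot>\<^bsub>C\<^esub> e0 j)"
  proof (rule mpushI)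
    show "mcone C W J m (\<lambda>j. g \<cdot>\<^bsub>C\<^esub> g0 j) Z q (\<lambda>j. p \<cdot>\<^bsub>C\<^esub> e0 j)"
    proof (rule mconeI[OF pD(1)])
      fix j assume j: "j \<in> J"
      show "p \<cdot>\<^bsub>C\<^esub> e0 j \<in> hom C (Cod C (m j)) Z" by (rule comp_hom[OF cat mpD(2)[OF j] pD(2)])
      show "(p \<cdot>\<^bsub>C\<^esub> e0 j) \<cdot>\<^bsub>C\<^esub> m j = q \<cdot>\<^bsub>C\<^esub> (g \<cdot>\<^bsub>C\<^esub> g0 j)"
        using comp_assoc[OF cat wfD(2)[OF j] mpD(2)[OF j] pD(2)] comp_assoc[OF cat wfD(3)[OF j] fh pD(2)]
          comp_assoc[OF cat wfD(3)[OF j] g pD(1)] mpD(3)[OF j] pD(3) by simp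
    qed
  next
    fix Y u' e' assume "mcone C W J m (\<lambda>j. g \<cdot>\<^bsub>C\<^esub> g0 j) Y u' e'"
    note D = mconeD[OF this]
    have "mcone C A J m g0 Y (u' \<cdot>\<^bsub>C\<^esub> g) e'"
      using comp_hom[OF cat g D(1)] D(2,3) comp_assoc[OF cat wfD(3) g D(1)] by (auto simp: mcone_def)
    then obtain y where y: "y \<in> hom C A' Y" "y \<cdot>\<^bsub>C\<^esub> f = u' \<cdot>\<^bsub>C\<^esub> g" "\<And>j. j \<in> J \<Longrightarrow> y \<cdot>\<^bsub>C\<^esub> e0 j = e' j"
      using mpush_factor[OF mp] by blast
    have "y \<in> hom C (Cod C f) Y" using y fh by (simp add: hom_def)
    then obtain w where w: "w \<in> hom C Z Y" "w \<cdot>\<^bsub>C\<^esub> q = u'" "w \<cdot>\<^bsub>C\<^esub> p = y"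
      using po_factor[OF p D(1) _ y(2)] by metis
    have "w \<cdot>\<^bsub>C\<^esub> (p \<cdot>\<^bsub>C\<^esub> e0 j) = e' j" if "j \<in> J" for j
      using comp_assoc[OF cat mpD(2)[OF that] pD(2) w(1)] y(3)[OF that] w(3) by simp
    then show "\<exists>w. w \<in> hom C Z Y \<and> w \<cdot>\<^bsub>C\<^esub> q = u' \<and> (\<forall>j \<in> J. w \<cdot>\<^bsub>C\<^esub> (p \<cdot>\<^bsub>C\<^esub> e0 j) = e' j)" using w by blast
  next
    fix Y x y assume x: "x \<in> hom C Z Y" and y: "y \<in> hom C Z Y" and q: "x \<cdot>\<^bsub>C\<^esub> q = y \<cdot>\<^bsub>C\<^esub> q"
      and e: "\<And>j. j \<in> J \<Longrightarrow> x \<cdot>\<^bsub>C\<^esub> (p \<cdot>\<^bsub>C\<^esub> e0 j) = y \<cdot>\<^bsub>C\<^esub> (p \<cdot>\<^bsub>C\<^esub> e0 j)"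
    have "x \<cdot>\<^bsub>C\<^esub> p = y \<cdot>\<^bsub>C\<^esub> p"
    proof (rule mpush_eq[OF cat wf mp comp_hom[OF cat pD(2) x] comp_hom[OF cat pD(2) y]])
      show "(x \<cdot>\<^bsub>C\<^esub> p) \<cdot>\<^bsub>C\<^esub> f = (y \<cdot>\<^bsub>C\<^esub> p) \<cdot>\<^bsub>C\<^esub> f"
        using comp_assoc[OF cat fh pD(2) x] comp_assoc[OF cat fh pD(2) y] comp_assoc[OF cat g pD(1) x]
          comp_assoc[OF cat g pD(1) y] q pD(3) by simp
      fix j assume j: "j \<in> J"
      show "(x \<cdot>\<^bsub>C\<^esub> p) \<cdot>\<^bsub>C\<^esub> e0 j = (y \<cdot>\<^bsub>C\<^esub> p) \<cdot>\<^bsub>C\<^esub> e0 j"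
        using comp_assoc[OF cat mpD(2)[OF j] pD(2) x] comp_assoc[OF cat mpD(2)[OF j] pD(2) y] e[OF j] by simp
    qed
    then show "x = y" using mpush_eq[OF cat wfp p x y q] by simp
  qed
  then show ?thesis using cstepsI[OF J, of C W "\<lambda>j. g \<cdot>\<^bsub>C\<^esub> g0 j" Z q "\<lambda>j. p \<cdot>\<^bsub>C\<^esub> e0 j"] wfW unfolding m_def by blast
qed

text \<open>The pushouts of the initial segments of a chain form a chain.\<close>

lemma po_Cel:
  assumes f: "f \<in> Cel" and fh: "f \<in> hom C A A'" and g: "g \<in> hom C A W" and p: "po C f g W Z q p"
  shows "q \<in> Cel"
proof -
  obtain r :: "'u rel" and X h z t where "small U (Field r) \<and> cchain C (csteps U C B) r X h z t \<and> f = h z t"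
    using f unfolding Cel_def cc_def mem_Collect_eq by (elim exE) (rule that)
  then have sm: "small U (Field r)" and ch: "cchain C (csteps U C B) r X h z t" and fe: "f = h z t" by auto
  note D = cchainD[OF ch]
  have Xzt: "X z = A" "X t = A'"
    using cchain_composite_hom[OF ch] fh unfolding fe by (auto simp: hom_def)
  let ?F = "Field r"
  have hz: "h z a \<in> hom C A (X a)" if "a \<in> ?F" for a
    using pdiag_hom[OF D(6) D(4)[OF that] D(2) that] Xzt by simp
  have hh: "h a b \<in> hom C (X a) (X b)" if "(a, b) \<in> r" for a b
    using pdiag_hom[OF D(6) that] that by (auto simp: Field_def)
  have hc: "h b c \<cdot>\<^bsub>C\<^esub> h a b = h a c" if "(a, b) \<in> r" "(b, c) \<in> r" for a b c
    using pdiag_comp[OF D(6) that] that by (auto simp: Field_def)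
  have rF: "a \<in> ?F" "b \<in> ?F" if "(a, b) \<in> r" for a b using that by (auto simp: Field_def)
  \<comment> \<open>Every initial composite \<open>h z a\<close> is pushed out along the same
    \<open>g\<close>; the universal properties supply the connecting morphisms
    \<open>H\<close>.\<close>
  have "\<exists>P w v. po C (h z a) g W P w v" if "a \<in> ?F" for a
    using po_exists[OF hz[OF that] g] by metis
  then obtain P w v where P: "\<And>a. a \<in> ?F \<Longrightarrow> po C (h z a) g W (P a) (w a) (v a)" by metis
  have w: "w a \<in> hom C W (P a)" and v: "v a \<in> hom C (X a) (P a)" and vw: "v a \<cdot>\<^bsub>C\<^esub> h z a = w a \<cdot>\<^bsub>C\<^esub> g"
    if "a \<in> ?F" for a using mpushD[OF P[OF that]] hz[OF that] by (auto simp: hom_def)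
  have wf: "mwf C W {()} (\<lambda>_. h z a) (\<lambda>_. g)" if "a \<in> ?F" for a
    using hz[OF that] g hom_cod[OF cat g] by (auto simp: mwf_def hom_def)
  have fac: "\<exists>k. k \<in> hom C (P a) Y \<and> k \<cdot>\<^bsub>C\<^esub> w a = x \<and> k \<cdot>\<^bsub>C\<^esub> v a = y"
    if aF: "a \<in> ?F" and "x \<in> hom C W Y" "y \<in> hom C (X a) Y" "y \<cdot>\<^bsub>C\<^esub> h z a = x \<cdot>\<^bsub>C\<^esub> g" for a x y Y
  proof -
    have "y \<in> hom C (Cod C (h z a)) Y" using that hz[OF aF] by (simp add: hom_def)
    from po_factor[OF P[OF aF] that(2) this that(4)] show ?thesis by metis
  qed
  have eqI: "x = y" if "a \<in> ?F" "x \<in> hom C (P a) Y" "y \<in> hom C (P a) Y" "x \<cdot>\<^bsub>C\<^esub> w a = y \<cdot>\<^bsub>C\<^esub> w a"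
      "x \<cdot>\<^bsub>C\<^esub> v a = y \<cdot>\<^bsub>C\<^esub> v a" for a x y Y
    by (rule mpush_eq[OF cat wf[OF that(1)] P[OF that(1)] that(2-4)]) (use that in auto)
  have "\<exists>k. k \<in> hom C (P a) (P b) \<and> k \<cdot>\<^bsub>C\<^esub> w a = w b \<and> k \<cdot>\<^bsub>C\<^esub> v a = v b \<cdot>\<^bsub>C\<^esub> h a b" if ab: "(a, b) \<in> r" for a b
  proof (rule fac[OF rF(1)[OF ab] w[OF rF(2)[OF ab]] comp_hom[OF cat hh[OF ab] v[OF rF(2)[OF ab]]]])
    have "(v b \<cdot>\<^bsub>C\<^esub> h a b) \<cdot>\<^bsub>C\<^esub> h z a = v b \<cdot>\<^bsub>C\<^esub> h z b"
      using comp_assoc[OF cat hz[OF rF(1)[OF ab]] hh[OF ab] v[OF rF(2)[OF ab]]] hc[OF D(4)[OF rF(1)[OF ab]] ab] by simp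
    then show "(v b \<cdot>\<^bsub>C\<^esub> h a b) \<cdot>\<^bsub>C\<^esub> h z a = w b \<cdot>\<^bsub>C\<^esub> g" using vw[OF rF(2)[OF ab]] by simp
  qed
  then obtain H where Hs: "\<And>a b. (a, b) \<in> r \<Longrightarrow> H a b \<in> hom C (P a) (P b) \<and> H a b \<cdot>\<^bsub>C\<^esub> w a = w b \<and> H a b \<cdot>\<^bsub>C\<^esub> v a = v b \<cdot>\<^bsub>C\<^esub> h a b"
    by metis
  have H: "H a b \<in> hom C (P a) (P b)" "H a b \<cdot>\<^bsub>C\<^esub> w a = w b" "H a b \<cdot>\<^bsub>C\<^esub> v a = v b \<cdot>\<^bsub>C\<^esub> h a b" if "(a, b) \<in> r" for a b
    using Hs[OF that] by auto
  have pd: "pdiag C ?F r P H"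
    unfolding pdiag_def
  proof (intro conjI ballI impI)
    fix a assume a: "a \<in> ?F"
    note aa = Well_order_facts(1)[OF D(1) a]
    show PO: "P a \<in> Ob C" by (rule hom_cod[OF cat w[OF a]])
    show "H a a = Idt C (P a)"
      by (rule eqI[OF a H(1)[OF aa] id_hom[OF cat PO]])
        (use H[OF aa] id_left[OF cat w[OF a]] id_left[OF cat v[OF a]] id_right[OF cat v[OF a]] pdiag_id[OF D(6) a] in auto)
    fix b assume b: "b \<in> ?F"
    show "H a b \<in> hom C (P a) (P b)" if "(a, b) \<in> r" by (rule H(1)[OF that])
    fix c assume c: "c \<in> ?F"
    show "H b c \<cdot>\<^bsub>C\<^esub> H a b = H a c" if ab: "(a, b) \<in> r" and bc: "(b, c) \<in> r"
    proof (rule eqI[OF a comp_hom[OF cat H(1)[OF ab] H(1)[OF bc]]])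
      note ac = Well_order_facts(3)[OF D(1) ab bc]
      show "H a c \<in> hom C (P a) (P c)" by (rule H(1)[OF ac])
      show "(H b c \<cdot>\<^bsub>C\<^esub> H a b) \<cdot>\<^bsub>C\<^esub> w a = H a c \<cdot>\<^bsub>C\<^esub> w a"
        using comp_assoc[OF cat w[OF a] H(1)[OF ab] H(1)[OF bc]] H(2)[OF ab] H(2)[OF bc] H(2)[OF ac] by simp
      have "(H b c \<cdot>\<^bsub>C\<^esub> H a b) \<cdot>\<^bsub>C\<^esub> v a = H b c \<cdot>\<^bsub>C\<^esub> (v b \<cdot>\<^bsub>C\<^esub> h a b)"
        using comp_assoc[OF cat v[OF a] H(1)[OF ab] H(1)[OF bc]] H(3)[OF ab] by simp
      also have "\<dots> = v c \<cdot>\<^bsub>C\<^esub> (h b c \<cdot>\<^bsub>C\<^esub> h a b)"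
        using comp_assoc[OF cat hh[OF ab] v[OF b] H(1)[OF bc]] H(3)[OF bc] comp_assoc[OF cat hh[OF ab] hh[OF bc] v[OF c]] by simp
      finally show "(H b c \<cdot>\<^bsub>C\<^esub> H a b) \<cdot>\<^bsub>C\<^esub> v a = H a c \<cdot>\<^bsub>C\<^esub> v a" using hc[OF ab bc] H(3)[OF ac] by simp
    qed
  qed
  have step: "H a b \<in> csteps U C B" if co: "covers r a b" for a b
  proof (rule po_pushout_csteps[OF D(7)[OF co]])
    have ab: "(a, b) \<in> r" using co by (simp add: covers_def)
    have a: "a \<in> ?F" and b: "b \<in> ?F" using rF[OF ab] .
    show "h a b \<in> hom C (X a) (X b)" by (rule hh[OF ab])
    show "v a \<in> hom C (X a) (P a)" by (rule v[OF a])
    \<comment> \<open>Cancellation for pushouts: the squares over \<open>h z a\<close> and over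
      \<open>h z b\<close> are pushouts, hence so is the square over \<open>h a b\<close> between
      them.\<close>
    show "po C (h a b) (v a) (P a) (P b) (H a b) (v b)"
    proof (rule mpushI)
      show "mcone C (P a) {()} (\<lambda>_. h a b) (\<lambda>_. v a) (P b) (H a b) (\<lambda>_. v b)"
        using H[OF ab] v[OF b] hh[OF ab] by (auto simp: mcone_def hom_def)
    next
      fix Y u' e' assume "mcone C (P a) {()} (\<lambda>_. h a b) (\<lambda>_. v a) Y u' e'"
      then have u': "u' \<in> hom C (P a) Y" and e': "e' () \<in> hom C (X b) Y" "e' () \<cdot>\<^bsub>C\<^esub> h a b = u' \<cdot>\<^bsub>C\<^esub> v a"
        using hh[OF ab] by (auto simp: mcone_def hom_def)
      have "e' () \<cdot>\<^bsub>C\<^esub> h z b = (u' \<cdot>\<^bsub>C\<^esub> v a) \<cdot>\<^bsub>C\<^esub> h z a"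
        using hc[OF D(4)[OF a] ab] comp_assoc[OF cat hz[OF a] hh[OF ab] e'(1)] e'(2) by simp
      also have "\<dots> = (u' \<cdot>\<^bsub>C\<^esub> w a) \<cdot>\<^bsub>C\<^esub> g"
        using comp_assoc[OF cat hz[OF a] v[OF a] u'] comp_assoc[OF cat g w[OF a] u'] vw[OF a] by simp
      finally obtain k where k: "k \<in> hom C (P b) Y" "k \<cdot>\<^bsub>C\<^esub> w b = u' \<cdot>\<^bsub>C\<^esub> w a" "k \<cdot>\<^bsub>C\<^esub> v b = e' ()"
        using fac[OF b comp_hom[OF cat w[OF a] u'] e'(1)] by blast
      have "k \<cdot>\<^bsub>C\<^esub> H a b = u'"
      proof (rule eqI[OF a comp_hom[OF cat H(1)[OF ab] k(1)] u'])
        show "(k \<cdot>\<^bsub>C\<^esub> H a b) \<cdot>\<^bsub>C\<^esub> w a = u' \<cdot>\<^bsub>C\<^esub> w a"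
          using comp_assoc[OF cat w[OF a] H(1)[OF ab] k(1)] H(2)[OF ab] k(2) by simp
        show "(k \<cdot>\<^bsub>C\<^esub> H a b) \<cdot>\<^bsub>C\<^esub> v a = u' \<cdot>\<^bsub>C\<^esub> v a"
          using comp_assoc[OF cat v[OF a] H(1)[OF ab] k(1)] comp_assoc[OF cat hh[OF ab] v[OF b] k(1)] H(3)[OF ab] k(3) e'(2) by simp
      qed
      then show "\<exists>k. k \<in> hom C (P b) Y \<and> k \<cdot>\<^bsub>C\<^esub> H a b = u' \<and> (\<forall>j \<in> {()}. k \<cdot>\<^bsub>C\<^esub> v b = e' j)" using k by auto
    next
      fix Y x y assume x: "x \<in> hom C (P b) Y" and y: "y \<in> hom C (P b) Y" and e: "x \<cdot>\<^bsub>C\<^esub> H a b = y \<cdot>\<^bsub>C\<^esub> H a b"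
        and e2: "\<And>j. j \<in> {()} \<Longrightarrow> x \<cdot>\<^bsub>C\<^esub> v b = y \<cdot>\<^bsub>C\<^esub> v b"
      show "x = y"
      proof (rule eqI[OF b x y])
        show "x \<cdot>\<^bsub>C\<^esub> w b = y \<cdot>\<^bsub>C\<^esub> w b"
          using comp_assoc[OF cat w[OF a] H(1)[OF ab] x] comp_assoc[OF cat w[OF a] H(1)[OF ab] y] H(2)[OF ab] e by simp
        show "x \<cdot>\<^bsub>C\<^esub> v b = y \<cdot>\<^bsub>C\<^esub> v b" using e2 by blast
      qed
    qed
  qed
  have lim: "pcolim C (underS r a) r P H (P a) (\<lambda>b. H b a)"
    if a: "a \<in> ?F" and az: "a \<noteq> z" and n: "\<nexists>b. covers r b a" for a
  proof -
    have pc: "pcolim C (underS r a) r X h (X a) (\<lambda>b. h b a)" by (rule D(8)[OF a az n])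
    have pdu: "pdiag C (underS r a) r X h" by (rule pdiag_subset[OF D(6) underS_Field])
    have u: "(b, a) \<in> r" "b \<in> ?F" if "b \<in> underS r a" for b using that by (auto simp: underS_def Field_def)
    have zu: "z \<in> underS r a" using D(4)[OF a] az by (auto simp: underS_def)
    show ?thesis
      unfolding pcolim_def
    proof (intro conjI allI impI)
      show "pcone C (underS r a) r P H (P a) (\<lambda>b. H b a)"
        unfolding pcone_def
      proof (intro conjI ballI impI)
        show "P a \<in> Ob C" by (rule hom_cod[OF cat w[OF a]])
        show "H b a \<in> hom C (P b) (P a)" if "b \<in> underS r a" for b by (rule H(1)[OF u(1)[OF that]])
        show "H c a \<cdot>\<^bsub>C\<^esub> H b c = H b a" if "b \<in> underS r a" "c \<in> underS r a" "(b, c) \<in> r" for b c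
          by (rule pdiag_comp[OF pd that(3) u(1)[OF that(2)] u(2)[OF that(1)] u(2)[OF that(2)] a])
      qed
      fix Y d assume "pcone C (underS r a) r P H Y d"
      then have YO: "Y \<in> Ob C" and d: "\<And>b. b \<in> underS r a \<Longrightarrow> d b \<in> hom C (P b) Y"
        and dd: "\<And>b c. b \<in> underS r a \<Longrightarrow> c \<in> underS r a \<Longrightarrow> (b, c) \<in> r \<Longrightarrow> d c \<cdot>\<^bsub>C\<^esub> H b c = d b"
        unfolding pcone_def by blast+
      \<comment> \<open>A cocone on the pushouts \<open>P b\<close> consists of a cocone on the
        \<open>X b\<close> and one compatible morphism from \<open>W\<close>. The first part factors
        through \<open>X a\<close>, and the pushout \<open>P a\<close> joins the two.\<close>
      have "pcone C (underS r a) r X h Y (\<lambda>b. d b \<cdot>\<^bsub>C\<^esub> v b)"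
        unfolding pcone_def
      proof (intro conjI ballI impI YO)
        show "d b \<cdot>\<^bsub>C\<^esub> v b \<in> hom C (X b) Y" if "b \<in> underS r a" for b
          by (rule comp_hom[OF cat v[OF u(2)[OF that]] d[OF that]])
        show "(d c \<cdot>\<^bsub>C\<^esub> v c) \<cdot>\<^bsub>C\<^esub> h b c = d b \<cdot>\<^bsub>C\<^esub> v b" if b: "b \<in> underS r a" and c: "c \<in> underS r a" and bc: "(b, c) \<in> r" for b c
          using comp_assoc[OF cat hh[OF bc] v[OF u(2)[OF c]] d[OF c]] H(3)[OF bc]
            comp_assoc[OF cat v[OF u(2)[OF b]] H(1)[OF bc] d[OF c]] dd[OF b c bc] by simp
      qed
      then obtain y where y: "y \<in> hom C (X a) Y" "\<And>b. b \<in> underS r a \<Longrightarrow> y \<cdot>\<^bsub>C\<^esub> h b a = d b \<cdot>\<^bsub>C\<^esub> v b"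
        using pcolim_factor[OF pc] by blast
      have zF: "z \<in> ?F" by (rule D(2))
      have "y \<cdot>\<^bsub>C\<^esub> h z a = (d z \<cdot>\<^bsub>C\<^esub> v z) \<cdot>\<^bsub>C\<^esub> h z z"
        using y(2)[OF zu] pdiag_id[OF D(6) zF] id_right[OF cat comp_hom[OF cat v[OF zF] d[OF zu]]] by simp
      also have "\<dots> = (d z \<cdot>\<^bsub>C\<^esub> w z) \<cdot>\<^bsub>C\<^esub> g"
        using comp_assoc[OF cat hz[OF zF] _ d[OF zu], of "v z"] v[OF zF] comp_assoc[OF cat g w[OF zF] d[OF zu]] vw[OF zF] by (simp add: Xzt)
      finally obtain k where k: "k \<in> hom C (P a) Y" "k \<cdot>\<^bsub>C\<^esub> w a = d z \<cdot>\<^bsub>C\<^esub> w z" "k \<cdot>\<^bsub>C\<^esub> v a = y"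
        using fac[OF a comp_hom[OF cat w[OF zF] d[OF zu]] y(1)] by blast
      have kH: "k \<cdot>\<^bsub>C\<^esub> H b a = d b" if b: "b \<in> underS r a" for b
      proof (rule eqI[OF u(2)[OF b] comp_hom[OF cat H(1)[OF u(1)[OF b]] k(1)] d[OF b]])
        note bF = u(2)[OF b] and ba = u(1)[OF b]
        show "(k \<cdot>\<^bsub>C\<^esub> H b a) \<cdot>\<^bsub>C\<^esub> w b = d b \<cdot>\<^bsub>C\<^esub> w b"
          using comp_assoc[OF cat w[OF bF] H(1)[OF ba] k(1)] H(2)[OF ba] k(2)
            comp_assoc[OF cat w[OF zF] H(1)[OF D(4)[OF bF]] d[OF b]] H(2)[OF D(4)[OF bF]] dd[OF zu b D(4)[OF bF]] by simp
        show "(k \<cdot>\<^bsub>C\<^esub> H b a) \<cdot>\<^bsub>C\<^esub> v b = d b \<cdot>\<^bsub>C\<^esub> v b"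
          using comp_assoc[OF cat v[OF bF] H(1)[OF ba] k(1)] H(3)[OF ba] comp_assoc[OF cat hh[OF ba] v[OF a] k(1)] k(3) y(2)[OF b] by simp
      qed
      show "\<exists>!k. k \<in> hom C (P a) Y \<and> (\<forall>b \<in> underS r a. k \<cdot>\<^bsub>C\<^esub> H b a = d b)"
      proof (rule ex1I[of _ k])
        show "k \<in> hom C (P a) Y \<and> (\<forall>b \<in> underS r a. k \<cdot>\<^bsub>C\<^esub> H b a = d b)" using k(1) kH by blast
        fix l assume "l \<in> hom C (P a) Y \<and> (\<forall>b \<in> underS r a. l \<cdot>\<^bsub>C\<^esub> H b a = d b)"
        then have l: "l \<in> hom C (P a) Y" "\<And>b. b \<in> underS r a \<Longrightarrow> l \<cdot>\<^bsub>C\<^esub> H b a = d b" by auto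
        show "l = k"
        proof (rule eqI[OF a l(1) k(1)])
          show "l \<cdot>\<^bsub>C\<^esub> w a = k \<cdot>\<^bsub>C\<^esub> w a"
            using comp_assoc[OF cat w[OF zF] H(1)[OF D(4)[OF a]] l(1)] H(2)[OF D(4)[OF a]] l(2)[OF zu] k(2) by simp
          have "l \<cdot>\<^bsub>C\<^esub> v a = y"
          proof (rule pcolim_eq[OF cat pdu pc comp_hom[OF cat v[OF a] l(1)] y(1)])
            fix b assume b: "b \<in> underS r a"
            note bF = u(2)[OF b] and ba = u(1)[OF b]
            show "(l \<cdot>\<^bsub>C\<^esub> v a) \<cdot>\<^bsub>C\<^esub> h b a = y \<cdot>\<^bsub>C\<^esub> h b a"
              using comp_assoc[OF cat hh[OF ba] v[OF a] l(1)] comp_assoc[OF cat v[OF bF] H(1)[OF ba] l(1)] H(3)[OF ba] l(2)[OF b] y(2)[OF b] by simp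
          qed
          then show "l \<cdot>\<^bsub>C\<^esub> v a = k \<cdot>\<^bsub>C\<^esub> v a" using k(3) by simp
        qed
      qed
    qed
  qed
  have "cchain C (csteps U C B) r P H z t"
    unfolding cchain_def using D(1-5) pd step lim by blast
  then have HC: "H z t \<in> Cel" unfolding Cel_def by (rule cc_intro[OF cat sm])
  have zt: "(z, t) \<in> r" by (rule D(4)[OF D(3)])
  \<comment> \<open>The chain runs from \<open>P z\<close> to \<open>P t\<close>, which are only
    isomorphic to \<open>W\<close> and \<open>Z\<close>: \<open>P z\<close> is a pushout along an
    identity and \<open>P t\<close> is another pushout of \<open>f\<close>. Both ends are corrected
    by isomorphisms.\<close>
  obtain i where i: "iso_ar C (P t) Z i" "i \<cdot>\<^bsub>C\<^esub> w t = q"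
    by (rule mpush_iso[OF cat wf[OF D(3)] P[OF D(3)] p[unfolded fe]])
  have z1: "h z z = Idt C A" using pdiag_id[OF D(6,2)] Xzt by simp
  have WO: "W \<in> Ob C" by (rule hom_cod[OF cat g])
  obtain k where k: "k \<in> hom C (P z) W" "k \<cdot>\<^bsub>C\<^esub> w z = Idt C W" "k \<cdot>\<^bsub>C\<^esub> v z = g"
    using fac[OF D(2) id_hom[OF cat WO], of g] g z1 id_left[OF cat g] id_right[OF cat g] Xzt by auto
  have vz: "v z = w z \<cdot>\<^bsub>C\<^esub> g" using vw[OF D(2)] z1 id_right[OF cat v[OF D(2)]] Xzt by simp
  have PzO: "P z \<in> Ob C" by (rule hom_cod[OF cat w[OF D(2)]])
  have "w z \<cdot>\<^bsub>C\<^esub> k = Idt C (P z)"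
  proof (rule eqI[OF D(2) comp_hom[OF cat k(1) w[OF D(2)]] id_hom[OF cat PzO]])
    show "(w z \<cdot>\<^bsub>C\<^esub> k) \<cdot>\<^bsub>C\<^esub> w z = Idt C (P z) \<cdot>\<^bsub>C\<^esub> w z"
      using comp_assoc[OF cat w[OF D(2)] k(1) w[OF D(2)]] k(2) id_left[OF cat w[OF D(2)]] id_right[OF cat w[OF D(2)]] by simp
    show "(w z \<cdot>\<^bsub>C\<^esub> k) \<cdot>\<^bsub>C\<^esub> v z = Idt C (P z) \<cdot>\<^bsub>C\<^esub> v z"
      using comp_assoc[OF cat v[OF D(2)] k(1) w[OF D(2)]] k(3) vz id_left[OF cat v[OF D(2)]] by simp
  qed
  then have "iso_ar C W (P z) (w z)" by (intro iso_arI[OF w[OF D(2)] k(1) k(2)])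
  then have "H z t \<cdot>\<^bsub>C\<^esub> w z \<in> Cel" by (intro comp_Cel[OF iso_Cel HC w[OF D(2)] H(1)[OF zt]])
  then have "w t \<in> Cel" using H(2)[OF zt] by simp
  from comp_Cel[OF this iso_Cel[OF i(1)] w[OF D(3)] iso_hom[OF i(1)]] show ?thesis using i(2) by simp
qed

end

context cellular_cat
begin

lemma seq_Cel:
  assumes "\<And>n. u n \<in> hom C (X n) (X (Suc n))" "pcolim C UNIV nle X (nh C X u) Z c" "\<And>n. u n \<in> Cel"
  shows "c 0 \<in> Cel"
  using cc_seq[OF cat assms] cc_Cel by blast

text \<open>Well-order the family and push out one member at a time.\<close>

lemma mpush_Cel:
  fixes J :: "'j set"
  assumes sm: "small U J" and wf: "mwf C W J al g" and mp: "mpush C W J al g Z u e0" and al: "\<And>j. j \<in> J \<Longrightarrow> al j \<in> Cel"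
  shows "u \<in> Cel"
proof -
  note wfD = mwfD[OF wf]
  obtain r where "well_order_on J r" using well_order_on by blast
  then have wo: "Well_order r" and FJ: "Field r = J" using well_order_on_Well_order by blast+
  define r1 where "r1 = dir_image r Some"
  have wo1: "Well_order r1" unfolding r1_def by (rule Well_order_dir_image[OF wo]) simp
  have F1: "Field r1 = Some ` J" unfolding r1_def dir_image_Field FJ ..
  \<comment> \<open>The top element \<open>None\<close> indexes the finished pushout;
    \<open>Some j\<close> indexes the stage just before the member \<open>j\<close> is
    attached.\<close>
  define r' where "r' = r1 \<union> insert None (Field r1) \<times> {None}"
  have N: "None \<notin> Field r1" by (auto simp: F1)
  note wo' = Well_order_add_top(1)[OF wo1 N, folded r'_def]
  define A where "A = insert None (Some ` J)"
  have FA: "Field r' = A" using Well_order_add_top(2)[OF wo1 N, folded r'_def] by (simp add: A_def F1)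
  have top: "(x, None) \<in> r'" if "x \<in> A" for x using that by (auto simp: r'_def A_def F1)
  note o = Well_order_facts[OF wo', unfolded FA]
  have rA: "x \<in> A" "y \<in> A" if "(x, y) \<in> r'" for x y using that FA by (auto simp: Field_def)
  have SJ: "Some j \<in> A \<longleftrightarrow> j \<in> J" for j by (auto simp: A_def)
  have "A \<noteq> {}" "A \<subseteq> A" by (auto simp: A_def)
  then obtain z where zA: "z \<in> A" and zl: "\<And>x. x \<in> A \<Longrightarrow> (z, x) \<in> r'" using o(5)[of A] by blast
  \<comment> \<open>The members already attached at stage \<open>x\<close>, strictly before
    \<open>x\<close>. Strictness makes the first stage isomorphic to \<open>W\<close> and lets limit
    stages add nothing of their own.\<close>
  define Dn where "Dn x = {j. (Some j, x) \<in> r' \<and> Some j \<noteq> x}" for x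
  have DnJ: "Dn x \<subseteq> J" for x using rA(1) SJ unfolding Dn_def by blast
  have Dnm: "j \<in> Dn y" if "(x, y) \<in> r'" "j \<in> Dn x" for x y j
    using that o(3)[of "Some j" x y] o(2)[of x y] unfolding Dn_def by blast
  have Dnz: "Dn z = {}" using zl rA o(2) unfolding Dn_def by blast
  have DnN: "Dn None = J" using top SJ DnJ[of None] by (auto simp: Dn_def)
  have wfx: "mwf C W (Dn x) al g" for x using wf DnJ[of x] unfolding mwf_def by blast
  have "\<exists>P w e. mpush C W (Dn x) al g P w e" for x
    by (rule mpush_exists[OF rc cat small_subset[OF sm DnJ] wfx])
  then obtain P w e where P: "\<And>x. mpush C W (Dn x) al g (P x) (w x) (e x)" by metis
  note Pw = mpushD(1)[OF P] and Pe = mpushD(2)[OF P] and Pc = mpushD(3)[OF P]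
  have fac: "\<exists>k. k \<in> hom C (P x) Y \<and> k \<cdot>\<^bsub>C\<^esub> w x = u' \<and> (\<forall>j \<in> Dn x. k \<cdot>\<^bsub>C\<^esub> e x j = e' j)"
    if "u' \<in> hom C W Y" "\<And>j. j \<in> Dn x \<Longrightarrow> e' j \<in> hom C (Cod C (al j)) Y"
      "\<And>j. j \<in> Dn x \<Longrightarrow> e' j \<cdot>\<^bsub>C\<^esub> al j = u' \<cdot>\<^bsub>C\<^esub> g j" for x u' e' Y
  proof -
    have "mcone C W (Dn x) al g Y u' e'" by (rule mconeI[OF that])
    from mpush_unique[OF cat wfx P this] show ?thesis by blast
  qed
  have eqI: "k = l" if "k \<in> hom C (P x) Y" "l \<in> hom C (P x) Y" "k \<cdot>\<^bsub>C\<^esub> w x = l \<cdot>\<^bsub>C\<^esub> w x"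
      "\<And>j. j \<in> Dn x \<Longrightarrow> k \<cdot>\<^bsub>C\<^esub> e x j = l \<cdot>\<^bsub>C\<^esub> e x j" for x k l Y
    by (rule mpush_eq[OF cat wfx P that])
  have "\<exists>k. k \<in> hom C (P x) (P y) \<and> k \<cdot>\<^bsub>C\<^esub> w x = w y \<and> (\<forall>j \<in> Dn x. k \<cdot>\<^bsub>C\<^esub> e x j = e y j)" if xy: "(x, y) \<in> r'" for x y
    by (rule fac[OF Pw Pe[OF Dnm[OF xy]] Pc[OF Dnm[OF xy]]])
  then obtain H where Hs: "\<And>x y. (x, y) \<in> r' \<Longrightarrow> H x y \<in> hom C (P x) (P y) \<and> H x y \<cdot>\<^bsub>C\<^esub> w x = w y \<and> (\<forall>j \<in> Dn x. H x y \<cdot>\<^bsub>C\<^esub> e x j = e y j)"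
    by metis
  have H: "H x y \<in> hom C (P x) (P y)" "H x y \<cdot>\<^bsub>C\<^esub> w x = w y" "\<And>j. j \<in> Dn x \<Longrightarrow> H x y \<cdot>\<^bsub>C\<^esub> e x j = e y j" if "(x, y) \<in> r'" for x y
    using Hs[OF that] by auto
  have PO: "P x \<in> Ob C" for x by (rule hom_cod[OF cat Pw])
  have pd: "pdiag C A r' P H"
    unfolding pdiag_def
  proof (intro conjI ballI impI PO)
    fix a assume a: "a \<in> A"
    note aa = o(1)[OF a]
    show "H a a = Idt C (P a)"
      by (rule eqI[OF H(1)[OF aa] id_hom[OF cat PO]])
        (simp_all add: H(2,3)[OF aa] id_left[OF cat Pw] id_left[OF cat Pe])
    fix b assume b: "b \<in> A"
    show "H a b \<in> hom C (P a) (P b)" if "(a, b) \<in> r'" by (rule H(1)[OF that])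
    fix c assume c: "c \<in> A"
    show "H b c \<cdot>\<^bsub>C\<^esub> H a b = H a c" if ab: "(a, b) \<in> r'" and bc: "(b, c) \<in> r'"
    proof (rule eqI[OF comp_hom[OF cat H(1)[OF ab] H(1)[OF bc]]])
      note ac = o(3)[OF ab bc]
      show "H a c \<in> hom C (P a) (P c)" by (rule H(1)[OF ac])
      show "(H b c \<cdot>\<^bsub>C\<^esub> H a b) \<cdot>\<^bsub>C\<^esub> w a = H a c \<cdot>\<^bsub>C\<^esub> w a"
        using comp_assoc[OF cat Pw H(1)[OF ab] H(1)[OF bc]] H(2)[OF ab] H(2)[OF bc] H(2)[OF ac] by simp
      show "(H b c \<cdot>\<^bsub>C\<^esub> H a b) \<cdot>\<^bsub>C\<^esub> e a j = H a c \<cdot>\<^bsub>C\<^esub> e a j" if j: "j \<in> Dn a" for j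
        using comp_assoc[OF cat Pe[OF j] H(1)[OF ab] H(1)[OF bc]] H(3)[OF ab j] H(3)[OF bc Dnm[OF ab j]] H(3)[OF ac j] by simp
    qed
  qed
  have step: "H x y \<in> Cel" if co: "covers r' x y" for x y
  proof -
    have xy: "(x, y) \<in> r'" "x \<noteq> y" and bt: "\<And>c. (x, c) \<in> r' \<Longrightarrow> (c, y) \<in> r' \<Longrightarrow> c = x \<or> c = y"
      using co unfolding covers_def by blast+
    have "x \<noteq> None"
    proof
      assume "x = None"
      then show False using o(2)[OF xy(1)] top[OF rA(2)[OF xy(1)]] xy(2) by simp
    qed
    then obtain a where x: "x = Some a" by blast
    have aJ: "a \<in> J" using rA(1)[OF xy(1)] x SJ by blast
    have ay: "a \<in> Dn y" using xy x by (simp add: Dn_def)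
    have ax: "a \<notin> Dn x" by (simp add: Dn_def x)
    \<comment> \<open>Since \<open>y\<close> covers \<open>Some a\<close>, the members before
      \<open>y\<close> are those before \<open>x\<close> together with \<open>a\<close>: a covering
      step attaches exactly one member.\<close>
    have Dy: "j = a \<or> j \<in> Dn x" if j: "j \<in> Dn y" for j
    proof -
      have jy: "(Some j, y) \<in> r'" "Some j \<noteq> y" using j by (auto simp: Dn_def)
      consider "(Some j, x) \<in> r'" | "(x, Some j) \<in> r'"
        using o(4)[OF rA(1)[OF jy(1)] rA(1)[OF xy(1)]] by blast
      then show ?thesis
      proof cases
        case 1
        then show ?thesis using x by (auto simp: Dn_def)
      next
        case 2
        then show ?thesis using bt[OF 2 jy(1)] jy(2) x by blast
      qed
    qed
    have fh: "al a \<in> hom C (Dom C (al a)) (Cod C (al a))" by (rule wfD(2)[OF aJ])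
    have ga: "w x \<cdot>\<^bsub>C\<^esub> g a \<in> hom C (Dom C (al a)) (P x)" by (rule comp_hom[OF cat wfD(3)[OF aJ] Pw])
    have "po C (al a) (w x \<cdot>\<^bsub>C\<^esub> g a) (P x) (P y) (H x y) (e y a)"
    proof (rule mpushI)
      show "mcone C (P x) {()} (\<lambda>_. al a) (\<lambda>_. w x \<cdot>\<^bsub>C\<^esub> g a) (P y) (H x y) (\<lambda>_. e y a)"
        using H(1,2)[OF xy(1)] Pe[OF ay] Pc[OF ay] comp_assoc[OF cat wfD(3)[OF aJ] Pw H(1)[OF xy(1)]]
        by (simp add: mcone_def)
    next
      fix Y u' e' assume "mcone C (P x) {()} (\<lambda>_. al a) (\<lambda>_. w x \<cdot>\<^bsub>C\<^esub> g a) Y u' e'"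
      then have u': "u' \<in> hom C (P x) Y" and e': "e' () \<in> hom C (Cod C (al a)) Y"
        "e' () \<cdot>\<^bsub>C\<^esub> al a = u' \<cdot>\<^bsub>C\<^esub> (w x \<cdot>\<^bsub>C\<^esub> g a)" by (auto simp: mcone_def)
      define e'' where "e'' j = (if j = a then e' () else u' \<cdot>\<^bsub>C\<^esub> e x j)" for j
      have "e'' j \<in> hom C (Cod C (al j)) Y" "e'' j \<cdot>\<^bsub>C\<^esub> al j = (u' \<cdot>\<^bsub>C\<^esub> w x) \<cdot>\<^bsub>C\<^esub> g j" if j: "j \<in> Dn y" for j
      proof -
        note jJ = subsetD[OF DnJ j]
        show "e'' j \<in> hom C (Cod C (al j)) Y"
          using Dy[OF j] e' comp_hom[OF cat Pe u'] by (auto simp: e''_def)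
        show "e'' j \<cdot>\<^bsub>C\<^esub> al j = (u' \<cdot>\<^bsub>C\<^esub> w x) \<cdot>\<^bsub>C\<^esub> g j"
          using Dy[OF j] e' comp_assoc[OF cat wfD(2)[OF jJ] Pe u'] Pc[of j x] comp_assoc[OF cat wfD(3)[OF jJ] Pw u']
          by (auto simp: e''_def)
      qed
      then obtain k where k: "k \<in> hom C (P y) Y" "k \<cdot>\<^bsub>C\<^esub> w y = u' \<cdot>\<^bsub>C\<^esub> w x" "\<forall>j \<in> Dn y. k \<cdot>\<^bsub>C\<^esub> e y j = e'' j"
        using fac[OF comp_hom[OF cat Pw u'], of y e''] by metis
      have "k \<cdot>\<^bsub>C\<^esub> H x y = u'"
      proof (rule eqI[OF comp_hom[OF cat H(1)[OF xy(1)] k(1)] u'])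
        show "(k \<cdot>\<^bsub>C\<^esub> H x y) \<cdot>\<^bsub>C\<^esub> w x = u' \<cdot>\<^bsub>C\<^esub> w x"
          using comp_assoc[OF cat Pw H(1)[OF xy(1)] k(1)] H(2)[OF xy(1)] k(2) by simp
        fix j assume j: "j \<in> Dn x"
        then have "j \<noteq> a" using ax by blast
        then show "(k \<cdot>\<^bsub>C\<^esub> H x y) \<cdot>\<^bsub>C\<^esub> e x j = u' \<cdot>\<^bsub>C\<^esub> e x j"
          using comp_assoc[OF cat Pe[OF j] H(1)[OF xy(1)] k(1)] H(3)[OF xy(1) j] k(3) Dnm[OF xy(1) j] by (simp add: e''_def)
      qed
      moreover have "k \<cdot>\<^bsub>C\<^esub> e y a = e' ()" using k(3) ay by (simp add: e''_def)
      ultimately show "\<exists>k. k \<in> hom C (P y) Y \<and> k \<cdot>\<^bsub>C\<^esub> H x y = u' \<and> (\<forall>j \<in> {()}. k \<cdot>\<^bsub>C\<^esub> e y a = e' j)"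
        using k(1) by auto
    next
      fix Y k l assume k: "k \<in> hom C (P y) Y" and l: "l \<in> hom C (P y) Y" and kl: "k \<cdot>\<^bsub>C\<^esub> H x y = l \<cdot>\<^bsub>C\<^esub> H x y"
        and kl2: "\<And>j. j \<in> {()} \<Longrightarrow> k \<cdot>\<^bsub>C\<^esub> e y a = l \<cdot>\<^bsub>C\<^esub> e y a"
      show "k = l"
      proof (rule eqI[OF k l])
        show "k \<cdot>\<^bsub>C\<^esub> w y = l \<cdot>\<^bsub>C\<^esub> w y"
          using comp_assoc[OF cat Pw H(1)[OF xy(1)] k] comp_assoc[OF cat Pw H(1)[OF xy(1)] l] H(2)[OF xy(1)] kl by simp
        fix j assume "j \<in> Dn y"
        then consider "j = a" | "j \<in> Dn x" using Dy by blast
        then show "k \<cdot>\<^bsub>C\<^esub> e y j = l \<cdot>\<^bsub>C\<^esub> e y j"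
        proof cases
          case 1
          then show ?thesis using kl2 by blast
        next
          case 2
          then show ?thesis
            using comp_assoc[OF cat Pe[OF 2] H(1)[OF xy(1)] k] comp_assoc[OF cat Pe[OF 2] H(1)[OF xy(1)] l] H(3)[OF xy(1) 2] kl by simp
        qed
      qed
    qed
    from po_Cel[OF al[OF aJ] fh ga this] show ?thesis .
  qed
  have lim: "pcolim C (underS r' x) r' P H (P x) (\<lambda>b. H b x)"
    if x: "x \<in> A" and xz: "x \<noteq> z" and n: "\<nexists>b. covers r' b x" for x
  proof -
    have us: "(b, x) \<in> r'" "b \<in> A" if "b \<in> underS r' x" for b using that rA by (auto simp: underS_def)
    have zu: "z \<in> underS r' x" using zl[OF x] xz by (auto simp: underS_def)
    \<comment> \<open>At a limit every earlier member has been attached at some still earlier stage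
      \<open>s j\<close>, so \<open>P x\<close> brings in nothing new.\<close>
    have "\<exists>y. y \<in> underS r' x \<and> j \<in> Dn y" if j: "j \<in> Dn x" for j
    proof -
      have jx: "(Some j, x) \<in> r'" "Some j \<noteq> x" using j by (auto simp: Dn_def)
      have "\<not> covers r' (Some j) x" using n by blast
      then obtain y where "(Some j, y) \<in> r'" "(y, x) \<in> r'" "y \<noteq> Some j" "y \<noteq> x"
        using jx unfolding covers_def by blast
      then show ?thesis by (auto simp: underS_def Dn_def)
    qed
    then obtain s where s: "\<And>j. j \<in> Dn x \<Longrightarrow> s j \<in> underS r' x" "\<And>j. j \<in> Dn x \<Longrightarrow> j \<in> Dn (s j)" by metis
    show ?thesis
      unfolding pcolim_def
    proof (intro conjI allI impI)
      show "pcone C (underS r' x) r' P H (P x) (\<lambda>b. H b x)"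
        unfolding pcone_def
      proof (intro conjI ballI impI PO)
        show "H b x \<in> hom C (P b) (P x)" if "b \<in> underS r' x" for b by (rule H(1)[OF us(1)[OF that]])
        show "H c x \<cdot>\<^bsub>C\<^esub> H b c = H b x" if "b \<in> underS r' x" "c \<in> underS r' x" "(b, c) \<in> r'" for b c
          by (rule pdiag_comp[OF pd that(3) us(1)[OF that(2)] us(2)[OF that(1)] us(2)[OF that(2)] x])
      qed
      fix Y d assume "pcone C (underS r' x) r' P H Y d"
      then have YO: "Y \<in> Ob C" and d: "\<And>b. b \<in> underS r' x \<Longrightarrow> d b \<in> hom C (P b) Y"
        and dd: "\<And>b c. b \<in> underS r' x \<Longrightarrow> c \<in> underS r' x \<Longrightarrow> (b, c) \<in> r' \<Longrightarrow> d c \<cdot>\<^bsub>C\<^esub> H b c = d b"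
        unfolding pcone_def by blast+
      have dw: "d b \<cdot>\<^bsub>C\<^esub> w b = d z \<cdot>\<^bsub>C\<^esub> w z" if b: "b \<in> underS r' x" for b
        using comp_assoc[OF cat Pw H(1)[OF zl[OF us(2)[OF b]]] d[OF b]] H(2)[OF zl[OF us(2)[OF b]]]
          dd[OF zu b zl[OF us(2)[OF b]]] by simp
      have de': "d b \<cdot>\<^bsub>C\<^esub> e b j = d c \<cdot>\<^bsub>C\<^esub> e c j"
        if b: "b \<in> underS r' x" and c: "c \<in> underS r' x" and jb: "j \<in> Dn b" and jc: "j \<in> Dn c" and bc: "(b, c) \<in> r'" for b c j
        using comp_assoc[OF cat Pe[OF jb] H(1)[OF bc] d[OF c]] H(3)[OF bc jb] dd[OF b c bc] by simp
      have de: "d b \<cdot>\<^bsub>C\<^esub> e b j = d c \<cdot>\<^bsub>C\<^esub> e c j"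
        if b: "b \<in> underS r' x" and c: "c \<in> underS r' x" and jb: "j \<in> Dn b" and jc: "j \<in> Dn c" for b c j
        using o(4)[OF us(2)[OF b] us(2)[OF c]] de'[OF b c jb jc] de'[OF c b jc jb] by auto
      define e' where "e' j = d (s j) \<cdot>\<^bsub>C\<^esub> e (s j) j" for j
      have "e' j \<in> hom C (Cod C (al j)) Y" "e' j \<cdot>\<^bsub>C\<^esub> al j = (d z \<cdot>\<^bsub>C\<^esub> w z) \<cdot>\<^bsub>C\<^esub> g j" if j: "j \<in> Dn x" for j
      proof -
        note jJ = subsetD[OF DnJ j] and sj = s[OF j]
        show "e' j \<in> hom C (Cod C (al j)) Y" unfolding e'_def by (rule comp_hom[OF cat Pe[OF sj(2)] d[OF sj(1)]])
        have "e' j \<cdot>\<^bsub>C\<^esub> al j = (d (s j) \<cdot>\<^bsub>C\<^esub> w (s j)) \<cdot>\<^bsub>C\<^esub> g j"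
          using comp_assoc[OF cat wfD(2)[OF jJ] Pe[OF sj(2)] d[OF sj(1)]] Pc[OF sj(2)]
            comp_assoc[OF cat wfD(3)[OF jJ] Pw d[OF sj(1)]] by (simp add: e'_def)
        then show "e' j \<cdot>\<^bsub>C\<^esub> al j = (d z \<cdot>\<^bsub>C\<^esub> w z) \<cdot>\<^bsub>C\<^esub> g j" using dw[OF sj(1)] by simp
      qed
      then obtain k where k: "k \<in> hom C (P x) Y" "k \<cdot>\<^bsub>C\<^esub> w x = d z \<cdot>\<^bsub>C\<^esub> w z" "\<forall>j \<in> Dn x. k \<cdot>\<^bsub>C\<^esub> e x j = e' j"
        using fac[OF comp_hom[OF cat Pw d[OF zu]], of x e'] by metis
      have kH: "k \<cdot>\<^bsub>C\<^esub> H b x = d b" if b: "b \<in> underS r' x" for b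
      proof (rule eqI[OF comp_hom[OF cat H(1)[OF us(1)[OF b]] k(1)] d[OF b]])
        note bx = us(1)[OF b]
        show "(k \<cdot>\<^bsub>C\<^esub> H b x) \<cdot>\<^bsub>C\<^esub> w b = d b \<cdot>\<^bsub>C\<^esub> w b"
          using comp_assoc[OF cat Pw H(1)[OF bx] k(1)] H(2)[OF bx] k(2) dw[OF b] by simp
        fix j assume j: "j \<in> Dn b"
        note jx = Dnm[OF bx j]
        show "(k \<cdot>\<^bsub>C\<^esub> H b x) \<cdot>\<^bsub>C\<^esub> e b j = d b \<cdot>\<^bsub>C\<^esub> e b j"
          using comp_assoc[OF cat Pe[OF j] H(1)[OF bx] k(1)] H(3)[OF bx j] k(3) jx de[OF b s(1)[OF jx] j s(2)[OF jx]] by (simp add: e'_def)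
      qed
      show "\<exists>!k. k \<in> hom C (P x) Y \<and> (\<forall>b \<in> underS r' x. k \<cdot>\<^bsub>C\<^esub> H b x = d b)"
      proof (rule ex1I[of _ k])
        show "k \<in> hom C (P x) Y \<and> (\<forall>b \<in> underS r' x. k \<cdot>\<^bsub>C\<^esub> H b x = d b)" using k(1) kH by blast
        fix l assume "l \<in> hom C (P x) Y \<and> (\<forall>b \<in> underS r' x. l \<cdot>\<^bsub>C\<^esub> H b x = d b)"
        then have l: "l \<in> hom C (P x) Y" "\<And>b. b \<in> underS r' x \<Longrightarrow> l \<cdot>\<^bsub>C\<^esub> H b x = d b" by auto
        show "l = k"
        proof (rule eqI[OF l(1) k(1)])
          show "l \<cdot>\<^bsub>C\<^esub> w x = k \<cdot>\<^bsub>C\<^esub> w x"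
            using comp_assoc[OF cat Pw H(1)[OF zl[OF x]] l(1)] H(2)[OF zl[OF x]] l(2)[OF zu] k(2) by simp
          fix j assume j: "j \<in> Dn x"
          note sj = s[OF j] and sx = us(1)[OF s(1)[OF j]]
          show "l \<cdot>\<^bsub>C\<^esub> e x j = k \<cdot>\<^bsub>C\<^esub> e x j"
            using comp_assoc[OF cat Pe[OF sj(2)] H(1)[OF sx] l(1)] H(3)[OF sx sj(2)] l(2)[OF sj(1)] k(3) j by (simp add: e'_def)
        qed
      qed
    qed
  qed
  have NA: "None \<in> A" by (simp add: A_def)
  have "cchain C Cel r' P H z None"
    unfolding cchain_def FA
    using wo'[unfolded FA] zA NA zl top pd step lim by blast
  moreover have "small U (Field r')" unfolding FA A_def by (intro small_insert small_image sm)
  ultimately have HC: "H z None \<in> Cel" using cc_intro[OF cat, of r' Cel P H z None] cc_Cel by blast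
  \<comment> \<open>Again only up to isomorphism: \<open>P None\<close> is a second pushout of the
    whole family, and \<open>P z\<close> attaches the empty family to \<open>W\<close>.\<close>
  obtain i where i: "iso_ar C (P None) Z i" "i \<cdot>\<^bsub>C\<^esub> w None = u"
    by (rule mpush_iso[OF cat wf _ mp]) (use P[of None] DnN in auto)
  have "iso_ar C W (P z) (w z)" using mpush_empty_is_iso[OF cat wfD(1)] P[of z] unfolding Dnz by blast
  then have "H z None \<cdot>\<^bsub>C\<^esub> w z \<in> Cel" by (intro comp_Cel[OF iso_Cel HC Pw H(1)[OF zl[OF NA]]])
  then have "w None \<in> Cel" using H(2)[OF zl[OF NA]] by simp
  from comp_Cel[OF this iso_Cel[OF i(1)] Pw iso_hom[OF i(1)]] show ?thesis using i(2) by simp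
qed

end

section \<open>Images of transfinite composites under functors\<close>

lemma functor_pdiag:
  assumes "is_functor C D V" "pdiag C A r X h"
  shows "pdiag D A r (\<lambda>a. on_ob V (X a)) (\<lambda>a b. on_ar V (h a b))"
  unfolding pdiag_def
proof (intro conjI ballI impI)
  fix a b c assume a: "a \<in> A" "b \<in> A" "c \<in> A"
  show "on_ob V (X a) \<in> Ob D" by (rule functor_ob[OF assms(1) pdiag_ob[OF assms(2) a(1)]])
  show "on_ar V (h a a) = Idt D (on_ob V (X a))"
    using functor_id[OF assms(1) pdiag_ob[OF assms(2) a(1)]] pdiag_id[OF assms(2) a(1)] by simp
  show "on_ar V (h a b) \<in> hom D (on_ob V (X a)) (on_ob V (X b))" if "(a, b) \<in> r"
    by (rule functor_hom[OF assms(1) pdiag_hom[OF assms(2) that a(1,2)]])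
  show "on_ar V (h b c) \<cdot>\<^bsub>D\<^esub> on_ar V (h a b) = on_ar V (h a c)" if "(a, b) \<in> r" "(b, c) \<in> r"
    using functor_comp[OF assms(1) pdiag_hom[OF assms(2) that(1) a(1,2)] pdiag_hom[OF assms(2) that(2) a(2,3)]]
      pdiag_comp[OF assms(2) that a] by simp
qed

lemma functor_pcone:
  assumes "is_functor C D V" "pdiag C A r X h" "pcone C A r X h Z c"
  shows "pcone D A r (\<lambda>a. on_ob V (X a)) (\<lambda>a b. on_ar V (h a b)) (on_ob V Z) (\<lambda>a. on_ar V (c a))"
  unfolding pcone_def
proof (intro conjI ballI impI)
  have c: "Z \<in> Ob C" "\<And>a. a \<in> A \<Longrightarrow> c a \<in> hom C (X a) Z"
      "\<And>a b. a \<in> A \<Longrightarrow> b \<in> A \<Longrightarrow> (a, b) \<in> r \<Longrightarrow> c b \<cdot>\<^bsub>C\<^esub> h a b = c a"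
    using assms(3) unfolding pcone_def by blast+
  show "on_ob V Z \<in> Ob D" by (rule functor_ob[OF assms(1) c(1)])
  fix a assume a: "a \<in> A"
  show "on_ar V (c a) \<in> hom D (on_ob V (X a)) (on_ob V Z)" by (rule functor_hom[OF assms(1) c(2)[OF a]])
  fix b assume b: "b \<in> A" and ab: "(a, b) \<in> r"
  show "on_ar V (c b) \<cdot>\<^bsub>D\<^esub> on_ar V (h a b) = on_ar V (c a)"
    using functor_comp[OF assms(1) pdiag_hom[OF assms(2) ab a b] c(2)[OF b]] c(3)[OF a b ab] by simp
qed

text \<open>Index sets in \<open>'u\<close> are enough here because the chains in the definition of
  transfinite composites are indexed there.\<close>

definition preserves_directed :: "'u rel \<Rightarrow> ('o, 'm) cat \<Rightarrow> ('p, 'q) cat \<Rightarrow> ('o, 'm, 'p, 'q) fctr \<Rightarrow> bool" where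
  "preserves_directed U C D V \<longleftrightarrow> (\<forall>(A :: 'u set) r X h Z c.
     small U A \<and> dirset A r \<and> pdiag C A r X h \<and> pcolim C A r X h Z c \<longrightarrow>
     pcolim D A r (\<lambda>a. on_ob V (X a)) (\<lambda>a b. on_ar V (h a b)) (on_ob V Z) (\<lambda>a. on_ar V (c a)))"

lemma dirset_Restr:
  assumes "dirset A r" shows "dirset A (Restr r A)"
  unfolding dirset_def
proof (intro conjI ballI impI)
  show "A \<noteq> {}" by (rule dirset_ne[OF assms])
  fix a assume a: "a \<in> A"
  show "(a, a) \<in> Restr r A" using dirset_refl[OF assms a] a by blast
  fix b assume b: "b \<in> A"
  show "a = b" if "(a, b) \<in> Restr r A" "(b, a) \<in> Restr r A"
    using dirset_antisym[OF assms a b] that by blast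
  obtain c where "c \<in> A" "(a, c) \<in> r" "(b, c) \<in> r" by (rule dirset_bound[OF assms a b])
  then show "\<exists>c \<in> A. (a, c) \<in> Restr r A \<and> (b, c) \<in> Restr r A" using a b by blast
  fix c assume c: "c \<in> A"
  show "(a, c) \<in> Restr r A" if "(a, b) \<in> Restr r A" "(b, c) \<in> Restr r A"
    using dirset_trans[OF assms _ _ a b c] that a c by blast
qed

text \<open>All colimits in a transfinite composite are taken over the whole chain or over the part
  below a limit. Both are nonempty well-orders, as they contain \<open>z\<close>, and hence
  directed.\<close>

lemma (in universe) transfinite_composites_image:
  assumes V: "is_functor C D V" and pres: "preserves_directed U C D V" and S: "on_ar V ` S \<subseteq> T"
  shows "on_ar V ` transfinite_composites U C S \<subseteq> transfinite_composites U D T"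
proof safe
  fix f assume "f \<in> transfinite_composites U C S"
  then obtain r :: "'u rel" and E Z c z where all: "Well_order r \<and> small U (Field r) \<and>
     z \<in> Field r \<and> (\<forall>a \<in> Field r. (z, a) \<in> r) \<and>
     is_colimit (poset_cat r) C E Z c \<and> f = c z \<and>
     (\<forall>a b. covers r a b \<longrightarrow> on_ar E (a, b) \<in> S) \<and>
     (\<forall>a \<in> Field r. a \<noteq> z \<and> \<not> (\<exists>b. covers r b a) \<longrightarrow>
        is_colimit (poset_cat (Restr r (underS r a))) C E (on_ob E a) (\<lambda>b. on_ar E (b, a)))"
    unfolding transfinite_composites_def mem_Collect_eq by (elim exE) (rule that)
  then have wo: "Well_order r" and sm: "small U (Field r)" and z: "z \<in> Field r" "\<And>a. a \<in> Field r \<Longrightarrow> (z, a) \<in> r"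
    and col: "is_colimit (poset_cat r) C E Z c" and f: "f = c z" by blast+
  define E' where "E' = \<lparr>on_ob = (\<lambda>a. on_ob V (on_ob E a)), on_ar = (\<lambda>p. on_ar V (on_ar E (fst p, snd p)))\<rparr>"
  have im: "is_colimit (poset_cat q) D E' (on_ob V Z') (\<lambda>a. on_ar V (c' a))"
    if pre: "Preorder q" and q: "Field q \<subseteq> Field r" "dirset (Field q) q" and c: "is_colimit (poset_cat q) C E Z' c'" for q :: "'u rel" and Z' c'
  proof -
    note P = poset_colimitD[OF c]
    have "pcolim D (Field q) q (\<lambda>a. on_ob V (on_ob E a)) (\<lambda>a b. on_ar V (on_ar E (a, b))) (on_ob V Z') (\<lambda>a. on_ar V (c' a))"
      using pres small_subset[OF sm q(1)] q(2) P unfolding preserves_directed_def by blast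
    from poset_colimitI[OF functor_cats(2)[OF V] pre functor_pdiag[OF V P(1)] this] show ?thesis unfolding E'_def .
  qed
  have pre: "Preorder r" using wo by (auto simp: order_on_defs)
  have c1: "is_colimit (poset_cat r) D E' (on_ob V Z) (\<lambda>a. on_ar V (c a))"
    by (rule im[OF pre subset_refl Well_order_dirset[OF wo subset_refl] col]) (use z in blast)
  have c2: "is_colimit (poset_cat (Restr r (underS r a))) D E' (on_ob E' a) (\<lambda>b. on_ar E' (b, a))"
    if a: "a \<in> Field r" "a \<noteq> z" "\<nexists>b. covers r b a" for a
  proof -
    note R = Well_order_Restr[OF wo underS_Field[of r a]]
    have "is_colimit (poset_cat (Restr r (underS r a))) C E (on_ob E a) (\<lambda>b. on_ar E (b, a))"
      using all a by blast
    moreover have "z \<in> underS r a" using z(2)[OF a(1)] a(2) by (auto simp: underS_def)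
    then have "dirset (underS r a) r" using Well_order_dirset[OF wo underS_Field] by blast
    then have "dirset (underS r a) (Restr r (underS r a))" by (rule dirset_Restr)
    ultimately show ?thesis using im[OF R(2)] underS_Field[of r a] unfolding R(1) by (simp add: E'_def)
  qed
  have st: "on_ar E' (a, b) \<in> T" if "covers r a b" for a b
  proof -
    have "on_ar E (a, b) \<in> S" using all that by blast
    then show ?thesis using S by (auto simp: E'_def)
  qed
  show "on_ar V f \<in> transfinite_composites U D T"
    unfolding transfinite_composites_def mem_Collect_eq
    by (rule exI[of _ r], rule exI[of _ E'], rule exI[of _ "on_ob V Z"], rule exI[of _ "\<lambda>a. on_ar V (c a)"], rule exI[of _ z])
      (use wo sm z c1 c2 st f in auto)
qed

section \<open>Algebraic injectives over a category\<close>

text \<open>\<open>D\<close> consists of the objects of \<open>C\<close> with a structure \<open>ext\<close> of chosen extensions, up to an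
  isomorphism over \<open>C\<close>.\<close>

locale alg_step = cellular_cat U C B for U :: "'u rel" and C :: "('o, 'm) cat" and B :: "('b, 'm) family" +
  fixes I :: "('i, 'm) family" and D :: "('p, 'q) cat" and V :: "('p, 'q, 'o, 'm) fctr"
    and ext :: "'p \<Rightarrow> 'i \<Rightarrow> 'm \<Rightarrow> 'm"
  assumes loc: "\<And>X Y. X \<in> Ob C \<Longrightarrow> Y \<in> Ob C \<Longrightarrow> small U (hom C X Y)"
    and famI: "is_family U C I"
    and fp: "\<And>i. i \<in> Idx I \<Longrightarrow> finitely_presentable U C (Dom C (mor I i))"
    and cellI: "\<And>i. i \<in> Idx I \<Longrightarrow> mor I i \<in> Cel" and mono: "Cel \<subseteq> Mono C"
    and V: "is_functor D C V"
    and ext: "\<And>Y. Y \<in> Ob D \<Longrightarrow> ext_structure C I (on_ob V Y) (ext Y)"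
    and mor_ext: "\<And>X Y w i f. w \<in> hom D X Y \<Longrightarrow> i \<in> Idx I \<Longrightarrow> f \<in> hom C (Dom C (mor I i)) (on_ob V X) \<Longrightarrow>
        on_ar V w \<cdot>\<^bsub>C\<^esub> ext X i f = ext Y i (on_ar V w \<cdot>\<^bsub>C\<^esub> f)"
    and lift: "\<And>X Y u. X \<in> Ob D \<Longrightarrow> Y \<in> Ob D \<Longrightarrow> u \<in> hom C (on_ob V X) (on_ob V Y) \<Longrightarrow>
        (\<And>i f. i \<in> Idx I \<Longrightarrow> f \<in> hom C (Dom C (mor I i)) (on_ob V X) \<Longrightarrow> u \<cdot>\<^bsub>C\<^esub> ext X i f = ext Y i (u \<cdot>\<^bsub>C\<^esub> f)) \<Longrightarrow>
        \<exists>w. w \<in> hom D X Y \<and> on_ar V w = u"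
    and faith: "\<And>X Y w w'. w \<in> hom D X Y \<Longrightarrow> w' \<in> hom D X Y \<Longrightarrow> on_ar V w = on_ar V w' \<Longrightarrow> w = w'"
    and obj: "\<And>Z c. Z \<in> Ob C \<Longrightarrow> ext_structure C I Z c \<Longrightarrow> \<exists>Y. Y \<in> Ob D \<and> on_ob V Y = Z \<and> ext Y = c"
begin

abbreviation "al i \<equiv> mor I i"
abbreviation "dm i \<equiv> Dom C (mor I i)"
abbreviation "cd i \<equiv> Cod C (mor I i)"

lemma catD: "category D"
  by (rule functor_cats(1)[OF V])

lemma al_hom: "i \<in> Idx I \<Longrightarrow> al i \<in> hom C (dm i) (cd i)"
  using famI by (simp add: is_family_def hom_def)

lemma dm_ob: "i \<in> Idx I \<Longrightarrow> dm i \<in> Ob C" and cd_ob: "i \<in> Idx I \<Longrightarrow> cd i \<in> Ob C"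
  using hom_dom[OF cat al_hom] hom_cod[OF cat al_hom] by auto

lemma ext_hom:
  assumes "Y \<in> Ob D" "i \<in> Idx I" "f \<in> hom C (dm i) (on_ob V Y)"
  shows "ext Y i f \<in> hom C (cd i) (on_ob V Y)" "ext Y i f \<cdot>\<^bsub>C\<^esub> al i = f"
  using ext[OF assms(1)] assms(2,3) unfolding ext_structure_def by (auto split: if_splits)

lemmas Vh = functor_hom[OF V]
lemmas Vo = functor_ob[OF V]
lemmas Vc = functor_comp[OF V]

text \<open>A morphism from a finitely presentable \<open>dm i\<close> to the colimit factors
  through a stage and is solved at a later one by \<open>tot\<close>; two factorizations agree at a
  later stage, after which \<open>push\<close> and \<open>sv\<close> make their solutions agree. The
  data are relations rather than functions so that one statement serves diagrams of algebraic
  injectives as well as the completion sequence, whose stages are only partially structured.\<close>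

lemma directed_ext:
  fixes T :: "'j set"
  assumes sm: "small U T" and dir: "dirset T r" and pd: "pdiag C T r X h" and pc: "pcolim C T r X h Z c"
    and Rwf: "\<And>a i f k. a \<in> T \<Longrightarrow> (i, f, k) \<in> R a \<Longrightarrow> i \<in> Idx I \<and> f \<in> hom C (dm i) (X a) \<and> k \<in> hom C (cd i) (X a) \<and> k \<cdot>\<^bsub>C\<^esub> al i = f"
    and tot: "\<And>a i f. a \<in> T \<Longrightarrow> i \<in> Idx I \<Longrightarrow> f \<in> hom C (dm i) (X a) \<Longrightarrow> \<exists>b \<in> T. (a, b) \<in> r \<and> (\<exists>k. (i, h a b \<cdot>\<^bsub>C\<^esub> f, k) \<in> R b)"
    and push: "\<And>a b i f k. a \<in> T \<Longrightarrow> b \<in> T \<Longrightarrow> (a, b) \<in> r \<Longrightarrow> (i, f, k) \<in> R a \<Longrightarrow> (i, h a b \<cdot>\<^bsub>C\<^esub> f, h a b \<cdot>\<^bsub>C\<^esub> k) \<in> R b"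
    and sv: "\<And>a i f k k'. a \<in> T \<Longrightarrow> (i, f, k) \<in> R a \<Longrightarrow> (i, f, k') \<in> R a \<Longrightarrow> \<exists>b \<in> T. (a, b) \<in> r \<and> h a b \<cdot>\<^bsub>C\<^esub> k = h a b \<cdot>\<^bsub>C\<^esub> k'"
  shows "\<exists>Y. Y \<in> Ob D \<and> on_ob V Y = Z \<and> (\<forall>a \<in> T. \<forall>i f k. (i, f, k) \<in> R a \<longrightarrow> ext Y i (c a \<cdot>\<^bsub>C\<^esub> f) = c a \<cdot>\<^bsub>C\<^esub> k)"
proof -
  \<comment> \<open>The images in \<open>Z\<close> of the solutions at all stages. What remains is
    that this relation is total and single-valued.\<close>
  define G where "G i f k \<longleftrightarrow> (\<exists>a f' k'. a \<in> T \<and> (i, f', k') \<in> R a \<and> f = c a \<cdot>\<^bsub>C\<^esub> f' \<and> k = c a \<cdot>\<^bsub>C\<^esub> k')" for i f k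
  note leg = pcolim_leg[OF pc] and legc = pcolim_leg_comp[OF pc]
  have hh: "h a b \<in> hom C (X a) (X b)" if "a \<in> T" "b \<in> T" "(a, b) \<in> r" for a b
    by (rule pdiag_hom[OF pd that(3,1,2)])
  have Gtot: "\<exists>k. G i f k" if i: "i \<in> Idx I" and f: "f \<in> hom C (dm i) Z" for i f
  proof -
    obtain a f0 where a: "a \<in> T" "f0 \<in> hom C (dm i) (X a)" "c a \<cdot>\<^bsub>C\<^esub> f0 = f"
      using finitely_presentable_directed(1)[OF cat fp[OF i] sm dir pd pc] f by blast
    obtain b k where b: "b \<in> T" "(a, b) \<in> r" "(i, h a b \<cdot>\<^bsub>C\<^esub> f0, k) \<in> R b" using tot[OF a(1) i a(2)] by blast
    have "c b \<cdot>\<^bsub>C\<^esub> (h a b \<cdot>\<^bsub>C\<^esub> f0) = f"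
      using comp_assoc[OF cat a(2) hh[OF a(1) b(1,2)] leg[OF b(1)]] legc[OF a(1) b(1,2)] a(3) by simp
    then show ?thesis using b unfolding G_def by blast
  qed
  have Gsv: "k = l" if "G i f k" "G i f l" for i f k l
  proof -
    obtain a f1 k1 where a: "a \<in> T" "(i, f1, k1) \<in> R a" "f = c a \<cdot>\<^bsub>C\<^esub> f1" "k = c a \<cdot>\<^bsub>C\<^esub> k1"
      using \<open>G i f k\<close> unfolding G_def by blast
    obtain b f2 k2 where b: "b \<in> T" "(i, f2, k2) \<in> R b" "f = c b \<cdot>\<^bsub>C\<^esub> f2" "l = c b \<cdot>\<^bsub>C\<^esub> k2"
      using \<open>G i f l\<close> unfolding G_def by blast
    note ra = Rwf[OF a(1,2)] and rb = Rwf[OF b(1,2)]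
    obtain d where d: "d \<in> T" "(a, d) \<in> r" "(b, d) \<in> r" "h a d \<cdot>\<^bsub>C\<^esub> f1 = h b d \<cdot>\<^bsub>C\<^esub> f2"
      using finitely_presentable_directed(2)[OF cat fp sm dir pd pc, of i] ra rb a b by metis
    have "(i, h a d \<cdot>\<^bsub>C\<^esub> f1, h a d \<cdot>\<^bsub>C\<^esub> k1) \<in> R d" "(i, h a d \<cdot>\<^bsub>C\<^esub> f1, h b d \<cdot>\<^bsub>C\<^esub> k2) \<in> R d"
      using push[OF a(1) d(1,2) a(2)] push[OF b(1) d(1,3) b(2)] d(4) by auto
    then obtain e where e: "e \<in> T" "(d, e) \<in> r" "h d e \<cdot>\<^bsub>C\<^esub> (h a d \<cdot>\<^bsub>C\<^esub> k1) = h d e \<cdot>\<^bsub>C\<^esub> (h b d \<cdot>\<^bsub>C\<^esub> k2)"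
      using sv[OF d(1)] by blast
    have "c x \<cdot>\<^bsub>C\<^esub> k0 = c e \<cdot>\<^bsub>C\<^esub> (h d e \<cdot>\<^bsub>C\<^esub> (h x d \<cdot>\<^bsub>C\<^esub> k0))"
      if x: "x \<in> T" "(x, d) \<in> r" and k0: "k0 \<in> hom C (cd i) (X x)" for x k0
    proof -
      have 1: "h x d \<cdot>\<^bsub>C\<^esub> k0 \<in> hom C (cd i) (X d)" by (rule comp_hom[OF cat k0 hh[OF x(1) d(1) x(2)]])
      have "c e \<cdot>\<^bsub>C\<^esub> (h d e \<cdot>\<^bsub>C\<^esub> (h x d \<cdot>\<^bsub>C\<^esub> k0)) = c d \<cdot>\<^bsub>C\<^esub> (h x d \<cdot>\<^bsub>C\<^esub> k0)"
        by (rule comp_reassoc[OF cat legc[OF d(1) e(1,2)] hh[OF d(1) e(1,2)] leg[OF e(1)] 1])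
      also have "\<dots> = c x \<cdot>\<^bsub>C\<^esub> k0"
        by (rule comp_reassoc[OF cat legc[OF x(1) d(1) x(2)] hh[OF x(1) d(1) x(2)] leg[OF d(1)] k0])
      finally show ?thesis ..
    qed
    from this[OF a(1) d(2), of k1] this[OF b(1) d(3), of k2] show ?thesis using a b ra rb e(3) by simp
  qed
  have Gwf: "k \<in> hom C (cd i) Z \<and> k \<cdot>\<^bsub>C\<^esub> al i = f" if G: "G i f k" for i f k
  proof -
    obtain a f1 k1 where a: "a \<in> T" "(i, f1, k1) \<in> R a" "f = c a \<cdot>\<^bsub>C\<^esub> f1" "k = c a \<cdot>\<^bsub>C\<^esub> k1"
      using G unfolding G_def by blast
    note ra = Rwf[OF a(1,2)]
    then have k1: "i \<in> Idx I" "k1 \<in> hom C (cd i) (X a)" "k1 \<cdot>\<^bsub>C\<^esub> al i = f1" by auto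
    show ?thesis using comp_hom[OF cat k1(2) leg[OF a(1)]] comp_assoc[OF cat al_hom[OF k1(1)] k1(2) leg[OF a(1)]] k1(3) a by simp
  qed
  \<comment> \<open>The value \<open>undefined\<close> away from genuine problems is imposed by
    \<open>ext_structure\<close>, which makes structures comparable as functions.\<close>
  define cs where "cs i f = (if i \<in> Idx I \<and> f \<in> hom C (dm i) Z then SOME k. G i f k else undefined)" for i f
  have cs: "G i f (cs i f)" if "i \<in> Idx I" "f \<in> hom C (dm i) Z" for i f
    using someI_ex[OF Gtot[OF that]] that by (simp add: cs_def)
  have "ext_structure C I Z cs"
    unfolding ext_structure_def using Gwf[OF cs] by (auto simp: cs_def)
  then obtain Y where Y: "Y \<in> Ob D" "on_ob V Y = Z" "ext Y = cs" using obj[OF pcolim_ob[OF pc]] by blast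
  have "ext Y i (c a \<cdot>\<^bsub>C\<^esub> f) = c a \<cdot>\<^bsub>C\<^esub> k" if a: "a \<in> T" and fk: "(i, f, k) \<in> R a" for a i f k
  proof -
    have G: "G i (c a \<cdot>\<^bsub>C\<^esub> f) (c a \<cdot>\<^bsub>C\<^esub> k)" using a fk unfolding G_def by blast
    have i: "i \<in> Idx I" "f \<in> hom C (dm i) (X a)" using Rwf[OF a fk] by auto
    show ?thesis unfolding Y(3) by (rule Gsv[OF cs[OF i(1) comp_hom[OF cat i(2) leg[OF a]]] G])
  qed
  then show ?thesis using Y by blast
qed

text \<open>The structures of the diagram induce one on the colimit \<open>Z\<close> itself, not
  just on an isomorphic copy. This strictness is what later allows colimits of successive stages to
  be stacked exactly over each other.\<close>

lemma creates_directed: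
  fixes T :: "'j set"
  assumes sm: "small U T" and dir: "dirset T r" and pd: "pdiag D T r X h"
    and pc: "pcolim C T r (\<lambda>a. on_ob V (X a)) (\<lambda>a b. on_ar V (h a b)) Z c"
  shows "\<exists>Y c'. Y \<in> Ob D \<and> on_ob V Y = Z \<and> (\<forall>a \<in> T. on_ar V (c' a) = c a) \<and> pcolim D T r X h Y c'"
proof -
  note pdC = functor_pdiag[OF V pd]
  define R where "R a = {(i, f, ext (X a) i f) | i f. i \<in> Idx I \<and> f \<in> hom C (dm i) (on_ob V (X a))}" for a
  have R: "(i, f, k) \<in> R a \<longleftrightarrow> i \<in> Idx I \<and> f \<in> hom C (dm i) (on_ob V (X a)) \<and> k = ext (X a) i f" for a i f k
    by (auto simp: R_def)
  have XO: "X a \<in> Ob D" if "a \<in> T" for a by (rule pdiag_ob[OF pd that])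
  have hD: "h a b \<in> hom D (X a) (X b)" if "a \<in> T" "b \<in> T" "(a, b) \<in> r" for a b by (rule pdiag_hom[OF pd that(3,1,2)])
  have push: "(i, on_ar V (h a b) \<cdot>\<^bsub>C\<^esub> f, on_ar V (h a b) \<cdot>\<^bsub>C\<^esub> k) \<in> R b"
    if "a \<in> T" "b \<in> T" "(a, b) \<in> r" "(i, f, k) \<in> R a" for a b i f k
  proof -
    have f: "i \<in> Idx I" "f \<in> hom C (dm i) (on_ob V (X a))" "k = ext (X a) i f" using that(4) R by auto
    show ?thesis unfolding R f(3)
      using f(1) comp_hom[OF cat f(2) Vh[OF hD[OF that(1-3)]]] mor_ext[OF hD[OF that(1-3)] f(1,2)] by blast
  qed
  have "\<exists>Y. Y \<in> Ob D \<and> on_ob V Y = Z \<and> (\<forall>a \<in> T. \<forall>i f k. (i, f, k) \<in> R a \<longrightarrow> ext Y i (c a \<cdot>\<^bsub>C\<^esub> f) = c a \<cdot>\<^bsub>C\<^esub> k)"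
  proof (rule directed_ext[OF sm dir pdC pc])
    show "i \<in> Idx I \<and> f \<in> hom C (dm i) (on_ob V (X a)) \<and> k \<in> hom C (cd i) (on_ob V (X a)) \<and> k \<cdot>\<^bsub>C\<^esub> al i = f"
      if "a \<in> T" "(i, f, k) \<in> R a" for a i f k
      using that ext_hom[OF XO[OF that(1)], of i f] unfolding R by auto
    show "\<exists>b \<in> T. (a, b) \<in> r \<and> (\<exists>k. (i, on_ar V (h a b) \<cdot>\<^bsub>C\<^esub> f, k) \<in> R b)"
      if a: "a \<in> T" and i: "i \<in> Idx I" and f: "f \<in> hom C (dm i) (on_ob V (X a))" for a i f
    proof -
      have "(i, f, ext (X a) i f) \<in> R a" using i f R by blast
      then show ?thesis using push[OF a a dirset_refl[OF dir a]] dirset_refl[OF dir a] a by blast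
    qed
    show "\<exists>b \<in> T. (a, b) \<in> r \<and> on_ar V (h a b) \<cdot>\<^bsub>C\<^esub> k = on_ar V (h a b) \<cdot>\<^bsub>C\<^esub> k'"
      if "a \<in> T" "(i, f, k) \<in> R a" "(i, f, k') \<in> R a" for a i f k k'
      using that dirset_refl[OF dir that(1)] unfolding R by blast
  qed (rule push)
  then obtain Y where Y: "Y \<in> Ob D" "on_ob V Y = Z"
    and eY: "\<And>a i f k. a \<in> T \<Longrightarrow> (i, f, k) \<in> R a \<Longrightarrow> ext Y i (c a \<cdot>\<^bsub>C\<^esub> f) = c a \<cdot>\<^bsub>C\<^esub> k" by metis
  have eYc: "c a \<cdot>\<^bsub>C\<^esub> ext (X a) i f = ext Y i (c a \<cdot>\<^bsub>C\<^esub> f)" if "a \<in> T" "i \<in> Idx I" "f \<in> hom C (dm i) (on_ob V (X a))" for a i f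
    using eY[OF that(1), of i f "ext (X a) i f"] R that by simp
  have "\<exists>w. w \<in> hom D (X a) Y \<and> on_ar V w = c a" if a: "a \<in> T" for a
    by (rule lift[OF XO[OF a] Y(1)]) (use pcolim_leg[OF pc a] Y(2) eYc[OF a] in auto)
  then obtain c' where c': "\<And>a. a \<in> T \<Longrightarrow> c' a \<in> hom D (X a) Y \<and> on_ar V (c' a) = c a" by metis
  have "pcolim D T r X h Y c'"
    unfolding pcolim_def
  proof (intro conjI allI impI)
    show "pcone D T r X h Y c'"
      unfolding pcone_def
    proof (intro conjI ballI impI Y(1))
      fix a assume a: "a \<in> T"
      show ca: "c' a \<in> hom D (X a) Y" using c'[OF a] by blast
      fix b assume b: "b \<in> T" and ab: "(a, b) \<in> r"
      have cb: "c' b \<in> hom D (X b) Y" using c'[OF b] by blast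
      show "c' b \<cdot>\<^bsub>D\<^esub> h a b = c' a"
        by (rule faith[OF comp_hom[OF catD hD[OF a b ab] cb] ca])
          (use Vc[OF hD[OF a b ab] cb] c'[OF a] c'[OF b] pcolim_leg_comp[OF pc a b ab] in simp)
    qed
    fix W d assume d: "pcone D T r X h W d"
    then have dD: "W \<in> Ob D" "\<And>a. a \<in> T \<Longrightarrow> d a \<in> hom D (X a) W" unfolding pcone_def by blast+
    obtain y where y: "y \<in> hom C Z (on_ob V W)" "\<And>a. a \<in> T \<Longrightarrow> y \<cdot>\<^bsub>C\<^esub> c a = on_ar V (d a)"
      using pcolim_factor[OF pc functor_pcone[OF V pd d]] by blast
    \<comment> \<open>By finite presentability each problem in \<open>Y\<close> comes from some
      \<open>X a\<close>, and there compatibility holds because \<open>d a\<close> is a morphism of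
      algebraic injectives.\<close>
    have "\<exists>w. w \<in> hom D Y W \<and> on_ar V w = y"
    proof (rule lift[OF Y(1) dD(1)])
      show "y \<in> hom C (on_ob V Y) (on_ob V W)" using y Y by simp
      fix i f assume i: "i \<in> Idx I" and f: "f \<in> hom C (dm i) (on_ob V Y)"
      obtain a f0 where a: "a \<in> T" "f0 \<in> hom C (dm i) (on_ob V (X a))" "c a \<cdot>\<^bsub>C\<^esub> f0 = f"
        using finitely_presentable_directed(1)[OF cat fp[OF i] sm dir pdC pc] f unfolding Y(2) by blast
      note ca = pcolim_leg[OF pc a(1)]
      have "y \<cdot>\<^bsub>C\<^esub> ext Y i f = y \<cdot>\<^bsub>C\<^esub> (c a \<cdot>\<^bsub>C\<^esub> ext (X a) i f0)" using eYc[OF a(1) i a(2)] a(3) by simp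
      also have "\<dots> = on_ar V (d a) \<cdot>\<^bsub>C\<^esub> ext (X a) i f0"
        by (rule comp_reassoc[OF cat y(2)[OF a(1)] ca y(1) ext_hom(1)[OF XO[OF a(1)] i a(2)]])
      also have "\<dots> = ext W i (on_ar V (d a) \<cdot>\<^bsub>C\<^esub> f0)" by (rule mor_ext[OF dD(2)[OF a(1)] i a(2)])
      also have "on_ar V (d a) \<cdot>\<^bsub>C\<^esub> f0 = y \<cdot>\<^bsub>C\<^esub> f"
        using comp_reassoc[OF cat y(2)[OF a(1)] ca y(1) a(2)] a(3) by simp
      finally show "y \<cdot>\<^bsub>C\<^esub> ext Y i f = ext W i (y \<cdot>\<^bsub>C\<^esub> f)" .
    qed
    then obtain w where w: "w \<in> hom D Y W" "on_ar V w = y" by blast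
    show "\<exists>!w. w \<in> hom D Y W \<and> (\<forall>a \<in> T. w \<cdot>\<^bsub>D\<^esub> c' a = d a)"
    proof (rule ex1I[of _ w], intro conjI ballI w(1))
      fix a assume a: "a \<in> T"
      have ca: "c' a \<in> hom D (X a) Y" using c'[OF a] by blast
      show "w \<cdot>\<^bsub>D\<^esub> c' a = d a"
        by (rule faith[OF comp_hom[OF catD ca w(1)] dD(2)[OF a]]) (use Vc[OF ca w(1)] c'[OF a] w(2) y(2)[OF a] in simp)
    next
      fix v assume v: "v \<in> hom D Y W \<and> (\<forall>a \<in> T. v \<cdot>\<^bsub>D\<^esub> c' a = d a)"
      then have vh: "v \<in> hom D Y W" by blast
      have "on_ar V v = y"
      proof (rule pcolim_eq[OF cat pdC pc _ y(1)])
        show "on_ar V v \<in> hom C Z (on_ob V W)" using Vh[OF vh] Y(2) by simp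
        fix a assume a: "a \<in> T"
        have ca: "c' a \<in> hom D (X a) Y" using c'[OF a] by blast
        have "on_ar V v \<cdot>\<^bsub>C\<^esub> c a = on_ar V (d a)" using Vc[OF ca vh] c'[OF a] v a by simp
        then show "on_ar V v \<cdot>\<^bsub>C\<^esub> c a = y \<cdot>\<^bsub>C\<^esub> c a" using y(2)[OF a] by simp
      qed
      then show "v = w" using faith[OF vh w(1)] w(2) by simp
    qed
  qed
  then show ?thesis using Y c' by blast
qed

text \<open>A given colimit in \<open>D\<close> is isomorphic to the created one, and functors
  preserve isomorphisms.\<close>

lemma V_preserves_directed: "preserves_directed U D C V"
  unfolding preserves_directed_def
proof (intro allI impI, elim conjE)
  fix T :: "'u set" and r X h Z c
  assume sm: "small U T" and dir: "dirset T r" and pd: "pdiag D T r X h" and pc: "pcolim D T r X h Z c"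
  note pdC = functor_pdiag[OF V pd]
  obtain Z' c' where pc': "pcolim C T r (\<lambda>a. on_ob V (X a)) (\<lambda>a b. on_ar V (h a b)) Z' c'"
    using pcolim_exists[OF rc cat sm pdC] by blast
  obtain Y k where Y: "Y \<in> Ob D" "on_ob V Y = Z'" "\<And>a. a \<in> T \<Longrightarrow> on_ar V (k a) = c' a" and k: "pcolim D T r X h Y k"
    using creates_directed[OF sm dir pd pc'] by blast
  obtain i where i: "iso_ar D Y Z i" "\<And>a. a \<in> T \<Longrightarrow> i \<cdot>\<^bsub>D\<^esub> k a = c a"
    using pcolim_iso[OF catD pd k pc] by blast
  have Vi: "iso_ar C Z' (on_ob V Z) (on_ar V i)" using functor_iso[OF V i(1)] Y(2) by simp
  have "pcolim C T r (\<lambda>a. on_ob V (X a)) (\<lambda>a b. on_ar V (h a b)) (on_ob V Z) (\<lambda>a. on_ar V i \<cdot>\<^bsub>C\<^esub> c' a)"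
    by (rule pcolim_transport[OF cat pdC pc' Vi])
  moreover have "on_ar V i \<cdot>\<^bsub>C\<^esub> c' a = on_ar V (c a)" if a: "a \<in> T" for a
    using Vc[OF pcolim_leg[OF k a] iso_hom[OF i(1)]] i(2)[OF a] Y(3)[OF a] by simp
  ultimately show "pcolim C T r (\<lambda>a. on_ob V (X a)) (\<lambda>a b. on_ar V (h a b)) (on_ob V Z) (\<lambda>a. on_ar V (c a))"
    by (subst (asm) pcolim_cong[where c' = "\<lambda>a. on_ar V (c a)" and X' = "\<lambda>a. on_ob V (X a)" and h' = "\<lambda>a b. on_ar V (h a b)"]) auto
qed


subsection \<open>Completing a partial structure\<close>

text \<open>A partial structure on \<open>Z\<close> is a set \<open>R\<close> of triples \<open>(i, f, k)\<close> demanding that \<open>k\<close> be the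
  chosen extension of \<open>f\<close> along \<open>al i\<close>. Its completion is the colimit of a sequence which adds, at
  each stage, extensions of all \<open>f : dm i \<rightarrow> Z\<close>.\<close>

definition "problems Z = {(i, f). i \<in> Idx I \<and> f \<in> hom C (dm i) Z}"

definition "solutions Z = {(i, f, k). i \<in> Idx I \<and> f \<in> hom C (dm i) Z \<and> k \<in> hom C (cd i) Z \<and> k \<cdot>\<^bsub>C\<^esub> al i = f}"

definition "resp R y Y \<longleftrightarrow> (\<forall>i f k. (i, f, k) \<in> R \<longrightarrow> y \<cdot>\<^bsub>C\<^esub> k = ext Y i (y \<cdot>\<^bsub>C\<^esub> f))"

text \<open>The last clause ties the new extension of a problem to the one prescribed by
  \<open>R\<close>, so that solved problems receive no second solution.\<close>

definition "ucone Z R Y u e \<longleftrightarrow> u \<in> hom C Z Y \<and>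
   (\<forall>i f. (i, f) \<in> problems Z \<longrightarrow> e i f \<in> hom C (cd i) Y \<and> e i f \<cdot>\<^bsub>C\<^esub> al i = u \<cdot>\<^bsub>C\<^esub> f) \<and>
   (\<forall>i f k. (i, f, k) \<in> R \<longrightarrow> u \<cdot>\<^bsub>C\<^esub> k = e i f)"

definition "ustep Z R Z' u e \<longleftrightarrow> ucone Z R Z' u e \<and> (\<forall>Y u' e'. ucone Z R Y u' e' \<longrightarrow>
   (\<exists>!w. w \<in> hom C Z' Y \<and> w \<cdot>\<^bsub>C\<^esub> u = u' \<and> (\<forall>i f. (i, f) \<in> problems Z \<longrightarrow> w \<cdot>\<^bsub>C\<^esub> e i f = e' i f)))"

lemma problems_small: "Z \<in> Ob C \<Longrightarrow> small U (problems Z)"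
  using small_Sigma[of "Idx I" "\<lambda>i. hom C (dm i) Z"] loc[OF dm_ob, of _ Z] famI
  by (rule_tac small_subset) (auto simp: problems_def is_family_def)

lemma solutions_small: "Z \<in> Ob C \<Longrightarrow> small U (solutions Z)"
  using small_Sigma[of "Idx I" "\<lambda>i. hom C (dm i) Z \<times> hom C (cd i) Z"] small_Times[OF loc[OF dm_ob, of _ Z] loc[OF cd_ob, of _ Z]] famI
  by (rule_tac small_subset) (auto simp: solutions_def is_family_def)

lemma ustep_exists:
  assumes Z: "Z \<in> Ob C" and R: "R \<subseteq> solutions Z"
  shows "\<exists>Z' u e. ustep Z R Z' u e"
proof -
  \<comment> \<open>A stage is a presented colimit: \<open>None\<close> is \<open>Z\<close> and
    \<open>Some (i, f)\<close> a copy of \<open>cd i\<close>. One kind of relation glues each copy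
    along \<open>al i\<close>, the other collapses it onto a prescribed solution.\<close>
  define J where "J = insert None (Some ` problems Z)"
  define X where "X = case_option Z (\<lambda>(i, f :: 'm). cd i)"
  define E where "E = (\<lambda>(i, f). (Some (i, f), al i, None, f)) ` problems Z \<union> (\<lambda>(i, f, k). (None, k, Some (i, f), Idt C (cd i))) ` R"
  have sJ: "small U J" unfolding J_def by (intro small_insert small_image problems_small Z)
  have sE: "small U E" unfolding E_def by (intro small_Un small_image problems_small Z small_subset[OF solutions_small[OF Z] R])
  have KD: "i \<in> Idx I" "f \<in> hom C (dm i) Z" if "(i, f) \<in> problems Z" for i f using that by (auto simp: problems_def)
  have TD: "i \<in> Idx I" "k \<in> hom C (cd i) Z" "(i, f) \<in> problems Z" if "(i, f, k) \<in> R" for i f k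
    using subsetD[OF R that] by (auto simp: solutions_def problems_def)
  have wf: "rel_wf C J X E"
    unfolding rel_wf_def
  proof (intro conjI ballI)
    show "X j \<in> Ob C" if "j \<in> J" for j using that Z cd_ob by (auto simp: J_def X_def problems_def)
    show "case \<rho> of (j, a, k, b) \<Rightarrow> j \<in> J \<and> k \<in> J \<and> (\<exists>A. a \<in> hom C A (X j) \<and> b \<in> hom C A (X k))" if \<rho>: "\<rho> \<in> E" for \<rho>
    proof -
      consider i f where "(i, f) \<in> problems Z" "\<rho> = (Some (i, f), al i, None, f)"
        | i f k where "(i, f, k) \<in> R" "\<rho> = (None, k, Some (i, f), Idt C (cd i))" using \<rho> unfolding E_def by auto
      then show ?thesis
      proof cases
        case 1
        then show ?thesis using al_hom[OF KD(1)[OF 1(1)]] KD(2)[OF 1(1)] by (auto simp: J_def X_def)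
      next
        case 2
        then show ?thesis using TD[OF 2(1)] id_hom[OF cat cd_ob[OF TD(1)[OF 2(1)]]] by (auto simp: J_def X_def)
      qed
    qed
  qed
  obtain Z' c where Zc: "relcolim C J X E Z' c" using relcoc_any[OF rc sJ sE wf] by blast
  have cone: "relcone C J X E Y d \<longleftrightarrow> ucone Z R Y (d None) (\<lambda>i f. d (Some (i, f)))" for Y d
  proof -
    have "(\<forall>j \<in> J. d j \<in> hom C (X j) Y) \<longleftrightarrow> d None \<in> hom C Z Y \<and> (\<forall>i f. (i, f) \<in> problems Z \<longrightarrow> d (Some (i, f)) \<in> hom C (cd i) Y)"
      by (auto simp: J_def X_def)
    moreover have "(\<forall>(j, a, k, b) \<in> E. d j \<cdot>\<^bsub>C\<^esub> a = d k \<cdot>\<^bsub>C\<^esub> b) \<longleftrightarrow>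
       (\<forall>i f. (i, f) \<in> problems Z \<longrightarrow> d (Some (i, f)) \<cdot>\<^bsub>C\<^esub> al i = d None \<cdot>\<^bsub>C\<^esub> f) \<and>
       (\<forall>i f k. (i, f, k) \<in> R \<longrightarrow> d None \<cdot>\<^bsub>C\<^esub> k = d (Some (i, f)) \<cdot>\<^bsub>C\<^esub> Idt C (cd i))"
      unfolding E_def by (auto simp: ball_Un)
    moreover have "d (Some (i, f)) \<cdot>\<^bsub>C\<^esub> Idt C (cd i) = d (Some (i, f))" if "d (Some (i, f)) \<in> hom C (cd i) Y" for i f
      by (rule id_right[OF cat that])
    moreover have "Y \<in> Ob C" if "d None \<in> hom C Z Y" by (rule hom_cod[OF cat that])
    ultimately show ?thesis unfolding relcone_def ucone_def using TD(3) by (smt (verit))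
  qed
  have "ustep Z R Z' (c None) (\<lambda>i f. c (Some (i, f)))"
    unfolding ustep_def
  proof (intro conjI allI impI)
    show "ucone Z R Z' (c None) (\<lambda>i f. c (Some (i, f)))" using relcolim_cone[OF Zc] unfolding cone .
    fix Y u' e' assume u: "ucone Z R Y u' e'"
    define d where "d = case_option u' (\<lambda>(i, f). e' i f)"
    have "relcone C J X E Y d" unfolding cone using u by (simp add: d_def)
    then have "\<exists>!w. w \<in> hom C Z' Y \<and> (\<forall>j \<in> J. w \<cdot>\<^bsub>C\<^esub> c j = d j)" using Zc unfolding relcolim_def by blast
    moreover have "(\<forall>j \<in> J. w \<cdot>\<^bsub>C\<^esub> c j = d j) \<longleftrightarrow>
      w \<cdot>\<^bsub>C\<^esub> c None = u' \<and> (\<forall>i f. (i, f) \<in> problems Z \<longrightarrow> w \<cdot>\<^bsub>C\<^esub> c (Some (i, f)) = e' i f)" for w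
      by (auto simp: J_def d_def)
    ultimately show "\<exists>!w. w \<in> hom C Z' Y \<and> w \<cdot>\<^bsub>C\<^esub> c None = u' \<and> (\<forall>i f. (i, f) \<in> problems Z \<longrightarrow> w \<cdot>\<^bsub>C\<^esub> c (Some (i, f)) = e' i f)"
      by simp
  qed
  then show ?thesis by blast
qed

lemma ustepD:
  assumes "ustep Z R Z' u e"
  shows "u \<in> hom C Z Z'" "\<And>i f. (i, f) \<in> problems Z \<Longrightarrow> e i f \<in> hom C (cd i) Z'"
    "\<And>i f. (i, f) \<in> problems Z \<Longrightarrow> e i f \<cdot>\<^bsub>C\<^esub> al i = u \<cdot>\<^bsub>C\<^esub> f" "\<And>i f k. (i, f, k) \<in> R \<Longrightarrow> u \<cdot>\<^bsub>C\<^esub> k = e i f"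
  using assms unfolding ustep_def ucone_def by blast+

lemma ustep_factor:
  assumes "ustep Z R Z' u e" "ucone Z R Y u' e'"
  obtains w where "w \<in> hom C Z' Y" "w \<cdot>\<^bsub>C\<^esub> u = u'" "\<And>i f. (i, f) \<in> problems Z \<Longrightarrow> w \<cdot>\<^bsub>C\<^esub> e i f = e' i f"
  using assms unfolding ustep_def by blast

lemma ustep_eq:
  assumes us: "ustep Z R Z' u e" and R: "R \<subseteq> solutions Z" and x: "x \<in> hom C Z' Y" and y: "y \<in> hom C Z' Y"
    and xu: "x \<cdot>\<^bsub>C\<^esub> u = y \<cdot>\<^bsub>C\<^esub> u" and xe: "\<And>i f. (i, f) \<in> problems Z \<Longrightarrow> x \<cdot>\<^bsub>C\<^esub> e i f = y \<cdot>\<^bsub>C\<^esub> e i f"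
  shows "x = y"
proof -
  note D = ustepD[OF us]
  have "ucone Z R Y (y \<cdot>\<^bsub>C\<^esub> u) (\<lambda>i f. y \<cdot>\<^bsub>C\<^esub> e i f)"
    unfolding ucone_def
  proof (intro conjI allI impI)
    show "y \<cdot>\<^bsub>C\<^esub> u \<in> hom C Z Y" by (rule comp_hom[OF cat D(1) y])
    fix i f assume k: "(i, f) \<in> problems Z"
    then have i: "i \<in> Idx I" and f: "f \<in> hom C (dm i) Z" by (auto simp: problems_def)
    show "y \<cdot>\<^bsub>C\<^esub> e i f \<in> hom C (cd i) Y" by (rule comp_hom[OF cat D(2)[OF k] y])
    show "(y \<cdot>\<^bsub>C\<^esub> e i f) \<cdot>\<^bsub>C\<^esub> al i = (y \<cdot>\<^bsub>C\<^esub> u) \<cdot>\<^bsub>C\<^esub> f"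
      using comp_assoc[OF cat al_hom[OF i] D(2)[OF k] y] comp_assoc[OF cat f D(1) y] D(3)[OF k] by simp
  next
    fix i f k assume r: "(i, f, k) \<in> R"
    then have k: "k \<in> hom C (cd i) Z" using R by (auto simp: solutions_def)
    show "(y \<cdot>\<^bsub>C\<^esub> u) \<cdot>\<^bsub>C\<^esub> k = y \<cdot>\<^bsub>C\<^esub> e i f" using comp_assoc[OF cat k D(1) y] D(4)[OF r] by simp
  qed
  then have "\<exists>!w. w \<in> hom C Z' Y \<and> w \<cdot>\<^bsub>C\<^esub> u = y \<cdot>\<^bsub>C\<^esub> u \<and> (\<forall>i f. (i, f) \<in> problems Z \<longrightarrow> w \<cdot>\<^bsub>C\<^esub> e i f = y \<cdot>\<^bsub>C\<^esub> e i f)"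
    using us unfolding ustep_def by blast
  then show ?thesis using x y xu xe by blast
qed

end

text \<open>Left adjoints are handled one object at a time: universal arrows can be composed,
  cancelled and compared separately, while a functor is assembled from them only at the end.\<close>

definition uarrow :: "('o, 'm) cat \<Rightarrow> ('p, 'q) cat \<Rightarrow> ('p, 'q, 'o, 'm) fctr \<Rightarrow> 'o \<Rightarrow> 'p \<Rightarrow> 'm \<Rightarrow> bool" where
  "uarrow C D V X Y \<eta> \<longleftrightarrow> Y \<in> Ob D \<and> \<eta> \<in> hom C X (on_ob V Y) \<and>
     (\<forall>Y' \<in> Ob D. \<forall>f \<in> hom C X (on_ob V Y'). \<exists>!g. g \<in> hom D Y Y' \<and> on_ar V g \<cdot>\<^bsub>C\<^esub> \<eta> = f)"

lemma uarrowD: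
  assumes "uarrow C D V X Y \<eta>"
  shows "Y \<in> Ob D" "\<eta> \<in> hom C X (on_ob V Y)"
    "\<And>Y' f. Y' \<in> Ob D \<Longrightarrow> f \<in> hom C X (on_ob V Y') \<Longrightarrow> \<exists>g. g \<in> hom D Y Y' \<and> on_ar V g \<cdot>\<^bsub>C\<^esub> \<eta> = f"
  using assms unfolding uarrow_def by blast+

lemma uarrow_eq:
  assumes "is_functor D C V" "uarrow C D V X Y \<eta>" "g \<in> hom D Y Y'" "g' \<in> hom D Y Y'" "on_ar V g \<cdot>\<^bsub>C\<^esub> \<eta> = on_ar V g' \<cdot>\<^bsub>C\<^esub> \<eta>"
  shows "g = g'"
proof -
  have "Y' \<in> Ob D" by (rule hom_cod[OF functor_cats(1)[OF assms(1)] assms(3)])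
  moreover have "on_ar V g' \<cdot>\<^bsub>C\<^esub> \<eta> \<in> hom C X (on_ob V Y')"
    by (rule comp_hom[OF functor_cats(2)[OF assms(1)] uarrowD(2)[OF assms(2)] functor_hom[OF assms(1,4)]])
  ultimately have "\<exists>!k. k \<in> hom D Y Y' \<and> on_ar V k \<cdot>\<^bsub>C\<^esub> \<eta> = on_ar V g' \<cdot>\<^bsub>C\<^esub> \<eta>"
    using assms(2) unfolding uarrow_def by blast
  then show ?thesis using assms(3-5) by blast
qed

context alg_step
begin

lemma resp_comp:
  assumes "Z \<in> Ob C" "R \<subseteq> solutions Z" "t \<in> hom C Z (on_ob V Y)" "resp R t Y" "w \<in> hom D Y Y'"
  shows "resp R (on_ar V w \<cdot>\<^bsub>C\<^esub> t) Y'"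
  unfolding resp_def
proof (intro allI impI)
  fix i f k assume r: "(i, f, k) \<in> R"
  then have T: "i \<in> Idx I" "f \<in> hom C (dm i) Z" "k \<in> hom C (cd i) Z" using assms(2) by (auto simp: solutions_def)
  note Vw = Vh[OF assms(5)]
  have "(on_ar V w \<cdot>\<^bsub>C\<^esub> t) \<cdot>\<^bsub>C\<^esub> k = on_ar V w \<cdot>\<^bsub>C\<^esub> ext Y i (t \<cdot>\<^bsub>C\<^esub> f)"
    using comp_assoc[OF cat T(3) assms(3) Vw] assms(4) r by (simp add: resp_def)
  also have "\<dots> = ext Y' i (on_ar V w \<cdot>\<^bsub>C\<^esub> (t \<cdot>\<^bsub>C\<^esub> f))"
    by (rule mor_ext[OF assms(5) T(1) comp_hom[OF cat T(2) assms(3)]])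
  finally show "(on_ar V w \<cdot>\<^bsub>C\<^esub> t) \<cdot>\<^bsub>C\<^esub> k = ext Y' i ((on_ar V w \<cdot>\<^bsub>C\<^esub> t) \<cdot>\<^bsub>C\<^esub> f)"
    using comp_assoc[OF cat T(2) assms(3) Vw] by simp
qed

text \<open>The algebraic injective freely generated by an object with a partial structure; empty
  \<open>R\<close> gives the free object on \<open>Z\<close>.\<close>

definition "reflects Z R Z' t \<longleftrightarrow> Z' \<in> Ob D \<and> t \<in> hom C Z (on_ob V Z') \<and> resp R t Z' \<and>
   (\<forall>Y y. Y \<in> Ob D \<longrightarrow> y \<in> hom C Z (on_ob V Y) \<longrightarrow> resp R y Y \<longrightarrow> (\<exists>!w. w \<in> hom D Z' Y \<and> on_ar V w \<cdot>\<^bsub>C\<^esub> t = y))"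

definition "sv R \<longleftrightarrow> (\<forall>i f k k'. (i, f, k) \<in> R \<longrightarrow> (i, f, k') \<in> R \<longrightarrow> k = k')"

text \<open>For single-valued \<open>R\<close>, only the \<open>f\<close> without an extension contribute, so that the step is a
  pushout of the corresponding \<open>al i\<close>.\<close>

lemma ustep_Cel:
  assumes Z: "Z \<in> Ob C" and R: "R \<subseteq> solutions Z" and us: "ustep Z R Z' u e" and sv: "sv R"
  shows "u \<in> Cel"
proof -
  note D = ustepD[OF us]
  \<comment> \<open>The unsolved problems. Only for these is a new copy of \<open>cd i\<close>
    attached.\<close>
  define J where "J = {(i, f). (i, f) \<in> problems Z \<and> (\<nexists>k. (i, f, k) \<in> R)}"
  have KD: "i \<in> Idx I" "f \<in> hom C (dm i) Z" if "(i, f) \<in> problems Z" for i f using that by (auto simp: problems_def)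
  have sJ: "small U J" by (rule small_subset[OF problems_small[OF Z]]) (auto simp: J_def)
  have wf: "mwf C Z J (\<lambda>j. al (fst j)) snd"
    unfolding mwf_def using Z al_hom KD by (auto simp: J_def hom_def)
  have "mpush C Z J (\<lambda>j. al (fst j)) snd Z' u (\<lambda>j. e (fst j) (snd j))"
  proof (rule mpushI)
    show "mcone C Z J (\<lambda>j. al (fst j)) snd Z' u (\<lambda>j. e (fst j) (snd j))"
      by (rule mconeI[OF D(1)]) (use D(2,3) in \<open>auto simp: J_def\<close>)
  next
    fix Y u' e' assume "mcone C Z J (\<lambda>j. al (fst j)) snd Y u' e'"
    note m = mconeD[OF this]
    \<comment> \<open>On solved problems the value is forced to be the image of the prescribed
      solution; single-valuedness makes the choice of that solution immaterial.\<close>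
    define e'' where "e'' i f = (if \<exists>k. (i, f, k) \<in> R then u' \<cdot>\<^bsub>C\<^esub> (SOME k. (i, f, k) \<in> R) else e' (i, f))" for i f
    have e1: "e'' i f = u' \<cdot>\<^bsub>C\<^esub> k" if "(i, f, k) \<in> R" for i f k
    proof -
      have "(i, f, SOME k. (i, f, k) \<in> R) \<in> R" using someI[of "\<lambda>k. (i, f, k) \<in> R", OF that] .
      then have "(SOME k. (i, f, k) \<in> R) = k" using sv that unfolding sv_def by blast
      then show ?thesis using that by (auto simp: e''_def)
    qed
    have e2: "e'' i f = e' (i, f)" if "(i, f) \<in> J" for i f using that by (auto simp: e''_def J_def)
    have "ucone Z R Y u' e''"
      unfolding ucone_def
    proof (intro conjI allI impI m(1))
      fix i f assume k: "(i, f) \<in> problems Z"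
      have "e'' i f \<in> hom C (cd i) Y \<and> e'' i f \<cdot>\<^bsub>C\<^esub> al i = u' \<cdot>\<^bsub>C\<^esub> f"
      proof (cases "\<exists>k. (i, f, k) \<in> R")
        case True
        then obtain k where r: "(i, f, k) \<in> R" by blast
        then have "k \<in> hom C (cd i) Z" "k \<cdot>\<^bsub>C\<^esub> al i = f" using R by (auto simp: solutions_def)
        then show ?thesis using e1[OF r] comp_hom[OF cat _ m(1)] comp_assoc[OF cat al_hom[OF KD(1)[OF k]] _ m(1)] by auto
      next
        case False
        then have "(i, f) \<in> J" using k by (simp add: J_def)
        then show ?thesis using e2 m(2,3)[of "(i, f)"] by simp
      qed
      then show "e'' i f \<in> hom C (cd i) Y" "e'' i f \<cdot>\<^bsub>C\<^esub> al i = u' \<cdot>\<^bsub>C\<^esub> f" by auto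
    qed (rule e1[symmetric])
    then obtain w where w: "w \<in> hom C Z' Y" "w \<cdot>\<^bsub>C\<^esub> u = u'" "\<And>i f. (i, f) \<in> problems Z \<Longrightarrow> w \<cdot>\<^bsub>C\<^esub> e i f = e'' i f"
      by (rule ustep_factor[OF us]) blast
    have "w \<cdot>\<^bsub>C\<^esub> e (fst j) (snd j) = e' j" if "j \<in> J" for j
      using w(3)[of "fst j" "snd j"] e2[of "fst j" "snd j"] that by (auto simp: J_def)
    then show "\<exists>w. w \<in> hom C Z' Y \<and> w \<cdot>\<^bsub>C\<^esub> u = u' \<and> (\<forall>j \<in> J. w \<cdot>\<^bsub>C\<^esub> e (fst j) (snd j) = e' j)" using w by blast
  next
    fix Y x y assume x: "x \<in> hom C Z' Y" and y: "y \<in> hom C Z' Y" and xy: "x \<cdot>\<^bsub>C\<^esub> u = y \<cdot>\<^bsub>C\<^esub> u"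
      and xe: "\<And>j. j \<in> J \<Longrightarrow> x \<cdot>\<^bsub>C\<^esub> e (fst j) (snd j) = y \<cdot>\<^bsub>C\<^esub> e (fst j) (snd j)"
    show "x = y"
    proof (rule ustep_eq[OF us R x y xy])
      fix i f assume k: "(i, f) \<in> problems Z"
      show "x \<cdot>\<^bsub>C\<^esub> e i f = y \<cdot>\<^bsub>C\<^esub> e i f"
      proof (cases "\<exists>k. (i, f, k) \<in> R")
        case True
        then obtain k where r: "(i, f, k) \<in> R" by blast
        then have "k \<in> hom C (cd i) Z" using R by (auto simp: solutions_def)
        then have "v \<cdot>\<^bsub>C\<^esub> e i f = (v \<cdot>\<^bsub>C\<^esub> u) \<cdot>\<^bsub>C\<^esub> k" if "v \<in> hom C Z' Y" for v
          using comp_assoc[OF cat _ D(1) that] D(4)[OF r] by simp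
        from this[OF x] this[OF y] xy show ?thesis by simp
      next
        case False
        then have "(i, f) \<in> J" using k by (simp add: J_def)
        then show ?thesis using xe[of "(i, f)"] by simp
      qed
    qed
  qed
  then show ?thesis by (rule mpush_Cel[OF sJ wf]) (use cellI KD in \<open>auto simp: J_def\<close>)
qed

text \<open>Every problem of the colimit appears at a finite stage and is solved at the next one, so
  \<omega> steps suffice. Universality holds because each stage is generated by the previous one
  together with the new solutions, whose images in an algebraic injective are forced. Existence is
  proved for arbitrary \<open>R0\<close>, as general colimits need it; cellularity is claimed for
  single-valued \<open>R0\<close> only.\<close>

lemma reflection:
  assumes Z0: "Z0 \<in> Ob C" and R0: "R0 \<subseteq> solutions Z0"
  shows "\<exists>Z' t. reflects Z0 R0 Z' t \<and> (sv R0 \<longrightarrow> t \<in> Cel)"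
proof -
  \<comment> \<open>The states of the recursion are objects with a partial structure; the last
    clause fixes the initial state inside the dependent choice.\<close>
  define P where "P = (\<lambda>(n :: nat) p. fst p \<in> Ob C \<and> snd p \<subseteq> solutions (fst p) \<and> (n = 0 \<longrightarrow> p = (Z0, R0)))"
  define Q where "Q = (\<lambda>(n :: nat) p p'. \<exists>u e. ustep (fst p) (snd p) (fst p') u e \<and>
     snd p' = {(i, u \<cdot>\<^bsub>C\<^esub> f, e i f) | i f. (i, f) \<in> problems (fst p)})"
  have "\<exists>p. \<forall>n. P n (p n) \<and> Q n (p n) (p (Suc n))"
  proof (rule dependent_nat_choice)
    show "\<exists>p. P 0 p" using Z0 R0 by (auto simp: P_def)
    fix p n assume p: "P n p"
    then have p1: "fst p \<in> Ob C" "snd p \<subseteq> solutions (fst p)" by (auto simp: P_def)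
    obtain Z' u e where us: "ustep (fst p) (snd p) Z' u e" using ustep_exists[OF p1] by blast
    note D = ustepD[OF us]
    define R' where "R' = {(i, u \<cdot>\<^bsub>C\<^esub> f, e i f) | i f. (i, f) \<in> problems (fst p)}"
    have "R' \<subseteq> solutions Z'" unfolding R'_def solutions_def using D(1-3) comp_hom[OF cat _ D(1)] by (auto simp: problems_def)
    then have "P (Suc n) (Z', R')" using hom_cod[OF cat D(1)] by (simp add: P_def)
    moreover have "Q n p (Z', R')" unfolding Q_def using us R'_def by auto
    ultimately show "\<exists>p'. P (Suc n) p' \<and> Q n p p'" by blast
  qed
  then obtain p where p: "\<And>n. P n (p n)" "\<And>n. Q n (p n) (p (Suc n))" by blast
  define X where "X n = fst (p n)" for n
  define R where "R n = snd (p n)" for n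
  have X0: "X 0 = Z0" "R 0 = R0" using p(1)[of 0] by (auto simp: P_def X_def R_def)
  have XO: "X n \<in> Ob C" and RT: "R n \<subseteq> solutions (X n)" for n using p(1)[of n] by (auto simp: P_def X_def R_def)
  have "\<forall>n. \<exists>u e. ustep (X n) (R n) (X (Suc n)) u e \<and> R (Suc n) = {(i, u \<cdot>\<^bsub>C\<^esub> f, e i f) | i f. (i, f) \<in> problems (X n)}"
    using p(2) unfolding Q_def X_def R_def by blast
  from choice[OF this] obtain u where "\<forall>n. \<exists>e. ustep (X n) (R n) (X (Suc n)) (u n) e \<and>
      R (Suc n) = {(i, u n \<cdot>\<^bsub>C\<^esub> f, e i f) | i f. (i, f) \<in> problems (X n)}" by (rule exE)
  from choice[OF this] obtain e where "\<forall>n. ustep (X n) (R n) (X (Suc n)) (u n) (e n) \<and>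
      R (Suc n) = {(i, u n \<cdot>\<^bsub>C\<^esub> f, e n i f) | i f. (i, f) \<in> problems (X n)}" by (rule exE)
  then have us: "ustep (X n) (R n) (X (Suc n)) (u n) (e n)"
    and RS: "R (Suc n) = {(i, u n \<cdot>\<^bsub>C\<^esub> f, e n i f) | i f. (i, f) \<in> problems (X n)}" for n by simp_all
  note uh = ustepD(1)[OF us] and eh = ustepD(2)[OF us] and uR = ustepD(4)[OF us]
  have problemsI: "(i, f) \<in> problems Z \<longleftrightarrow> i \<in> Idx I \<and> f \<in> hom C (dm i) Z" for i f Z by (simp add: problems_def)
  have RS': "(i, u n \<cdot>\<^bsub>C\<^esub> f, e n i f) \<in> R (Suc n)" if "(i, f) \<in> problems (X n)" for n i f using that unfolding RS by blast
  have RTD: "i \<in> Idx I" "f \<in> hom C (dm i) (X n)" "k \<in> hom C (cd i) (X n)" "k \<cdot>\<^bsub>C\<^esub> al i = f" "(i, f) \<in> problems (X n)"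
    if "(i, f, k) \<in> R n" for i f k n using subsetD[OF RT that] by (auto simp: solutions_def problems_def)
  note sq = seq_pdiag[where X = X and u = u, OF cat uh] and sc = seq_pcone[where X = X and u = u, OF cat uh]
    and hstep = nh_step[where X = X and u = u, OF cat uh] and hS = nh_Suc[where X = X and u = u, OF cat uh]
    and hself = nh_self[where X = X and u = u, OF cat uh] and hhom = nh_hom[where X = X and u = u, OF cat uh]
  obtain Z c where pc: "pcolim C UNIV nle X (nh C X u) Z c"
    using pcolim_exists[OF rc cat small_countable[OF countableI_type] sq] by blast
  have c: "c n \<in> hom C (X n) Z" "c (Suc n) \<cdot>\<^bsub>C\<^esub> u n = c n" for n
    using pcolim_cone[OF pc] unfolding sc by auto
  \<comment> \<open>The structure at stage \<open>n + 1\<close> lists only the freshly added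
    solutions. Old ones persist because \<open>u n\<close> sends a prescribed solution to the new
    solution of its problem.\<close>
  have pushn: "(i, nh C X u m n \<cdot>\<^bsub>C\<^esub> f, nh C X u m n \<cdot>\<^bsub>C\<^esub> k) \<in> R n" if mn: "m \<le> n" and r: "(i, f, k) \<in> R m" for m n i f k
    using mn
  proof (induction n rule: nat_induct_at_least)
    case base
    then show ?case using r RTD[OF r] hself id_left[OF cat RTD(2)[OF r]] id_left[OF cat RTD(3)[OF r]] by simp
  next
    case (Suc n)
    let ?f = "nh C X u m n \<cdot>\<^bsub>C\<^esub> f" and ?k = "nh C X u m n \<cdot>\<^bsub>C\<^esub> k"
    have "(i, u n \<cdot>\<^bsub>C\<^esub> ?f, u n \<cdot>\<^bsub>C\<^esub> ?k) \<in> R (Suc n)"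
      using RS'[OF RTD(5)[OF Suc.IH]] uR[OF Suc.IH] by simp
    then show ?case
      using comp_assoc[OF cat RTD(2)[OF r] hhom[OF \<open>m \<le> n\<close>] uh] comp_assoc[OF cat RTD(3)[OF r] hhom[OF \<open>m \<le> n\<close>] uh] hS[OF \<open>m \<le> n\<close>] by simp
  qed
  have "\<exists>Y. Y \<in> Ob D \<and> on_ob V Y = Z \<and> (\<forall>n \<in> UNIV. \<forall>i f k. (i, f, k) \<in> R n \<longrightarrow> ext Y i (c n \<cdot>\<^bsub>C\<^esub> f) = c n \<cdot>\<^bsub>C\<^esub> k)"
  proof (rule directed_ext[OF small_countable[OF countableI_type] nle_dirset sq pc])
    show "i \<in> Idx I \<and> f \<in> hom C (dm i) (X n) \<and> k \<in> hom C (cd i) (X n) \<and> k \<cdot>\<^bsub>C\<^esub> al i = f" if "(i, f, k) \<in> R n" for n i f k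
      using RTD[OF that] by blast
    show "\<exists>b \<in> UNIV. (n, b) \<in> nle \<and> (\<exists>k. (i, nh C X u n b \<cdot>\<^bsub>C\<^esub> f, k) \<in> R b)" if "i \<in> Idx I" "f \<in> hom C (dm i) (X n)" for n i f
      using RS'[of i f n] that hstep[of n] by (intro bexI[of _ "Suc n"]) (auto simp: problemsI)
    show "(i, nh C X u m n \<cdot>\<^bsub>C\<^esub> f, nh C X u m n \<cdot>\<^bsub>C\<^esub> k) \<in> R n" if "(m, n) \<in> nle" "(i, f, k) \<in> R m" for m n i f k
      using pushn that by simp
    show "\<exists>b \<in> UNIV. (n, b) \<in> nle \<and> nh C X u n b \<cdot>\<^bsub>C\<^esub> k = nh C X u n b \<cdot>\<^bsub>C\<^esub> k'" if "(i, f, k) \<in> R n" "(i, f, k') \<in> R n" for n i f k k'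
      using uR[OF that(1)] uR[OF that(2)] hstep[of n] by (intro bexI[of _ "Suc n"]) auto
  qed
  then obtain Z' where Z': "Z' \<in> Ob D" "on_ob V Z' = Z" and eZ: "\<And>n i f k. (i, f, k) \<in> R n \<Longrightarrow> ext Z' i (c n \<cdot>\<^bsub>C\<^esub> f) = c n \<cdot>\<^bsub>C\<^esub> k" by blast
  have eZe: "ext Z' i (c n \<cdot>\<^bsub>C\<^esub> f) = c (Suc n) \<cdot>\<^bsub>C\<^esub> e n i f" if k: "(i, f) \<in> problems (X n)" for n i f
  proof -
    have f: "f \<in> hom C (dm i) (X n)" using k by (simp add: problemsI)
    show ?thesis using eZ[OF RS'[OF k]] comp_reassoc[OF cat c(2) uh c(1) f] by simp
  qed
  have "reflects Z0 R0 Z' (c 0)"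
    unfolding reflects_def
  proof (intro conjI allI impI Z'(1))
    show "c 0 \<in> hom C Z0 (on_ob V Z')" using c(1)[of 0] X0 Z' by simp
    show "resp R0 (c 0) Z'" unfolding resp_def using eZ[of _ _ _ 0] X0 by simp
    fix Y y0 assume YO: "Y \<in> Ob D" and y0: "y0 \<in> hom C Z0 (on_ob V Y)" and r0: "resp R0 y0 Y"
    \<comment> \<open>The morphism to \<open>Y\<close> is extended one stage at a time; on new
      solutions its value must be the extension chosen in \<open>Y\<close>, and this keeps
      \<open>resp\<close> true.\<close>
    define S where "S = (\<lambda>n y. y \<in> hom C (X n) (on_ob V Y) \<and> resp (R n) y Y \<and> (n = 0 \<longrightarrow> y = y0))"
    define T where "T = (\<lambda>n y y'. y' \<cdot>\<^bsub>C\<^esub> u n = y \<and> (\<forall>i f. (i, f) \<in> problems (X n) \<longrightarrow> y' \<cdot>\<^bsub>C\<^esub> e n i f = ext Y i (y \<cdot>\<^bsub>C\<^esub> f)))"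
    have "\<exists>y. \<forall>n. S n (y n) \<and> T n (y n) (y (Suc n))"
    proof (rule dependent_nat_choice)
      show "\<exists>y. S 0 y" using y0 r0 X0 by (auto simp: S_def)
      fix y n assume "S n y"
      then have y: "y \<in> hom C (X n) (on_ob V Y)" "resp (R n) y Y" by (auto simp: S_def)
      have "ucone (X n) (R n) (on_ob V Y) y (\<lambda>i f. ext Y i (y \<cdot>\<^bsub>C\<^esub> f))"
        unfolding ucone_def problemsI
        using y ext_hom[OF YO _ comp_hom[OF cat _ y(1)]] unfolding resp_def by blast
      then obtain y' where y': "y' \<in> hom C (X (Suc n)) (on_ob V Y)" "y' \<cdot>\<^bsub>C\<^esub> u n = y"
        "\<And>i f. (i, f) \<in> problems (X n) \<Longrightarrow> y' \<cdot>\<^bsub>C\<^esub> e n i f = ext Y i (y \<cdot>\<^bsub>C\<^esub> f)"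
        by (rule ustep_factor[OF us]) blast
      have "resp (R (Suc n)) y' Y"
        unfolding resp_def RS
      proof (intro allI impI)
        fix i f k assume "(i, f, k) \<in> {(i, u n \<cdot>\<^bsub>C\<^esub> f, e n i f) | i f. (i, f) \<in> problems (X n)}"
        then obtain f0 where f0: "(i, f0) \<in> problems (X n)" "f = u n \<cdot>\<^bsub>C\<^esub> f0" "k = e n i f0" by blast
        have "f0 \<in> hom C (dm i) (X n)" using f0(1) by (simp add: problemsI)
        from comp_reassoc[OF cat y'(2) uh y'(1) this] show "y' \<cdot>\<^bsub>C\<^esub> k = ext Y i (y' \<cdot>\<^bsub>C\<^esub> f)"
          using y'(3)[OF f0(1)] f0 by simp
      qed
      then have "S (Suc n) y'" using y'(1) by (simp add: S_def)
      moreover have "T n y y'" using y' by (simp add: T_def)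
      ultimately show "\<exists>y'. S (Suc n) y' \<and> T n y y'" by blast
    qed
    then obtain y where yS: "\<And>n. S n (y n)" and yT: "\<And>n. T n (y n) (y (Suc n))" by blast
    have yh: "y n \<in> hom C (X n) (on_ob V Y)" for n using yS[of n] by (simp add: S_def)
    have y00: "y 0 = y0" using yS[of 0] by (simp add: S_def)
    have yu: "y (Suc n) \<cdot>\<^bsub>C\<^esub> u n = y n" and ye: "(i, f) \<in> problems (X n) \<Longrightarrow> y (Suc n) \<cdot>\<^bsub>C\<^esub> e n i f = ext Y i (y n \<cdot>\<^bsub>C\<^esub> f)" for n i f
      using yT[of n] by (auto simp: T_def)
    have "pcone C UNIV nle X (nh C X u) (on_ob V Y) y" unfolding sc using yh yu Vo[OF YO] by blast
    then obtain v where v: "v \<in> hom C Z (on_ob V Y)" "\<And>n. n \<in> UNIV \<Longrightarrow> v \<cdot>\<^bsub>C\<^esub> c n = y n" by (rule pcolim_factor[OF pc]) blast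
    have "\<exists>w. w \<in> hom D Z' Y \<and> on_ar V w = v"
    proof (rule lift[OF Z'(1) YO])
      show "v \<in> hom C (on_ob V Z') (on_ob V Y)" using v Z' by simp
      fix i f assume i: "i \<in> Idx I" and f: "f \<in> hom C (dm i) (on_ob V Z')"
      obtain n f0 where f0: "f0 \<in> hom C (dm i) (X n)" "c n \<cdot>\<^bsub>C\<^esub> f0 = f"
        using finitely_presentable_directed(1)[OF cat fp[OF i] small_countable[OF countableI_type] nle_dirset sq pc] f unfolding Z'(2) by blast
      have k: "(i, f0) \<in> problems (X n)" using i f0 by (simp add: problemsI)
      have "v \<cdot>\<^bsub>C\<^esub> ext Z' i f = v \<cdot>\<^bsub>C\<^esub> (c (Suc n) \<cdot>\<^bsub>C\<^esub> e n i f0)" using eZe[OF k] f0(2) by simp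
      also have "\<dots> = ext Y i (y n \<cdot>\<^bsub>C\<^esub> f0)" using comp_reassoc[OF cat v(2)[OF UNIV_I] c(1) v(1) eh[OF k]] ye[OF k] by simp
      also have "y n \<cdot>\<^bsub>C\<^esub> f0 = v \<cdot>\<^bsub>C\<^esub> f" using comp_reassoc[OF cat v(2)[OF UNIV_I] c(1) v(1) f0(1)] f0(2) by simp
      finally show "v \<cdot>\<^bsub>C\<^esub> ext Z' i f = ext Y i (v \<cdot>\<^bsub>C\<^esub> f)" .
    qed
    then obtain w where w: "w \<in> hom D Z' Y" "on_ar V w = v" by blast
    show "\<exists>!w. w \<in> hom D Z' Y \<and> on_ar V w \<cdot>\<^bsub>C\<^esub> c 0 = y0"
    proof (rule ex1I[of _ w], intro conjI w(1))
      show "on_ar V w \<cdot>\<^bsub>C\<^esub> c 0 = y0" using w(2) v(2) y00 by simp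
      fix w' assume w': "w' \<in> hom D Z' Y \<and> on_ar V w' \<cdot>\<^bsub>C\<^esub> c 0 = y0"
      then have wh: "w' \<in> hom D Z' Y" and w0: "on_ar V w' \<cdot>\<^bsub>C\<^esub> c 0 = y0" by auto
      have Vw: "on_ar V w' \<in> hom C Z (on_ob V Y)" using Vh[OF wh] Z' by simp
      \<comment> \<open>Any competing morphism agrees with \<open>y\<close> at every stage: on the
        old part by induction, on new solutions because it preserves chosen extensions.\<close>
      have wn: "on_ar V w' \<cdot>\<^bsub>C\<^esub> c n = y n" for n
      proof (induction n)
        case 0
        then show ?case using w0 y00 by simp
      next
        case (Suc n)
        show ?case
        proof (rule ustep_eq[OF us RT comp_hom[OF cat c(1) Vw] yh])
          show "(on_ar V w' \<cdot>\<^bsub>C\<^esub> c (Suc n)) \<cdot>\<^bsub>C\<^esub> u n = y (Suc n) \<cdot>\<^bsub>C\<^esub> u n"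
            using comp_assoc[OF cat uh c(1) Vw] c(2) Suc yu by simp
          fix i f assume k: "(i, f) \<in> problems (X n)"
          then have i: "i \<in> Idx I" and f: "f \<in> hom C (dm i) (X n)" by (auto simp: problemsI)
          have cf: "c n \<cdot>\<^bsub>C\<^esub> f \<in> hom C (dm i) (on_ob V Z')" using comp_hom[OF cat f c(1)] Z' by simp
          have "(on_ar V w' \<cdot>\<^bsub>C\<^esub> c (Suc n)) \<cdot>\<^bsub>C\<^esub> e n i f = on_ar V w' \<cdot>\<^bsub>C\<^esub> ext Z' i (c n \<cdot>\<^bsub>C\<^esub> f)"
            using comp_assoc[OF cat eh[OF k] c(1) Vw] eZe[OF k] by simp
          also have "\<dots> = ext Y i (on_ar V w' \<cdot>\<^bsub>C\<^esub> (c n \<cdot>\<^bsub>C\<^esub> f))" by (rule mor_ext[OF wh i cf])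
          also have "on_ar V w' \<cdot>\<^bsub>C\<^esub> (c n \<cdot>\<^bsub>C\<^esub> f) = y n \<cdot>\<^bsub>C\<^esub> f" by (rule comp_reassoc[OF cat Suc c(1) Vw f])
          finally show "(on_ar V w' \<cdot>\<^bsub>C\<^esub> c (Suc n)) \<cdot>\<^bsub>C\<^esub> e n i f = y (Suc n) \<cdot>\<^bsub>C\<^esub> e n i f" using ye[OF k] by simp
        qed
      qed
      have "on_ar V w' = v" by (rule pcolim_eq[OF cat sq pc Vw v(1)]) (use wn v(2) in simp)
      then show "w' = w" using faith[OF wh w(1)] w(2) by simp
    qed
  qed
  moreover have "c 0 \<in> Cel" if sv0: "sv R0"
  proof (rule seq_Cel[OF uh pc])
    \<comment> \<open>Here monicity of cells enters. Distinct problems at stage \<open>n\<close>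
      could acquire equal images and hence two solutions for one problem; \<open>u n\<close> is
      cellular, thus monic, which excludes this and keeps the next step cellular.\<close>
    have svn: "sv (R n)" for n
    proof (induction n)
      case 0
      then show ?case using sv0 X0 by simp
    next
      case (Suc n)
      have "u n \<in> Cel" by (rule ustep_Cel[OF XO RT us Suc])
      then have mu: "u n \<in> Mono C" using mono by blast
      show ?case
        unfolding sv_def RS
      proof (intro allI impI)
        fix i f k k' assume "(i, f, k) \<in> {(i, u n \<cdot>\<^bsub>C\<^esub> f, e n i f) | i f. (i, f) \<in> problems (X n)}"
          "(i, f, k') \<in> {(i, u n \<cdot>\<^bsub>C\<^esub> f, e n i f) | i f. (i, f) \<in> problems (X n)}"
        then obtain f1 f2 where f: "(i, f1) \<in> problems (X n)" "(i, f2) \<in> problems (X n)" "f = u n \<cdot>\<^bsub>C\<^esub> f1" "f = u n \<cdot>\<^bsub>C\<^esub> f2"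
          "k = e n i f1" "k' = e n i f2" by blast
        have "f1 = f2" by (rule Mono_cancel[OF mu uh]) (use f in \<open>auto simp: problemsI\<close>)
        then show "k = k'" using f by simp
      qed
    qed
    show "u n \<in> Cel" for n by (rule ustep_Cel[OF XO RT us svn])
  qed
  ultimately show ?thesis by blast
qed

section \<open>Free objects, colimits and pushouts of algebraic injectives\<close>

lemma free_exists:
  assumes "X \<in> Ob C"
  shows "\<exists>Y t. uarrow C D V X Y t \<and> t \<in> Cel"
proof -
  \<comment> \<open>The empty structure is single-valued and respected by every morphism.\<close>
  obtain Y t where t: "reflects X {} Y t" "t \<in> Cel" using reflection[OF assms, of "{}"] by (auto simp: sv_def)
  then show ?thesis unfolding reflects_def uarrow_def resp_def by blast
qed

lemma D_loc:
  assumes "X \<in> Ob D" "Y \<in> Ob D" shows "small U (hom D X Y)"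
proof (rule small_inj_image[of "on_ar V"])
  show "inj_on (on_ar V) (hom D X Y)" by (rule inj_onI) (rule faith)
  show "small U (on_ar V ` hom D X Y)" by (rule small_subset[OF loc[OF Vo[OF assms(1)] Vo[OF assms(2)]]]) (use Vh in blast)
qed

text \<open>Take the colimit of the underlying objects and complete it so that all legs preserve
  chosen extensions. The inherited relation need not be single-valued, since the legs need not be
  monic or disjoint; only the existence of the reflection is used.\<close>

lemma D_relcoc: "relcoc U D"
  unfolding relcoc_def
proof (intro allI impI, elim conjE)
  fix J :: "'u set" and X and E :: "('u \<times> 'q \<times> 'u \<times> 'q) set"
  assume sJ: "small U J" and sE: "small U E" and wf: "rel_wf D J X E"
  define E' where "E' = (\<lambda>(j, a, k, b). (j, on_ar V a, k, on_ar V b)) ` E"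
  have XO: "X j \<in> Ob D" if "j \<in> J" for j using wf that by (simp add: rel_wf_def)
  have ED: "j \<in> J \<and> k \<in> J \<and> (\<exists>A. a \<in> hom D A (X j) \<and> b \<in> hom D A (X k))" if "(j, a, k, b) \<in> E" for j a k b
    using wf that unfolding rel_wf_def by blast
  have wf': "rel_wf C J (\<lambda>j. on_ob V (X j)) E'"
    unfolding rel_wf_def E'_def using Vo[OF XO] ED Vh by (auto simp: split_beta) blast
  obtain Z c where Zc: "relcolim C J (\<lambda>j. on_ob V (X j)) E' Z c"
    using relcoc_any[OF rc sJ _ wf'] small_image[OF sE] unfolding E'_def by blast
  have ZO: "Z \<in> Ob C" and c: "\<And>j. j \<in> J \<Longrightarrow> c j \<in> hom C (on_ob V (X j)) Z"
    and cE: "\<And>j a k b. (j, a, k, b) \<in> E \<Longrightarrow> c j \<cdot>\<^bsub>C\<^esub> on_ar V a = c k \<cdot>\<^bsub>C\<^esub> on_ar V b"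
    using relcolim_cone[OF Zc] unfolding relcone_def E'_def by auto
  \<comment> \<open>The chosen extensions of all \<open>X j\<close>, transported along the legs.
    Respecting \<open>R\<close> says exactly that the composites with the legs preserve chosen
    extensions.\<close>
  define R where "R = {(i, c j \<cdot>\<^bsub>C\<^esub> f, c j \<cdot>\<^bsub>C\<^esub> ext (X j) i f) | i f j. j \<in> J \<and> i \<in> Idx I \<and> f \<in> hom C (dm i) (on_ob V (X j))}"
  have R: "R \<subseteq> solutions Z"
  proof
    fix \<rho> assume "\<rho> \<in> R"
    then obtain i f j where \<rho>: "\<rho> = (i, c j \<cdot>\<^bsub>C\<^esub> f, c j \<cdot>\<^bsub>C\<^esub> ext (X j) i f)" and j: "j \<in> J" and i: "i \<in> Idx I" and f: "f \<in> hom C (dm i) (on_ob V (X j))"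
      unfolding R_def by blast
    note e = ext_hom[OF XO[OF j] i f]
    show "\<rho> \<in> solutions Z" unfolding \<rho> solutions_def
      using i comp_hom[OF cat f c[OF j]] comp_hom[OF cat e(1) c[OF j]] comp_assoc[OF cat al_hom[OF i] e(1) c[OF j]] e(2) by simp
  qed
  have respR: "resp R y Y \<longleftrightarrow> (\<forall>j \<in> J. \<forall>i \<in> Idx I. \<forall>f \<in> hom C (dm i) (on_ob V (X j)).
      (y \<cdot>\<^bsub>C\<^esub> c j) \<cdot>\<^bsub>C\<^esub> ext (X j) i f = ext Y i ((y \<cdot>\<^bsub>C\<^esub> c j) \<cdot>\<^bsub>C\<^esub> f))" if y: "y \<in> hom C Z W" for y Y W
  proof -
    have "(y \<cdot>\<^bsub>C\<^esub> c j) \<cdot>\<^bsub>C\<^esub> ext (X j) i f = y \<cdot>\<^bsub>C\<^esub> (c j \<cdot>\<^bsub>C\<^esub> ext (X j) i f)"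
         "(y \<cdot>\<^bsub>C\<^esub> c j) \<cdot>\<^bsub>C\<^esub> f = y \<cdot>\<^bsub>C\<^esub> (c j \<cdot>\<^bsub>C\<^esub> f)" if "j \<in> J" "i \<in> Idx I" "f \<in> hom C (dm i) (on_ob V (X j))" for i j f
      using comp_assoc[OF cat ext_hom(1)[OF XO[OF that(1)] that(2,3)] c[OF that(1)] y] comp_assoc[OF cat that(3) c[OF that(1)] y] by auto
    then show ?thesis unfolding resp_def R_def by auto blast
  qed
  obtain Z' t where rf: "reflects Z R Z' t" using reflection[OF ZO R] by blast
  then have Z': "Z' \<in> Ob D" and t: "t \<in> hom C Z (on_ob V Z')" and rt: "resp R t Z'"
    and ut: "\<And>Y y. Y \<in> Ob D \<Longrightarrow> y \<in> hom C Z (on_ob V Y) \<Longrightarrow> resp R y Y \<Longrightarrow> \<exists>!w. w \<in> hom D Z' Y \<and> on_ar V w \<cdot>\<^bsub>C\<^esub> t = y"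
    unfolding reflects_def by blast+
  have "\<exists>w. w \<in> hom D (X j) Z' \<and> on_ar V w = t \<cdot>\<^bsub>C\<^esub> c j" if j: "j \<in> J" for j
    by (rule lift[OF XO[OF j] Z' comp_hom[OF cat c[OF j] t]]) (use rt[unfolded respR[OF t]] j in blast)
  then obtain c' where c': "\<And>j. j \<in> J \<Longrightarrow> c' j \<in> hom D (X j) Z'" "\<And>j. j \<in> J \<Longrightarrow> on_ar V (c' j) = t \<cdot>\<^bsub>C\<^esub> c j" by metis
  have "relcolim D J X E Z' c'"
    unfolding relcolim_def
  proof (intro conjI allI impI)
    have "c' j \<cdot>\<^bsub>D\<^esub> a = c' k \<cdot>\<^bsub>D\<^esub> b" if r: "(j, a, k, b) \<in> E" for j a k b
    proof -
      obtain A where A: "j \<in> J" "k \<in> J" "a \<in> hom D A (X j)" "b \<in> hom D A (X k)" using ED[OF r] by blast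
      show ?thesis
        by (rule faith[OF comp_hom[OF catD A(3) c'(1)[OF A(1)]] comp_hom[OF catD A(4) c'(1)[OF A(2)]]])
          (use Vc[OF A(3) c'(1)[OF A(1)]] Vc[OF A(4) c'(1)[OF A(2)]] c'(2)[OF A(1)] c'(2)[OF A(2)]
            comp_assoc[OF cat Vh[OF A(3)] c[OF A(1)] t] comp_assoc[OF cat Vh[OF A(4)] c[OF A(2)] t] cE[OF r] in simp)
    qed
    then show "relcone D J X E Z' c'" unfolding relcone_def using Z' c' by auto
    fix Y d assume dc: "relcone D J X E Y d"
    then have YO: "Y \<in> Ob D" and d: "\<And>j. j \<in> J \<Longrightarrow> d j \<in> hom D (X j) Y"
      and dE: "\<And>j a k b. (j, a, k, b) \<in> E \<Longrightarrow> d j \<cdot>\<^bsub>D\<^esub> a = d k \<cdot>\<^bsub>D\<^esub> b" unfolding relcone_def by auto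
    have "on_ar V (d j) \<cdot>\<^bsub>C\<^esub> on_ar V a = on_ar V (d k) \<cdot>\<^bsub>C\<^esub> on_ar V b" if r: "(j, a, k, b) \<in> E" for j a k b
    proof -
      obtain A where A: "j \<in> J" "k \<in> J" "a \<in> hom D A (X j)" "b \<in> hom D A (X k)" using ED[OF r] by blast
      show ?thesis using Vc[OF A(3) d[OF A(1)]] Vc[OF A(4) d[OF A(2)]] dE[OF r] by simp
    qed
    then have "relcone C J (\<lambda>j. on_ob V (X j)) E' (on_ob V Y) (\<lambda>j. on_ar V (d j))"
      unfolding relcone_def E'_def using Vo[OF YO] Vh[OF d] by auto
    then obtain y where y: "y \<in> hom C Z (on_ob V Y)" "\<And>j. j \<in> J \<Longrightarrow> y \<cdot>\<^bsub>C\<^esub> c j = on_ar V (d j)"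
      using Zc unfolding relcolim_def by blast
    have "resp R y Y" unfolding respR[OF y(1)] using y(2) mor_ext[OF d] by simp
    then have ex: "\<exists>!w. w \<in> hom D Z' Y \<and> on_ar V w \<cdot>\<^bsub>C\<^esub> t = y" using ut[OF YO y(1)] by blast
    \<comment> \<open>Morphisms out of the reflection correspond to morphisms out of
      \<open>Z\<close>, so uniqueness passes between the two cocone conditions.\<close>
    have "on_ar V w \<cdot>\<^bsub>C\<^esub> t = y \<longleftrightarrow> (\<forall>j \<in> J. w \<cdot>\<^bsub>D\<^esub> c' j = d j)" if w: "w \<in> hom D Z' Y" for w
    proof -
      have 1: "(on_ar V w \<cdot>\<^bsub>C\<^esub> t) \<cdot>\<^bsub>C\<^esub> c j = on_ar V (w \<cdot>\<^bsub>D\<^esub> c' j)" if j: "j \<in> J" for j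
        using comp_assoc[OF cat c[OF j] t Vh[OF w]] Vc[OF c'(1)[OF j] w] c'(2)[OF j] by simp
      show ?thesis
      proof
        assume e: "on_ar V w \<cdot>\<^bsub>C\<^esub> t = y"
        show "\<forall>j \<in> J. w \<cdot>\<^bsub>D\<^esub> c' j = d j"
        proof
          fix j assume j: "j \<in> J"
          show "w \<cdot>\<^bsub>D\<^esub> c' j = d j" by (rule faith[OF comp_hom[OF catD c'(1)[OF j] w] d[OF j]]) (use 1[OF j] e y(2)[OF j] in simp)
        qed
      next
        assume e: "\<forall>j \<in> J. w \<cdot>\<^bsub>D\<^esub> c' j = d j"
        show "on_ar V w \<cdot>\<^bsub>C\<^esub> t = y"
          by (rule relcolim_eq[OF cat wf' Zc comp_hom[OF cat t Vh[OF w]] y(1)]) (use 1 e y(2) in simp)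
      qed
    qed
    with ex show "\<exists>!w. w \<in> hom D Z' Y \<and> (\<forall>j \<in> J. w \<cdot>\<^bsub>D\<^esub> c' j = d j)" by metis
  qed
  then show "\<exists>Z c. relcolim D J X E Z c" by blast
qed

text \<open>The pushout in \<open>D\<close> of free morphisms: push out in \<open>C\<close> and complete the partial structure on
  the result that is inherited from \<open>X\<close>; it is single-valued because \<open>p\<close> is monic.\<close>

lemma mpush_step:
  assumes X: "X \<in> Ob D" and \<beta>: "\<And>j. j \<in> J \<Longrightarrow> \<beta> j \<in> hom C (a j) (b j)" and \<gamma>: "\<And>j. j \<in> J \<Longrightarrow> \<gamma> j \<in> hom D (a' j) (b' j)"
    and ua: "\<And>j. j \<in> J \<Longrightarrow> uarrow C D V (a j) (a' j) (\<eta>a j)" and ub: "\<And>j. j \<in> J \<Longrightarrow> uarrow C D V (b j) (b' j) (\<eta>b j)"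
    and nat: "\<And>j. j \<in> J \<Longrightarrow> on_ar V (\<gamma> j) \<cdot>\<^bsub>C\<^esub> \<eta>a j = \<eta>b j \<cdot>\<^bsub>C\<^esub> \<beta> j"
    and G: "\<And>j. j \<in> J \<Longrightarrow> G j \<in> hom D (a' j) X"
    and mD: "mpush D X J \<gamma> G X' p' e'"
    and mC: "mpush C (on_ob V X) J \<beta> (\<lambda>j. on_ar V (G j) \<cdot>\<^bsub>C\<^esub> \<eta>a j) P p e" and p: "p \<in> Cel"
  shows "\<exists>t. t \<in> hom C P (on_ob V X') \<and> t \<in> Cel \<and> t \<cdot>\<^bsub>C\<^esub> p = on_ar V p' \<and> (\<forall>j \<in> J. t \<cdot>\<^bsub>C\<^esub> e j = on_ar V (e' j) \<cdot>\<^bsub>C\<^esub> \<eta>b j)"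
proof -
  note \<eta>a = uarrowD(2)[OF ua] and \<eta>b = uarrowD(2)[OF ub]
  define g where "g j = on_ar V (G j) \<cdot>\<^bsub>C\<^esub> \<eta>a j" for j
  note mC = mC[folded g_def]
  have gh: "g j \<in> hom C (a j) (on_ob V X)" if "j \<in> J" for j unfolding g_def by (rule comp_hom[OF cat \<eta>a[OF that] Vh[OF G[OF that]]])
  have cod\<beta>: "Cod C (\<beta> j) = b j" "Dom C (\<beta> j) = a j" if "j \<in> J" for j using \<beta>[OF that] by (auto simp: hom_def)
  have cod\<gamma>: "Cod D (\<gamma> j) = b' j" "Dom D (\<gamma> j) = a' j" if "j \<in> J" for j using \<gamma>[OF that] by (auto simp: hom_def)
  have wfC: "mwf C (on_ob V X) J \<beta> g" using Vo[OF X] \<beta> gh by (auto simp: mwf_def hom_def)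
  have wfD': "mwf D X J \<gamma> G" using X \<gamma> G by (auto simp: mwf_def hom_def)
  have ph: "p \<in> hom C (on_ob V X) P" and eh: "\<And>j. j \<in> J \<Longrightarrow> e j \<in> hom C (b j) P" and ec: "\<And>j. j \<in> J \<Longrightarrow> e j \<cdot>\<^bsub>C\<^esub> \<beta> j = p \<cdot>\<^bsub>C\<^esub> g j"
    using mpushD[OF mC] cod\<beta> by auto
  have PO: "P \<in> Ob C" by (rule hom_cod[OF cat ph])
  have pm: "p \<in> Mono C" using p mono by blast
  define R where "R = {(i, p \<cdot>\<^bsub>C\<^esub> f, p \<cdot>\<^bsub>C\<^esub> ext X i f) | i f. i \<in> Idx I \<and> f \<in> hom C (dm i) (on_ob V X)}"
  have R: "R \<subseteq> solutions P"
    unfolding R_def solutions_def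
    using comp_hom[OF cat _ ph] ext_hom[OF X] comp_assoc[OF cat al_hom ext_hom(1)[OF X] ph] by auto
  have sv: "sv R"
    unfolding sv_def
  proof (intro allI impI)
    fix i f k k' assume "(i, f, k) \<in> R" "(i, f, k') \<in> R"
    then obtain f1 f2 where f: "f1 \<in> hom C (dm i) (on_ob V X)" "f2 \<in> hom C (dm i) (on_ob V X)" "f = p \<cdot>\<^bsub>C\<^esub> f1" "f = p \<cdot>\<^bsub>C\<^esub> f2"
      "k = p \<cdot>\<^bsub>C\<^esub> ext X i f1" "k' = p \<cdot>\<^bsub>C\<^esub> ext X i f2" unfolding R_def by blast
    have "f1 = f2" by (rule Mono_cancel[OF pm ph f(1,2)]) (use f in simp)
    then show "k = k'" using f by simp
  qed
  have respR: "resp R y Y \<longleftrightarrow> (\<forall>i \<in> Idx I. \<forall>f \<in> hom C (dm i) (on_ob V X).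
      (y \<cdot>\<^bsub>C\<^esub> p) \<cdot>\<^bsub>C\<^esub> ext X i f = ext Y i ((y \<cdot>\<^bsub>C\<^esub> p) \<cdot>\<^bsub>C\<^esub> f))" if y: "y \<in> hom C P W" for y Y W
  proof -
    have "(y \<cdot>\<^bsub>C\<^esub> p) \<cdot>\<^bsub>C\<^esub> ext X i f = y \<cdot>\<^bsub>C\<^esub> (p \<cdot>\<^bsub>C\<^esub> ext X i f)"
         "(y \<cdot>\<^bsub>C\<^esub> p) \<cdot>\<^bsub>C\<^esub> f = y \<cdot>\<^bsub>C\<^esub> (p \<cdot>\<^bsub>C\<^esub> f)" if "i \<in> Idx I" "f \<in> hom C (dm i) (on_ob V X)" for i f
      using comp_assoc[OF cat ext_hom(1)[OF X that] ph y] comp_assoc[OF cat that(2) ph y] by auto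
    then show ?thesis unfolding resp_def R_def by auto blast
  qed
  obtain Z' t where rf: "reflects P R Z' t" and tC: "t \<in> Cel" using reflection[OF PO R] sv by blast
  then have Z': "Z' \<in> Ob D" and t: "t \<in> hom C P (on_ob V Z')" and rt: "resp R t Z'"
    and ut: "\<And>Y y. Y \<in> Ob D \<Longrightarrow> y \<in> hom C P (on_ob V Y) \<Longrightarrow> resp R y Y \<Longrightarrow> \<exists>!w. w \<in> hom D Z' Y \<and> on_ar V w \<cdot>\<^bsub>C\<^esub> t = y"
    unfolding reflects_def by blast+
  have "\<exists>w. w \<in> hom D X Z' \<and> on_ar V w = t \<cdot>\<^bsub>C\<^esub> p"
    by (rule lift[OF X Z' comp_hom[OF cat ph t]]) (use rt[unfolded respR[OF t]] in blast)
  then obtain q where q: "q \<in> hom D X Z'" "on_ar V q = t \<cdot>\<^bsub>C\<^esub> p" by blast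
  \<comment> \<open>The object \<open>b' j\<close> is free on \<open>b j\<close>, so the pushout leg
    \<open>e j\<close> followed by \<open>t\<close> extends to a unique morphism in
    \<open>D\<close>.\<close>
  have "\<exists>\<epsilon>. \<epsilon> \<in> hom D (b' j) Z' \<and> on_ar V \<epsilon> \<cdot>\<^bsub>C\<^esub> \<eta>b j = t \<cdot>\<^bsub>C\<^esub> e j" if "j \<in> J" for j
    by (rule uarrowD(3)[OF ub[OF that] Z' comp_hom[OF cat eh[OF that] t]])
  then obtain \<epsilon> where \<epsilon>: "\<And>j. j \<in> J \<Longrightarrow> \<epsilon> j \<in> hom D (b' j) Z'" "\<And>j. j \<in> J \<Longrightarrow> on_ar V (\<epsilon> j) \<cdot>\<^bsub>C\<^esub> \<eta>b j = t \<cdot>\<^bsub>C\<^esub> e j" by metis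
  have "mpush D X J \<gamma> G Z' q \<epsilon>"
  proof (rule mpushI)
    show "mcone D X J \<gamma> G Z' q \<epsilon>"
    proof (rule mconeI[OF q(1)])
      fix j assume j: "j \<in> J"
      show "\<epsilon> j \<in> hom D (Cod D (\<gamma> j)) Z'" using \<epsilon>(1)[OF j] cod\<gamma>[OF j] by simp
      show "\<epsilon> j \<cdot>\<^bsub>D\<^esub> \<gamma> j = q \<cdot>\<^bsub>D\<^esub> G j"
      proof (rule uarrow_eq[OF V ua[OF j] comp_hom[OF catD \<gamma>[OF j] \<epsilon>(1)[OF j]] comp_hom[OF catD G[OF j] q(1)]])
        have "on_ar V (\<epsilon> j \<cdot>\<^bsub>D\<^esub> \<gamma> j) \<cdot>\<^bsub>C\<^esub> \<eta>a j = on_ar V (\<epsilon> j) \<cdot>\<^bsub>C\<^esub> (\<eta>b j \<cdot>\<^bsub>C\<^esub> \<beta> j)"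
          using Vc[OF \<gamma>[OF j] \<epsilon>(1)[OF j]] comp_assoc[OF cat \<eta>a[OF j] Vh[OF \<gamma>[OF j]] Vh[OF \<epsilon>(1)[OF j]]] nat[OF j] by simp
        also have "\<dots> = (t \<cdot>\<^bsub>C\<^esub> e j) \<cdot>\<^bsub>C\<^esub> \<beta> j"
          using comp_reassoc[OF cat \<epsilon>(2)[OF j] \<eta>b[OF j] Vh[OF \<epsilon>(1)[OF j]] \<beta>[OF j]] .
        also have "\<dots> = (t \<cdot>\<^bsub>C\<^esub> p) \<cdot>\<^bsub>C\<^esub> g j"
          using comp_assoc[OF cat \<beta>[OF j] eh[OF j] t] comp_assoc[OF cat gh[OF j] ph t] ec[OF j] by simp
        also have "\<dots> = on_ar V (q \<cdot>\<^bsub>D\<^esub> G j) \<cdot>\<^bsub>C\<^esub> \<eta>a j"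
          using Vc[OF G[OF j] q(1)] comp_assoc[OF cat \<eta>a[OF j] Vh[OF G[OF j]] Vh[OF q(1)]] q(2) by (simp add: g_def)
        finally show "on_ar V (\<epsilon> j \<cdot>\<^bsub>D\<^esub> \<gamma> j) \<cdot>\<^bsub>C\<^esub> \<eta>a j = on_ar V (q \<cdot>\<^bsub>D\<^esub> G j) \<cdot>\<^bsub>C\<^esub> \<eta>a j" .
      qed
    qed
  next
    fix Y q' \<epsilon>' assume "mcone D X J \<gamma> G Y q' \<epsilon>'"
    note m = mconeD[OF this]
    have q': "q' \<in> hom D X Y" by (rule m(1))
    have \<epsilon>': "\<epsilon>' j \<in> hom D (b' j) Y" if "j \<in> J" for j using m(2)[OF that] cod\<gamma>[OF that] by simp
    have YO: "Y \<in> Ob D" by (rule hom_cod[OF catD q'])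
    have "mcone C (on_ob V X) J \<beta> g (on_ob V Y) (on_ar V q') (\<lambda>j. on_ar V (\<epsilon>' j) \<cdot>\<^bsub>C\<^esub> \<eta>b j)"
    proof (rule mconeI[OF Vh[OF q']])
      fix j assume j: "j \<in> J"
      show "on_ar V (\<epsilon>' j) \<cdot>\<^bsub>C\<^esub> \<eta>b j \<in> hom C (Cod C (\<beta> j)) (on_ob V Y)"
        using comp_hom[OF cat \<eta>b[OF j] Vh[OF \<epsilon>'[OF j]]] cod\<beta>[OF j] by simp
      have "(on_ar V (\<epsilon>' j) \<cdot>\<^bsub>C\<^esub> \<eta>b j) \<cdot>\<^bsub>C\<^esub> \<beta> j = on_ar V (\<epsilon>' j \<cdot>\<^bsub>D\<^esub> \<gamma> j) \<cdot>\<^bsub>C\<^esub> \<eta>a j"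
        using comp_assoc[OF cat \<beta>[OF j] \<eta>b[OF j] Vh[OF \<epsilon>'[OF j]]] nat[OF j] Vc[OF \<gamma>[OF j] \<epsilon>'[OF j]]
          comp_assoc[OF cat \<eta>a[OF j] Vh[OF \<gamma>[OF j]] Vh[OF \<epsilon>'[OF j]]] by simp
      then show "(on_ar V (\<epsilon>' j) \<cdot>\<^bsub>C\<^esub> \<eta>b j) \<cdot>\<^bsub>C\<^esub> \<beta> j = on_ar V q' \<cdot>\<^bsub>C\<^esub> g j"
        using m(3)[OF j] Vc[OF G[OF j] q'] comp_assoc[OF cat \<eta>a[OF j] Vh[OF G[OF j]] Vh[OF q']] by (simp add: g_def)
    qed
    then obtain y where y: "y \<in> hom C P (on_ob V Y)" "y \<cdot>\<^bsub>C\<^esub> p = on_ar V q'" "\<And>j. j \<in> J \<Longrightarrow> y \<cdot>\<^bsub>C\<^esub> e j = on_ar V (\<epsilon>' j) \<cdot>\<^bsub>C\<^esub> \<eta>b j"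
      by (rule mpush_factor[OF mC]) blast
    have "resp R y Y" unfolding respR[OF y(1)] y(2) using mor_ext[OF q'] by simp
    then obtain w where w: "w \<in> hom D Z' Y" "on_ar V w \<cdot>\<^bsub>C\<^esub> t = y" using ut[OF YO y(1)] by blast
    have "w \<cdot>\<^bsub>D\<^esub> q = q'"
      by (rule faith[OF comp_hom[OF catD q(1) w(1)] q'])
        (use Vc[OF q(1) w(1)] q(2) comp_assoc[OF cat ph t Vh[OF w(1)]] w(2) y(2) in simp)
    moreover have "w \<cdot>\<^bsub>D\<^esub> \<epsilon> j = \<epsilon>' j" if j: "j \<in> J" for j
      by (rule uarrow_eq[OF V ub[OF j] comp_hom[OF catD \<epsilon>(1)[OF j] w(1)] \<epsilon>'[OF j]])
        (use Vc[OF \<epsilon>(1)[OF j] w(1)] comp_assoc[OF cat \<eta>b[OF j] Vh[OF \<epsilon>(1)[OF j]] Vh[OF w(1)]] \<epsilon>(2)[OF j]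
          comp_assoc[OF cat eh[OF j] t Vh[OF w(1)]] w(2) y(3)[OF j] in simp)
    ultimately show "\<exists>w. w \<in> hom D Z' Y \<and> w \<cdot>\<^bsub>D\<^esub> q = q' \<and> (\<forall>j \<in> J. w \<cdot>\<^bsub>D\<^esub> \<epsilon> j = \<epsilon>' j)" using w(1) by blast
  next
    fix Y x y assume x: "x \<in> hom D Z' Y" and y: "y \<in> hom D Z' Y" and xy: "x \<cdot>\<^bsub>D\<^esub> q = y \<cdot>\<^bsub>D\<^esub> q"
      and xe: "\<And>j. j \<in> J \<Longrightarrow> x \<cdot>\<^bsub>D\<^esub> \<epsilon> j = y \<cdot>\<^bsub>D\<^esub> \<epsilon> j"
    have YO: "Y \<in> Ob D" by (rule hom_cod[OF catD x])
    have 1: "(on_ar V w \<cdot>\<^bsub>C\<^esub> t) \<cdot>\<^bsub>C\<^esub> p = on_ar V (w \<cdot>\<^bsub>D\<^esub> q)" if w: "w \<in> hom D Z' Y" for w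
      using Vc[OF q(1) w] q(2) comp_assoc[OF cat ph t Vh[OF w]] by simp
    have 2: "(on_ar V w \<cdot>\<^bsub>C\<^esub> t) \<cdot>\<^bsub>C\<^esub> e j = on_ar V (w \<cdot>\<^bsub>D\<^esub> \<epsilon> j) \<cdot>\<^bsub>C\<^esub> \<eta>b j" if w: "w \<in> hom D Z' Y" and j: "j \<in> J" for w j
      using Vc[OF \<epsilon>(1)[OF j] w] \<epsilon>(2)[OF j] comp_assoc[OF cat eh[OF j] t Vh[OF w]] comp_assoc[OF cat \<eta>b[OF j] Vh[OF \<epsilon>(1)[OF j]] Vh[OF w]] by simp
    \<comment> \<open>Two morphisms from \<open>Z'\<close> are compared on \<open>P\<close>, where
      the base \<open>X\<close> and the attached objects are jointly epic; \<open>t\<close> being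
      universal then gives equality in \<open>D\<close>.\<close>
    have e: "on_ar V x \<cdot>\<^bsub>C\<^esub> t = on_ar V y \<cdot>\<^bsub>C\<^esub> t"
      by (rule mpush_eq[OF cat wfC mC comp_hom[OF cat t Vh[OF x]] comp_hom[OF cat t Vh[OF y]]])
        (use 1[OF x] 1[OF y] 2[OF x] 2[OF y] xy xe in auto)
    have "\<exists>!w. w \<in> hom D Z' Y \<and> on_ar V w \<cdot>\<^bsub>C\<^esub> t = on_ar V y \<cdot>\<^bsub>C\<^esub> t"
      by (rule ut[OF YO comp_hom[OF cat t Vh[OF y]] resp_comp[OF PO R t rt y]])
    then show "x = y" using x y e by blast
  qed
  \<comment> \<open>The constructed pushout is moved onto the given one; correcting \<open>t\<close>
    by the image of this isomorphism keeps it cellular.\<close>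
  then obtain i where i: "iso_ar D Z' X' i" "i \<cdot>\<^bsub>D\<^esub> q = p'" "\<And>j. j \<in> J \<Longrightarrow> i \<cdot>\<^bsub>D\<^esub> \<epsilon> j = e' j"
    using mpush_iso[OF catD wfD' _ mD] by blast
  note ih = iso_hom[OF i(1)]
  show ?thesis
  proof (intro exI[of _ "on_ar V i \<cdot>\<^bsub>C\<^esub> t"] conjI ballI)
    show "on_ar V i \<cdot>\<^bsub>C\<^esub> t \<in> hom C P (on_ob V X')" by (rule comp_hom[OF cat t Vh[OF ih]])
    show "on_ar V i \<cdot>\<^bsub>C\<^esub> t \<in> Cel" by (rule comp_Cel[OF tC iso_Cel[OF functor_iso[OF V i(1)]] t Vh[OF ih]])
    show "(on_ar V i \<cdot>\<^bsub>C\<^esub> t) \<cdot>\<^bsub>C\<^esub> p = on_ar V p'"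
      using comp_assoc[OF cat ph t Vh[OF ih]] q(2) Vc[OF q(1) ih] i(2) by simp
    show "(on_ar V i \<cdot>\<^bsub>C\<^esub> t) \<cdot>\<^bsub>C\<^esub> e j = on_ar V (e' j) \<cdot>\<^bsub>C\<^esub> \<eta>b j" if j: "j \<in> J" for j
      using comp_assoc[OF cat eh[OF j] t Vh[OF ih]] \<epsilon>(2)[OF j] Vc[OF \<epsilon>(1)[OF j] ih] i(3)[OF j]
        comp_assoc[OF cat \<eta>b[OF j] Vh[OF \<epsilon>(1)[OF j]] Vh[OF ih]] by simp
  qed
qed

end

text \<open>The structure \<open>ext\<close> is the second component of the object map of the
  isomorphism \<open>\<Phi>\<close>. Surjectivity of \<open>\<Phi>\<close> realizes every structure
  and every structure-preserving morphism; injectivity on arrows gives faithfulness.\<close>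

lemma alg_inj_forget_structure:
  fixes C :: "('o, 'm) cat" and I :: "('i, 'm) family" and D :: "('p, 'q) cat" and V :: "('p, 'q, 'o, 'm) fctr"
  assumes "is_alg_inj_forget C I D V"
  shows "\<exists>ext :: 'p \<Rightarrow> 'i \<Rightarrow> 'm \<Rightarrow> 'm.
    (\<forall>Y. Y \<in> Ob D \<longrightarrow> ext_structure C I (on_ob V Y) (ext Y)) \<and>
    (\<forall>X Y w i f. w \<in> hom D X Y \<longrightarrow> i \<in> Idx I \<longrightarrow> f \<in> hom C (Dom C (mor I i)) (on_ob V X) \<longrightarrow>
        on_ar V w \<cdot>\<^bsub>C\<^esub> ext X i f = ext Y i (on_ar V w \<cdot>\<^bsub>C\<^esub> f)) \<and>
    (\<forall>X Y u. X \<in> Ob D \<longrightarrow> Y \<in> Ob D \<longrightarrow> u \<in> hom C (on_ob V X) (on_ob V Y) \<longrightarrow>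
        (\<forall>i f. i \<in> Idx I \<longrightarrow> f \<in> hom C (Dom C (mor I i)) (on_ob V X) \<longrightarrow> u \<cdot>\<^bsub>C\<^esub> ext X i f = ext Y i (u \<cdot>\<^bsub>C\<^esub> f)) \<longrightarrow>
        (\<exists>w. w \<in> hom D X Y \<and> on_ar V w = u)) \<and>
    (\<forall>X Y w w'. w \<in> hom D X Y \<longrightarrow> w' \<in> hom D X Y \<longrightarrow> on_ar V w = on_ar V w' \<longrightarrow> w = w') \<and>
    (\<forall>Z c. Z \<in> Ob C \<longrightarrow> ext_structure C I Z c \<longrightarrow> (\<exists>Y. Y \<in> Ob D \<and> on_ob V Y = Z \<and> ext Y = c))"
proof -
  obtain \<Phi> where iso: "is_isomorphism D (alg_inj C I) \<Phi>"
    and Vo: "\<And>X. X \<in> Ob D \<Longrightarrow> on_ob V X = fst (on_ob \<Phi> X)"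
    and Va: "\<And>f. f \<in> Ar D \<Longrightarrow> on_ar V f = fst (snd (on_ar \<Phi> f))"
    using assms unfolding is_alg_inj_forget_def alg_inj_forget_def by auto
  have F: "is_functor D (alg_inj C I) \<Phi>" and bo: "bij_betw (on_ob \<Phi>) (Ob D) (Ob (alg_inj C I))"
    and ba: "bij_betw (on_ar \<Phi>) (Ar D) (Ar (alg_inj C I))" using iso by (auto simp: is_isomorphism_def)
  note cD = functor_cats(1)[OF F]
  define ext where "ext Y = snd (on_ob \<Phi> Y)" for Y
  have ob: "on_ob V Y \<in> Ob C \<and> ext_structure C I (on_ob V Y) (ext Y)" if "Y \<in> Ob D" for Y
    using functor_ob[OF F that] Vo[OF that] by (auto simp: alg_inj_def ext_def split_beta)
  have ar: "on_ar \<Phi> w = (on_ob \<Phi> X, on_ar V w, on_ob \<Phi> Y) \<and> X \<in> Ob D \<and> Y \<in> Ob D \<and> on_ar \<Phi> w \<in> Ar (alg_inj C I)" if "w \<in> hom D X Y" for X Y w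
  proof -
    have "on_ar \<Phi> w \<in> hom (alg_inj C I) (on_ob \<Phi> X) (on_ob \<Phi> Y)" by (rule functor_hom[OF F that])
    moreover have "w \<in> Ar D" using that by (simp add: hom_def)
    ultimately show ?thesis using Va hom_dom[OF cD that] hom_cod[OF cD that]
      by (simp add: hom_def alg_inj_def) (metis prod.collapse)
  qed
  have 1: "on_ar V w \<cdot>\<^bsub>C\<^esub> ext X i f = ext Y i (on_ar V w \<cdot>\<^bsub>C\<^esub> f)"
    if "w \<in> hom D X Y" "i \<in> Idx I" "f \<in> hom C (Dom C (mor I i)) (on_ob V X)" for X Y w i f
  proof -
    have "X \<in> Ob D" "Y \<in> Ob D" using ar[OF that(1)] by auto
    then have eX: "on_ob \<Phi> X = (on_ob V X, ext X)" "on_ob \<Phi> Y = (on_ob V Y, ext Y)" using Vo by (simp_all add: ext_def)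
    show ?thesis using ar[OF that(1)] that(2,3) unfolding eX by (auto simp: alg_inj_def)
  qed
  have 2: "\<exists>w. w \<in> hom D X Y \<and> on_ar V w = u" if X: "X \<in> Ob D" and Y: "Y \<in> Ob D" and u: "u \<in> hom C (on_ob V X) (on_ob V Y)"
    and c: "\<forall>i f. i \<in> Idx I \<longrightarrow> f \<in> hom C (Dom C (mor I i)) (on_ob V X) \<longrightarrow> u \<cdot>\<^bsub>C\<^esub> ext X i f = ext Y i (u \<cdot>\<^bsub>C\<^esub> f)" for X Y u
  proof -
    have eX: "on_ob \<Phi> X = (on_ob V X, ext X)" "on_ob \<Phi> Y = (on_ob V Y, ext Y)" using Vo X Y by (simp_all add: ext_def)
    have "(on_ob \<Phi> X, u, on_ob \<Phi> Y) \<in> Ar (alg_inj C I)"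
      unfolding eX using ob[OF X] ob[OF Y] u c by (auto simp: alg_inj_def)
    then have "(on_ob \<Phi> X, u, on_ob \<Phi> Y) \<in> on_ar \<Phi> ` Ar D" using bij_betw_imp_surj_on[OF ba] by simp
    then obtain w where w: "w \<in> Ar D" "on_ar \<Phi> w = (on_ob \<Phi> X, u, on_ob \<Phi> Y)" by auto
    have wh: "w \<in> hom D (Dom D w) (Cod D w)" by (rule hom_self[OF w(1)])
    have "on_ob \<Phi> (Dom D w) = on_ob \<Phi> X" "on_ob \<Phi> (Cod D w) = on_ob \<Phi> Y" "on_ar V w = u" using ar[OF wh] w(2) by auto
    moreover have "Dom D w \<in> Ob D" "Cod D w \<in> Ob D" using ar[OF wh] by auto
    \<comment> \<open>Surjectivity on arrows yields some preimage; its endpoints are the intended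
      ones because \<open>\<Phi>\<close> is injective on objects.\<close>
    ultimately have "Dom D w = X" "Cod D w = Y" using bo X Y unfolding bij_betw_def by (auto dest: inj_onD)
    then show ?thesis using wh \<open>on_ar V w = u\<close> by auto
  qed
  have 3: "w = w'" if "w \<in> hom D X Y" "w' \<in> hom D X Y" "on_ar V w = on_ar V w'" for X Y w w'
  proof -
    have "on_ar \<Phi> w = on_ar \<Phi> w'" using ar[OF that(1)] ar[OF that(2)] that(3) by simp
    then show ?thesis using ba that unfolding bij_betw_def hom_def by (auto dest: inj_onD)
  qed
  have 4: "\<exists>Y. Y \<in> Ob D \<and> on_ob V Y = Z \<and> ext Y = c" if "Z \<in> Ob C" "ext_structure C I Z c" for Z c
  proof -
    have "(Z, c) \<in> Ob (alg_inj C I)" using that by (simp add: alg_inj_def)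
    then have "(Z, c) \<in> on_ob \<Phi> ` Ob D" using bij_betw_imp_surj_on[OF bo] by simp
    then obtain Y where "Y \<in> Ob D" "on_ob \<Phi> Y = (Z, c)" by auto
    then show ?thesis using Vo by (auto simp: ext_def)
  qed
  show ?thesis
    by (rule exI[of _ ext]) (use ob 1 2 3 4 in blast)
qed


section \<open>Universal arrows and adjoints\<close>

lemma left_adjoint_uarrow:
  assumes "left_adjoint C D V F \<eta>" "X \<in> Ob C"
  shows "uarrow C D V X (on_ob F X) (\<eta> X)"
  using assms functor_ob[of C D F X] unfolding left_adjoint_def uarrow_def by blast

lemma left_adjoint_exists:
  assumes V: "is_functor D C V" and u: "\<And>X. X \<in> Ob C \<Longrightarrow> \<exists>Y t. uarrow C D V X Y t"
  shows "\<exists>F \<eta>. left_adjoint C D V F \<eta>"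
proof -
  note cD = functor_cats(1)[OF V] and cC = functor_cats(2)[OF V]
  obtain F0 \<eta> where U: "\<And>X. X \<in> Ob C \<Longrightarrow> uarrow C D V X (F0 X) (\<eta> X)" using u by metis
  note UD = uarrowD[OF U]
  have "\<exists>g. g \<in> hom D (F0 (Dom C f)) (F0 (Cod C f)) \<and> on_ar V g \<cdot>\<^bsub>C\<^esub> \<eta> (Dom C f) = \<eta> (Cod C f) \<cdot>\<^bsub>C\<^esub> f" if "f \<in> Ar C" for f
  proof -
    have fh: "f \<in> hom C (Dom C f) (Cod C f)" by (rule hom_self[OF that])
    note d = hom_dom[OF cC fh] and c = hom_cod[OF cC fh]
    show ?thesis by (rule UD(3)[OF d UD(1)[OF c] comp_hom[OF cC fh UD(2)[OF c]]])
  qed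
  then obtain F1 where F1: "\<And>f. f \<in> Ar C \<Longrightarrow> F1 f \<in> hom D (F0 (Dom C f)) (F0 (Cod C f)) \<and> on_ar V (F1 f) \<cdot>\<^bsub>C\<^esub> \<eta> (Dom C f) = \<eta> (Cod C f) \<cdot>\<^bsub>C\<^esub> f"
    by metis
  have F1h: "F1 f \<in> hom D (F0 X) (F0 Y)" "on_ar V (F1 f) \<cdot>\<^bsub>C\<^esub> \<eta> X = \<eta> Y \<cdot>\<^bsub>C\<^esub> f" if "f \<in> hom C X Y" for f X Y
    using F1[of f] that by (auto simp: hom_def)
  define F where "F = \<lparr>on_ob = F0, on_ar = F1\<rparr>"
  have "is_functor C D F"
    unfolding is_functor_def
  proof (intro conjI ballI impI cC cD)
    show "on_ob F X \<in> Ob D" if "X \<in> Ob C" for X using UD(1)[OF that] by (simp add: F_def)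
    show "on_ar F f \<in> hom D (on_ob F (Dom C f)) (on_ob F (Cod C f))" if "f \<in> Ar C" for f using F1[OF that] by (simp add: F_def)
    show "on_ar F (Idt C X) = Idt D (on_ob F X)" if X: "X \<in> Ob C" for X
    proof -
      note i = id_hom[OF cC X] and j = id_hom[OF cD UD(1)[OF X]]
      have "F1 (Idt C X) = Idt D (F0 X)"
        by (rule uarrow_eq[OF V U[OF X] F1h(1)[OF i] j])
          (use F1h(2)[OF i] id_right[OF cC UD(2)[OF X]] id_left[OF cC UD(2)[OF X]] functor_id[OF V UD(1)[OF X]] in simp)
      then show ?thesis by (simp add: F_def)
    qed
    show "on_ar F (g \<cdot>\<^bsub>C\<^esub> f) = on_ar F g \<cdot>\<^bsub>D\<^esub> on_ar F f" if "f \<in> Ar C" "g \<in> Ar C" "Cod C f = Dom C g" for f g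
    proof -
      define X Y Z where "X = Dom C f" and "Y = Cod C f" and "Z = Cod C g"
      have f: "f \<in> hom C X Y" and g: "g \<in> hom C Y Z" using that by (auto simp: hom_def X_def Y_def Z_def)
      note XO = hom_dom[OF cC f] and YO = hom_cod[OF cC f] and ZO = hom_cod[OF cC g]
      note gf = comp_hom[OF cC f g]
      have "F1 (g \<cdot>\<^bsub>C\<^esub> f) = F1 g \<cdot>\<^bsub>D\<^esub> F1 f"
      proof (rule uarrow_eq[OF V U[OF XO] F1h(1)[OF gf] comp_hom[OF cD F1h(1)[OF f] F1h(1)[OF g]]])
        have "on_ar V (F1 g \<cdot>\<^bsub>D\<^esub> F1 f) \<cdot>\<^bsub>C\<^esub> \<eta> X = on_ar V (F1 g) \<cdot>\<^bsub>C\<^esub> (\<eta> Y \<cdot>\<^bsub>C\<^esub> f)"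
          using functor_comp[OF V F1h(1)[OF f] F1h(1)[OF g]] F1h(2)[OF f]
            comp_assoc[OF cC UD(2)[OF XO] functor_hom[OF V F1h(1)[OF f]] functor_hom[OF V F1h(1)[OF g]]] by simp
        also have "\<dots> = (\<eta> Z \<cdot>\<^bsub>C\<^esub> g) \<cdot>\<^bsub>C\<^esub> f"
          by (rule comp_reassoc[OF cC F1h(2)[OF g] UD(2)[OF YO] functor_hom[OF V F1h(1)[OF g]] f])
        also have "\<dots> = on_ar V (F1 (g \<cdot>\<^bsub>C\<^esub> f)) \<cdot>\<^bsub>C\<^esub> \<eta> X"
          using F1h(2)[OF gf] comp_assoc[OF cC f g UD(2)[OF ZO]] by simp
        finally show "on_ar V (F1 (g \<cdot>\<^bsub>C\<^esub> f)) \<cdot>\<^bsub>C\<^esub> \<eta> X = on_ar V (F1 g \<cdot>\<^bsub>D\<^esub> F1 f) \<cdot>\<^bsub>C\<^esub> \<eta> X" ..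
      qed
      then show ?thesis by (simp add: F_def)
    qed
  qed
  then have "left_adjoint C D V F \<eta>"
    unfolding left_adjoint_def using V U F1 UD(2) unfolding uarrow_def by (simp add: F_def)
  then show ?thesis by blast
qed

lemma uarrow_comp:
  assumes W: "is_functor E D W" and V: "is_functor D C V"
    and VWo: "\<And>Z. Z \<in> Ob E \<Longrightarrow> on_ob VW Z = on_ob V (on_ob W Z)" and VWa: "\<And>f. f \<in> Ar E \<Longrightarrow> on_ar VW f = on_ar V (on_ar W f)"
    and u1: "uarrow C D V X Y \<eta>" and u2: "uarrow D E W Y Z \<theta>"
  shows "uarrow C E VW X Z (on_ar V \<theta> \<cdot>\<^bsub>C\<^esub> \<eta>)"
  unfolding uarrow_def
proof (intro conjI ballI)
  note cD = functor_cats(1)[OF V] and cC = functor_cats(2)[OF V]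
  note D1 = uarrowD[OF u1] and D2 = uarrowD[OF u2]
  show "Z \<in> Ob E" by (rule D2(1))
  show "on_ar V \<theta> \<cdot>\<^bsub>C\<^esub> \<eta> \<in> hom C X (on_ob VW Z)"
    using comp_hom[OF cC D1(2) functor_hom[OF V D2(2)]] VWo[OF D2(1)] by simp
  fix Y' f assume Y': "Y' \<in> Ob E" and "f \<in> hom C X (on_ob VW Y')"
  then have f: "f \<in> hom C X (on_ob V (on_ob W Y'))" using VWo by simp
  obtain g where g: "g \<in> hom D Y (on_ob W Y')" "on_ar V g \<cdot>\<^bsub>C\<^esub> \<eta> = f" using D1(3)[OF functor_ob[OF W Y'] f] by blast
  obtain k where k: "k \<in> hom E Z Y'" "on_ar W k \<cdot>\<^bsub>D\<^esub> \<theta> = g" using D2(3)[OF Y' g(1)] by blast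
  have e: "on_ar VW l \<cdot>\<^bsub>C\<^esub> (on_ar V \<theta> \<cdot>\<^bsub>C\<^esub> \<eta>) = on_ar V (on_ar W l \<cdot>\<^bsub>D\<^esub> \<theta>) \<cdot>\<^bsub>C\<^esub> \<eta>" if l: "l \<in> hom E Z Y'" for l
    using VWa[of l] l functor_comp[OF V D2(2) functor_hom[OF W l]]
      comp_assoc[OF cC D1(2) functor_hom[OF V D2(2)] functor_hom[OF V functor_hom[OF W l]]] by (simp add: hom_def)
  show "\<exists>!l. l \<in> hom E Z Y' \<and> on_ar VW l \<cdot>\<^bsub>C\<^esub> (on_ar V \<theta> \<cdot>\<^bsub>C\<^esub> \<eta>) = f"
  proof (rule ex1I[of _ k], intro conjI k(1))
    show "on_ar VW k \<cdot>\<^bsub>C\<^esub> (on_ar V \<theta> \<cdot>\<^bsub>C\<^esub> \<eta>) = f" using e[OF k(1)] k(2) g(2) by simp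
    fix l assume "l \<in> hom E Z Y' \<and> on_ar VW l \<cdot>\<^bsub>C\<^esub> (on_ar V \<theta> \<cdot>\<^bsub>C\<^esub> \<eta>) = f"
    then have l: "l \<in> hom E Z Y'" "on_ar V (on_ar W l \<cdot>\<^bsub>D\<^esub> \<theta>) \<cdot>\<^bsub>C\<^esub> \<eta> = f" using e by auto
    have "on_ar W l \<cdot>\<^bsub>D\<^esub> \<theta> = g"
      by (rule uarrow_eq[OF V u1 comp_hom[OF cD D2(2) functor_hom[OF W l(1)]] g(1)]) (use l g in simp)
    then show "l = k" by (intro uarrow_eq[OF W u2 l(1) k(1)]) (use k in simp)
  qed
qed

text \<open>Morphisms from \<open>Y\<close> into objects over \<open>D\<close> correspond to
  morphisms from \<open>X\<close>, for which \<open>Z\<close> is already universal. In this way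
  \<open>F_n A\<close> is seen to be free on \<open>F_m A\<close> without any direct
  construction.\<close>

lemma uarrow_cancel:
  assumes W: "is_functor E D W" and V: "is_functor D C V"
    and VWo: "\<And>Z. Z \<in> Ob E \<Longrightarrow> on_ob VW Z = on_ob V (on_ob W Z)" and VWa: "\<And>f. f \<in> Ar E \<Longrightarrow> on_ar VW f = on_ar V (on_ar W f)"
    and u1: "uarrow C D V X Y \<eta>" and u2: "uarrow C E VW X Z \<zeta>" and VW: "is_functor E C VW"
    and g: "g \<in> hom D Y (on_ob W Z)" "on_ar V g \<cdot>\<^bsub>C\<^esub> \<eta> = \<zeta>"
  shows "uarrow D E W Y Z g"
  unfolding uarrow_def
proof (intro conjI ballI)
  note cD = functor_cats(1)[OF V] and cC = functor_cats(2)[OF V]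
  note D1 = uarrowD[OF u1] and D2 = uarrowD[OF u2]
  show "Z \<in> Ob E" by (rule D2(1))
  show "g \<in> hom D Y (on_ob W Z)" by (rule g(1))
  fix Y' f assume Y': "Y' \<in> Ob E" and f: "f \<in> hom D Y (on_ob W Y')"
  have "on_ar V f \<cdot>\<^bsub>C\<^esub> \<eta> \<in> hom C X (on_ob VW Y')" using comp_hom[OF cC D1(2) functor_hom[OF V f]] VWo[OF Y'] by simp
  then obtain k where k: "k \<in> hom E Z Y'" "on_ar VW k \<cdot>\<^bsub>C\<^esub> \<zeta> = on_ar V f \<cdot>\<^bsub>C\<^esub> \<eta>" using D2(3)[OF Y'] by blast
  have e: "on_ar VW l \<cdot>\<^bsub>C\<^esub> \<zeta> = on_ar V (on_ar W l \<cdot>\<^bsub>D\<^esub> g) \<cdot>\<^bsub>C\<^esub> \<eta>" if l: "l \<in> hom E Z Y'" for l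
    using VWa[of l] l functor_comp[OF V g(1) functor_hom[OF W l]] g(2)
      comp_assoc[OF cC D1(2) functor_hom[OF V g(1)] functor_hom[OF V functor_hom[OF W l]]] by (simp add: hom_def)
  show "\<exists>!l. l \<in> hom E Z Y' \<and> on_ar W l \<cdot>\<^bsub>D\<^esub> g = f"
  proof (rule ex1I[of _ k], intro conjI k(1))
    show "on_ar W k \<cdot>\<^bsub>D\<^esub> g = f"
      by (rule uarrow_eq[OF V u1 comp_hom[OF cD g(1) functor_hom[OF W k(1)]] f]) (use e[OF k(1)] k(2) in simp)
    fix l assume l: "l \<in> hom E Z Y' \<and> on_ar W l \<cdot>\<^bsub>D\<^esub> g = f"
    show "l = k" by (rule uarrow_eq[OF VW u2]) (use l k e in auto)
  qed
qed

lemma uarrow_iso: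
  assumes V: "is_functor D C V" and u1: "uarrow C D V X Y \<eta>" and u2: "uarrow C D V X Y' \<eta>'"
  obtains i where "iso_ar D Y Y' i" "on_ar V i \<cdot>\<^bsub>C\<^esub> \<eta> = \<eta>'"
proof -
  note cD = functor_cats(1)[OF V] and cC = functor_cats(2)[OF V]
  note D1 = uarrowD[OF u1] and D2 = uarrowD[OF u2]
  obtain i where i: "i \<in> hom D Y Y'" "on_ar V i \<cdot>\<^bsub>C\<^esub> \<eta> = \<eta>'" using D1(3)[OF D2(1,2)] by blast
  obtain j where j: "j \<in> hom D Y' Y" "on_ar V j \<cdot>\<^bsub>C\<^esub> \<eta>' = \<eta>" using D2(3)[OF D1(1,2)] by blast
  have "j \<cdot>\<^bsub>D\<^esub> i = Idt D Y"
    by (rule uarrow_eq[OF V u1 comp_hom[OF cD i(1) j(1)] id_hom[OF cD D1(1)]])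
      (use functor_comp[OF V i(1) j(1)] comp_assoc[OF cC D1(2) functor_hom[OF V i(1)] functor_hom[OF V j(1)]] i j
        functor_id[OF V D1(1)] id_left[OF cC D1(2)] in simp)
  moreover have "i \<cdot>\<^bsub>D\<^esub> j = Idt D Y'"
    by (rule uarrow_eq[OF V u2 comp_hom[OF cD j(1) i(1)] id_hom[OF cD D2(1)]])
      (use functor_comp[OF V j(1) i(1)] comp_assoc[OF cC D2(2) functor_hom[OF V j(1)] functor_hom[OF V i(1)]] i j
        functor_id[OF V D2(1)] id_left[OF cC D2(2)] in simp)
  ultimately show ?thesis using that iso_arI[OF i(1) j(1)] i(2) by blast
qed

lemma faithful_if_unit_mono:
  assumes adj: "left_adjoint C D V F \<eta>" and m: "\<And>X. X \<in> Ob C \<Longrightarrow> \<eta> X \<in> Mono C"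
  shows "faithful C F"
  unfolding faithful_def
proof (intro ballI inj_onI)
  fix X Y f g assume Y: "Y \<in> Ob C" and f: "f \<in> hom C X Y" and g: "g \<in> hom C X Y" and e: "on_ar F f = on_ar F g"
  have n: "on_ar V (on_ar F f) \<cdot>\<^bsub>C\<^esub> \<eta> (Dom C f) = \<eta> (Cod C f) \<cdot>\<^bsub>C\<^esub> f" if "f \<in> Ar C" for f
    using adj that unfolding left_adjoint_def by blast
  have \<eta>: "\<eta> Y \<in> hom C Y (on_ob V (on_ob F Y))" using adj Y unfolding left_adjoint_def by blast
  have "\<eta> Y \<cdot>\<^bsub>C\<^esub> f = \<eta> Y \<cdot>\<^bsub>C\<^esub> g" using n[of f] n[of g] f g e by (simp add: hom_def)
  then show "f = g" by (rule Mono_cancel[OF m[OF Y] \<eta> f g])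
qed


section \<open>Finite stages of the tower\<close>

locale tower = universe U for U :: "'u rel" +
  fixes C :: "('o, 'm) cat" and B :: "('b, 'm) family" and I :: "nat \<Rightarrow> ('i, 'm) family"
    and E :: "enat \<Rightarrow> ('o, 'm) cat" and V :: "enat \<Rightarrow> enat \<Rightarrow> ('o, 'm, 'o, 'm) fctr"
  assumes lp: "locally_presentable U C" and famB: "is_family U C B" and monoB: "Cell U C B \<subseteq> Mono C"
    and tow: "is_tower U C I E V"
    and gen: "\<And>k i. i \<in> Idx (I (Suc k)) \<Longrightarrow> mor (I (Suc k)) i \<in> Cell U (E (enat k)) (free_family E V B (enat k)) \<and>
           finitely_presentable U (E (enat k)) (Dom (E (enat k)) (mor (I (Suc k)) i))"
begin

abbreviation "Fr n \<equiv> Free E V n 0"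
abbreviation "un n \<equiv> free_unit E V n 0"
abbreviation "FB n \<equiv> free_family E V B n"
abbreviation "Cl n \<equiv> Cell U (E n) (FB n)"

lemma E0: "E 0 = C" using tow by (simp add: is_tower_def)

lemma VF: "m \<le> n \<Longrightarrow> is_functor (E n) (E m) (V n m)"
  using tow by (simp add: is_tower_def is_cochain_def)

lemma V_id: "X \<in> Ob (E n) \<Longrightarrow> on_ob (V n n) X = X" "f \<in> Ar (E n) \<Longrightarrow> on_ar (V n n) f = f"
  using tow by (auto simp: is_tower_def is_cochain_def)

lemma VV: "k \<le> m \<Longrightarrow> m \<le> n \<Longrightarrow> X \<in> Ob (E n) \<Longrightarrow> on_ob (V m k) (on_ob (V n m) X) = on_ob (V n k) X"
  "k \<le> m \<Longrightarrow> m \<le> n \<Longrightarrow> f \<in> Ar (E n) \<Longrightarrow> on_ar (V m k) (on_ar (V n m) f) = on_ar (V n k) f"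
  using tow unfolding is_tower_def is_cochain_def by blast+

lemma catE: "category (E n)" using functor_cats(1)[OF VF[of n n]] by simp

text \<open>\<open>Free\<close> is defined by choice and carries information only where an adjoint
  exists. Existence is established stage by stage and recorded by this predicate.\<close>

definition "Adj n \<longleftrightarrow> left_adjoint (E 0) (E n) (V n 0) (Fr n) (un n)"

lemma chosen_left_adjoint:
  assumes "n \<noteq> m" "\<exists>F \<eta>. left_adjoint (E m) (E n) (V n m) F \<eta>"
  shows "left_adjoint (E m) (E n) (V n m) (Free E V n m) (free_unit E V n m)"
proof -
  define p where "p = (SOME (F, \<eta>). left_adjoint (E m) (E n) (V n m) F \<eta>)"
  have "\<exists>p. case p of (F, \<eta>) \<Rightarrow> left_adjoint (E m) (E n) (V n m) F \<eta>" using assms(2) by auto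
  from someI_ex[OF this] have "case p of (F, \<eta>) \<Rightarrow> left_adjoint (E m) (E n) (V n m) F \<eta>" unfolding p_def .
  moreover have "chosen_adjoint E V n m = p" using assms(1) by (simp add: chosen_adjoint_def p_def)
  ultimately show ?thesis by (simp add: Free_def free_unit_def split_beta)
qed

lemma Adj_0: "Adj 0"
proof -
  have F: "Free E V 0 0 = id_fctr" "free_unit E V 0 0 = Idt (E 0)" by (auto simp: Free_def free_unit_def chosen_adjoint_def)
  have "is_functor (E 0) (E 0) id_fctr" unfolding is_functor_def id_fctr_def using catE[of 0] hom_self by auto
  moreover have "\<exists>!g. g \<in> hom (E 0) X Y \<and> on_ar (V 0 0) g \<cdot>\<^bsub>E 0\<^esub> Idt (E 0) X = f" if f: "f \<in> hom (E 0) X Y" for X Y f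
  proof (rule ex1I[of _ f])
    show "f \<in> hom (E 0) X Y \<and> on_ar (V 0 0) f \<cdot>\<^bsub>E 0\<^esub> Idt (E 0) X = f"
      using f id_right[OF catE f] V_id(2)[of f 0] by (simp add: hom_def)
    show "g = f" if "g \<in> hom (E 0) X Y \<and> on_ar (V 0 0) g \<cdot>\<^bsub>E 0\<^esub> Idt (E 0) X = f" for g
      using that id_right[OF catE, of g 0 X Y] V_id(2)[of g 0] by (simp add: hom_def)
  qed
  moreover have "on_ar (V 0 0) f \<cdot>\<^bsub>E 0\<^esub> Idt (E 0) (Dom (E 0) f) = Idt (E 0) (Cod (E 0) f) \<cdot>\<^bsub>E 0\<^esub> f" if "f \<in> Ar (E 0)" for f
    using V_id(2)[OF that] id_left[OF catE hom_self[OF that]] id_right[OF catE hom_self[OF that]] by simp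
  ultimately show ?thesis
    unfolding Adj_def left_adjoint_def F using VF[of 0 0] id_hom[OF catE] V_id(1) by (auto simp: id_fctr_def)
qed

lemma FB_0: "FB 0 = B"
  by (cases B) (simp add: free_family_def map_family_def Free_def chosen_adjoint_def id_fctr_def)

lemma FB_family: "Adj n \<Longrightarrow> is_family U (E n) (FB n)"
  using famB functor_hom[of "E 0" "E n" "Fr n", OF _ hom_self]
  unfolding Adj_def left_adjoint_def is_family_def free_family_def map_family_def E0 by (simp add: hom_def)

lemma FB_sel: "Idx (FB n) = Idx B" "mor (FB n) i = on_ar (Fr n) (mor B i)"
  by (simp_all add: free_family_def map_family_def)

text \<open>The canonical morphism \<open>F\<^sub>m A \<rightarrow> V F\<^sub>n A\<close>.\<close>

definition "kap m n A = (SOME g. g \<in> hom (E m) (on_ob (Fr m) A) (on_ob (V n m) (on_ob (Fr n) A)) \<and>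
   on_ar (V m 0) g \<cdot>\<^bsub>E 0\<^esub> un m A = un n A)"

lemma Adj_uarrow: "Adj n \<Longrightarrow> A \<in> Ob C \<Longrightarrow> uarrow (E 0) (E n) (V n 0) A (on_ob (Fr n) A) (un n A)"
  unfolding Adj_def by (rule left_adjoint_uarrow) (simp_all add: E0)

text \<open>By the third claim the attaching morphisms of generators can be transposed between
  stages: a morphism out of \<open>F_n A\<close> amounts to one out of \<open>F_m A\<close> one or
  more stages below.\<close>

lemma kap:
  assumes "m \<le> n" "Adj m" "Adj n" "A \<in> Ob C"
  shows "kap m n A \<in> hom (E m) (on_ob (Fr m) A) (on_ob (V n m) (on_ob (Fr n) A))"
    "on_ar (V m 0) (kap m n A) \<cdot>\<^bsub>E 0\<^esub> un m A = un n A"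
    "uarrow (E m) (E n) (V n m) (on_ob (Fr m) A) (on_ob (Fr n) A) (kap m n A)"
proof -
  note um = Adj_uarrow[OF assms(2,4)] and uu = Adj_uarrow[OF assms(3,4)]
  have o: "on_ob (V n m) (on_ob (Fr n) A) \<in> Ob (E m)" by (rule functor_ob[OF VF[OF assms(1)] uarrowD(1)[OF uu]])
  have "un n A \<in> hom (E 0) A (on_ob (V m 0) (on_ob (V n m) (on_ob (Fr n) A)))"
    using uarrowD(2)[OF uu] VV(1)[OF _ assms(1) uarrowD(1)[OF uu], of 0] by simp
  from someI_ex[OF uarrowD(3)[OF um o this]]
  show k: "kap m n A \<in> hom (E m) (on_ob (Fr m) A) (on_ob (V n m) (on_ob (Fr n) A))"
    "on_ar (V m 0) (kap m n A) \<cdot>\<^bsub>E 0\<^esub> un m A = un n A" unfolding kap_def by blast+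
  show "uarrow (E m) (E n) (V n m) (on_ob (Fr m) A) (on_ob (Fr n) A) (kap m n A)"
    by (rule uarrow_cancel[OF VF[OF assms(1)] VF[of 0 m] _ _ um uu VF[of 0 n] k]) (simp_all add: VV assms(1))
qed

lemma Fr_hom: "Adj n \<Longrightarrow> f \<in> hom C X Y \<Longrightarrow> on_ar (Fr n) f \<in> hom (E n) (on_ob (Fr n) X) (on_ob (Fr n) Y)"
  using functor_hom[of "E 0" "E n" "Fr n" f X Y] unfolding Adj_def left_adjoint_def E0 by blast

lemma un_nat: "Adj n \<Longrightarrow> f \<in> hom C X Y \<Longrightarrow> on_ar (V n 0) (on_ar (Fr n) f) \<cdot>\<^bsub>E 0\<^esub> un n X = un n Y \<cdot>\<^bsub>E 0\<^esub> f"
  unfolding Adj_def left_adjoint_def E0 by (auto simp: hom_def)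

text \<open>Both sides start at the free object \<open>F_m X\<close>, so they are compared after
  composing with its unit, where naturality of the units at stages \<open>m\<close> and
  \<open>n\<close> applies.\<close>

lemma kap_nat:
  assumes mn: "m \<le> n" and am: "Adj m" and an: "Adj n" and f: "f \<in> hom C X Y"
  shows "on_ar (V n m) (on_ar (Fr n) f) \<cdot>\<^bsub>E m\<^esub> kap m n X = kap m n Y \<cdot>\<^bsub>E m\<^esub> on_ar (Fr m) f"
proof -
  have c: "category C" using catE[of 0] E0 by simp
  note X = hom_dom[OF c f] and Y = hom_cod[OF c f]
  note kX = kap[OF mn am an X] and kY = kap[OF mn am an Y] and uX = Adj_uarrow[OF am X] and uY = Adj_uarrow[OF am Y]
  note V0 = VF[of 0 m, simplified] and Vnm = VF[OF mn]
  note fn = Fr_hom[OF an f] and fm = Fr_hom[OF am f]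
  note vfn = functor_hom[OF Vnm fn]
  note cE = catE
  have f0: "f \<in> hom (E 0) X Y" using f E0 by simp
  show ?thesis
  proof (rule uarrow_eq[OF V0 uX comp_hom[OF cE kX(1) vfn] comp_hom[OF cE fm kY(1)]])
    have "on_ar (V m 0) (on_ar (V n m) (on_ar (Fr n) f) \<cdot>\<^bsub>E m\<^esub> kap m n X) \<cdot>\<^bsub>E 0\<^esub> un m X = on_ar (V n 0) (on_ar (Fr n) f) \<cdot>\<^bsub>E 0\<^esub> un n X"
      using functor_comp[OF V0 kX(1) vfn] comp_assoc[OF cE uarrowD(2)[OF uX] functor_hom[OF V0 kX(1)] functor_hom[OF V0 vfn]]
        kX(2) VV(2)[OF _ mn, of 0] fn by (simp add: hom_def)
    also have "\<dots> = (on_ar (V m 0) (kap m n Y) \<cdot>\<^bsub>E 0\<^esub> un m Y) \<cdot>\<^bsub>E 0\<^esub> f" using un_nat[OF an f] kY(2) by simp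
    also have "\<dots> = on_ar (V m 0) (kap m n Y) \<cdot>\<^bsub>E 0\<^esub> (on_ar (V m 0) (on_ar (Fr m) f) \<cdot>\<^bsub>E 0\<^esub> un m X)"
      using comp_assoc[OF cE f0 uarrowD(2)[OF uY] functor_hom[OF V0 kY(1)]] un_nat[OF am f] by simp
    also have "\<dots> = on_ar (V m 0) (kap m n Y \<cdot>\<^bsub>E m\<^esub> on_ar (Fr m) f) \<cdot>\<^bsub>E 0\<^esub> un m X"
      using functor_comp[OF V0 fm kY(1)] comp_assoc[OF cE uarrowD(2)[OF uX] functor_hom[OF V0 fm] functor_hom[OF V0 kY(1)]] by simp
    finally show "on_ar (V m 0) (on_ar (V n m) (on_ar (Fr n) f) \<cdot>\<^bsub>E m\<^esub> kap m n X) \<cdot>\<^bsub>E 0\<^esub> un m X =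
      on_ar (V m 0) (kap m n Y \<cdot>\<^bsub>E m\<^esub> on_ar (Fr m) f) \<cdot>\<^bsub>E 0\<^esub> un m X" .
  qed
qed

lemma kap_comp:
  assumes km: "k \<le> m" and mn: "m \<le> n" and a: "Adj k" "Adj m" "Adj n" and A: "A \<in> Ob C"
  shows "on_ar (V m k) (kap m n A) \<cdot>\<^bsub>E k\<^esub> kap k m A = kap k n A"
proof -
  have kn: "k \<le> n" using km mn by simp
  note kkm = kap[OF km a(1,2) A] and kmn = kap[OF mn a(2,3) A] and kkn = kap[OF kn a(1,3) A]
  note uk = Adj_uarrow[OF a(1) A]
  note V0 = VF[of 0 k, simplified] and Vk = VF[OF km]
  note vk = functor_hom[OF Vk kmn(1)]
  have no: "on_ob (Fr n) A \<in> Ob (E n)" by (rule uarrowD(1)[OF Adj_uarrow[OF a(3) A]])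
  have vk': "on_ar (V m k) (kap m n A) \<in> hom (E k) (on_ob (V m k) (on_ob (Fr m) A)) (on_ob (V n k) (on_ob (Fr n) A))"
    using vk VV(1)[OF km mn no] by simp
  have "on_ar (V k 0) (on_ar (V m k) (kap m n A) \<cdot>\<^bsub>E k\<^esub> kap k m A) \<cdot>\<^bsub>E 0\<^esub> un k A = on_ar (V m 0) (kap m n A) \<cdot>\<^bsub>E 0\<^esub> un m A"
    using functor_comp[OF V0 kkm(1) vk] comp_assoc[OF catE uarrowD(2)[OF uk] functor_hom[OF V0 kkm(1)] functor_hom[OF V0 vk]]
      kkm(2) VV(2)[OF _ km, of 0 "kap m n A"] kmn(1) by (simp add: hom_def)
  then show ?thesis
    by (intro uarrow_eq[OF V0 uk comp_hom[OF catE kkm(1) vk'] kkn(1)]) (use kmn(2) kkn(2) in simp)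
qed

text \<open>The hypotheses under which stage \<open>k + 1\<close> can be analysed. They are proved
  together: local smallness and presented colimits produce the completions, monicity makes them
  cellular, and the adjoint supplies the generators \<open>F_k B\<close>.\<close>

definition "Inv k \<longleftrightarrow> cellular_cat U (E (enat k)) (FB (enat k)) \<and>
   (\<forall>X \<in> Ob (E (enat k)). \<forall>Y \<in> Ob (E (enat k)). small U (hom (E (enat k)) X Y)) \<and>
   Adj (enat k) \<and> Cl (enat k) \<subseteq> Mono (E (enat k))"

abbreviation "VS k \<equiv> V (enat (Suc k)) (enat k)"

lemma VS_F: "is_functor (E (enat (Suc k))) (E (enat k)) (VS k)"
  by (rule VF) simp

lemma Inv_step:
  assumes "Inv k"
  shows "\<exists>ext. alg_step U (E (enat k)) (FB (enat k)) (I (Suc k)) (E (enat (Suc k))) (VS k) ext"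
proof -
  interpret cc: cellular_cat U "E (enat k)" "FB (enat k)" using assms by (simp add: Inv_def)
  have al: "is_alg_inj_forget (E (enat k)) (I (Suc k)) (E (enat (Suc k))) (VS k)" and fa: "is_family U (E (enat k)) (I (Suc k))"
    using tow by (auto simp: is_tower_def)
  have inv: "X \<in> Ob (E (enat k)) \<Longrightarrow> Y \<in> Ob (E (enat k)) \<Longrightarrow> small U (hom (E (enat k)) X Y)" "Cl (enat k) \<subseteq> Mono (E (enat k))" for X Y
    using assms by (auto simp: Inv_def)
  from alg_inj_forget_structure[OF al] obtain ext :: "'o \<Rightarrow> 'i \<Rightarrow> 'm \<Rightarrow> 'm" where ext:
    "(\<forall>Y. Y \<in> Ob (E (enat (Suc k))) \<longrightarrow> ext_structure (E (enat k)) (I (Suc k)) (on_ob (VS k) Y) (ext Y)) \<and>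
    (\<forall>X Y w i f. w \<in> hom (E (enat (Suc k))) X Y \<longrightarrow> i \<in> Idx (I (Suc k)) \<longrightarrow> f \<in> hom (E (enat k)) (Dom (E (enat k)) (mor (I (Suc k)) i)) (on_ob (VS k) X) \<longrightarrow>
        on_ar (VS k) w \<cdot>\<^bsub>E (enat k)\<^esub> ext X i f = ext Y i (on_ar (VS k) w \<cdot>\<^bsub>E (enat k)\<^esub> f)) \<and>
    (\<forall>X Y u. X \<in> Ob (E (enat (Suc k))) \<longrightarrow> Y \<in> Ob (E (enat (Suc k))) \<longrightarrow> u \<in> hom (E (enat k)) (on_ob (VS k) X) (on_ob (VS k) Y) \<longrightarrow>
        (\<forall>i f. i \<in> Idx (I (Suc k)) \<longrightarrow> f \<in> hom (E (enat k)) (Dom (E (enat k)) (mor (I (Suc k)) i)) (on_ob (VS k) X) \<longrightarrow> u \<cdot>\<^bsub>E (enat k)\<^esub> ext X i f = ext Y i (u \<cdot>\<^bsub>E (enat k)\<^esub> f)) \<longrightarrow>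
        (\<exists>w. w \<in> hom (E (enat (Suc k))) X Y \<and> on_ar (VS k) w = u)) \<and>
    (\<forall>X Y w w'. w \<in> hom (E (enat (Suc k))) X Y \<longrightarrow> w' \<in> hom (E (enat (Suc k))) X Y \<longrightarrow> on_ar (VS k) w = on_ar (VS k) w' \<longrightarrow> w = w') \<and>
    (\<forall>Z c. Z \<in> Ob (E (enat k)) \<longrightarrow> ext_structure (E (enat k)) (I (Suc k)) Z c \<longrightarrow> (\<exists>Y. Y \<in> Ob (E (enat (Suc k))) \<and> on_ob (VS k) Y = Z \<and> ext Y = c))"
    by (rule exE)
  have "alg_step U (E (enat k)) (FB (enat k)) (I (Suc k)) (E (enat (Suc k))) (VS k) ext"
  proof (unfold_locales, goal_cases)
    case (4 i) then show ?case using gen[of i k] cc.Cell_Cel by blast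
  next
    case 5 show ?case using inv(2) cc.Cell_Cel by blast
  next
    case 7 then show ?case using ext by blast
  next
    case 8 then show ?case using ext by blast
  next
    case (9 X Y u) then show ?case using ext by blast
  next
    case 10 then show ?case using ext by blast
  next
    case 11 then show ?case using ext by blast
  qed (use inv fa gen VS_F in auto)
  then show ?thesis by blast
qed

end

lemma transfinite_composites_mono:
  fixes U :: "'u rel"
  assumes "S \<subseteq> T" shows "transfinite_composites U C S \<subseteq> transfinite_composites U C T"
proof
  fix f assume "f \<in> transfinite_composites U C S"
  then obtain r :: "'u rel" and D Z c z where "Well_order r \<and> small U (Field r) \<and>
     z \<in> Field r \<and> (\<forall>a \<in> Field r. (z, a) \<in> r) \<and>
     is_colimit (poset_cat r) C D Z c \<and> f = c z \<and>
     (\<forall>a b. covers r a b \<longrightarrow> on_ar D (a, b) \<in> S) \<and>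
     (\<forall>a \<in> Field r. a \<noteq> z \<and> \<not> (\<exists>b. covers r b a) \<longrightarrow>
        is_colimit (poset_cat (Restr r (underS r a))) C D (on_ob D a) (\<lambda>b. on_ar D (b, a)))"
    unfolding transfinite_composites_def mem_Collect_eq by (elim exE) (rule that)
  then show "f \<in> transfinite_composites U C T"
    unfolding transfinite_composites_def mem_Collect_eq using assms
    by (intro exI[of _ r] exI[of _ D] exI[of _ Z] exI[of _ c] exI[of _ z]) blast
qed

section \<open>Induction over the finite stages\<close>

context tower
begin

lemma Inv_0: "Inv 0"
proof -
  have c: "category C" and co: "cocomplete U C" and l: "\<And>X Y. X \<in> Ob C \<Longrightarrow> Y \<in> Ob C \<Longrightarrow> small U (hom C X Y)"
    using lp by (auto simp: locally_presentable_def)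
  have "cellular_cat U C B" by unfold_locales (use c cocomplete_relcoc[OF co c] famB in auto)
  then show ?thesis
    unfolding Inv_def using l Adj_0 monoB by (simp add: zero_enat_def[symmetric] E0 FB_0)
qed

lemma E0_category: "category C"
  using lp by (simp add: locally_presentable_def)

lemma FB_mor:
  assumes "Adj n" "i \<in> Idx B"
  shows "mor (FB n) i \<in> hom (E n) (on_ob (Fr n) (Dom C (mor B i))) (on_ob (Fr n) (Cod C (mor B i)))"
    "Dom C (mor B i) \<in> Ob C" "Cod C (mor B i) \<in> Ob C" "mor B i \<in> hom C (Dom C (mor B i)) (Cod C (mor B i))"
proof -
  show h: "mor B i \<in> hom C (Dom C (mor B i)) (Cod C (mor B i))" using famB assms(2) by (simp add: is_family_def hom_def)
  show "mor (FB n) i \<in> hom (E n) (on_ob (Fr n) (Dom C (mor B i))) (on_ob (Fr n) (Cod C (mor B i)))"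
    unfolding FB_sel by (rule Fr_hom[OF assms(1) h])
  show "Dom C (mor B i) \<in> Ob C" by (rule hom_dom[OF E0_category h])
  show "Cod C (mor B i) \<in> Ob C" by (rule hom_cod[OF E0_category h])
qed

lemma FB_DomCod:
  assumes "Adj n" "i \<in> Idx B"
  shows "Dom (E n) (mor (FB n) i) = on_ob (Fr n) (Dom C (mor B i))" "Cod (E n) (mor (FB n) i) = on_ob (Fr n) (Cod C (mor B i))"
  using FB_mor(1)[OF assms] by (auto simp: hom_def)

text \<open>Preservation of cells reduces to single attachments: \<open>V\<close> preserves the
  colimits of a transfinite composite, and transfinite composites of cellular morphisms are
  cellular.\<close>

lemma Cell_image:
  assumes m: "Inv m" and n: "Adj n" and mn: "enat m \<le> n"
    and pres: "preserves_directed U (E n) (E (enat m)) (V n (enat m))"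
    and st: "on_ar (V n (enat m)) ` csteps U (E n) (FB n) \<subseteq> Cl (enat m)"
  shows "on_ar (V n (enat m)) ` Cl n \<subseteq> Cl (enat m)"
proof -
  interpret c: cellular_cat U "E (enat m)" "FB (enat m)" using m by (simp add: Inv_def)
  have "Cl n \<subseteq> transfinite_composites U (E n) (csteps U (E n) (FB n))"
    unfolding Cell_def by (rule transfinite_composites_mono[OF pushouts_csteps[OF catE FB_family[OF n]]])
  then have "on_ar (V n (enat m)) ` Cl n \<subseteq> on_ar (V n (enat m)) ` transfinite_composites U (E n) (csteps U (E n) (FB n))"
    by (rule image_mono)
  also have "\<dots> \<subseteq> transfinite_composites U (E (enat m)) (Cl (enat m))"
    by (rule transfinite_composites_image[OF VF[OF mn] pres st])
  also have "\<dots> \<subseteq> Cl (enat m)" unfolding c.Cell_Cel by (rule c.transfinite_Cel)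
  finally show ?thesis .
qed

lemma Adj_Suc:
  assumes "Inv k" shows "Adj (enat (Suc k))"
proof -
  obtain ext where "alg_step U (E (enat k)) (FB (enat k)) (I (Suc k)) (E (enat (Suc k))) (VS k) ext"
    using Inv_step[OF assms] by (rule exE)
  then interpret A: alg_step U "E (enat k)" "FB (enat k)" "I (Suc k)" "E (enat (Suc k))" "VS k" ext .
  have ak: "Adj (enat k)" using assms by (simp add: Inv_def)
  have "\<exists>Y t. uarrow (E 0) (E (enat (Suc k))) (V (enat (Suc k)) 0) X Y t" if X: "X \<in> Ob (E 0)" for X
  proof -
    have u1: "uarrow (E 0) (E (enat k)) (V (enat k) 0) X (on_ob (Fr (enat k)) X) (un (enat k) X)"
      using Adj_uarrow[OF ak] X E0 by simp
    obtain Y t where "uarrow (E (enat k)) (E (enat (Suc k))) (VS k) (on_ob (Fr (enat k)) X) Y t"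
      using A.free_exists[OF uarrowD(1)[OF u1]] by blast
    from uarrow_comp[OF VS_F VF[of 0 "enat k"] _ _ u1 this, of "V (enat (Suc k)) 0"]
    have "uarrow (E 0) (E (enat (Suc k))) (V (enat (Suc k)) 0) X Y (on_ar (V (enat k) 0) t \<cdot>\<^bsub>E 0\<^esub> un (enat k) X)"
      by (simp add: VV)
    then show ?thesis by blast
  qed
  then have "\<exists>F \<eta>. left_adjoint (E 0) (E (enat (Suc k))) (V (enat (Suc k)) 0) F \<eta>"
    by (rule left_adjoint_exists[OF VF[OF i0_lb]])
  then show ?thesis unfolding Adj_def by (intro chosen_left_adjoint) (auto simp: zero_enat_def)
qed

text \<open>The form of \<open>A.mpush_step\<close> for the generators \<open>F_k B\<close> and
  \<open>F_(k+1) B\<close>: the attaching morphisms at stage \<open>k\<close> are the transposes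
  along \<open>kap\<close> of those at stage \<open>k + 1\<close>. Both \<open>p\<close> and the
  completion \<open>t\<close> are cellular.\<close>

lemma mpush_tower_step:
  fixes J :: "'u set"
  assumes k: "Inv k" and X: "X \<in> Ob (E (enat (Suc k)))" and J: "small U J" "s ` J \<subseteq> Idx B"
    and G: "\<And>j. j \<in> J \<Longrightarrow> G j \<in> hom (E (enat (Suc k))) (on_ob (Fr (enat (Suc k))) (Dom C (mor B (s j)))) X"
    and mD: "mpush (E (enat (Suc k))) X J (\<lambda>j. mor (FB (enat (Suc k))) (s j)) G X' p' e'"
    and mC: "mpush (E (enat k)) (on_ob (VS k) X) J (\<lambda>j. mor (FB (enat k)) (s j))
        (\<lambda>j. on_ar (VS k) (G j) \<cdot>\<^bsub>E (enat k)\<^esub> kap (enat k) (enat (Suc k)) (Dom C (mor B (s j)))) P p e"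
  shows "p \<in> Cl (enat k) \<and> (\<exists>t. t \<in> hom (E (enat k)) P (on_ob (VS k) X') \<and> t \<in> Cl (enat k) \<and> t \<cdot>\<^bsub>E (enat k)\<^esub> p = on_ar (VS k) p' \<and>
    (\<forall>j \<in> J. t \<cdot>\<^bsub>E (enat k)\<^esub> e j = on_ar (VS k) (e' j) \<cdot>\<^bsub>E (enat k)\<^esub> kap (enat k) (enat (Suc k)) (Cod C (mor B (s j)))))"
proof -
  obtain ext where "alg_step U (E (enat k)) (FB (enat k)) (I (Suc k)) (E (enat (Suc k))) (VS k) ext"
    using Inv_step[OF k] by (rule exE)
  then interpret A: alg_step U "E (enat k)" "FB (enat k)" "I (Suc k)" "E (enat (Suc k))" "VS k" ext .
  have ak: "Adj (enat k)" and aS: "Adj (enat (Suc k))" using k Adj_Suc[OF k] by (auto simp: Inv_def)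
  have kS: "enat k \<le> enat (Suc k)" by simp
  have sB: "s j \<in> Idx B" if "j \<in> J" for j using J(2) that by blast
  have kd: "kap (enat k) (enat (Suc k)) (Dom C (mor B (s j))) \<in> hom (E (enat k)) (on_ob (Fr (enat k)) (Dom C (mor B (s j))))
      (on_ob (VS k) (on_ob (Fr (enat (Suc k))) (Dom C (mor B (s j)))))" if "j \<in> J" for j
    by (rule kap(1)[OF kS ak aS FB_mor(2)[OF ak sB[OF that]]])
  have wf: "mwf (E (enat k)) (on_ob (VS k) X) J (\<lambda>j. mor (FB (enat k)) (s j))
        (\<lambda>j. on_ar (VS k) (G j) \<cdot>\<^bsub>E (enat k)\<^esub> kap (enat k) (enat (Suc k)) (Dom C (mor B (s j))))"
    unfolding mwf_def
    using functor_ob[OF VS_F X] FB_mor(1)[OF ak sB] comp_hom[OF catE kd functor_hom[OF VS_F G]] FB_DomCod[OF ak sB]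
    by (auto simp: hom_def)
  have "p \<in> csteps U (E (enat k)) (FB (enat k))"
    by (rule cstepsI[OF J(1) _ wf mC]) (use J(2) FB_sel in auto)
  then have p: "p \<in> A.Cel" by (rule A.csteps_Cel)
  have "\<exists>t. t \<in> hom (E (enat k)) P (on_ob (VS k) X') \<and> t \<in> A.Cel \<and> t \<cdot>\<^bsub>E (enat k)\<^esub> p = on_ar (VS k) p' \<and>
    (\<forall>j \<in> J. t \<cdot>\<^bsub>E (enat k)\<^esub> e j = on_ar (VS k) (e' j) \<cdot>\<^bsub>E (enat k)\<^esub> kap (enat k) (enat (Suc k)) (Cod C (mor B (s j))))"
    by (rule A.mpush_step[OF X FB_mor(1)[OF ak sB] FB_mor(1)[OF aS sB] kap(3)[OF kS ak aS FB_mor(2)[OF ak sB]]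
        kap(3)[OF kS ak aS FB_mor(3)[OF ak sB]] _ G mD mC p])
      (use kap_nat[OF kS ak aS FB_mor(4)[OF ak sB]] FB_sel in auto)
  then show ?thesis using p A.Cell_Cel by simp
qed

text \<open>The image of an attachment at stage \<open>k + 1\<close> factors as the transposed
  attachment at stage \<open>k\<close> followed by a completion.\<close>

lemma csteps_image_step:
  assumes k: "Inv k"
  shows "on_ar (VS k) ` csteps U (E (enat (Suc k))) (FB (enat (Suc k))) \<subseteq> Cl (enat k)"
proof safe
  interpret c: cellular_cat U "E (enat k)" "FB (enat k)" using k by (simp add: Inv_def)
  have ak: "Adj (enat k)" and aS: "Adj (enat (Suc k))" using k Adj_Suc[OF k] by (auto simp: Inv_def)
  have kS: "enat k \<le> enat (Suc k)" by simp
  fix u assume "u \<in> csteps U (E (enat (Suc k))) (FB (enat (Suc k)))"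
  then obtain J :: "'u set" and s W g Z e where "small U J \<and> s ` J \<subseteq> Idx (FB (enat (Suc k))) \<and>
     mwf (E (enat (Suc k))) W J (\<lambda>j. mor (FB (enat (Suc k))) (s j)) g \<and> mpush (E (enat (Suc k))) W J (\<lambda>j. mor (FB (enat (Suc k))) (s j)) g Z u e"
    unfolding csteps_def mem_Collect_eq by (elim exE) (rule that)
  then have J: "small U J" "s ` J \<subseteq> Idx B" and wf: "mwf (E (enat (Suc k))) W J (\<lambda>j. mor (FB (enat (Suc k))) (s j)) g"
    and mp: "mpush (E (enat (Suc k))) W J (\<lambda>j. mor (FB (enat (Suc k))) (s j)) g Z u e" by (simp_all add: FB_sel)
  have sB: "s j \<in> Idx B" if "j \<in> J" for j using J(2) that by blast
  have G: "g j \<in> hom (E (enat (Suc k))) (on_ob (Fr (enat (Suc k))) (Dom C (mor B (s j)))) W" if "j \<in> J" for j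
    using mwfD(3)[OF wf that] FB_DomCod(1)[OF aS sB[OF that]] by simp
  have kd: "kap (enat k) (enat (Suc k)) (Dom C (mor B (s j))) \<in> hom (E (enat k)) (on_ob (Fr (enat k)) (Dom C (mor B (s j))))
      (on_ob (VS k) (on_ob (Fr (enat (Suc k))) (Dom C (mor B (s j)))))" if "j \<in> J" for j
    by (rule kap(1)[OF kS ak aS FB_mor(2)[OF ak sB[OF that]]])
  note WO = mwfD(1)[OF wf]
  have wf': "mwf (E (enat k)) (on_ob (VS k) W) J (\<lambda>j. mor (FB (enat k)) (s j))
        (\<lambda>j. on_ar (VS k) (g j) \<cdot>\<^bsub>E (enat k)\<^esub> kap (enat k) (enat (Suc k)) (Dom C (mor B (s j))))"
    unfolding mwf_def
    using functor_ob[OF VS_F WO] FB_mor(1)[OF ak sB] comp_hom[OF catE kd functor_hom[OF VS_F G]] FB_DomCod[OF ak sB]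
    by (auto simp: hom_def)
  obtain P p e0 where mC: "mpush (E (enat k)) (on_ob (VS k) W) J (\<lambda>j. mor (FB (enat k)) (s j))
        (\<lambda>j. on_ar (VS k) (g j) \<cdot>\<^bsub>E (enat k)\<^esub> kap (enat k) (enat (Suc k)) (Dom C (mor B (s j)))) P p e0"
    using mpush_exists[OF c.rc c.cat J(1) wf'] by blast
  obtain t where p: "p \<in> Cl (enat k)" and t: "t \<in> hom (E (enat k)) P (on_ob (VS k) Z)" "t \<in> Cl (enat k)" "t \<cdot>\<^bsub>E (enat k)\<^esub> p = on_ar (VS k) u"
    using mpush_tower_step[OF k WO J G mp mC] by blast
  have "t \<cdot>\<^bsub>E (enat k)\<^esub> p \<in> Cl (enat k)"
    using c.comp_Cel[OF _ _ mpushD(1)[OF mC] t(1)] p t(2) unfolding c.Cell_Cel by blast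
  then show "on_ar (VS k) u \<in> Cl (enat k)" using t(3) by simp
qed

text \<open>An equation \<open>f g = f h\<close> is mapped to one that \<open>W f\<close> cancels,
  and faithfulness lifts the resulting equality.\<close>

lemma Cell_Mono_reflect:
  assumes F: "is_functor D C' W" and f: "f \<in> Ar D" "on_ar W f \<in> Mono C'"
    and faith: "\<And>X Y g h. g \<in> hom D X Y \<Longrightarrow> h \<in> hom D X Y \<Longrightarrow> on_ar W g = on_ar W h \<Longrightarrow> g = h"
  shows "f \<in> Mono D"
  unfolding Mono_def
proof (intro CollectI conjI ballI impI f(1), elim conjE)
  fix g h assume g: "g \<in> Ar D" and h: "h \<in> Ar D" and gh: "Dom D g = Dom D h" "Cod D g = Dom D f" "Cod D h = Dom D f"
    and e: "f \<cdot>\<^bsub>D\<^esub> g = f \<cdot>\<^bsub>D\<^esub> h"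
  have fh: "f \<in> hom D (Dom D f) (Cod D f)" and g': "g \<in> hom D (Dom D g) (Dom D f)" and h': "h \<in> hom D (Dom D g) (Dom D f)"
    using f g h gh by (auto simp: hom_def)
  have "on_ar W f \<cdot>\<^bsub>C'\<^esub> on_ar W g = on_ar W f \<cdot>\<^bsub>C'\<^esub> on_ar W h"
    using functor_comp[OF F g' fh] functor_comp[OF F h' fh] e by simp
  then have "on_ar W g = on_ar W h"
    by (rule Mono_cancel[OF f(2) functor_hom[OF F fh] functor_hom[OF F g'] functor_hom[OF F h']])
  then show "g = h" by (rule faith[OF g' h'])
qed

lemma Cell_Ar:
  assumes "Adj n" "f \<in> Cl n" shows "f \<in> Ar (E n)"
proof -
  have "Cl n \<subseteq> transfinite_composites U (E n) UNIV"
    unfolding Cell_def by (rule transfinite_composites_mono) simp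
  then have "f \<in> cc U (E n) UNIV" using transfinite_composites_cc[OF catE, of n UNIV] assms(2) by blast
  then show ?thesis by (rule cc_hom)
qed

text \<open>The second claim comes first: once \<open>V\<close> sends cells at stage
  \<open>k + 1\<close> to cells at stage \<open>k\<close>, which are monic, faithfulness of
  \<open>V\<close> makes the former monic as well.\<close>

lemma Inv_Suc:
  assumes k: "Inv k" shows "Inv (Suc k)" "on_ar (VS k) ` Cl (enat (Suc k)) \<subseteq> Cl (enat k)"
proof -
  obtain ext where "alg_step U (E (enat k)) (FB (enat k)) (I (Suc k)) (E (enat (Suc k))) (VS k) ext"
    using Inv_step[OF k] by (rule exE)
  then interpret A: alg_step U "E (enat k)" "FB (enat k)" "I (Suc k)" "E (enat (Suc k))" "VS k" ext .
  note aS = Adj_Suc[OF k]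
  show im: "on_ar (VS k) ` Cl (enat (Suc k)) \<subseteq> Cl (enat k)"
    by (rule Cell_image[OF k aS _ A.V_preserves_directed csteps_image_step[OF k]]) simp
  have "Cl (enat (Suc k)) \<subseteq> Mono (E (enat (Suc k)))"
  proof
    fix f assume f: "f \<in> Cl (enat (Suc k))"
    have "on_ar (VS k) f \<in> Mono (E (enat k))" using im f k unfolding Inv_def by blast
    then show "f \<in> Mono (E (enat (Suc k)))"
      by (rule Cell_Mono_reflect[OF VS_F Cell_Ar[OF aS f]]) (rule A.faith)
  qed
  moreover have "cellular_cat U (E (enat (Suc k))) (FB (enat (Suc k)))"
    by unfold_locales (use catE A.D_relcoc FB_family[OF aS] in auto)
  ultimately show "Inv (Suc k)" unfolding Inv_def using aS A.D_loc by blast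
qed

lemma Inv_all: "Inv k"
  by (induction k) (auto intro: Inv_0 Inv_Suc)

lemma Adj_fin: "Adj (enat k)"
  using Inv_all[of k] by (simp add: Inv_def)

lemma Cl_mono: "Cl (enat k) \<subseteq> Mono (E (enat k))"
  using Inv_all[of k] by (simp add: Inv_def)

lemma cellular_fin: "cellular_cat U (E (enat k)) (FB (enat k))"
  using Inv_all[of k] by (simp add: Inv_def)

lemma step_fin: "\<exists>ext. alg_step U (E (enat k)) (FB (enat k)) (I (Suc k)) (E (enat (Suc k))) (VS k) ext"
  by (rule Inv_step[OF Inv_all])

lemmas Cl_Cel = cellular_cat.Cell_Cel[OF cellular_fin]

lemma Cl_comp: "f \<in> Cl (enat k) \<Longrightarrow> g \<in> Cl (enat k) \<Longrightarrow> f \<in> hom (E (enat k)) X Y \<Longrightarrow> g \<in> hom (E (enat k)) Y Z \<Longrightarrow>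
    g \<cdot>\<^bsub>E (enat k)\<^esub> f \<in> Cl (enat k)"
  using cellular_cat.comp_Cel[OF cellular_fin] unfolding Cl_Cel by blast

lemma Cl_iso: "iso_ar (E (enat k)) X Y f \<Longrightarrow> f \<in> Cl (enat k)"
  using cellular_cat.iso_Cel[OF cellular_fin] unfolding Cl_Cel by blast

lemma Cell_image_fin:
  assumes "m \<le> k" shows "on_ar (V (enat k) (enat m)) ` Cl (enat k) \<subseteq> Cl (enat m)"
  using assms
proof (induction k rule: nat_induct_at_least)
  case base
  have "on_ar (V (enat m) (enat m)) f = f" if "f \<in> Cl (enat m)" for f using V_id(2) Cell_Ar[OF Adj_fin that] by blast
  then show ?case by auto
next
  case (Suc k)
  show ?case
  proof safe
    fix f assume f: "f \<in> Cl (enat (Suc k))"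
    have "on_ar (VS k) f \<in> Cl (enat k)" using Inv_Suc(2)[OF Inv_all] f by blast
    then have "on_ar (V (enat k) (enat m)) (on_ar (VS k) f) \<in> Cl (enat m)" using Suc.IH by blast
    then show "on_ar (V (enat (Suc k)) (enat m)) f \<in> Cl (enat m)"
      using VV(2)[of "enat m" "enat k" "enat (Suc k)" f] Cell_Ar[OF Adj_fin f] Suc.hyps by simp
  qed
qed

lemma free_step:
  assumes "X \<in> Ob (E (enat k))"
  shows "\<exists>Y t. uarrow (E (enat k)) (E (enat (Suc k))) (VS k) X Y t \<and> t \<in> Cl (enat k)"
proof -
  obtain ext where "alg_step U (E (enat k)) (FB (enat k)) (I (Suc k)) (E (enat (Suc k))) (VS k) ext"
    using step_fin by (rule exE)
  then interpret A: alg_step U "E (enat k)" "FB (enat k)" "I (Suc k)" "E (enat (Suc k))" "VS k" ext .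
  show ?thesis using A.free_exists[OF assms] unfolding Cl_Cel by blast
qed

lemma uarrow_self:
  assumes "X \<in> Ob (E n)" shows "uarrow (E n) (E n) (V n n) X X (Idt (E n) X)"
  unfolding uarrow_def
proof (intro conjI ballI)
  show "X \<in> Ob (E n)" "Idt (E n) X \<in> hom (E n) X (on_ob (V n n) X)" using assms V_id(1) id_hom[OF catE] by auto
  fix Y f assume "Y \<in> Ob (E n)" "f \<in> hom (E n) X (on_ob (V n n) Y)"
  then have f: "f \<in> hom (E n) X Y" using V_id(1) by simp
  have e: "on_ar (V n n) g \<cdot>\<^bsub>E n\<^esub> Idt (E n) X = g" if "g \<in> hom (E n) X Y" for g
    using V_id(2)[of g n] id_right[OF catE that] that by (simp add: hom_def)
  show "\<exists>!g. g \<in> hom (E n) X Y \<and> on_ar (V n n) g \<cdot>\<^bsub>E n\<^esub> Idt (E n) X = f"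
    using f e by (intro ex1I[of _ f]) auto
qed

text \<open>Units compose: the unit of each further stage is cellular there, and its image at stage
  \<open>m\<close> is cellular by \<open>Cell_image_fin\<close>.\<close>

lemma free_fin:
  assumes "m \<le> k" "X \<in> Ob (E (enat m))"
  shows "\<exists>Y t. uarrow (E (enat m)) (E (enat k)) (V (enat k) (enat m)) X Y t \<and> t \<in> Cl (enat m)"
  using assms(1)
proof (induction k rule: nat_induct_at_least)
  case base
  show ?case using uarrow_self[OF assms(2)] Cl_iso[OF iso_id[OF catE assms(2)]] by blast
next
  case (Suc k)
  have mk: "enat m \<le> enat k" using Suc.hyps by simp
  obtain Y t where Y: "uarrow (E (enat m)) (E (enat k)) (V (enat k) (enat m)) X Y t" "t \<in> Cl (enat m)" using Suc.IH by blast
  obtain Y' t' where Y': "uarrow (E (enat k)) (E (enat (Suc k))) (VS k) Y Y' t'" "t' \<in> Cl (enat k)"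
    using free_step[OF uarrowD(1)[OF Y(1)]] by blast
  have "uarrow (E (enat m)) (E (enat (Suc k))) (V (enat (Suc k)) (enat m)) X Y' (on_ar (V (enat k) (enat m)) t' \<cdot>\<^bsub>E (enat m)\<^esub> t)"
    by (rule uarrow_comp[OF VS_F VF[OF mk] _ _ Y(1) Y'(1)]) (use mk VV in auto)
  moreover have "on_ar (V (enat k) (enat m)) t' \<cdot>\<^bsub>E (enat m)\<^esub> t \<in> Cl (enat m)"
    by (rule Cl_comp[OF Y(2) _ uarrowD(2)[OF Y(1)] functor_hom[OF VF[OF mk] uarrowD(2)[OF Y'(1)]]])
      (use Cell_image_fin[OF Suc.hyps] Y'(2) in blast)
  ultimately show ?case by blast
qed

lemma VS_creates:
  fixes T :: "'j set"
  assumes "small U T" "dirset T r" "pdiag (E (enat (Suc k))) T r X h"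
    "pcolim (E (enat k)) T r (\<lambda>a. on_ob (VS k) (X a)) (\<lambda>a b. on_ar (VS k) (h a b)) Z c"
  shows "\<exists>Y c'. Y \<in> Ob (E (enat (Suc k))) \<and> on_ob (VS k) Y = Z \<and> (\<forall>a \<in> T. on_ar (VS k) (c' a) = c a) \<and> pcolim (E (enat (Suc k))) T r X h Y c'"
proof -
  obtain ext where "alg_step U (E (enat k)) (FB (enat k)) (I (Suc k)) (E (enat (Suc k))) (VS k) ext"
    using step_fin by (rule exE)
  then interpret A: alg_step U "E (enat k)" "FB (enat k)" "I (Suc k)" "E (enat (Suc k))" "VS k" ext .
  show ?thesis by (rule A.creates_directed[OF assms])
qed


section \<open>The limit stage\<close>

abbreviation "VI n \<equiv> V \<infinity> (enat n)"

lemma VI_F: "is_functor (E \<infinity>) (E (enat n)) (VI n)"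
  by (rule VF) simp

lemma VI_VS: "X \<in> Ob (E \<infinity>) \<Longrightarrow> on_ob (VS n) (on_ob (VI (Suc n)) X) = on_ob (VI n) X"
  "f \<in> Ar (E \<infinity>) \<Longrightarrow> on_ar (VS n) (on_ar (VI (Suc n)) f) = on_ar (VI n) f"
  by (simp_all add: VV)

lemma limit_iso: "bij_betw (\<lambda>X n. on_ob (VI n) X) (Ob (E \<infinity>)) (Ob (seq_limit E V))"
  "bij_betw (\<lambda>f n. on_ar (VI n) f) (Ar (E \<infinity>)) (Ar (seq_limit E V))"
  using tow by (simp_all add: is_tower_def is_isomorphism_def)

lemma limit_ar_eq:
  assumes "f \<in> Ar (E \<infinity>)" "g \<in> Ar (E \<infinity>)" "\<And>n. on_ar (VI n) f = on_ar (VI n) g"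
  shows "f = g"
proof (rule inj_onD[OF bij_betw_imp_inj_on[OF limit_iso(2)] _ assms(1,2)])
  show "(\<lambda>n. on_ar (VI n) f) = (\<lambda>n. on_ar (VI n) g)" using assms(3) by blast
qed

lemma limit_ob:
  assumes "\<And>n. X n \<in> Ob (E (enat n))" "\<And>n. on_ob (VS n) (X (Suc n)) = X n"
  shows "\<exists>Y. Y \<in> Ob (E \<infinity>) \<and> (\<forall>n. on_ob (VI n) Y = X n)"
proof -
  have "X \<in> Ob (seq_limit E V)" using assms by (simp add: seq_limit_def)
  then have "X \<in> (\<lambda>Y n. on_ob (VI n) Y) ` Ob (E \<infinity>)" using bij_betw_imp_surj_on[OF limit_iso(1)] by simp
  then show ?thesis by auto
qed

text \<open>The bijection on arrows yields some \<open>w\<close> with the given components; its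
  domain and codomain have the components of \<open>X\<close> and \<open>Y\<close> and are
  identified by injectivity on objects.\<close>

lemma limit_ar:
  assumes X: "X \<in> Ob (E \<infinity>)" and Y: "Y \<in> Ob (E \<infinity>)"
    and f: "\<And>n. f n \<in> hom (E (enat n)) (on_ob (VI n) X) (on_ob (VI n) Y)" "\<And>n. on_ar (VS n) (f (Suc n)) = f n"
  shows "\<exists>w. w \<in> hom (E \<infinity>) X Y \<and> (\<forall>n. on_ar (VI n) w = f n)"
proof -
  have "f \<in> Ar (seq_limit E V)" using f by (simp add: seq_limit_def hom_def)
  then have "f \<in> (\<lambda>w n. on_ar (VI n) w) ` Ar (E \<infinity>)" using bij_betw_imp_surj_on[OF limit_iso(2)] by simp
  then obtain w where w: "w \<in> Ar (E \<infinity>)" "\<And>n. on_ar (VI n) w = f n" by auto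
  have wh: "w \<in> hom (E \<infinity>) (Dom (E \<infinity>) w) (Cod (E \<infinity>) w)" by (rule hom_self[OF w(1)])
  have O: "Dom (E \<infinity>) w \<in> Ob (E \<infinity>)" "Cod (E \<infinity>) w \<in> Ob (E \<infinity>)" using hom_dom[OF catE wh] hom_cod[OF catE wh] by auto
  have e: "on_ob (VI n) (Dom (E \<infinity>) w) = on_ob (VI n) X" "on_ob (VI n) (Cod (E \<infinity>) w) = on_ob (VI n) Y" for n
    using functor_hom[OF VI_F wh, of n] f(1)[of n] w(2)[of n] by (auto simp: hom_def)
  have "Dom (E \<infinity>) w = X"
    by (rule inj_onD[OF bij_betw_imp_inj_on[OF limit_iso(1)] _ O(1) X]) (use e in blast)
  moreover have "Cod (E \<infinity>) w = Y"
    by (rule inj_onD[OF bij_betw_imp_inj_on[OF limit_iso(1)] _ O(2) Y]) (use e in blast)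
  ultimately show ?thesis using wh w(2) by blast
qed

text \<open>Diagrams at all finite stages that lie over each other from some point on; \<open>A n\<close> indexes the
  objects present at stage \<open>n\<close>.\<close>

definition ldiag :: "(nat \<Rightarrow> 'j set) \<Rightarrow> 'j rel \<Rightarrow> (nat \<Rightarrow> 'j \<Rightarrow> 'o) \<Rightarrow> (nat \<Rightarrow> 'j \<Rightarrow> 'j \<Rightarrow> 'm) \<Rightarrow> bool" where
  "ldiag A r X h \<longleftrightarrow> (\<forall>n. small U (A n) \<and> dirset (A n) r \<and> A (Suc n) \<subseteq> A n \<and>
     (\<forall>x \<in> A n. \<exists>a \<in> A (Suc n). (x, a) \<in> r) \<and> pdiag (E (enat n)) (A n) r (X n) (h n) \<and>
     (\<forall>a \<in> A (Suc n). on_ob (VS n) (X (Suc n) a) = X n a) \<and>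
     (\<forall>a \<in> A (Suc n). \<forall>b \<in> A (Suc n). (a, b) \<in> r \<longrightarrow> on_ar (VS n) (h (Suc n) a b) = h n a b))"

lemma ldiagD:
  assumes "ldiag A r X h"
  shows "small U (A n)" "dirset (A n) r" "A (Suc n) \<subseteq> A n" "\<And>x. x \<in> A n \<Longrightarrow> \<exists>a \<in> A (Suc n). (x, a) \<in> r"
    "pdiag (E (enat n)) (A n) r (X n) (h n)" "\<And>a. a \<in> A (Suc n) \<Longrightarrow> on_ob (VS n) (X (Suc n) a) = X n a"
    "\<And>a b. a \<in> A (Suc n) \<Longrightarrow> b \<in> A (Suc n) \<Longrightarrow> (a, b) \<in> r \<Longrightarrow> on_ar (VS n) (h (Suc n) a b) = h n a b"
  using assms unfolding ldiag_def by blast+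

text \<open>The legs are families at finite stages, not morphisms of \<open>E \<infinity>\<close>,
  because an index \<open>a\<close> need not belong to all \<open>A n\<close> and its object need
  not come from the limit.\<close>

definition lcolim :: "(nat \<Rightarrow> 'j set) \<Rightarrow> 'j rel \<Rightarrow> (nat \<Rightarrow> 'j \<Rightarrow> 'o) \<Rightarrow> (nat \<Rightarrow> 'j \<Rightarrow> 'j \<Rightarrow> 'm) \<Rightarrow> 'o \<Rightarrow> (nat \<Rightarrow> 'j \<Rightarrow> 'm) \<Rightarrow> bool" where
  "lcolim A r X h L c \<longleftrightarrow> L \<in> Ob (E \<infinity>) \<and> (\<forall>n. pcolim (E (enat n)) (A n) r (X n) (h n) (on_ob (VI n) L) (c n)) \<and>
     (\<forall>n. \<forall>a \<in> A (Suc n). on_ar (VS n) (c (Suc n) a) = c n a)"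

lemma lcolim_restrict:
  assumes d: "ldiag A r X h" and pc: "pcolim (E (enat n)) (A n) r (X n) (h n) Z c"
  shows "pcolim (E (enat n)) (A (Suc n)) r (X n) (h n) Z c"
  by (rule pcolim_restrict[OF catE ldiagD(5)[OF d] pc ldiagD(2)[OF d] ldiagD(3)[OF d] ldiagD(2)[OF d] ldiagD(4)[OF d]])

text \<open>The colimit at stage \<open>n\<close> is also one over the cofinal part
  \<open>A (n + 1)\<close>, and there \<open>VS n\<close> creates a colimit lying strictly over it.
  The resulting sequence of objects is strictly compatible and so defines an object of the limit
  category.\<close>

lemma lcolim_exists:
  assumes d: "ldiag A r X h"
  shows "\<exists>L c. lcolim A r X h L c"
proof -
  note D = ldiagD[OF d]
  define P where "P = (\<lambda>n p. pcolim (E (enat n)) (A n) r (X n) (h n) (fst p) (snd p))"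
  define Q where "Q = (\<lambda>n p q. on_ob (VS n) (fst q) = fst p \<and> (\<forall>a \<in> A (Suc n). on_ar (VS n) (snd q a) = snd p a))"
  have "\<exists>p. \<forall>n. P n (p n) \<and> Q n (p n) (p (Suc n))"
  proof (rule dependent_nat_choice)
    interpret c: cellular_cat U "E (enat 0)" "FB (enat 0)" by (rule cellular_fin)
    \<comment> \<open>Only the colimit at stage \<open>0\<close> is formed directly; all others are
      created above it.\<close>
    show "\<exists>p. P 0 p" using pcolim_exists[OF c.rc c.cat D(1) D(5)] by (auto simp: P_def)
    fix p n assume "P n p"
    then have "pcolim (E (enat n)) (A (Suc n)) r (X n) (h n) (fst p) (snd p)"
      unfolding P_def by (rule lcolim_restrict[OF d])
    then have "pcolim (E (enat n)) (A (Suc n)) r (\<lambda>a. on_ob (VS n) (X (Suc n) a)) (\<lambda>a b. on_ar (VS n) (h (Suc n) a b)) (fst p) (snd p)"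
      by (subst pcolim_cong[where X' = "X n" and h' = "h n" and c' = "snd p"]) (simp_all add: D(6,7))
    from VS_creates[OF D(1,2,5) this] obtain Y c' where "Y \<in> Ob (E (enat (Suc n)))" "on_ob (VS n) Y = fst p"
      "\<forall>a \<in> A (Suc n). on_ar (VS n) (c' a) = snd p a" "pcolim (E (enat (Suc n))) (A (Suc n)) r (X (Suc n)) (h (Suc n)) Y c'" by blast
    then show "\<exists>q. P (Suc n) q \<and> Q n p q" by (intro exI[of _ "(Y, c')"]) (simp add: P_def Q_def)
  qed
  then obtain p where p: "\<And>n. P n (p n)" "\<And>n. Q n (p n) (p (Suc n))" by blast
  have "\<exists>L. L \<in> Ob (E \<infinity>) \<and> (\<forall>n. on_ob (VI n) L = fst (p n))"
  proof (rule limit_ob)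
    show "fst (p n) \<in> Ob (E (enat n))" for n by (rule pcolim_ob[OF p(1)[of n, unfolded P_def]])
    show "on_ob (VS n) (fst (p (Suc n))) = fst (p n)" for n using p(2)[of n] by (simp add: Q_def)
  qed
  then obtain L where L: "L \<in> Ob (E \<infinity>)" "\<And>n. on_ob (VI n) L = fst (p n)" by blast
  have "lcolim A r X h L (\<lambda>n. snd (p n))"
    unfolding lcolim_def using L p by (simp add: P_def Q_def)
  then show ?thesis by blast
qed

text \<open>The factorizations at the stages are compatible: the image of the one at
  \<open>n + 1\<close> agrees with the one at \<open>n\<close> on \<open>A (n + 1)\<close>, which is
  cofinal in \<open>A n\<close> and thus determines morphisms out of the colimit.\<close>

lemma lcolim_factor:
  assumes d: "ldiag A r X h" and l: "lcolim A r X h L c" and Y: "Y \<in> Ob (E \<infinity>)"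
    and y: "\<And>n. pcone (E (enat n)) (A n) r (X n) (h n) (on_ob (VI n) Y) (y n)"
    and yS: "\<And>n a. a \<in> A (Suc n) \<Longrightarrow> on_ar (VS n) (y (Suc n) a) = y n a"
  shows "\<exists>w. w \<in> hom (E \<infinity>) L Y \<and> (\<forall>n. \<forall>a \<in> A n. on_ar (VI n) w \<cdot>\<^bsub>E (enat n)\<^esub> c n a = y n a)"
proof -
  note D = ldiagD[OF d]
  have L: "L \<in> Ob (E \<infinity>)" and pc: "\<And>n. pcolim (E (enat n)) (A n) r (X n) (h n) (on_ob (VI n) L) (c n)"
    and cS: "\<And>n a. a \<in> A (Suc n) \<Longrightarrow> on_ar (VS n) (c (Suc n) a) = c n a" using l unfolding lcolim_def by blast+
  have "\<exists>w. w \<in> hom (E (enat n)) (on_ob (VI n) L) (on_ob (VI n) Y) \<and> (\<forall>a \<in> A n. w \<cdot>\<^bsub>E (enat n)\<^esub> c n a = y n a)" for n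
    using pcolim_factor[OF pc y] by metis
  then obtain f where f: "\<And>n. f n \<in> hom (E (enat n)) (on_ob (VI n) L) (on_ob (VI n) Y)"
    "\<And>n a. a \<in> A n \<Longrightarrow> f n \<cdot>\<^bsub>E (enat n)\<^esub> c n a = y n a" by metis
  have "on_ar (VS n) (f (Suc n)) = f n" for n
  proof (rule pcolim_eq[OF catE pdiag_subset[OF D(5) D(3)] lcolim_restrict[OF d pc] _ f(1)])
    show fS: "on_ar (VS n) (f (Suc n)) \<in> hom (E (enat n)) (on_ob (VI n) L) (on_ob (VI n) Y)"
      using functor_hom[OF VS_F f(1)[of "Suc n"]] VI_VS(1)[OF L] VI_VS(1)[OF Y] by simp
    fix a assume a: "a \<in> A (Suc n)"
    have "on_ar (VS n) (f (Suc n)) \<cdot>\<^bsub>E (enat n)\<^esub> c n a = on_ar (VS n) (y (Suc n) a)"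
      using functor_comp[OF VS_F pcolim_leg[OF pc a] f(1)[of "Suc n"]] f(2)[OF a] cS[OF a] by simp
    then show "on_ar (VS n) (f (Suc n)) \<cdot>\<^bsub>E (enat n)\<^esub> c n a = f n \<cdot>\<^bsub>E (enat n)\<^esub> c n a"
      using yS[OF a] f(2)[OF subsetD[OF D(3) a]] by simp
  qed
  from limit_ar[OF L Y f(1) this] f(2) show ?thesis by metis
qed

lemma lcolim_eq:
  assumes d: "ldiag A r X h" and l: "lcolim A r X h L c" and v: "v \<in> hom (E \<infinity>) L Y" and w: "w \<in> hom (E \<infinity>) L Y"
    and e: "\<And>n a. a \<in> A n \<Longrightarrow> on_ar (VI n) v \<cdot>\<^bsub>E (enat n)\<^esub> c n a = on_ar (VI n) w \<cdot>\<^bsub>E (enat n)\<^esub> c n a"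
  shows "v = w"
proof (rule limit_ar_eq)
  show "v \<in> Ar (E \<infinity>)" "w \<in> Ar (E \<infinity>)" using v w by (auto simp: hom_def)
  have pc: "pcolim (E (enat n)) (A n) r (X n) (h n) (on_ob (VI n) L) (c n)" for n using l unfolding lcolim_def by blast
  show "on_ar (VI n) v = on_ar (VI n) w" for n
    by (rule pcolim_eq[OF catE ldiagD(5)[OF d] pc functor_hom[OF VI_F v] functor_hom[OF VI_F w] e])
qed

end

lemma mpush_cong:
  assumes "\<And>j. j \<in> J \<Longrightarrow> g j = g' j"
  shows "mpush C W J al g = mpush C W J al g'"
proof -
  have "mcone C W J al g = mcone C W J al g'" unfolding mcone_def using assms by (intro ext) auto
  then show ?thesis unfolding mpush_def by (intro ext) simp
qed

lemma seq_pcone_from: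
  assumes cat: "category C" and u: "\<And>n. u n \<in> hom C (X n) (X (Suc n))" and Y: "Y \<in> Ob C"
    and d: "\<And>n. m \<le> n \<Longrightarrow> d n \<in> hom C (X n) Y" "\<And>n. m \<le> n \<Longrightarrow> d (Suc n) \<cdot>\<^bsub>C\<^esub> u n = d n"
  shows "pcone C {m..} nle X (nh C X u) Y d"
proof -
  note hself = nh_self[where X = X and u = u, OF cat u] and hS = nh_Suc[where X = X and u = u, OF cat u]
    and hhom = nh_hom[where X = X and u = u, OF cat u]
  have "d n \<cdot>\<^bsub>C\<^esub> nh C X u k n = d k" if k: "m \<le> k" and kn: "k \<le> n" for k n
    using kn
  proof (induction n rule: nat_induct_at_least)
    case base
    then show ?case using id_right[OF cat d(1)[OF k]] hself by simp
  next
    case (Suc n)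
    have mn: "m \<le> n" using k Suc.hyps by simp
    then show ?case
      using comp_assoc[OF cat hhom[OF Suc.hyps] u d(1)[of "Suc n"]] d(2)[OF mn] Suc by (simp add: hS)
  qed
  then show ?thesis unfolding pcone_def using Y d(1) by auto
qed

section \<open>Directed colimits and colimits of towers at the limit stage\<close>

context tower
begin

text \<open>A diagram at the limit stage is a stagewise diagram with constant index set. Its
  stagewise colimit is a colimit in \<open>E \<infinity>\<close>, so any given colimit is isomorphic
  to one computed stage by stage.\<close>

lemma VI_preserves_directed: "preserves_directed U (E \<infinity>) (E (enat m)) (VI m)"
  unfolding preserves_directed_def
proof (intro allI impI, elim conjE)
  fix T :: "'u set" and r X h Z c
  assume sm: "small U T" and dir: "dirset T r" and pd: "pdiag (E \<infinity>) T r X h" and pc: "pcolim (E \<infinity>) T r X h Z c"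
  define X' where "X' n a = on_ob (VI n) (X a)" for n a
  define h' where "h' n a b = on_ar (VI n) (h a b)" for n a b
  have XO: "X a \<in> Ob (E \<infinity>)" if "a \<in> T" for a by (rule pdiag_ob[OF pd that])
  have hh: "h a b \<in> hom (E \<infinity>) (X a) (X b)" if "(a, b) \<in> r" "a \<in> T" "b \<in> T" for a b by (rule pdiag_hom[OF pd that])
  have pdn: "pdiag (E (enat n)) T r (X' n) (h' n)" for n unfolding X'_def h'_def by (rule functor_pdiag[OF VI_F pd])
  have ld: "ldiag (\<lambda>_. T) r X' h'"
    unfolding ldiag_def using sm dir pdn dirset_refl[OF dir] VI_VS(1)[OF XO] VI_VS(2)[OF conjunct1[OF hom_ArD[OF hh]]]
    by (auto simp: X'_def h'_def)
  obtain L k where l: "lcolim (\<lambda>_. T) r X' h' L k" using lcolim_exists[OF ld] by blast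
  have LO: "L \<in> Ob (E \<infinity>)" and pcn: "\<And>n. pcolim (E (enat n)) T r (X' n) (h' n) (on_ob (VI n) L) (k n)"
    and kS: "\<And>n a. a \<in> T \<Longrightarrow> on_ar (VS n) (k (Suc n) a) = k n a" using l unfolding lcolim_def by blast+
  have "\<exists>w. w \<in> hom (E \<infinity>) (X a) L \<and> (\<forall>n. on_ar (VI n) w = k n a)" if a: "a \<in> T" for a
    by (rule limit_ar[OF XO[OF a] LO]) (use pcolim_leg[OF pcn a] kS[OF a] in \<open>auto simp: X'_def\<close>)
  then obtain q where q: "\<And>a. a \<in> T \<Longrightarrow> q a \<in> hom (E \<infinity>) (X a) L" "\<And>a n. a \<in> T \<Longrightarrow> on_ar (VI n) (q a) = k n a" by metis
  have qc: "pcolim (E \<infinity>) T r X h L q"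
    unfolding pcolim_def
  proof (intro conjI allI impI)
    show "pcone (E \<infinity>) T r X h L q"
      unfolding pcone_def
    proof (intro conjI ballI impI LO)
      fix a assume a: "a \<in> T"
      show "q a \<in> hom (E \<infinity>) (X a) L" by (rule q(1)[OF a])
      fix b assume b: "b \<in> T" and ab: "(a, b) \<in> r"
      show "q b \<cdot>\<^bsub>E \<infinity>\<^esub> h a b = q a"
      proof (rule limit_ar_eq)
        show "q b \<cdot>\<^bsub>E \<infinity>\<^esub> h a b \<in> Ar (E \<infinity>)" "q a \<in> Ar (E \<infinity>)"
          using comp_hom[OF catE hh[OF ab a b] q(1)[OF b]] q(1)[OF a] by (auto simp: hom_def)
        show "on_ar (VI n) (q b \<cdot>\<^bsub>E \<infinity>\<^esub> h a b) = on_ar (VI n) (q a)" for n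
          using functor_comp[OF VI_F hh[OF ab a b] q(1)[OF b], of n] q(2)[OF a] q(2)[OF b] pcolim_leg_comp[OF pcn a b ab, of n] by (simp add: h'_def)
      qed
    qed
    fix Y d assume d: "pcone (E \<infinity>) T r X h Y d"
    then have YO: "Y \<in> Ob (E \<infinity>)" and dh: "\<And>a. a \<in> T \<Longrightarrow> d a \<in> hom (E \<infinity>) (X a) Y" unfolding pcone_def by blast+
    have "\<exists>w. w \<in> hom (E \<infinity>) L Y \<and> (\<forall>n. \<forall>a \<in> T. on_ar (VI n) w \<cdot>\<^bsub>E (enat n)\<^esub> k n a = on_ar (VI n) (d a))"
    proof (rule lcolim_factor[OF ld l YO])
      show "pcone (E (enat n)) T r (X' n) (h' n) (on_ob (VI n) Y) (\<lambda>a. on_ar (VI n) (d a))" for n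
        unfolding X'_def h'_def by (rule functor_pcone[OF VI_F pd d])
      show "on_ar (VS n) (on_ar (VI (Suc n)) (d a)) = on_ar (VI n) (d a)" if "a \<in> T" for n a
        using VI_VS(2) dh[OF that] by (simp add: hom_def)
    qed
    then obtain w where w: "w \<in> hom (E \<infinity>) L Y" "\<And>n a. a \<in> T \<Longrightarrow> on_ar (VI n) w \<cdot>\<^bsub>E (enat n)\<^esub> k n a = on_ar (VI n) (d a)" by blast
    have Vq: "on_ar (VI n) (v \<cdot>\<^bsub>E \<infinity>\<^esub> q a) = on_ar (VI n) v \<cdot>\<^bsub>E (enat n)\<^esub> k n a" if "a \<in> T" "v \<in> hom (E \<infinity>) L Y" for a v n
      using functor_comp[OF VI_F q(1)[OF that(1)] that(2)] q(2)[OF that(1)] by simp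
    show "\<exists>!w. w \<in> hom (E \<infinity>) L Y \<and> (\<forall>a \<in> T. w \<cdot>\<^bsub>E \<infinity>\<^esub> q a = d a)"
    proof (rule ex1I[of _ w], intro conjI ballI w(1))
      fix a assume a: "a \<in> T"
      show "w \<cdot>\<^bsub>E \<infinity>\<^esub> q a = d a"
        by (rule limit_ar_eq) (use comp_hom[OF catE q(1)[OF a] w(1)] dh[OF a] Vq[OF a w(1)] w(2)[OF a] in \<open>auto simp: hom_def\<close>)
    next
      fix v assume v: "v \<in> hom (E \<infinity>) L Y \<and> (\<forall>a \<in> T. v \<cdot>\<^bsub>E \<infinity>\<^esub> q a = d a)"
      then have vh: "v \<in> hom (E \<infinity>) L Y" by blast
      show "v = w" by (rule lcolim_eq[OF ld l vh w(1)]) (use v Vq[OF _ vh] w(2) in metis)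
    qed
  qed
  obtain i where i: "iso_ar (E \<infinity>) L Z i" "\<And>a. a \<in> T \<Longrightarrow> i \<cdot>\<^bsub>E \<infinity>\<^esub> q a = c a" using pcolim_iso[OF catE pd qc pc] by blast
  have "pcolim (E (enat m)) T r (X' m) (h' m) (on_ob (VI m) Z) (\<lambda>a. on_ar (VI m) i \<cdot>\<^bsub>E (enat m)\<^esub> k m a)"
    by (rule pcolim_transport[OF catE pdn pcn functor_iso[OF VI_F i(1)]])
  moreover have "on_ar (VI m) i \<cdot>\<^bsub>E (enat m)\<^esub> k m a = on_ar (VI m) (c a)" if a: "a \<in> T" for a
    using functor_comp[OF VI_F q(1)[OF a] iso_hom[OF i(1)], of m] i(2)[OF a] q(2)[OF a] by simp
  ultimately show "pcolim (E (enat m)) T r (\<lambda>a. on_ob (VI m) (X a)) (\<lambda>a b. on_ar (VI m) (h a b)) (on_ob (VI m) Z) (\<lambda>a. on_ar (VI m) (c a))"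
    by (subst (asm) pcolim_cong[where c' = "\<lambda>a. on_ar (VI m) (c a)" and X' = "\<lambda>a. on_ob (VI m) (X a)" and h' = "\<lambda>a b. on_ar (VI m) (h a b)"])
      (auto simp: X'_def h'_def)
qed

text \<open>A sequence of objects at successive stages, each mapping to the next, has a colimit at the
  limit stage: at stage \<open>n\<close> it is the colimit of the images of the objects from \<open>Z n\<close> on.\<close>

lemma tower_colimit:
  assumes Z: "\<And>k. Z k \<in> Ob (E (enat k))" and t: "\<And>k. t k \<in> hom (E (enat k)) (Z k) (on_ob (VS k) (Z (Suc k)))"
  shows "\<exists>L l. L \<in> Ob (E \<infinity>) \<and> (\<forall>k. l k \<in> hom (E (enat k)) (Z k) (on_ob (VI k) L)) \<and>
    (\<forall>k. on_ar (VS k) (l (Suc k)) \<cdot>\<^bsub>E (enat k)\<^esub> t k = l k) \<and>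
    (\<forall>Y y. Y \<in> Ob (E \<infinity>) \<longrightarrow> (\<forall>k. y k \<in> hom (E (enat k)) (Z k) (on_ob (VI k) Y)) \<longrightarrow>
       (\<forall>k. on_ar (VS k) (y (Suc k)) \<cdot>\<^bsub>E (enat k)\<^esub> t k = y k) \<longrightarrow>
       (\<exists>w. w \<in> hom (E \<infinity>) L Y \<and> (\<forall>k. on_ar (VI k) w \<cdot>\<^bsub>E (enat k)\<^esub> l k = y k))) \<and>
    (\<forall>Y v w. v \<in> hom (E \<infinity>) L Y \<longrightarrow> w \<in> hom (E \<infinity>) L Y \<longrightarrow>
       (\<forall>k. on_ar (VI k) v \<cdot>\<^bsub>E (enat k)\<^esub> l k = on_ar (VI k) w \<cdot>\<^bsub>E (enat k)\<^esub> l k) \<longrightarrow> v = w) \<and>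
    (\<forall>m. (\<forall>k \<ge> m. t k \<in> Cl (enat k)) \<longrightarrow> l m \<in> Cl (enat m))"
proof -
  \<comment> \<open>At stage \<open>n\<close> the sequence is constant with value \<open>Z n\<close>
    up to index \<open>n\<close> and continues with the images of the later objects. The constant
    beginning makes it a sequence from \<open>0\<close>; it is not compatible between stages, so
    only the indices in \<open>A n\<close> enter the colimit.\<close>
  define X where "X n k = on_ob (V (enat (max k n)) (enat n)) (Z (max k n))" for n k
  define u where "u n k = (if n \<le> k then on_ar (V (enat k) (enat n)) (t k) else Idt (E (enat n)) (Z n))" for n k
  define h where "h n = nh (E (enat n)) (X n) (u n)" for n
  define A where "A n = {n..}" for n :: nat
  have Xge: "X n k = on_ob (V (enat k) (enat n)) (Z k)" if "n \<le> k" for n k using that by (simp add: X_def max_absorb1)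
  have Xlt: "X n k = Z n" if "k \<le> n" for n k using that V_id(1)[OF Z] by (simp add: X_def max_absorb2)
  have VVo: "on_ob (V (enat m) (enat n)) (on_ob (V (enat k) (enat m)) x) = on_ob (V (enat k) (enat n)) x"
    if "n \<le> m" "m \<le> k" "x \<in> Ob (E (enat k))" for n m k x using VV(1)[of "enat n" "enat m" "enat k" x] that by simp
  have VVa: "on_ar (V (enat m) (enat n)) (on_ar (V (enat k) (enat m)) x) = on_ar (V (enat k) (enat n)) x"
    if "n \<le> m" "m \<le> k" "x \<in> hom (E (enat k)) P Q" for n m k x P Q
    using VV(2)[of "enat n" "enat m" "enat k" x] that by (simp add: hom_def)
  have VFf: "is_functor (E (enat k)) (E (enat n)) (V (enat k) (enat n))" if "n \<le> k" for n k by (rule VF) (use that in simp)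
  have u: "u n k \<in> hom (E (enat n)) (X n k) (X n (Suc k))" for n k
  proof (cases "n \<le> k")
    case True
    then show ?thesis using functor_hom[OF VFf[OF True] t[of k]] VVo[OF True _ Z[of "Suc k"]] Xge by (simp add: u_def)
  next
    case False
    then show ?thesis using id_hom[OF catE Z[of n]] Xlt by (simp add: u_def)
  qed
  note sq = seq_pdiag[where X = "X n" and u = "u n" for n, OF catE u, folded h_def]
  note hstep = nh_step[where X = "X n" and u = "u n" for n, OF catE u, folded h_def]
    and hself = nh_self[where X = "X n" and u = "u n" for n, OF catE u, folded h_def]
    and hS = nh_Suc[where X = "X n" and u = "u n" for n, OF catE u, folded h_def]
    and hhom = nh_hom[where X = "X n" and u = "u n" for n, OF catE u, folded h_def]
    and hO = seq_ob[where X = "X n" and u = "u n" for n, OF catE u]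
  have XS: "on_ob (VS n) (X (Suc n) k) = X n k" if "Suc n \<le> k" for n k
    using VVo[of n "Suc n" k "Z k"] that Z Xge[of "Suc n" k] Xge[of n k] by simp
  have uS: "on_ar (VS n) (u (Suc n) k) = u n k" if "Suc n \<le> k" for n k
    using VVa[of n "Suc n" k "t k"] that t[of k] by (simp add: u_def)
  have hSn: "on_ar (VS n) (h (Suc n) j k) = h n j k" if j: "Suc n \<le> j" and jk: "j \<le> k" for n j k
    using jk
  proof (induction k rule: nat_induct_at_least)
    case base
    show ?case using functor_id[OF VS_F hO] XS[OF j] by (simp add: hself)
  next
    case (Suc k)
    have nk: "Suc n \<le> k" using j Suc.hyps by simp
    show ?case using functor_comp[OF VS_F hhom[OF Suc.hyps] u] uS[OF nk] Suc by (simp add: hS)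
  qed
  have ld: "ldiag A nle X h"
    unfolding ldiag_def
  proof (intro allI conjI ballI impI)
    fix n
    show "small U (A n)" by (rule small_countable) simp
    show "dirset (A n) nle"
      unfolding dirset_def A_def
    proof (intro conjI ballI impI)
      show "\<exists>c \<in> {n..}. (a, c) \<in> nle \<and> (b, c) \<in> nle" if "a \<in> {n..}" "b \<in> {n..}" for a b
        using that by (intro bexI[of _ "max a b"]) auto
    qed auto
    show "A (Suc n) \<subseteq> A n" by (auto simp: A_def)
    show "\<exists>a \<in> A (Suc n). (x, a) \<in> nle" if "x \<in> A n" for x by (intro bexI[of _ "max x (Suc n)"]) (auto simp: A_def)
    show "pdiag (E (enat n)) (A n) nle (X n) (h n)" by (rule pdiag_subset[OF sq]) simp
    show "on_ob (VS n) (X (Suc n) a) = X n a" if "a \<in> A (Suc n)" for a using XS that by (simp add: A_def)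
    show "on_ar (VS n) (h (Suc n) a b) = h n a b" if "a \<in> A (Suc n)" "(a, b) \<in> nle" for a b using hSn that by (simp add: A_def)
  qed
  obtain L c where lc: "lcolim A nle X h L c" using lcolim_exists[OF ld] by blast
  have LO: "L \<in> Ob (E \<infinity>)" and pc: "\<And>n. pcolim (E (enat n)) (A n) nle (X n) (h n) (on_ob (VI n) L) (c n)"
    and cS: "\<And>n a. a \<in> A (Suc n) \<Longrightarrow> on_ar (VS n) (c (Suc n) a) = c n a" using lc unfolding lcolim_def by blast+
  \<comment> \<open>The leg of \<open>Z k\<close> at its own stage; all legs \<open>c n k\<close>
    with \<open>n \<le> k\<close> are images of it.\<close>
  define l where "l k = c k k" for k
  have AI: "k \<in> A n \<longleftrightarrow> n \<le> k" for k n by (simp add: A_def)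
  have lh: "l k \<in> hom (E (enat k)) (Z k) (on_ob (VI k) L)" for k
    using pcolim_leg[OF pc[of k], of k] Xlt[of k k] by (simp add: l_def AI)
  have Vl: "on_ar (V (enat k) (enat n)) (l k) = c n k" if "n \<le> k" for n k
    using that
  proof (induction n rule: inc_induct)
    case base
    show ?case using V_id(2)[of "l k" "enat k"] lh[of k] by (simp add: hom_def l_def)
  next
    case (step n)
    have "on_ar (V (enat k) (enat n)) (l k) = on_ar (VS n) (on_ar (V (enat k) (enat (Suc n))) (l k))"
      using VVa[of n "Suc n" k "l k"] step.hyps lh[of k] by simp
    then show ?case using step cS[of k n] by (simp add: AI)
  qed
  have lt: "on_ar (VS k) (l (Suc k)) \<cdot>\<^bsub>E (enat k)\<^esub> t k = l k" for k
  proof -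
    have "c k (Suc k) \<cdot>\<^bsub>E (enat k)\<^esub> h k k (Suc k) = c k k" by (rule pcolim_leg_comp[OF pc]) (simp_all add: AI)
    moreover have "h k k (Suc k) = t k" using hstep[of k k] V_id(2)[of "t k" "enat k"] t[of k] by (simp add: u_def hom_def)
    ultimately show ?thesis using Vl[of k "Suc k"] by (simp add: l_def)
  qed
  have fac: "\<exists>w. w \<in> hom (E \<infinity>) L Y \<and> (\<forall>k. on_ar (VI k) w \<cdot>\<^bsub>E (enat k)\<^esub> l k = y k)"
    if YO: "Y \<in> Ob (E \<infinity>)" and y: "\<forall>k. y k \<in> hom (E (enat k)) (Z k) (on_ob (VI k) Y)"
      and yt: "\<forall>k. on_ar (VS k) (y (Suc k)) \<cdot>\<^bsub>E (enat k)\<^esub> t k = y k" for Y y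
  proof -
    \<comment> \<open>A cocone given at the stages of the objects themselves is spread to every
      lower stage by the forgetful functors.\<close>
    define y' where "y' n k = on_ar (V (enat k) (enat n)) (y k)" for n k
    have yh: "y k \<in> hom (E (enat k)) (Z k) (on_ob (VI k) Y)" for k using y by blast
    have VIY: "on_ob (V (enat k) (enat n)) (on_ob (VI k) Y) = on_ob (VI n) Y" if "n \<le> k" for n k using VV(1)[of "enat n" "enat k" \<infinity> Y] YO that by simp
    have y'h: "y' n k \<in> hom (E (enat n)) (X n k) (on_ob (VI n) Y)" if "n \<le> k" for n k
      using functor_hom[OF VFf[OF that] yh] VIY[OF that] Xge[OF that] by (simp add: y'_def)
    have y't: "y' n (Suc k) \<cdot>\<^bsub>E (enat n)\<^esub> u n k = y' n k" if nk: "n \<le> k" for n k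
    proof -
      have yS: "on_ar (VS k) (y (Suc k)) \<in> hom (E (enat k)) (on_ob (VS k) (Z (Suc k))) (on_ob (VI k) Y)"
        using functor_hom[OF VS_F yh[of "Suc k"]] VI_VS(1)[OF YO] by simp
      have "y' n (Suc k) = on_ar (V (enat k) (enat n)) (on_ar (VS k) (y (Suc k)))"
        using VVa[OF nk _ yh[of "Suc k"]] by (simp add: y'_def)
      then show ?thesis using functor_comp[OF VFf[OF nk] t yS] yt nk by (simp add: u_def y'_def)
    qed
    have "\<exists>w. w \<in> hom (E \<infinity>) L Y \<and> (\<forall>n. \<forall>a \<in> A n. on_ar (VI n) w \<cdot>\<^bsub>E (enat n)\<^esub> c n a = y' n a)"
    proof (rule lcolim_factor[OF ld lc YO])
      show "pcone (E (enat n)) (A n) nle (X n) (h n) (on_ob (VI n) Y) (y' n)" for n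
        unfolding h_def A_def
      proof (rule seq_pcone_from[OF catE _ functor_ob[OF VI_F YO]])
        show "u n k \<in> hom (E (enat n)) (X n k) (X n (Suc k))" for k by (rule u)
      qed (use y'h y't in auto)
      show "on_ar (VS n) (y' (Suc n) a) = y' n a" if "a \<in> A (Suc n)" for n a
        using VVa[of n "Suc n" a "y a"] that yh[of a] by (simp add: y'_def AI)
    qed
    then obtain w where w: "w \<in> hom (E \<infinity>) L Y" "\<And>n a. a \<in> A n \<Longrightarrow> on_ar (VI n) w \<cdot>\<^bsub>E (enat n)\<^esub> c n a = y' n a" by blast
    have "y' k k = y k" for k using V_id(2)[of "y k" "enat k"] yh[of k] by (simp add: y'_def hom_def)
    then show ?thesis using w(1) w(2)[of k k for k] by (auto simp: AI l_def)
  qed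
  have uniq: "v = w" if v: "v \<in> hom (E \<infinity>) L Y" and w: "w \<in> hom (E \<infinity>) L Y"
      and e: "\<forall>k. on_ar (VI k) v \<cdot>\<^bsub>E (enat k)\<^esub> l k = on_ar (VI k) w \<cdot>\<^bsub>E (enat k)\<^esub> l k" for Y v w
  proof (rule lcolim_eq[OF ld lc v w])
    fix n k assume "k \<in> A n"
    then have nk: "n \<le> k" by (simp add: AI)
    have "on_ar (VI n) x \<cdot>\<^bsub>E (enat n)\<^esub> c n k = on_ar (V (enat k) (enat n)) (on_ar (VI k) x \<cdot>\<^bsub>E (enat k)\<^esub> l k)" if x: "x \<in> hom (E \<infinity>) L Y" for x
      using functor_comp[OF VFf[OF nk] lh functor_hom[OF VI_F x]] Vl[OF nk] VV(2)[of "enat n" "enat k" \<infinity> x] nk x by (simp add: hom_def)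
    then show "on_ar (VI n) v \<cdot>\<^bsub>E (enat n)\<^esub> c n k = on_ar (VI n) w \<cdot>\<^bsub>E (enat n)\<^esub> c n k" using v w e by simp
  qed
  have cell: "l m \<in> Cl (enat m)" if tc: "\<forall>k \<ge> m. t k \<in> Cl (enat k)" for m
  proof -
    interpret cm: cellular_cat U "E (enat m)" "FB (enat m)" by (rule cellular_fin)
    \<comment> \<open>The cocone on the tail from \<open>m\<close> is prolonged constantly to
      smaller indices, where the connecting morphisms are identities. Then \<open>l m\<close> is the
      leg at \<open>0\<close> of a full sequence, as \<open>seq_Cel\<close> requires.\<close>
    define d where "d k = (if k < m then c m m else c m k)" for k
    have ch: "c m k \<in> hom (E (enat m)) (X m k) (on_ob (VI m) L)" if "m \<le> k" for k using pcolim_leg[OF pc[of m], of k] that by (simp add: AI)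
    have dh: "d k \<in> hom (E (enat m)) (X m k) (on_ob (VI m) L)" for k using ch[of k] ch[of m] Xlt[of k m] Xlt[of m m] by (simp add: d_def)
    have du: "d (Suc k) \<cdot>\<^bsub>E (enat m)\<^esub> u m k = d k" for k
    proof (cases "m \<le> k")
      case True
      have "c m (Suc k) \<cdot>\<^bsub>E (enat m)\<^esub> h m k (Suc k) = c m k" by (rule pcolim_leg_comp[OF pc]) (use True in \<open>simp_all add: AI\<close>)
      then show ?thesis using True hstep[of m k] by (simp add: d_def)
    next
      case False
      then have "Suc k < m \<or> Suc k = m" by auto
      with False have "d (Suc k) = c m m" "d k = c m m" by (auto simp: d_def)
      then show ?thesis using False id_right[OF catE ch[of m]] Xlt[of m m] by (simp add: u_def)
    qed
    have cone: "pcone (E (enat m)) UNIV nle (X m) (h m) (on_ob (VI m) L) d"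
      unfolding h_def using seq_pcone[where X = "X m" and u = "u m", OF catE u] dh du functor_ob[OF VI_F LO] by blast
    have "pcolim (E (enat m)) UNIV nle (X m) (h m) (on_ob (VI m) L) d"
    proof (rule pcolim_reindex[OF catE sq cone, where A' = "A m" and r' = nle and \<phi> = "\<lambda>k. k"])
      show "pcolim (E (enat m)) (A m) nle (X m) (h m) (on_ob (VI m) L) d"
        using pc[of m] by (subst pcolim_cong[where X' = "X m" and h' = "h m" and c' = "c m"]) (auto simp: AI d_def)
      show "\<exists>a \<in> A m. (x, a) \<in> nle" for x by (intro bexI[of _ "max x m"]) (auto simp: AI)
    qed auto
    moreover have "u m k \<in> cm.Cel" for k
    proof (cases "m \<le> k")
      case True
      then show ?thesis using Cell_image_fin[OF True] tc by (auto simp: u_def cm.Cell_Cel[symmetric])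
    next
      case False
      then show ?thesis using cm.iso_Cel[OF iso_id[OF catE Z[of m]]] by (simp add: u_def)
    qed
    ultimately have "d 0 \<in> cm.Cel" unfolding h_def by (rule cm.seq_Cel[where X = "X m" and u = "u m", OF u])
    then show ?thesis unfolding l_def by (simp add: d_def cm.Cell_Cel split: if_splits)
  qed
  show ?thesis using LO lh lt fac uniq cell by blast
qed

text \<open>Free objects are formed one stage at a time starting from \<open>X\<close>, and the
  colimit of the resulting tower is free at the limit. Its unit is the leg at stage
  \<open>m\<close>, a composite of cellular morphisms.\<close>

lemma free_inf:
  assumes X: "X \<in> Ob (E (enat m))"
  shows "\<exists>L q. uarrow (E (enat m)) (E \<infinity>) (VI m) X L q \<and> q \<in> Cl (enat m)"
proof -
  have "\<forall>k Y. \<exists>Y' q. Y \<in> Ob (E (enat k)) \<longrightarrow> uarrow (E (enat k)) (E (enat (Suc k))) (VS k) Y Y' q \<and> q \<in> Cl (enat k)"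
    using free_step by blast
  then obtain F1 T1 where FT: "\<And>k Y. Y \<in> Ob (E (enat k)) \<Longrightarrow> uarrow (E (enat k)) (E (enat (Suc k))) (VS k) Y (F1 k Y) (T1 k Y)"
    "\<And>k Y. Y \<in> Ob (E (enat k)) \<Longrightarrow> T1 k Y \<in> Cl (enat k)" by metis
  define Zs where "Zs = rec_nat X (\<lambda>i Y. F1 (m + i) Y)"
  have Zs: "Zs 0 = X" "Zs (Suc i) = F1 (m + i) (Zs i)" for i by (simp_all add: Zs_def)
  have ZsO: "Zs i \<in> Ob (E (enat (m + i)))" for i
  proof (induction i)
    case (Suc i)
    then show ?case using uarrowD(1)[OF FT(1)[OF Suc]] Zs by simp
  qed (simp add: Zs X)
  \<comment> \<open>Below stage \<open>m\<close> the tower consists of the images of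
    \<open>X\<close> with identity transitions, since colimits of towers start at stage
    \<open>0\<close>.\<close>
  define Z where "Z k = (if k < m then on_ob (V (enat m) (enat k)) X else Zs (k - m))" for k
  define t where "t k = (if k < m then Idt (E (enat k)) (Z k) else T1 k (Z k))" for k
  have Zm: "Z m = X" by (simp add: Z_def Zs)
  have Zle: "Z k = on_ob (V (enat m) (enat k)) X" if "k \<le> m" for k
    using that V_id(1)[OF X] by (cases "k = m") (simp_all add: Z_def Zs(1))
  have ZO: "Z k \<in> Ob (E (enat k))" for k
  proof (cases "k < m")
    case True
    then show ?thesis using functor_ob[OF VF X, of "enat k"] by (simp add: Z_def)
  next
    case False
    then show ?thesis using ZsO[of "k - m"] by (simp add: Z_def)
  qed
  have ZS: "on_ob (VS k) (Z (Suc k)) = Z k" if "k < m" for k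
    using that VV(1)[of "enat k" "enat (Suc k)" "enat m" X] X by (simp add: Zle)
  have ut: "uarrow (E (enat k)) (E (enat (Suc k))) (VS k) (Z k) (Z (Suc k)) (t k)" if "m \<le> k" for k
    using FT(1)[OF ZO[of k]] that Zs(2)[of "k - m"] by (simp add: t_def Z_def Suc_diff_le)
  have th: "t k \<in> hom (E (enat k)) (Z k) (on_ob (VS k) (Z (Suc k)))" for k
  proof (cases "k < m")
    case True
    then show ?thesis using ZS id_hom[OF catE ZO[of k]] by (simp add: t_def)
  next
    case False
    then show ?thesis using uarrowD(2)[OF ut] by simp
  qed
  have tC: "\<forall>k \<ge> m. t k \<in> Cl (enat k)" using FT(2)[OF ZO] by (simp add: t_def)
  from tower_colimit[OF ZO th] obtain L l where
    LO: "L \<in> Ob (E \<infinity>)" and lh: "\<And>k. l k \<in> hom (E (enat k)) (Z k) (on_ob (VI k) L)"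
    and lt: "\<And>k. on_ar (VS k) (l (Suc k)) \<cdot>\<^bsub>E (enat k)\<^esub> t k = l k"
    and fac: "\<forall>Y y. Y \<in> Ob (E \<infinity>) \<longrightarrow> (\<forall>k. y k \<in> hom (E (enat k)) (Z k) (on_ob (VI k) Y)) \<longrightarrow>
       (\<forall>k. on_ar (VS k) (y (Suc k)) \<cdot>\<^bsub>E (enat k)\<^esub> t k = y k) \<longrightarrow>
       (\<exists>w. w \<in> hom (E \<infinity>) L Y \<and> (\<forall>k. on_ar (VI k) w \<cdot>\<^bsub>E (enat k)\<^esub> l k = y k))"
    and uniq: "\<And>Y v w. v \<in> hom (E \<infinity>) L Y \<Longrightarrow> w \<in> hom (E \<infinity>) L Y \<Longrightarrow>
       (\<And>k. on_ar (VI k) v \<cdot>\<^bsub>E (enat k)\<^esub> l k = on_ar (VI k) w \<cdot>\<^bsub>E (enat k)\<^esub> l k) \<Longrightarrow> v = w"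
    and cell: "\<forall>m. (\<forall>k \<ge> m. t k \<in> Cl (enat k)) \<longrightarrow> l m \<in> Cl (enat m)" by blast
  have lm: "l m \<in> Cl (enat m)" using cell tC by blast
  have "uarrow (E (enat m)) (E \<infinity>) (VI m) X L (l m)"
    unfolding uarrow_def
  proof (intro conjI ballI LO)
    show "l m \<in> hom (E (enat m)) X (on_ob (VI m) L)" using lh[of m] Zm by simp
    fix Y f assume YO: "Y \<in> Ob (E \<infinity>)" and f: "f \<in> hom (E (enat m)) X (on_ob (VI m) Y)"
    \<comment> \<open>The successive transposes of \<open>f\<close> along the free objects; together
      they form a cocone from stage \<open>m\<close> on.\<close>
    have "\<exists>ys. \<forall>i. (ys i \<in> hom (E (enat (m + i))) (Z (m + i)) (on_ob (VI (m + i)) Y) \<and> (i = 0 \<longrightarrow> ys i = f)) \<and>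
        on_ar (VS (m + i)) (ys (Suc i)) \<cdot>\<^bsub>E (enat (m + i))\<^esub> t (m + i) = ys i"
    proof (rule dependent_nat_choice)
      show "\<exists>y. y \<in> hom (E (enat (m + 0))) (Z (m + 0)) (on_ob (VI (m + 0)) Y) \<and> (0 = (0 :: nat) \<longrightarrow> y = f)"
        using f Zm by simp
      fix y i assume "y \<in> hom (E (enat (m + i))) (Z (m + i)) (on_ob (VI (m + i)) Y) \<and> (i = 0 \<longrightarrow> y = f)"
      then have "y \<in> hom (E (enat (m + i))) (Z (m + i)) (on_ob (VS (m + i)) (on_ob (VI (Suc (m + i))) Y))"
        using VI_VS(1)[OF YO] by simp
      from uarrowD(3)[OF ut functor_ob[OF VI_F YO] this]
      show "\<exists>y'. (y' \<in> hom (E (enat (m + Suc i))) (Z (m + Suc i)) (on_ob (VI (m + Suc i)) Y) \<and> (Suc i = 0 \<longrightarrow> y' = f)) \<and>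
        on_ar (VS (m + i)) y' \<cdot>\<^bsub>E (enat (m + i))\<^esub> t (m + i) = y" by simp
    qed
    then obtain ys where ys: "\<And>i. ys i \<in> hom (E (enat (m + i))) (Z (m + i)) (on_ob (VI (m + i)) Y)" "ys 0 = f"
      "\<And>i. on_ar (VS (m + i)) (ys (Suc i)) \<cdot>\<^bsub>E (enat (m + i))\<^esub> t (m + i) = ys i" by blast
    define y where "y k = (if k < m then on_ar (V (enat m) (enat k)) f else ys (k - m))" for k
    have ym: "y m = f" by (simp add: y_def ys)
    have yle: "y k = on_ar (V (enat m) (enat k)) f" if "k \<le> m" for k
      using that V_id(2)[of f "enat m"] f by (cases "k = m") (auto simp: y_def ys(2) hom_def)
    have yh: "y k \<in> hom (E (enat k)) (Z k) (on_ob (VI k) Y)" for k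
    proof (cases "k < m")
      case True
      then have km: "enat k \<le> enat m" by simp
      show ?thesis using functor_hom[OF VF[OF km] f] VV(1)[OF km _ YO] True by (simp add: y_def Z_def)
    next
      case False
      then show ?thesis using ys(1)[of "k - m"] by (simp add: y_def)
    qed
    have yt: "on_ar (VS k) (y (Suc k)) \<cdot>\<^bsub>E (enat k)\<^esub> t k = y k" for k
    proof (cases "k < m")
      case True
      then have "on_ar (VS k) (y (Suc k)) = y k"
        using VV(2)[of "enat k" "enat (Suc k)" "enat m" f] f by (simp add: yle hom_def)
      then show ?thesis using True id_right[OF catE yh[of k]] by (simp add: t_def)
    next
      case False
      then show ?thesis using ys(3)[of "k - m"] by (simp add: y_def Suc_diff_le)
    qed
    obtain w where w: "w \<in> hom (E \<infinity>) L Y" "\<And>k. on_ar (VI k) w \<cdot>\<^bsub>E (enat k)\<^esub> l k = y k"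
      using fac[rule_format, OF YO yh yt] by blast
    show "\<exists>!w. w \<in> hom (E \<infinity>) L Y \<and> on_ar (VI m) w \<cdot>\<^bsub>E (enat m)\<^esub> l m = f"
    proof (rule ex1I[of _ w])
      show "w \<in> hom (E \<infinity>) L Y \<and> on_ar (VI m) w \<cdot>\<^bsub>E (enat m)\<^esub> l m = f" using w ym by simp
      fix v assume "v \<in> hom (E \<infinity>) L Y \<and> on_ar (VI m) v \<cdot>\<^bsub>E (enat m)\<^esub> l m = f"
      then have v: "v \<in> hom (E \<infinity>) L Y" and vf: "on_ar (VI m) v \<cdot>\<^bsub>E (enat m)\<^esub> l m = f" by auto
      define a where "a x k = on_ar (VI k) x \<cdot>\<^bsub>E (enat k)\<^esub> l k" for x k
      have ah: "a x k \<in> hom (E (enat k)) (Z k) (on_ob (VI k) Y)" if "x \<in> hom (E \<infinity>) L Y" for x k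
        unfolding a_def by (rule comp_hom[OF catE lh functor_hom[OF VI_F that]])
      have at: "on_ar (VS k) (a x (Suc k)) \<cdot>\<^bsub>E (enat k)\<^esub> t k = a x k" if x: "x \<in> hom (E \<infinity>) L Y" for x k
      proof -
        have Vx: "on_ar (VI k) x \<in> hom (E (enat k)) (on_ob (VI k) L) (on_ob (VI k) Y)" by (rule functor_hom[OF VI_F x])
        have lS: "on_ar (VS k) (l (Suc k)) \<in> hom (E (enat k)) (on_ob (VS k) (Z (Suc k))) (on_ob (VI k) L)"
          using functor_hom[OF VS_F lh[of "Suc k"]] VI_VS(1)[OF LO] by simp
        have "on_ar (VS k) (a x (Suc k)) = on_ar (VI k) x \<cdot>\<^bsub>E (enat k)\<^esub> on_ar (VS k) (l (Suc k))"
          using functor_comp[OF VS_F lh[of "Suc k"] functor_hom[OF VI_F x, of "Suc k"]] VI_VS(2)[of x k] x by (simp add: a_def hom_def)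
        then show ?thesis using comp_assoc[OF catE th lS Vx] lt by (simp add: a_def)
      qed
      \<comment> \<open>Uniqueness spreads from stage \<open>m\<close> in both directions: upwards
        by the universal property of each free object, downwards by applying the forgetful
        functors.\<close>
      have up: "a v k = a w k" if "m \<le> k" for k
        using that
      proof (induction k rule: nat_induct_at_least)
        case base
        show ?case using vf w(2)[of m] ym by (simp add: a_def)
      next
        case (Suc k)
        show ?case by (rule uarrow_eq[OF VS_F ut[OF Suc.hyps] ah[OF v] ah[OF w(1)]]) (use at[OF v] at[OF w(1)] Suc.IH in simp)
      qed
      have down: "a v k = a w k" if "k \<le> m" for k
        using that
      proof (induction k rule: inc_induct)
        case base
        show ?case using up by simp
      next
        case (step k)
        then show ?case using at[OF v, of k] at[OF w(1), of k] by simp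
      qed
      have "a v k = a w k" for k using up[of k] down[of k] by (cases "m \<le> k") auto
      then show "v = w" unfolding a_def by (rule uniq[OF v w(1)])
    qed
  qed
  then show ?thesis using lm by blast
qed

section \<open>Cellular morphisms at the limit stage\<close>

lemma Adj_inf: "Adj \<infinity>"
proof -
  have "\<exists>Y q. uarrow (E 0) (E \<infinity>) (V \<infinity> 0) X Y q" if "X \<in> Ob (E 0)" for X
    using free_inf[of X 0] that by (auto simp: zero_enat_def)
  then have "\<exists>F \<eta>. left_adjoint (E 0) (E \<infinity>) (V \<infinity> 0) F \<eta>" by (rule left_adjoint_exists[OF VF[OF i0_lb]])
  then show ?thesis unfolding Adj_def by (intro chosen_left_adjoint) simp_all
qed

text \<open>The pushout at the limit stage is rebuilt as the colimit of the tower of pushouts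
  \<open>P k\<close> with transposed attaching morphisms. At stage \<open>m\<close> its image is, up
  to isomorphism, the attachment \<open>p m\<close> followed by the leg \<open>l m\<close>, which is
  cellular because all transitions \<open>t k\<close> are.\<close>

lemma csteps_image_inf: "on_ar (VI m) ` csteps U (E \<infinity>) (FB \<infinity>) \<subseteq> Cl (enat m)"
proof safe
  fix u0 assume "u0 \<in> csteps U (E \<infinity>) (FB \<infinity>)"
  then obtain J :: "'u set" and s W g Z0 e0 where "small U J \<and> s ` J \<subseteq> Idx (FB \<infinity>) \<and>
     mwf (E \<infinity>) W J (\<lambda>j. mor (FB \<infinity>) (s j)) g \<and> mpush (E \<infinity>) W J (\<lambda>j. mor (FB \<infinity>) (s j)) g Z0 u0 e0"
    unfolding csteps_def mem_Collect_eq by (elim exE) (rule that)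
  then have J: "small U J" "s ` J \<subseteq> Idx B" and wf: "mwf (E \<infinity>) W J (\<lambda>j. mor (FB \<infinity>) (s j)) g"
    and mp0: "mpush (E \<infinity>) W J (\<lambda>j. mor (FB \<infinity>) (s j)) g Z0 u0 e0" by (simp_all add: FB_sel)
  have sB: "s j \<in> Idx B" if "j \<in> J" for j using J(2) that by blast
  define a b where "a j = Dom C (mor B (s j))" and "b j = Cod C (mor B (s j))" for j
  define \<beta> where "\<beta> n j = mor (FB n) (s j)" for n j
  note wf = wf[folded \<beta>_def] and mp0 = mp0[folded \<beta>_def]
  note ai = Adj_inf and af = Adj_fin
  have aO: "a j \<in> Ob C" and bO: "b j \<in> Ob C" if "j \<in> J" for j
    using FB_mor(2,3)[OF ai sB[OF that]] by (auto simp: a_def b_def)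
  have \<beta>h: "\<beta> n j \<in> hom (E n) (on_ob (Fr n) (a j)) (on_ob (Fr n) (b j))" if "Adj n" "j \<in> J" for n j
    using FB_mor(1)[OF that(1) sB[OF that(2)]] by (simp add: \<beta>_def a_def b_def)
  have \<beta>DC: "Dom (E n) (\<beta> n j) = on_ob (Fr n) (a j)" "Cod (E n) (\<beta> n j) = on_ob (Fr n) (b j)" if "Adj n" "j \<in> J" for n j
    using \<beta>h[OF that] by (auto simp: hom_def)
  note WO = mwfD(1)[OF wf]
  have gh: "g j \<in> hom (E \<infinity>) (on_ob (Fr \<infinity>) (a j)) W" if "j \<in> J" for j
    using mwfD(3)[OF wf that] \<beta>DC[OF ai that] by simp
  have ki: "kap (enat k) \<infinity> X \<in> hom (E (enat k)) (on_ob (Fr (enat k)) X) (on_ob (VI k) (on_ob (Fr \<infinity>) X))" if "X \<in> Ob C" for k X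
    by (rule kap(1)[OF _ af ai that]) simp
  have ku: "uarrow (E (enat k)) (E \<infinity>) (VI k) (on_ob (Fr (enat k)) X) (on_ob (Fr \<infinity>) X) (kap (enat k) \<infinity> X)" if "X \<in> Ob C" for k X
    by (rule kap(3)[OF _ af ai that]) simp
  have kS: "kap (enat k) (enat (Suc k)) X \<in> hom (E (enat k)) (on_ob (Fr (enat k)) X) (on_ob (VS k) (on_ob (Fr (enat (Suc k))) X))"
    "uarrow (E (enat k)) (E (enat (Suc k))) (VS k) (on_ob (Fr (enat k)) X) (on_ob (Fr (enat (Suc k))) X) (kap (enat k) (enat (Suc k)) X)"
    if "X \<in> Ob C" for k X by (rule kap(1,3)[OF _ af af that]; simp)+
  have kc: "on_ar (VS k) (kap (enat (Suc k)) \<infinity> X) \<cdot>\<^bsub>E (enat k)\<^esub> kap (enat k) (enat (Suc k)) X = kap (enat k) \<infinity> X" if "X \<in> Ob C" for k X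
    by (rule kap_comp[OF _ _ af af ai that]) simp_all
  have kn: "on_ar (VI k) (\<beta> \<infinity> j) \<cdot>\<^bsub>E (enat k)\<^esub> kap (enat k) \<infinity> (a j) = kap (enat k) \<infinity> (b j) \<cdot>\<^bsub>E (enat k)\<^esub> \<beta> (enat k) j" if "j \<in> J" for k j
    using kap_nat[OF _ af ai FB_mor(4)[OF ai sB[OF that]], of k] by (simp add: \<beta>_def a_def b_def FB_sel)
  \<comment> \<open>The transpose of the attaching morphism \<open>g j\<close> at stage
    \<open>k\<close>, along the universal arrow from \<open>F_k\<close> of the domain of the
    generator.\<close>
  define G where "G k j = on_ar (VI k) (g j) \<cdot>\<^bsub>E (enat k)\<^esub> kap (enat k) \<infinity> (a j)" for k j
  have Gh: "G k j \<in> hom (E (enat k)) (on_ob (Fr (enat k)) (a j)) (on_ob (VI k) W)" if "j \<in> J" for k j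
    unfolding G_def by (rule comp_hom[OF catE ki[OF aO[OF that]] functor_hom[OF VI_F gh[OF that]]])
  have wfk: "mwf (E (enat k)) (on_ob (VI k) W) J (\<beta> (enat k)) (G k)" for k
    unfolding mwf_def using functor_ob[OF VI_F WO] \<beta>h[OF af] Gh \<beta>DC[OF af] by (auto simp: hom_def)
  have "\<exists>P p e. mpush (E (enat k)) (on_ob (VI k) W) J (\<beta> (enat k)) (G k) P p e" for k
  proof -
    interpret c: cellular_cat U "E (enat k)" "FB (enat k)" by (rule cellular_fin)
    show ?thesis by (rule mpush_exists[OF c.rc c.cat J(1) wfk])
  qed
  then obtain P p \<epsilon> where mp: "\<And>k. mpush (E (enat k)) (on_ob (VI k) W) J (\<beta> (enat k)) (G k) (P k) (p k) (\<epsilon> k)" by metis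
  note ph = mpushD(1)[OF mp] and pc = mpushD(3)[OF mp]
  have \<epsilon>h: "\<epsilon> k j \<in> hom (E (enat k)) (on_ob (Fr (enat k)) (b j)) (P k)" if "j \<in> J" for k j
    using mpushD(2)[OF mp that] \<beta>DC[OF af that] by simp
  have PO: "P k \<in> Ob (E (enat k))" for k by (rule hom_cod[OF catE ph])
  have GS: "G k j = on_ar (VS k) (G (Suc k) j) \<cdot>\<^bsub>E (enat k)\<^esub> kap (enat k) (enat (Suc k)) (a j)" if j: "j \<in> J" for k j
  proof -
    note A = aO[OF j]
    have ga: "g j \<in> Ar (E \<infinity>)" using gh[OF j] by (simp add: hom_def)
    have "on_ar (VS k) (G (Suc k) j) = on_ar (VI k) (g j) \<cdot>\<^bsub>E (enat k)\<^esub> on_ar (VS k) (kap (enat (Suc k)) \<infinity> (a j))"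
      unfolding G_def using functor_comp[OF VS_F ki[OF A] functor_hom[OF VI_F gh[OF j]]] VI_VS(2)[OF ga] by simp
    moreover have "on_ar (VS k) (kap (enat (Suc k)) \<infinity> (a j)) \<in> hom (E (enat k)) (on_ob (VS k) (on_ob (Fr (enat (Suc k))) (a j))) (on_ob (VI k) (on_ob (Fr \<infinity>) (a j)))"
      using functor_hom[OF VS_F ki[OF A, of "Suc k"]] VI_VS(1)[OF uarrowD(1)[OF ku[OF A]]] by simp
    ultimately show ?thesis
      using comp_assoc[OF catE kS(1)[OF A] _ functor_hom[OF VI_F gh[OF j]]] kc[OF A] by (simp add: G_def)
  qed
  have \<beta>f: "\<beta> n = (\<lambda>j. mor (FB n) (s j))" for n by (rule ext) (simp add: \<beta>_def)
  have "p k \<in> Cl (enat k) \<and> (\<exists>t. t \<in> hom (E (enat k)) (P k) (on_ob (VS k) (P (Suc k))) \<and> t \<in> Cl (enat k) \<and>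
      t \<cdot>\<^bsub>E (enat k)\<^esub> p k = on_ar (VS k) (p (Suc k)) \<and>
      (\<forall>j \<in> J. t \<cdot>\<^bsub>E (enat k)\<^esub> \<epsilon> k j = on_ar (VS k) (\<epsilon> (Suc k) j) \<cdot>\<^bsub>E (enat k)\<^esub> kap (enat k) (enat (Suc k)) (b j)))" for k
    unfolding b_def
  proof (rule mpush_tower_step[OF Inv_all functor_ob[OF VI_F WO] J])
    show "G (Suc k) j \<in> hom (E (enat (Suc k))) (on_ob (Fr (enat (Suc k))) (Dom C (mor B (s j)))) (on_ob (VI (Suc k)) W)" if "j \<in> J" for j
      using Gh[OF that] by (simp add: a_def)
    show "mpush (E (enat (Suc k))) (on_ob (VI (Suc k)) W) J (\<lambda>j. mor (FB (enat (Suc k))) (s j)) (G (Suc k)) (P (Suc k)) (p (Suc k)) (\<epsilon> (Suc k))"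
      using mp[of "Suc k"] unfolding \<beta>_def .
    have "mpush (E (enat k)) (on_ob (VI k) W) J (\<beta> (enat k)) (\<lambda>j. on_ar (VS k) (G (Suc k) j) \<cdot>\<^bsub>E (enat k)\<^esub> kap (enat k) (enat (Suc k)) (a j)) (P k) (p k) (\<epsilon> k)"
      using mp[of k] by (subst (asm) mpush_cong[OF GS]) simp_all
    then show "mpush (E (enat k)) (on_ob (VS k) (on_ob (VI (Suc k)) W)) J (\<lambda>j. mor (FB (enat k)) (s j))
      (\<lambda>j. on_ar (VS k) (G (Suc k) j) \<cdot>\<^bsub>E (enat k)\<^esub> kap (enat k) (enat (Suc k)) (Dom C (mor B (s j)))) (P k) (p k) (\<epsilon> k)"
      unfolding VI_VS(1)[OF WO] a_def \<beta>f .
  qed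
  then obtain t where pC: "\<And>k. p k \<in> Cl (enat k)" and th: "\<And>k. t k \<in> hom (E (enat k)) (P k) (on_ob (VS k) (P (Suc k)))"
    and tC: "\<And>k. t k \<in> Cl (enat k)" and tp: "\<And>k. t k \<cdot>\<^bsub>E (enat k)\<^esub> p k = on_ar (VS k) (p (Suc k))"
    and te: "\<And>k j. j \<in> J \<Longrightarrow> t k \<cdot>\<^bsub>E (enat k)\<^esub> \<epsilon> k j = on_ar (VS k) (\<epsilon> (Suc k) j) \<cdot>\<^bsub>E (enat k)\<^esub> kap (enat k) (enat (Suc k)) (b j)"
    by metis
  from tower_colimit[OF PO th] obtain L l where
    LO: "L \<in> Ob (E \<infinity>)" and lh: "\<And>k. l k \<in> hom (E (enat k)) (P k) (on_ob (VI k) L)"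
    and lt: "\<And>k. on_ar (VS k) (l (Suc k)) \<cdot>\<^bsub>E (enat k)\<^esub> t k = l k"
    and fac: "\<forall>Y y. Y \<in> Ob (E \<infinity>) \<longrightarrow> (\<forall>k. y k \<in> hom (E (enat k)) (P k) (on_ob (VI k) Y)) \<longrightarrow>
       (\<forall>k. on_ar (VS k) (y (Suc k)) \<cdot>\<^bsub>E (enat k)\<^esub> t k = y k) \<longrightarrow>
       (\<exists>w. w \<in> hom (E \<infinity>) L Y \<and> (\<forall>k. on_ar (VI k) w \<cdot>\<^bsub>E (enat k)\<^esub> l k = y k))"
    and uniq: "\<And>Y v w. v \<in> hom (E \<infinity>) L Y \<Longrightarrow> w \<in> hom (E \<infinity>) L Y \<Longrightarrow>
       (\<And>k. on_ar (VI k) v \<cdot>\<^bsub>E (enat k)\<^esub> l k = on_ar (VI k) w \<cdot>\<^bsub>E (enat k)\<^esub> l k) \<Longrightarrow> v = w"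
    and cell: "\<forall>m. (\<forall>k \<ge> m. t k \<in> Cl (enat k)) \<longrightarrow> l m \<in> Cl (enat m)" by blast
  have lS: "on_ar (VS k) (l (Suc k)) \<in> hom (E (enat k)) (on_ob (VS k) (P (Suc k))) (on_ob (VI k) L)" for k
    using functor_hom[OF VS_F lh[of "Suc k"]] VI_VS(1)[OF LO] by simp
  have "\<exists>q. q \<in> hom (E \<infinity>) W L \<and> (\<forall>k. on_ar (VI k) q = l k \<cdot>\<^bsub>E (enat k)\<^esub> p k)"
  proof (rule limit_ar[OF WO LO comp_hom[OF catE ph lh]])
    show "on_ar (VS k) (l (Suc k) \<cdot>\<^bsub>E (enat (Suc k))\<^esub> p (Suc k)) = l k \<cdot>\<^bsub>E (enat k)\<^esub> p k" for k
      using functor_comp[OF VS_F ph lh[of "Suc k"]] tp[of k] comp_assoc[OF catE ph th lS, of k] lt[of k] by simp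
  qed
  then obtain q where q: "q \<in> hom (E \<infinity>) W L" "\<And>k. on_ar (VI k) q = l k \<cdot>\<^bsub>E (enat k)\<^esub> p k" by blast
  \<comment> \<open>A morphism out of the free object is determined by its transpose at stage
    \<open>0\<close> alone, so \<open>x j\<close> is defined from
    \<open>\<epsilon> 0 j\<close>.\<close>
  have "\<exists>x. x \<in> hom (E \<infinity>) (on_ob (Fr \<infinity>) (b j)) L \<and> on_ar (VI 0) x \<cdot>\<^bsub>E (enat 0)\<^esub> kap (enat 0) \<infinity> (b j) = l 0 \<cdot>\<^bsub>E (enat 0)\<^esub> \<epsilon> 0 j" if j: "j \<in> J" for j
    by (rule uarrowD(3)[OF ku[OF bO[OF j]] LO comp_hom[OF catE \<epsilon>h[OF j] lh]])
  then obtain x where xh: "\<And>j. j \<in> J \<Longrightarrow> x j \<in> hom (E \<infinity>) (on_ob (Fr \<infinity>) (b j)) L"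
    and x0: "\<And>j. j \<in> J \<Longrightarrow> on_ar (VI 0) (x j) \<cdot>\<^bsub>E (enat 0)\<^esub> kap (enat 0) \<infinity> (b j) = l 0 \<cdot>\<^bsub>E (enat 0)\<^esub> \<epsilon> 0 j" by metis
  have VSk: "on_ar (VS k) (on_ar (VI (Suc k)) v \<cdot>\<^bsub>E (enat (Suc k))\<^esub> kap (enat (Suc k)) \<infinity> X) \<cdot>\<^bsub>E (enat k)\<^esub> kap (enat k) (enat (Suc k)) X
      = on_ar (VI k) v \<cdot>\<^bsub>E (enat k)\<^esub> kap (enat k) \<infinity> X" if X: "X \<in> Ob C" and v: "v \<in> hom (E \<infinity>) (on_ob (Fr \<infinity>) X) Y" for k X Y v
  proof -
    have va: "v \<in> Ar (E \<infinity>)" using v by (simp add: hom_def)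
    have kh: "on_ar (VS k) (kap (enat (Suc k)) \<infinity> X) \<in> hom (E (enat k)) (on_ob (VS k) (on_ob (Fr (enat (Suc k))) X)) (on_ob (VI k) (on_ob (Fr \<infinity>) X))"
      using functor_hom[OF VS_F ki[OF X, of "Suc k"]] VI_VS(1)[OF uarrowD(1)[OF ku[OF X]]] by simp
    show ?thesis
      using functor_comp[OF VS_F ki[OF X] functor_hom[OF VI_F v, of "Suc k"]] VI_VS(2)[OF va]
        comp_assoc[OF catE kS(1)[OF X] kh functor_hom[OF VI_F v]] kc[OF X] by simp
  qed
  \<comment> \<open>The defining equation at stage \<open>0\<close> propagates upwards: applying
    \<open>VS k\<close> brings stage \<open>k + 1\<close> back to stage \<open>k\<close>, and the
    arrow from stage \<open>k\<close> to \<open>k + 1\<close> is universal.\<close>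
  have xk: "on_ar (VI k) (x j) \<cdot>\<^bsub>E (enat k)\<^esub> kap (enat k) \<infinity> (b j) = l k \<cdot>\<^bsub>E (enat k)\<^esub> \<epsilon> k j" if j: "j \<in> J" for k j
  proof (induction k)
    case 0
    show ?case by (rule x0[OF j])
  next
    case (Suc k)
    note Bj = bO[OF j]
    have "on_ar (VS k) (l (Suc k) \<cdot>\<^bsub>E (enat (Suc k))\<^esub> \<epsilon> (Suc k) j) \<cdot>\<^bsub>E (enat k)\<^esub> kap (enat k) (enat (Suc k)) (b j)
        = on_ar (VS k) (l (Suc k)) \<cdot>\<^bsub>E (enat k)\<^esub> (t k \<cdot>\<^bsub>E (enat k)\<^esub> \<epsilon> k j)"
      using functor_comp[OF VS_F \<epsilon>h[OF j] lh[of "Suc k"]] te[OF j, of k]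
        comp_assoc[OF catE kS(1)[OF Bj] functor_hom[OF VS_F \<epsilon>h[OF j, of "Suc k"]] lS] by simp
    also have "\<dots> = l k \<cdot>\<^bsub>E (enat k)\<^esub> \<epsilon> k j" by (rule comp_reassoc[OF catE lt th lS \<epsilon>h[OF j]])
    finally show ?case
      by (intro uarrow_eq[OF VS_F kS(2)[OF Bj] comp_hom[OF catE ki[OF Bj] functor_hom[OF VI_F xh[OF j]]] comp_hom[OF catE \<epsilon>h[OF j] lh]])
        (use VSk[OF Bj xh[OF j], of k] Suc in simp)
  qed
  have "mpush (E \<infinity>) W J (\<beta> \<infinity>) g L q x"
  proof (rule mpushI)
    show "mcone (E \<infinity>) W J (\<beta> \<infinity>) g L q x"
    proof (rule mconeI[OF q(1)])
      fix j assume j: "j \<in> J"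
      show "x j \<in> hom (E \<infinity>) (Cod (E \<infinity>) (\<beta> \<infinity> j)) L" using xh[OF j] \<beta>DC[OF ai j] by simp
      note bh = \<beta>h[OF ai j] and b0 = \<beta>h[OF af j, of 0]
      show "x j \<cdot>\<^bsub>E \<infinity>\<^esub> \<beta> \<infinity> j = q \<cdot>\<^bsub>E \<infinity>\<^esub> g j"
      \<comment> \<open>Equality of morphisms out of a free object need be tested only at stage
        \<open>0\<close>, where it is the commutativity of the pushout square there.\<close>
      proof (rule uarrow_eq[OF VI_F ku[OF aO[OF j], of 0] comp_hom[OF catE bh xh[OF j]] comp_hom[OF catE gh[OF j] q(1)]])
        have "on_ar (VI 0) (x j \<cdot>\<^bsub>E \<infinity>\<^esub> \<beta> \<infinity> j) \<cdot>\<^bsub>E (enat 0)\<^esub> kap (enat 0) \<infinity> (a j) =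
            on_ar (VI 0) (x j) \<cdot>\<^bsub>E (enat 0)\<^esub> (kap (enat 0) \<infinity> (b j) \<cdot>\<^bsub>E (enat 0)\<^esub> \<beta> (enat 0) j)"
          using functor_comp[OF VI_F bh xh[OF j]] comp_assoc[OF catE ki[OF aO[OF j]] functor_hom[OF VI_F bh] functor_hom[OF VI_F xh[OF j]]] kn[OF j] by simp
        also have "\<dots> = (l 0 \<cdot>\<^bsub>E (enat 0)\<^esub> \<epsilon> 0 j) \<cdot>\<^bsub>E (enat 0)\<^esub> \<beta> (enat 0) j"
          by (rule comp_reassoc[OF catE x0[OF j] ki[OF bO[OF j]] functor_hom[OF VI_F xh[OF j]] b0])
        also have "\<dots> = (l 0 \<cdot>\<^bsub>E (enat 0)\<^esub> p 0) \<cdot>\<^bsub>E (enat 0)\<^esub> G 0 j"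
          using comp_assoc[OF catE b0 \<epsilon>h[OF j] lh] comp_assoc[OF catE Gh[OF j] ph lh] pc[OF j] by simp
        also have "\<dots> = on_ar (VI 0) (q \<cdot>\<^bsub>E \<infinity>\<^esub> g j) \<cdot>\<^bsub>E (enat 0)\<^esub> kap (enat 0) \<infinity> (a j)"
          unfolding G_def q(2)[symmetric]
          using functor_comp[OF VI_F gh[OF j] q(1)] comp_assoc[OF catE ki[OF aO[OF j]] functor_hom[OF VI_F gh[OF j]] functor_hom[OF VI_F q(1)]] by simp
        finally show "on_ar (VI 0) (x j \<cdot>\<^bsub>E \<infinity>\<^esub> \<beta> \<infinity> j) \<cdot>\<^bsub>E (enat 0)\<^esub> kap (enat 0) \<infinity> (a j) =
          on_ar (VI 0) (q \<cdot>\<^bsub>E \<infinity>\<^esub> g j) \<cdot>\<^bsub>E (enat 0)\<^esub> kap (enat 0) \<infinity> (a j)" .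
      qed
    qed
  next
    fix Y u' e' assume "mcone (E \<infinity>) W J (\<beta> \<infinity>) g Y u' e'"
    note mc = mconeD[OF this]
    have u': "u' \<in> hom (E \<infinity>) W Y" by (rule mc(1))
    have e': "e' j \<in> hom (E \<infinity>) (on_ob (Fr \<infinity>) (b j)) Y" if "j \<in> J" for j using mc(2)[OF that] \<beta>DC[OF ai that] by simp
    have YO: "Y \<in> Ob (E \<infinity>)" by (rule hom_cod[OF catE u'])
    have u'a: "u' \<in> Ar (E \<infinity>)" using u' by (simp add: hom_def)
    have "\<exists>y. y \<in> hom (E (enat k)) (P k) (on_ob (VI k) Y) \<and> y \<cdot>\<^bsub>E (enat k)\<^esub> p k = on_ar (VI k) u' \<and>
        (\<forall>j \<in> J. y \<cdot>\<^bsub>E (enat k)\<^esub> \<epsilon> k j = on_ar (VI k) (e' j) \<cdot>\<^bsub>E (enat k)\<^esub> kap (enat k) \<infinity> (b j))" for k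
    proof -
      have "mcone (E (enat k)) (on_ob (VI k) W) J (\<beta> (enat k)) (G k) (on_ob (VI k) Y) (on_ar (VI k) u')
          (\<lambda>j. on_ar (VI k) (e' j) \<cdot>\<^bsub>E (enat k)\<^esub> kap (enat k) \<infinity> (b j))"
      proof (rule mconeI[OF functor_hom[OF VI_F u']])
        fix j assume j: "j \<in> J"
        note bh = \<beta>h[OF ai j] and bk = \<beta>h[OF af j, of k]
        show "on_ar (VI k) (e' j) \<cdot>\<^bsub>E (enat k)\<^esub> kap (enat k) \<infinity> (b j) \<in> hom (E (enat k)) (Cod (E (enat k)) (\<beta> (enat k) j)) (on_ob (VI k) Y)"
          using comp_hom[OF catE ki[OF bO[OF j]] functor_hom[OF VI_F e'[OF j]]] \<beta>DC[OF af j] by simp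
        have "(on_ar (VI k) (e' j) \<cdot>\<^bsub>E (enat k)\<^esub> kap (enat k) \<infinity> (b j)) \<cdot>\<^bsub>E (enat k)\<^esub> \<beta> (enat k) j =
            on_ar (VI k) (e' j \<cdot>\<^bsub>E \<infinity>\<^esub> \<beta> \<infinity> j) \<cdot>\<^bsub>E (enat k)\<^esub> kap (enat k) \<infinity> (a j)"
          using comp_assoc[OF catE bk ki[OF bO[OF j]] functor_hom[OF VI_F e'[OF j]]] kn[OF j, of k]
            functor_comp[OF VI_F bh e'[OF j], of k] comp_assoc[OF catE ki[OF aO[OF j]] functor_hom[OF VI_F bh] functor_hom[OF VI_F e'[OF j]]] by simp
        then show "(on_ar (VI k) (e' j) \<cdot>\<^bsub>E (enat k)\<^esub> kap (enat k) \<infinity> (b j)) \<cdot>\<^bsub>E (enat k)\<^esub> \<beta> (enat k) j = on_ar (VI k) u' \<cdot>\<^bsub>E (enat k)\<^esub> G k j"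
          using mc(3)[OF j] functor_comp[OF VI_F gh[OF j] u', of k]
            comp_assoc[OF catE ki[OF aO[OF j]] functor_hom[OF VI_F gh[OF j]] functor_hom[OF VI_F u']] by (simp add: G_def)
      qed
      from mpush_unique[OF catE wfk mp this] show ?thesis by blast
    qed
    then obtain y where yh: "\<And>k. y k \<in> hom (E (enat k)) (P k) (on_ob (VI k) Y)" and yp: "\<And>k. y k \<cdot>\<^bsub>E (enat k)\<^esub> p k = on_ar (VI k) u'"
      and ye: "\<And>k j. j \<in> J \<Longrightarrow> y k \<cdot>\<^bsub>E (enat k)\<^esub> \<epsilon> k j = on_ar (VI k) (e' j) \<cdot>\<^bsub>E (enat k)\<^esub> kap (enat k) \<infinity> (b j)" by metis
    have yS: "on_ar (VS k) (y (Suc k)) \<in> hom (E (enat k)) (on_ob (VS k) (P (Suc k))) (on_ob (VI k) Y)" for k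
      using functor_hom[OF VS_F yh[of "Suc k"]] VI_VS(1)[OF YO] by simp
    \<comment> \<open>Compatibility with the transitions is tested on \<open>P k\<close>, where the
      base and the attached objects jointly detect equality.\<close>
    have yt: "on_ar (VS k) (y (Suc k)) \<cdot>\<^bsub>E (enat k)\<^esub> t k = y k" for k
    proof (rule mpush_eq[OF catE wfk mp comp_hom[OF catE th yS] yh])
      show "(on_ar (VS k) (y (Suc k)) \<cdot>\<^bsub>E (enat k)\<^esub> t k) \<cdot>\<^bsub>E (enat k)\<^esub> p k = y k \<cdot>\<^bsub>E (enat k)\<^esub> p k"
        using comp_assoc[OF catE ph th yS] tp[of k] functor_comp[OF VS_F ph yh[of "Suc k"]] yp[of "Suc k"] yp[of k] VI_VS(2)[OF u'a] by simp
      fix j assume j: "j \<in> J"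
      show "(on_ar (VS k) (y (Suc k)) \<cdot>\<^bsub>E (enat k)\<^esub> t k) \<cdot>\<^bsub>E (enat k)\<^esub> \<epsilon> k j = y k \<cdot>\<^bsub>E (enat k)\<^esub> \<epsilon> k j"
        using comp_assoc[OF catE \<epsilon>h[OF j] th yS] te[OF j, of k] comp_assoc[OF catE kS(1)[OF bO[OF j]] functor_hom[OF VS_F \<epsilon>h[OF j, of "Suc k"]] yS]
          functor_comp[OF VS_F \<epsilon>h[OF j] yh[of "Suc k"]] ye[OF j, of "Suc k"] ye[OF j, of k] VSk[OF bO[OF j] e'[OF j], of k] by simp
    qed
    obtain w where w: "w \<in> hom (E \<infinity>) L Y" "\<And>k. on_ar (VI k) w \<cdot>\<^bsub>E (enat k)\<^esub> l k = y k"
      using fac[rule_format, OF YO yh yt] by blast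
    have "w \<cdot>\<^bsub>E \<infinity>\<^esub> q = u'"
    proof (rule limit_ar_eq)
      show "w \<cdot>\<^bsub>E \<infinity>\<^esub> q \<in> Ar (E \<infinity>)" using comp_hom[OF catE q(1) w(1)] by (simp add: hom_def)
      show "u' \<in> Ar (E \<infinity>)" by (rule u'a)
      show "on_ar (VI k) (w \<cdot>\<^bsub>E \<infinity>\<^esub> q) = on_ar (VI k) u'" for k
        using functor_comp[OF VI_F q(1) w(1), of k] q(2)[of k] comp_assoc[OF catE ph lh functor_hom[OF VI_F w(1)], of k] w(2)[of k] yp[of k] by simp
    qed
    moreover have "w \<cdot>\<^bsub>E \<infinity>\<^esub> x j = e' j" if j: "j \<in> J" for j
      by (rule uarrow_eq[OF VI_F ku[OF bO[OF j], of 0] comp_hom[OF catE xh[OF j] w(1)] e'[OF j]])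
        (use functor_comp[OF VI_F xh[OF j] w(1), of 0] comp_assoc[OF catE ki[OF bO[OF j]] functor_hom[OF VI_F xh[OF j]] functor_hom[OF VI_F w(1)], of 0]
          x0[OF j] comp_assoc[OF catE \<epsilon>h[OF j] lh functor_hom[OF VI_F w(1)], of 0] w(2)[of 0] ye[OF j, of 0] in simp)
    ultimately show "\<exists>w. w \<in> hom (E \<infinity>) L Y \<and> w \<cdot>\<^bsub>E \<infinity>\<^esub> q = u' \<and> (\<forall>j \<in> J. w \<cdot>\<^bsub>E \<infinity>\<^esub> x j = e' j)" using w(1) by blast
  next
    fix Y v w assume v: "v \<in> hom (E \<infinity>) L Y" and w: "w \<in> hom (E \<infinity>) L Y" and vq: "v \<cdot>\<^bsub>E \<infinity>\<^esub> q = w \<cdot>\<^bsub>E \<infinity>\<^esub> q"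
      and vx: "\<And>j. j \<in> J \<Longrightarrow> v \<cdot>\<^bsub>E \<infinity>\<^esub> x j = w \<cdot>\<^bsub>E \<infinity>\<^esub> x j"
    have 1: "(on_ar (VI k) f \<cdot>\<^bsub>E (enat k)\<^esub> l k) \<cdot>\<^bsub>E (enat k)\<^esub> p k = on_ar (VI k) (f \<cdot>\<^bsub>E \<infinity>\<^esub> q)" if f: "f \<in> hom (E \<infinity>) L Y" for f k
      using comp_assoc[OF catE ph lh functor_hom[OF VI_F f]] q(2)[of k] functor_comp[OF VI_F q(1) f, of k] by simp
    have 2: "(on_ar (VI k) f \<cdot>\<^bsub>E (enat k)\<^esub> l k) \<cdot>\<^bsub>E (enat k)\<^esub> \<epsilon> k j = on_ar (VI k) (f \<cdot>\<^bsub>E \<infinity>\<^esub> x j) \<cdot>\<^bsub>E (enat k)\<^esub> kap (enat k) \<infinity> (b j)"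
      if f: "f \<in> hom (E \<infinity>) L Y" and j: "j \<in> J" for f k j
      using comp_assoc[OF catE \<epsilon>h[OF j] lh functor_hom[OF VI_F f], of k] xk[OF j, of k] functor_comp[OF VI_F xh[OF j] f, of k]
        comp_assoc[OF catE ki[OF bO[OF j]] functor_hom[OF VI_F xh[OF j]] functor_hom[OF VI_F f], of k] by simp
    show "v = w"
    proof (rule uniq[OF v w])
      fix k
      show "on_ar (VI k) v \<cdot>\<^bsub>E (enat k)\<^esub> l k = on_ar (VI k) w \<cdot>\<^bsub>E (enat k)\<^esub> l k"
        by (rule mpush_eq[OF catE wfk mp comp_hom[OF catE lh functor_hom[OF VI_F v]] comp_hom[OF catE lh functor_hom[OF VI_F w]]])
          (use 1[OF v] 1[OF w] 2[OF v] 2[OF w] vq vx in auto)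
    qed
  qed
  then obtain i where i: "iso_ar (E \<infinity>) L Z0 i" "i \<cdot>\<^bsub>E \<infinity>\<^esub> q = u0"
    using mpush_iso[OF catE wf _ mp0] by blast
  have lm: "l m \<in> Cl (enat m)" using cell tC by blast
  \<comment> \<open>The rebuilt pushout has cellular image; the given one differs from it by an
    isomorphism.\<close>
  have "l m \<cdot>\<^bsub>E (enat m)\<^esub> p m \<in> Cl (enat m)" by (rule Cl_comp[OF pC lm ph lh])
  then have qC: "on_ar (VI m) q \<in> Cl (enat m)" by (simp add: q(2))
  have "on_ar (VI m) i \<cdot>\<^bsub>E (enat m)\<^esub> on_ar (VI m) q \<in> Cl (enat m)"
    by (rule Cl_comp[OF qC Cl_iso[OF functor_iso[OF VI_F i(1)]] functor_hom[OF VI_F q(1)] functor_hom[OF VI_F iso_hom[OF i(1)]]])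
  then show "on_ar (VI m) u0 \<in> Cl (enat m)" using functor_comp[OF VI_F q(1) iso_hom[OF i(1)], of m] i(2) by simp
qed

lemma Cell_image_inf: "on_ar (VI m) ` Cl \<infinity> \<subseteq> Cl (enat m)"
  by (rule Cell_image[OF Inv_all Adj_inf _ VI_preserves_directed csteps_image_inf]) simp

text \<open>A parallel pair at the limit is equal once all its components are, and each component of
  a cell is monic at its finite stage.\<close>

lemma Cl_mono_inf: "Cl \<infinity> \<subseteq> Mono (E \<infinity>)"
proof
  fix f assume f: "f \<in> Cl \<infinity>"
  have fA: "f \<in> Ar (E \<infinity>)" by (rule Cell_Ar[OF Adj_inf f])
  then have fh: "f \<in> hom (E \<infinity>) (Dom (E \<infinity>) f) (Cod (E \<infinity>) f)" by (rule hom_self)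
  show "f \<in> Mono (E \<infinity>)"
    unfolding Mono_def
  proof (intro CollectI conjI ballI impI fA, elim conjE)
    fix g h assume g: "g \<in> Ar (E \<infinity>)" and h: "h \<in> Ar (E \<infinity>)" and gh: "Dom (E \<infinity>) g = Dom (E \<infinity>) h" "Cod (E \<infinity>) g = Dom (E \<infinity>) f" "Cod (E \<infinity>) h = Dom (E \<infinity>) f"
      and e: "f \<cdot>\<^bsub>E \<infinity>\<^esub> g = f \<cdot>\<^bsub>E \<infinity>\<^esub> h"
    have g': "g \<in> hom (E \<infinity>) (Dom (E \<infinity>) g) (Dom (E \<infinity>) f)" and h': "h \<in> hom (E \<infinity>) (Dom (E \<infinity>) g) (Dom (E \<infinity>) f)"
      using g h gh by (auto simp: hom_def)
    show "g = h"
    proof (rule limit_ar_eq[OF g h])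
      fix n
      have "on_ar (VI n) f \<in> Mono (E (enat n))" using Cell_image_inf Cl_mono f by blast
      then show "on_ar (VI n) g = on_ar (VI n) h"
        by (rule Mono_cancel[OF _ functor_hom[OF VI_F fh] functor_hom[OF VI_F g'] functor_hom[OF VI_F h']])
          (use functor_comp[OF VI_F g' fh, of n] functor_comp[OF VI_F h' fh, of n] e in simp)
    qed
  qed
qed

lemma tower_properties:
  assumes "m < n"
  shows "on_ar (V n m) ` Cl n \<subseteq> Cl m \<and> (\<forall>X \<in> Ob (E m). free_unit E V n m X \<in> Cl m) \<and> Cl n \<subseteq> Mono (E n) \<and>
    faithful (E m) (Free E V n m)"
proof -
  \<comment> \<open>Being below \<open>n\<close>, the stage \<open>m\<close> is finite; only
    \<open>n\<close> may be the limit stage.\<close>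
  obtain k where m: "m = enat k" using assms by (cases m) auto
  have mn: "enat k \<le> n" using assms m by simp
  have 1: "on_ar (V n m) ` Cl n \<subseteq> Cl m" and 3: "Cl n \<subseteq> Mono (E n)"
    and ex: "\<And>X. X \<in> Ob (E m) \<Longrightarrow> \<exists>Y q. uarrow (E m) (E n) (V n m) X Y q \<and> q \<in> Cl m"
    unfolding m using Cell_image_fin[of k] Cell_image_inf[of k] Cl_mono Cl_mono_inf free_fin[of k] free_inf[of _ k] mn
    by (cases n; simp)+
  have adj: "left_adjoint (E m) (E n) (V n m) (Free E V n m) (free_unit E V n m)"
  proof (rule chosen_left_adjoint)
    show "n \<noteq> m" using assms by simp
    show "\<exists>F \<eta>. left_adjoint (E m) (E n) (V n m) F \<eta>"
    proof (rule left_adjoint_exists[OF VF])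
      show "m \<le> n" using assms by simp
    qed (use ex in blast)
  qed
  have VFm: "is_functor (E n) (E m) (V n m)" by (rule VF) (use assms in simp)
  \<comment> \<open>Cellularity was shown for some universal arrow. The chosen unit differs from it
    by the image of an isomorphism and is therefore cellular too.\<close>
  have 2: "free_unit E V n m X \<in> Cl m" if X: "X \<in> Ob (E m)" for X
  proof -
    obtain Y q where u: "uarrow (E m) (E n) (V n m) X Y q" and qC: "q \<in> Cl m" using ex[OF X] by blast
    obtain i where i: "iso_ar (E n) Y (on_ob (Free E V n m) X) i" "on_ar (V n m) i \<cdot>\<^bsub>E m\<^esub> q = free_unit E V n m X"
      by (rule uarrow_iso[OF VFm u left_adjoint_uarrow[OF adj X]])
    have "on_ar (V n m) i \<cdot>\<^bsub>E m\<^esub> q \<in> Cl m"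
      using Cl_comp[of q k "on_ar (V n m) i"] Cl_iso[of k] functor_iso[OF VFm i(1)] qC uarrowD(2)[OF u] functor_hom[OF VFm iso_hom[OF i(1)]]
      unfolding m by blast
    then show ?thesis using i(2) by simp
  qed
  have "faithful (E m) (Free E V n m)"
    by (rule faithful_if_unit_mono[OF adj]) (use 2 Cl_mono m in blast)
  then show ?thesis using 1 2 3 by blast
qed

end

theorem theorem4p5:
  fixes U :: "'u rel"
    and C :: "('o, 'm) cat"
    and B :: "('b, 'm) family"
    and I :: "nat \<Rightarrow> ('i, 'm) family"
    and E :: "enat \<Rightarrow> ('o, 'm) cat"
    and V :: "enat \<Rightarrow> enat \<Rightarrow> ('o, 'm, 'o, 'm) fctr"
    and m n :: enat
  assumes "inaccessible U"
    and "locally_presentable U C"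
    and "is_family U C B"
    and "Cell U C B \<subseteq> Mono C"
    and "is_tower U C I E V"
    and "\<forall>k. \<forall>i \<in> Idx (I (Suc k)).
           mor (I (Suc k)) i \<in> Cell U (E (enat k)) (free_family E V B (enat k)) \<and>
           finitely_presentable U (E (enat k)) (Dom (E (enat k)) (mor (I (Suc k)) i))"
    and "m < n"
  shows "on_ar (V n m) ` Cell U (E n) (free_family E V B n) \<subseteq> Cell U (E m) (free_family E V B m) \<and>
    (\<forall>X \<in> Ob (E m). free_unit E V n m X \<in> Cell U (E m) (free_family E V B m)) \<and>
    Cell U (E n) (free_family E V B n) \<subseteq> Mono (E n) \<and>
    faithful (E m) (Free E V n m)"
proof -
  interpret tower U C B I E V by unfold_locales (use assms in auto)
  show ?thesis by (rule tower_properties[OF assms(7)])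
qed

end
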